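(* Let $k\subseteq l$ be algebraic number fields such that the group $E_{l/k}$ of relative units has positive rank $r(l/k)=r(l)-r(k)$. Let $\mathfrak{E}\subseteq E_{l/k}$ be a subgroup of rank $r(l/k)$. Then there exist multiplicatively independent relative units $\psi_1,\dots,\psi_{r(l/k)}$ in $\mathfrak{E}$ such that \[ \prod_{j=1}^{r(l/k)}\bigl([l:\mathbb{Q}]\,h(\psi_j)\bigr)\le r(l/k)!\,\mathrm{Reg}(E_{l/k})\,[E_{l/k}:\mathfrak{E}]. \]
   Context: For a number field $K$, $r(K)$ is the rank of the unit group $O_K^{\times}$, and $F_K=O_K^{\times}/\mathrm{Tor}(O_K^{\times})$. The norm $\mathrm{Norm}_{l/k}:O_l^{\times}\to O_k^{\times}$ induces a homomorphism $\mathrm{norm}_{l/k}:F_l\to F_k$, and $E_{l/k}=\{\alpha\in F_l:\mathrm{norm}_{l/k}(\alpha)=1\}$ is the group of relative units; it has rank $r(l)-r(k)$. Absolute values: for each place $w$ of $l$, $\|\cdot\|_w$ is the absolute value on the completion $l_w$ extending the usual archimedean absolute value on $\mathbb{Q}$ if $w\mid\infty$, or the usual $p$-adic absolute value if $w\mid p$; $|\cdot|_w=\|\cdot\|_w^{[l_w:\mathbb{Q}_w]/[l:\mathbb{Q}]}$. The absolute logarithmic Weil height of $\alpha\in l^{\times}$ is $h(\alpha)=\sum_w\log^+|\alpha|_w$ (sum over all places of $l$); it is independent of the field containing $\alpha$ and vanishes on roots of unity, so it is well defined on $F_l$. Relative regulator: for each archimedean place $v$ of $k$ choose one place $\widehat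 w_v$ of $l$ with $\widehat w_v\mid v$, and let $S(l/k)$ be the set of archimedean places of $l$ other than the chosen places $\widehat w_v$; it has $r(l/k)$ elements. If $\eta_1,\dots,\eta_{r(l/k)}$ is a basis of $E_{l/k}$, then $\mathrm{Reg}(E_{l/k})=\bigl|\det\bigl([l_w:\mathbb{Q}_w]\log\|\eta_j\|_w\bigr)\bigr|$, where $w\in S(l/k)$ indexes rows and $j$ indexes columns; this does not depend on the choices made. *)

theory Defs
  imports
    "HOL-Algebra.Algebraic_Closure_Type"
    "HOL-Algebra.Generated_Groups"
    "HOL-Analysis.Infinite_Sum"
    "Jordan_Normal_Form.Determinant"
begin

text \<open>
  Number fields are subsets of an arbitrary ambient field of characteristic zero, so that
  inclusions of number fields are inclusions of sets. Every abstract number field occurs,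
  since the ambient type may be chosen to be that field.
\<close>

abbreviation ambient :: "'a::field_char_0 ring" where
  "ambient \<equiv> ring_of_type_algebra"

definition number_field :: "'a::field_char_0 set \<Rightarrow> bool" where
  "number_field K \<longleftrightarrow> subfield K ambient \<and> ring.finite_dimension ambient \<rat> K"

definition number_field_degree :: "'a::field_char_0 set \<Rightarrow> nat" where
  "number_field_degree K = ring.dim ambient \<rat> K"

definition ring_of_integers :: "'a::field_char_0 set \<Rightarrow> 'a ring" where
  "ring_of_integers K = ambient\<lparr>carrier := {x \<in> K. algebraic_int x}\<rparr>"

definition unit_group :: "'a::field_char_0 set \<Rightarrow> 'a monoid" where
  "unit_group K = units_of (ring_of_integers K)"

text \<open>
  The norm of \<open>x \<in> l\<close> is the determinant of multiplication by \<open>x\<close> on the \<open>k\<close>-vector space \<open>l\<close>,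
  computed in any \<open>k\<close>-basis \<open>bs\<close> of \<open>l\<close>.
\<close>

definition field_norm :: "'a::field_char_0 set \<Rightarrow> 'a set \<Rightarrow> 'a \<Rightarrow> 'a" where
  "field_norm k l x = (SOME d. \<exists>bs A.
     ring.independent ambient k bs \<and> ring.Span ambient k bs = l \<and>
     A \<in> carrier_mat (length bs) (length bs) \<and>
     (\<forall>i<length bs. \<forall>j<length bs. A $$ (i, j) \<in> k) \<and>
     (\<forall>j<length bs. x * bs ! j = (\<Sum>i<length bs. A $$ (i, j) * bs ! i)) \<and>
     d = Determinant.det A)"

definition torsion :: "('a, 'b) monoid_scheme \<Rightarrow> 'a set" where
  "torsion G = {x \<in> carrier G. \<exists>n::nat. n > 0 \<and> x [^]\<^bsub>G\<^esub> n = \<one>\<^bsub>G\<^esub>}"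

definition mult_independent :: "('a, 'b) monoid_scheme \<Rightarrow> nat \<Rightarrow> (nat \<Rightarrow> 'a) \<Rightarrow> bool" where
  "mult_independent G r x \<longleftrightarrow>
     x \<in> {..<r} \<rightarrow> carrier G \<and>
     (\<forall>e::nat \<Rightarrow> int. finprod G (\<lambda>i. x i [^]\<^bsub>G\<^esub> e i) {..<r} = \<one>\<^bsub>G\<^esub> \<longrightarrow> (\<forall>i<r. e i = 0))"

definition group_rank :: "('a, 'b) monoid_scheme \<Rightarrow> nat" where
  "group_rank G = Max {r. \<exists>x. mult_independent G r x}"

definition group_basis :: "('a, 'b) monoid_scheme \<Rightarrow> nat \<Rightarrow> (nat \<Rightarrow> 'a) \<Rightarrow> bool" where
  "group_basis G r x \<longleftrightarrow> mult_independent G r x \<and> generate G (x ` {..<r}) = carrier G"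

definition units_mod_torsion :: "'a::field_char_0 set \<Rightarrow> 'a set monoid" where
  "units_mod_torsion K = unit_group K Mod torsion (unit_group K)"

text \<open>
  Elements of \<^term>\<open>units_mod_torsion K\<close> are cosets; a function \<open>f\<close> that is constant on such
  cosets induces the function \<open>\<lambda>A. the_elem (f ` A)\<close> on the quotient.
\<close>

definition norm_mod_torsion :: "'a::field_char_0 set \<Rightarrow> 'a set \<Rightarrow> 'a set \<Rightarrow> 'a set" where
  "norm_mod_torsion k l A =
     the_elem ((\<lambda>x. torsion (unit_group k) #>\<^bsub>unit_group k\<^esub> field_norm k l x) ` A)"

definition relative_units :: "'a::field_char_0 set \<Rightarrow> 'a set \<Rightarrow> 'a set monoid" where
  "relative_units k l = (units_mod_torsion l)
     \<lparr>carrier := kernel (units_mod_torsion l) (units_mod_torsion k) (norm_mod_torsion k l)\<rparr>"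

definition unit_rank :: "'a::field_char_0 set \<Rightarrow> nat" where
  "unit_rank K = group_rank (unit_group K)"

definition relative_unit_rank :: "'a::field_char_0 set \<Rightarrow> 'a set \<Rightarrow> nat" where
  "relative_unit_rank k l = unit_rank l - unit_rank k"

text \<open>
  A place is represented by the unique absolute value in its class that extends the usual
  archimedean or a usual \<open>p\<close>-adic absolute value of the rationals. Absolute values on \<open>K\<close> are
  extensional, so that distinct functions are distinct absolute values.
\<close>

definition absolute_value :: "'a::field_char_0 set \<Rightarrow> ('a \<Rightarrow> real) \<Rightarrow> bool" where
  "absolute_value K w \<longleftrightarrow>
     w \<in> extensional K \<and>
     (\<forall>x\<in>K. w x \<ge> 0) \<and>
     (\<forall>x\<in>K. w x = 0 \<longleftrightarrow> x = 0) \<and>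
     (\<forall>x\<in>K. \<forall>y\<in>K. w (x * y) = w x * w y) \<and>
     (\<forall>x\<in>K. \<forall>y\<in>K. w (x + y) \<le> w x + w y)"

definition padic_abs :: "nat \<Rightarrow> rat \<Rightarrow> real" where
  "padic_abs p q = (case quotient_of q of (a, b) \<Rightarrow>
     if a = 0 then 0
     else real p powi (int (multiplicity (int p) b) - int (multiplicity (int p) a)))"

definition arch_places :: "'a::field_char_0 set \<Rightarrow> ('a \<Rightarrow> real) set" where
  "arch_places K = {w. absolute_value K w \<and> (\<forall>q::rat. w (of_rat q) = of_rat \<bar>q\<bar>)}"

definition nonarch_places :: "'a::field_char_0 set \<Rightarrow> ('a \<Rightarrow> real) set" where
  "nonarch_places K =
     {w. absolute_value K w \<and> (\<exists>p. prime p \<and> (\<forall>q::rat. w (of_rat q) = padic_abs p q))}"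

definition places :: "'a::field_char_0 set \<Rightarrow> ('a \<Rightarrow> real) set" where
  "places K = arch_places K \<union> nonarch_places K"

definition lies_over :: "'a::field_char_0 set \<Rightarrow> ('a \<Rightarrow> real) \<Rightarrow> ('a \<Rightarrow> real) \<Rightarrow> bool" where
  "lies_over k w v \<longleftrightarrow> (\<forall>x\<in>k. w x = v x)"

text \<open>
  The completion of \<open>K\<close> at \<open>w\<close> is the ring of \<open>w\<close>-Cauchy sequences modulo null sequences. The
  completion of the rationals at the place below \<open>w\<close> is the subfield of the classes of Cauchy
  sequences of rationals.
\<close>

definition cauchy_sequences :: "'a::field_char_0 set \<Rightarrow> ('a \<Rightarrow> real) \<Rightarrow> (nat \<Rightarrow> 'a) ring" where
  "cauchy_sequences K w =
     \<lparr>carrier = {x. range x \<subseteq> K \<and> (\<forall>e>0. \<exists>N. \<forall>m\<ge>N. \<forall>n\<ge>N. w (x m - x n) < e)},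
      monoid.mult = (\<lambda>x y n. x n * y n), one = (\<lambda>n. 1),
      ring.zero = (\<lambda>n. 0), add = (\<lambda>x y n. x n + y n)\<rparr>"

definition null_sequences :: "'a::field_char_0 set \<Rightarrow> ('a \<Rightarrow> real) \<Rightarrow> (nat \<Rightarrow> 'a) set" where
  "null_sequences K w = {x \<in> carrier (cauchy_sequences K w). (\<lambda>n. w (x n)) \<longlonglongrightarrow> 0}"

definition completion :: "'a::field_char_0 set \<Rightarrow> ('a \<Rightarrow> real) \<Rightarrow> (nat \<Rightarrow> 'a) set ring" where
  "completion K w = cauchy_sequences K w Quot null_sequences K w"

definition rational_completion ::
    "'a::field_char_0 set \<Rightarrow> ('a \<Rightarrow> real) \<Rightarrow> (nat \<Rightarrow> 'a) set set" where
  "rational_completion K w =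
     {null_sequences K w +>\<^bsub>cauchy_sequences K w\<^esub> x | x.
        x \<in> carrier (cauchy_sequences K w) \<and> range x \<subseteq> \<rat>}"

definition local_degree :: "'a::field_char_0 set \<Rightarrow> ('a \<Rightarrow> real) \<Rightarrow> nat" where
  "local_degree K w =
     ring.dim (completion K w) (rational_completion K w) (carrier (completion K w))"

definition normalized_abs :: "'a::field_char_0 set \<Rightarrow> ('a \<Rightarrow> real) \<Rightarrow> 'a \<Rightarrow> real" where
  "normalized_abs K w x = w x powr (real (local_degree K w) / real (number_field_degree K))"

definition weil_height :: "'a::field_char_0 set \<Rightarrow> 'a \<Rightarrow> real" where
  "weil_height K x = (\<Sum>\<^sub>\<infinity>w\<in>places K. max 0 (ln (normalized_abs K w x)))"

definition height_mod_torsion :: "'a::field_char_0 set \<Rightarrow> 'a set \<Rightarrow> real" where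
  "height_mod_torsion K A = the_elem (weil_height K ` A)"

definition chosen_places ::
    "'a::field_char_0 set \<Rightarrow> 'a set \<Rightarrow> (('a \<Rightarrow> real) \<Rightarrow> ('a \<Rightarrow> real)) \<Rightarrow> bool" where
  "chosen_places k l c \<longleftrightarrow> (\<forall>v\<in>arch_places k. c v \<in> arch_places l \<and> lies_over k (c v) v)"

text \<open>
  The regulator does not depend on the chosen places \<open>c\<close>, on the enumeration \<open>w\<close> of the remaining
  archimedean places of \<open>l\<close>, or on the basis \<open>\<eta>\<close>.
\<close>

definition relative_regulator :: "'a::field_char_0 set \<Rightarrow> 'a set \<Rightarrow> real" where
  "relative_regulator k l = (SOME R. \<exists>c w \<eta>.
     let r = relative_unit_rank k l in
     chosen_places k l c \<and>
     bij_betw w {..<r} (arch_places l - c ` arch_places k) \<and>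
     group_basis (relative_units k l) r \<eta> \<and>
     R = \<bar>Determinant.det (mat r r (\<lambda>(i, j).
           real (local_degree l (w i)) * ln (the_elem (w i ` \<eta> j))))\<bar>)"

end

theory Submission
  imports Defs "HOL-Analysis.Analysis" "Jordan_Normal_Form.Char_Poly"
begin

text \<open>
  Choose one archimedean place of \<open>l\<close> over each archimedean place of \<open>k\<close>. The logarithms at the
  remaining places embed the relative units as a lattice of full rank \<open>r\<close> in \<open>r\<close>-space, of covolume
  the relative regulator; that the rank is full follows from Dirichlet's construction of units
  applied to \<open>u ^ m / N u\<close> with \<open>m = [l : k]\<close>. The norm condition makes the logarithms over each place
  of \<open>k\<close> sum to zero, so \<open>[l : \<rat>]\<close> times the height is at most the \<open>\<ell>\<^sup>1\<close>-norm of the embedded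
  unit. A subgroup of finite index is a sublattice whose covolume is multiplied by the index, and
  Minkowski's second theorem for the \<open>\<ell>\<^sup>1\<close>-ball, of volume \<open>2 ^ r / r!\<close>, yields independent lattice
  vectors with product of norms at most \<open>r!\<close> times the covolume.
\<close>

text \<open>Minkowski's theorem is proved by folding. The ball of radius half the
  \<open>i\<close>-th minimum survives division by one more lattice direction without overlap,
  because the difference of two of its points is too short to involve that direction. Between
  consecutive minima the radius grows by a factor \<open>c\<close>, and the volume by at least
  \<open>c\<close> for every direction not yet folded. Halving the radii cancels the
  \<open>2 ^ r\<close> in the volume of the cross-polytope, so that \<open>r!\<close> alone remains.
  The definitions raise two obstacles. Places are absolute values and local degrees are dimensions
  of completions, so archimedean places must first be identified with conjugacy classes of complex
  embeddings, and local degrees with the sizes of these classes; weighted sums over places then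
  become plain sums over embeddings. Moreover norm and regulator are values of a choice operator:
  some admissible value is shown to exist, and the argument then runs with whichever data the choice
  returns.\<close>

hide_const (open) Finite_Cartesian_Product.mat Finite_Cartesian_Product.vec Determinants.det
no_notation vec_nth (infixl "$" 90)

section \<open>Linear systems\<close>

text \<open>Gaussian elimination by induction on the equations: one that vanishes identically is
  dropped, and one with a nonzero coefficient at \<open>p\<close> is solved for the unknown
  \<open>p\<close> and substituted into the rest.\<close>

lemma homogeneous_nontrivial_solution:
  fixes a :: "'j \<Rightarrow> 'i \<Rightarrow> 'k::field"
  assumes "finite J" "finite I" "card J < card I"
  shows "\<exists>c. (\<exists>i\<in>I. c i \<noteq> 0) \<and> (\<forall>j\<in>J. (\<Sum>i\<in>I. a j i * c i) = 0)"
  using assms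
proof (induction J arbitrary: I a rule: finite_induct)
  case empty
  then obtain i where "i \<in> I" by (metis card_gt_0_iff card.empty ex_in_conv)
  thus ?case by (intro exI[of _ "\<lambda>_. 1"]) auto
next
  case (insert j0 J)
  show ?case
  proof (cases "\<forall>i\<in>I. a j0 i = 0")
    case True
    from insert.hyps insert.prems have "card J < card I" by simp
    from insert.IH[OF insert.prems(1) this, of a] True show ?thesis by auto
  next
    case False
    then obtain p where p: "p \<in> I" "a j0 p \<noteq> 0" by auto
    define I' where "I' = I - {p}"
    define a' where "a' j i = a j i - a j p * a j0 i / a j0 p" for j i
    have I: "I = insert p I'" "p \<notin> I'" "finite I'" using p insert.prems by (auto simp: I'_def)
    have "card J < card I'" using insert.hyps insert.prems I by simp
    from insert.IH[OF I(3) this, of a'] obtain c where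
      c: "\<exists>i\<in>I'. c i \<noteq> 0" "\<And>j. j \<in> J \<Longrightarrow> (\<Sum>i\<in>I'. a' j i * c i) = 0" by blast
    define s where "s = (\<Sum>i\<in>I'. a j0 i * c i)"
    define c' where "c' = c(p := - s / a j0 p)"
    have *: "(\<Sum>i\<in>I. a j i * c' i) = a j p * (- s / a j0 p) + (\<Sum>i\<in>I'. a j i * c i)" for j
    proof -
      have "(\<Sum>i\<in>I'. a j i * c' i) = (\<Sum>i\<in>I'. a j i * c i)"
        using I(2) by (intro sum.cong) (auto simp: c'_def)
      thus ?thesis using I by (simp add: c'_def)
    qed
    have "(\<Sum>i\<in>I. a j i * c' i) = 0" if j: "j \<in> J" for j
    proof -
      have "(\<Sum>i\<in>I'. a' j i * c i) = (\<Sum>i\<in>I'. a j i * c i) - a j p / a j0 p * s"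
        by (simp add: a'_def s_def algebra_simps sum_subtractf sum_distrib_left sum_divide_distrib)
      thus ?thesis using c(2)[OF j] by (simp add: *)
    qed
    moreover have "(\<Sum>i\<in>I. a j0 i * c' i) = 0" using p by (simp add: * s_def)
    moreover have "\<exists>i\<in>I. c' i \<noteq> 0" using c(1) I by (auto simp: c'_def)
    ultimately show ?thesis by auto
  qed
qed

text \<open>The right-hand side is adjoined as the column of an extra unknown \<open>None\<close>,
  which leaves more unknowns than equations. Triviality of the kernel forces the value at
  \<open>None\<close> to be nonzero, and dividing by it solves the system.\<close>

lemma square_system_solvable:
  fixes a :: "'j \<Rightarrow> 'i \<Rightarrow> 'k::field"
  assumes fin: "finite J" "finite I" and card: "card J = card I"
    and ker: "\<And>c. (\<And>j. j \<in> J \<Longrightarrow> (\<Sum>i\<in>I. a j i * c i) = 0) \<Longrightarrow> \<forall>i\<in>I. c i = 0"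
  shows "\<exists>c. \<forall>j\<in>J. (\<Sum>i\<in>I. a j i * c i) = t j"
proof -
  define a' where "a' j x = (case x of None \<Rightarrow> t j | Some i \<Rightarrow> a j i)" for j x
  have "card J < card (insert None (Some ` I))"
    using fin card by (simp add: card_image)
  from homogeneous_nontrivial_solution[OF fin(1) _ this, of a'] fin obtain c where
    c: "\<exists>x\<in>insert None (Some ` I). c x \<noteq> 0" and
    s: "\<And>j. j \<in> J \<Longrightarrow> (\<Sum>x\<in>insert None (Some ` I). a' j x * c x) = 0" by auto
  have s': "t j * c None + (\<Sum>i\<in>I. a j i * c (Some i)) = 0" if "j \<in> J" for j
    using s[OF that] fin by (simp add: sum.reindex a'_def)
  have N: "c None \<noteq> 0"
  proof
    assume 0: "c None = 0"
    have "\<forall>i\<in>I. c (Some i) = 0" using s' 0 by (intro ker) auto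
    with c 0 show False by auto
  qed
  show ?thesis
  proof (intro exI[of _ "\<lambda>i. - c (Some i) / c None"] ballI)
    fix j assume "j \<in> J"
    have "(\<Sum>i\<in>I. a j i * (- c (Some i) / c None)) = - (\<Sum>i\<in>I. a j i * c (Some i)) / c None"
      by (simp add: sum_negf sum_divide_distrib)
    also have "\<dots> = t j" using s'[OF \<open>j \<in> J\<close>] N by (simp add: field_simps add_eq_0_iff)
    finally show "(\<Sum>i\<in>I. a j i * (- c (Some i) / c None)) = t j" .
  qed
qed

text \<open>Row rank equals column rank, in kernel form: the transposed system is solvable for every
  unit vector, and pairing that solution with the equations for \<open>c\<close> isolates one
  coordinate of \<open>c\<close>.\<close>

lemma square_system_left_kernel:
  fixes a :: "'j \<Rightarrow> 'i \<Rightarrow> 'k::field"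
  assumes fin: "finite J" "finite I" and card: "card J = card I"
    and ker: "\<And>d. (\<And>i. i \<in> I \<Longrightarrow> (\<Sum>j\<in>J. d j * a j i) = 0) \<Longrightarrow> \<forall>j\<in>J. d j = 0"
    and c: "\<And>j. j \<in> J \<Longrightarrow> (\<Sum>i\<in>I. a j i * c i) = 0"
  shows "\<forall>i\<in>I. c i = 0"
proof
  fix i0 assume i0: "i0 \<in> I"
  have "\<exists>d. \<forall>i\<in>I. (\<Sum>j\<in>J. a j i * d j) = (if i = i0 then 1 else 0)"
    using ker fin card by (intro square_system_solvable) (auto simp: mult.commute)
  then obtain d where d: "\<And>i. i \<in> I \<Longrightarrow> (\<Sum>j\<in>J. a j i * d j) = (if i = i0 then 1 else 0)" by auto
  have "c i0 = (\<Sum>i\<in>I. (\<Sum>j\<in>J. a j i * d j) * c i)"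
    using i0 fin d by (simp add: if_distrib[of "\<lambda>x. x * _"] cong: if_cong)
  also have "\<dots> = (\<Sum>j\<in>J. d j * (\<Sum>i\<in>I. a j i * c i))"
    by (simp add: sum_distrib_left sum_distrib_right mult_ac sum.swap[of _ I J])
  also have "\<dots> = 0" using c by simp
  finally show "c i0 = 0" .
qed

lemma square_system_surj_left:
  fixes a :: "'j \<Rightarrow> 'i \<Rightarrow> 'k::field"
  assumes fin: "finite J" "finite I" and card: "card J = card I"
    and ker: "\<And>d. (\<And>i. i \<in> I \<Longrightarrow> (\<Sum>j\<in>J. d j * a j i) = 0) \<Longrightarrow> \<forall>j\<in>J. d j = 0"
  shows "\<exists>c. \<forall>j\<in>J. (\<Sum>i\<in>I. a j i * c i) = t j"
  using square_system_left_kernel[OF fin card ker] fin card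
  by (intro square_system_solvable) auto

text \<open>The family grows greedily. While it has fewer than \<open>card I\<close> members, some
  nonzero \<open>c\<close> is orthogonal to it; a member of \<open>V\<close> on which
  \<open>c\<close> does not vanish exists by assumption and is independent of the family.\<close>

lemma independent_family_of_trivial_annihilator:
  fixes V :: "('i \<Rightarrow> 'k::field) set"
  assumes fin: "finite I"
    and ann: "\<And>c. (\<And>x. x \<in> V \<Longrightarrow> (\<Sum>i\<in>I. c i * x i) = 0) \<Longrightarrow> \<forall>i\<in>I. c i = 0"
  shows "\<exists>v. (\<forall>p<card I. v p \<in> V) \<and>
    (\<forall>d. (\<forall>i\<in>I. (\<Sum>p<card I. d p * v p i) = 0) \<longrightarrow> (\<forall>p<card I. d p = 0))"
proof -
  have "\<exists>v. (\<forall>p<n. v p \<in> V) \<and>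
    (\<forall>d. (\<forall>i\<in>I. (\<Sum>p<n. d p * v p i) = 0) \<longrightarrow> (\<forall>p<n. d p = 0))" if "n \<le> card I" for n
    using that
  proof (induction n)
    case 0
    show ?case by simp
  next
    case (Suc n)
    from Suc.IH[OF Suc_leD[OF Suc.prems]]
    obtain v where v: "\<forall>p<n. v p \<in> V"
      "\<forall>d. (\<forall>i\<in>I. (\<Sum>p<n. d p * v p i) = 0) \<longrightarrow> (\<forall>p<n. d p = 0)"
      by (elim exE conjE)
    have "card {..<n} < card I" using Suc.prems by simp
    from homogeneous_nontrivial_solution[OF _ fin this, of v] obtain c
      where c: "\<exists>i\<in>I. c i \<noteq> 0" "\<forall>p\<in>{..<n}. (\<Sum>i\<in>I. v p i * c i) = 0" by blast
    have "\<not> (\<forall>x\<in>V. (\<Sum>i\<in>I. c i * x i) = 0)"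
    proof
      assume "\<forall>x\<in>V. (\<Sum>i\<in>I. c i * x i) = 0"
      hence "\<forall>i\<in>I. c i = 0" by (intro ann) simp
      with c(1) show False by simp
    qed
    then obtain x where x: "x \<in> V" "(\<Sum>i\<in>I. c i * x i) \<noteq> 0" unfolding Set.ball_simps by (elim bexE)
    have "\<forall>p<Suc n. d p = 0" if d: "\<forall>i\<in>I. (\<Sum>p<Suc n. d p * (v(n := x)) p i) = 0" for d
    proof -
      have d': "(\<Sum>p<n. d p * v p i) + d n * x i = 0" if "i \<in> I" for i
        using d that by simp
      have "(\<Sum>i\<in>I. c i * ((\<Sum>p<n. d p * v p i) + d n * x i)) =
            (\<Sum>p<n. d p * (\<Sum>i\<in>I. v p i * c i)) + d n * (\<Sum>i\<in>I. c i * x i)"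
        by (simp add: distrib_left sum.distrib sum_distrib_left mult_ac) (rule sum.swap)
      hence "d n * (\<Sum>i\<in>I. c i * x i) = 0" using d' c by simp
      hence dn: "d n = 0" using x by simp
      have "\<forall>i\<in>I. (\<Sum>p<n. d p * v p i) = 0" using d' dn by simp
      hence "\<forall>p<n. d p = 0" by (rule mp[OF spec[OF v(2)]])
      with dn show ?thesis by (simp add: less_Suc_eq)
    qed
    moreover have "\<forall>p<Suc n. (v(n := x)) p \<in> V" using v(1) x(1) by (simp add: less_Suc_eq)
    ultimately show ?case by (intro exI[of _ "v(n := x)"] conjI allI impI) simp_all
  qed
  from this[OF order.refl] show ?thesis .
qed

lemma det_nonzero_iff_kernel:
  fixes f :: "nat \<Rightarrow> nat \<Rightarrow> 'k::field"
  shows "det (mat n n (\<lambda>(i, j). f i j)) \<noteq> 0 \<longleftrightarrow>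
    (\<forall>c. (\<forall>i<n. (\<Sum>j<n. f i j * c j) = 0) \<longrightarrow> (\<forall>j<n. c j = 0))"
proof -
  let ?A = "mat n n (\<lambda>(i, j). f i j)"
  have *: "?A *\<^sub>v v = 0\<^sub>v n \<longleftrightarrow> (\<forall>i<n. (\<Sum>j<n. f i j * v $ j) = 0)" if "v \<in> carrier_vec n" for v
    using that by (auto simp: Matrix.vec_eq_iff scalar_prod_def lessThan_atLeast0)
  have "det ?A = 0 \<longleftrightarrow> (\<exists>v. v \<in> carrier_vec n \<and> v \<noteq> 0\<^sub>v n \<and> ?A *\<^sub>v v = 0\<^sub>v n)"
    by (rule det_0_iff_vec_prod_zero_field) simp
  also have "\<dots> \<longleftrightarrow> (\<exists>c. (\<forall>i<n. (\<Sum>j<n. f i j * c j) = 0) \<and> (\<exists>j<n. c j \<noteq> 0))"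
  proof (safe)
    fix v assume "v \<in> carrier_vec n" "v \<noteq> 0\<^sub>v n" "?A *\<^sub>v v = 0\<^sub>v n"
    thus "\<exists>c. (\<forall>i<n. (\<Sum>j<n. f i j * c j) = 0) \<and> (\<exists>j<n. c j \<noteq> 0)"
      using * by (intro exI[of _ "\<lambda>j. v $ j"]) (auto simp: Matrix.vec_eq_iff)
  next
    fix c j assume "\<forall>i<n. (\<Sum>j<n. f i j * c j) = 0" "j < n" "c j \<noteq> 0"
    thus "\<exists>v. v \<in> carrier_vec n \<and> v \<noteq> 0\<^sub>v n \<and> ?A *\<^sub>v v = 0\<^sub>v n"
      using * by (intro exI[of _ "vec n c"]) (auto simp: Matrix.vec_eq_iff)
  qed
  finally show ?thesis by blast
qed

section \<open>Algebraic integers\<close>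

text \<open>The vector \<open>v\<close> is a nonzero eigenvector, so \<open>z\<close> is a root of
  the characteristic polynomial of an integer matrix, which is monic with integer
  coefficients.\<close>

lemma algebraic_int_of_integral_system:
  fixes z :: "'a::field_char_0" and M :: "'i \<Rightarrow> 'i \<Rightarrow> int" and v :: "'i \<Rightarrow> 'a"
  assumes fin: "finite I"
    and eq: "\<And>i. i \<in> I \<Longrightarrow> z * v i = (\<Sum>j\<in>I. of_int (M i j) * v j)"
    and nz: "k \<in> I" "v k \<noteq> 0"
  shows "algebraic_int z"
proof -
  define n where "n = card I"
  obtain h where h: "bij_betw h {..<n} I"
    using ex_bij_betw_nat_finite[OF fin] by (auto simp: n_def lessThan_atLeast0)
  define A where "A = mat n n (\<lambda>(i, j). M (h i) (h j))"
  have A: "A \<in> carrier_mat n n" by (simp add: A_def)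
  have hI: "h i \<in> I" if "i < n" for i using h that by (auto simp: bij_betw_def)
  obtain k' where k': "k' < n" "h k' = k" using h nz(1) by (auto simp: bij_betw_def)
  have "z * v (h i) = (\<Sum>j=0..<n. of_int (M (h i) (h j)) * v (h j))" if "i < n" for i
    using eq[OF hI[OF that]] sum.reindex_bij_betw[OF h, of "\<lambda>j. of_int (M (h i) j) * v j"]
    by (simp add: lessThan_atLeast0)
  hence "eigenvector (of_int_hom.mat_hom A) (vec n (v \<circ> h)) z"
    unfolding eigenvector_def
    using nz k' by (auto simp: A_def Matrix.vec_eq_iff scalar_prod_def)
  hence "poly (char_poly (of_int_hom.mat_hom A)) z = 0"
    using eigenvalue_root_char_poly[of "of_int_hom.mat_hom A" n z] A by (auto simp: eigenvalue_def)
  hence "poly (of_int_poly (char_poly A)) z = 0" by (simp add: of_int_hom.char_poly_hom[OF A])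
  moreover have "lead_coeff (of_int_poly (char_poly A) :: 'a poly) = 1"
    using degree_monic_char_poly[OF A] by simp
  ultimately show ?thesis by (intro algebraic_int.intros[of "of_int_poly (char_poly A)"]) auto
qed

text \<open>Integrality as finite generation of the ring of integer polynomials in \<open>x\<close>.
  This form serves both the closure under sums and products and the bound at non-archimedean
  places.\<close>

lemma algebraic_int_power_reduction:
  fixes x :: "'a::field_char_0"
  assumes "algebraic_int x"
  obtains n and M :: "nat \<Rightarrow> nat \<Rightarrow> int" where "n > 0" "\<And>N. x ^ N = (\<Sum>j<n. of_int (M N j) * x ^ j)"
proof -
  from assms obtain p where p: "lead_coeff p = 1" "\<forall>i. coeff p i \<in> \<int>" "poly p x = 0"
    by (auto elim: algebraic_int.cases)
  define n where "n = Polynomial.degree p"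
  from p(2) have "\<forall>i. \<exists>a. coeff p i = of_int a" by (auto elim: Ints_cases)
  then obtain a where a: "\<And>i. coeff p i = of_int (a i)" by metis
  have n: "n > 0"
  proof (rule ccontr)
    assume "\<not> n > 0"
    hence "p = [:1:]" using p(1) by (auto simp: n_def elim!: degree_eq_zeroE)
    with p(3) show False by simp
  qed
  have "0 = (\<Sum>i\<le>n. of_int (a i) * x ^ i)" using p(3) by (simp add: poly_altdef a n_def)
  also have "\<dots> = (\<Sum>i<n. of_int (a i) * x ^ i) + of_int (a n) * x ^ n"
    by (simp add: lessThan_Suc_atMost[symmetric])
  also have "of_int (a n) = (1::'a)" using p(1) a[of n] by (simp add: n_def)
  finally have xn: "x ^ n = (\<Sum>i<n. of_int (- a i) * x ^ i)"
    by (simp add: sum_negf eq_neg_iff_add_eq_0 add.commute)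
  have "\<exists>b. x ^ N = (\<Sum>j<n. of_int (b j) * x ^ j)" for N
  proof (induction N)
    case 0
    show ?case using n
      by (intro exI[of _ "\<lambda>j. if j = 0 then 1 else 0"])
         (simp add: if_distrib[of of_int] if_distrib[of "\<lambda>y. y * _"] cong: if_cong)
  next
    case (Suc N)
    then obtain b where b: "x ^ N = (\<Sum>j<n. of_int (b j) * x ^ j)" by blast
    obtain m where m: "n = Suc m" using n gr0_conv_Suc by blast
    have "x ^ Suc N = (\<Sum>j<n. of_int (b j) * x ^ Suc j)"
      by (simp add: b sum_distrib_left mult_ac)
    also have "\<dots> = (\<Sum>j<m. of_int (b j) * x ^ Suc j) + of_int (b m) * x ^ n" by (simp add: m)
    also have "(\<Sum>j<m. of_int (b j) * x ^ Suc j) =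
               (\<Sum>j<n. of_int (if j = 0 then 0 else b (j - 1)) * x ^ j)"
      unfolding m sum.lessThan_Suc_shift by simp
    also have "of_int (b m) * x ^ n = (\<Sum>j<n. of_int (b m * - a j) * x ^ j)"
      by (simp add: xn sum_distrib_left mult_ac)
    also have "(\<Sum>j<n. of_int (if j = 0 then 0 else b (j - 1)) * x ^ j) + \<dots> =
      (\<Sum>j<n. of_int ((if j = 0 then 0 else b (j - 1)) + b m * - a j) * x ^ j)"
      unfolding sum.distrib[symmetric] by (intro sum.cong) (auto simp: algebra_simps)
    finally show ?case by (rule exI[where x = "\<lambda>j. (if j = 0 then 0 else b (j - 1)) + b m * - a j"])
  qed
  hence "\<exists>M. \<forall>N. x ^ N = (\<Sum>j<n. of_int (M N j) * x ^ j)" by metis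
  with n that show thesis by blast
qed

text \<open>Multiplication by \<open>x * y\<close> or by \<open>x + y\<close> takes a monomial to
  one or two monomials, so it acts by an integer matrix on finitely many spanning monomials. The
  parameters cover both cases: \<open>e = 0\<close> gives the product and \<open>e = 1\<close> the
  sum.\<close>

lemma algebraic_int_of_monomial_action:
  fixes x y z :: "'a::field_char_0" and P Q :: "nat \<Rightarrow> nat \<Rightarrow> int"
  assumes x: "\<And>N. x ^ N = (\<Sum>j<n. of_int (P N j) * x ^ j)" "n > 0"
    and y: "\<And>N. y ^ N = (\<Sum>j<m. of_int (Q N j) * y ^ j)" "m > 0"
    and z: "\<And>i j. z * (x ^ i * y ^ j) = x ^ (i + p) * y ^ (j + q) + of_int e * (x ^ (i + p') * y ^ (j + q'))"
  shows "algebraic_int z"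
proof -
  let ?I = "{..<n} \<times> {..<m}"
  define R where "R N N' = (\<lambda>(k, k'). P N k * Q N' k')" for N N'
  define v where "v = (\<lambda>(k, k'). x ^ k * y ^ k')"
  have R: "x ^ N * y ^ N' = (\<Sum>k\<in>?I. of_int (R N N' k) * v k)" for N N'
  proof -
    have "x ^ N * y ^ N' = (\<Sum>i<n. \<Sum>j<m. of_int (R N N' (i, j)) * v (i, j))"
      by (subst x(1)[of N], subst y(1)[of N'], subst sum_product, intro sum.cong refl)
         (simp add: R_def v_def)
    thus ?thesis by (simp add: sum.cartesian_product)
  qed
  define M where "M = (\<lambda>(k, k') l. R (k + p) (k' + q) l + e * R (k + p') (k' + q') l)"
  have eq: "z * v i = (\<Sum>j\<in>?I. of_int (M i j) * v j)" for i
  proof -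
    obtain k k' where i: "i = (k, k')" by (cases i)
    have "z * v i = x ^ (k + p) * y ^ (k' + q) + of_int e * (x ^ (k + p') * y ^ (k' + q'))"
      unfolding i v_def prod.case by (rule z)
    also have "\<dots> = (\<Sum>j\<in>?I. of_int (M i j) * v j)"
      unfolding R sum_distrib_left sum.distrib[symmetric]
      by (intro sum.cong refl) (simp add: M_def i algebra_simps)
    finally show ?thesis .
  qed
  show "algebraic_int z"
    by (rule algebraic_int_of_integral_system[of ?I, OF _ eq, of "(0, 0)"]) (use x(2) y(2) in \<open>auto simp: v_def\<close>)
qed

lemma algebraic_int_times:
  fixes x y :: "'a::field_char_0"
  assumes "algebraic_int x" "algebraic_int y"
  shows "algebraic_int (x * y)"
proof -
  from assms(1) obtain n and P :: "nat \<Rightarrow> nat \<Rightarrow> int" where x: "n > 0" "\<And>N. x ^ N = (\<Sum>j<n. of_int (P N j) * x ^ j)"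
    using algebraic_int_power_reduction by blast
  from assms(2) obtain m and Q :: "nat \<Rightarrow> nat \<Rightarrow> int" where y: "m > 0" "\<And>N. y ^ N = (\<Sum>j<m. of_int (Q N j) * y ^ j)"
    using algebraic_int_power_reduction by blast
  show ?thesis
    by (rule algebraic_int_of_monomial_action[OF x(2,1) y(2,1), where p = 1 and q = 1 and e = 0
       and p' = 0 and q' = 0]) (auto simp: algebra_simps)
qed

lemma algebraic_int_plus:
  fixes x y :: "'a::field_char_0"
  assumes "algebraic_int x" "algebraic_int y"
  shows "algebraic_int (x + y)"
proof -
  from assms(1) obtain n and P :: "nat \<Rightarrow> nat \<Rightarrow> int" where x: "n > 0" "\<And>N. x ^ N = (\<Sum>j<n. of_int (P N j) * x ^ j)"
    using algebraic_int_power_reduction by blast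
  from assms(2) obtain m and Q :: "nat \<Rightarrow> nat \<Rightarrow> int" where y: "m > 0" "\<And>N. y ^ N = (\<Sum>j<m. of_int (Q N j) * y ^ j)"
    using algebraic_int_power_reduction by blast
  show ?thesis
    by (rule algebraic_int_of_monomial_action[OF x(2,1) y(2,1), where p = 1 and q = 0 and e = 1
       and p' = 0 and q' = 1]) (auto simp: algebra_simps)
qed

lemma algebraic_int_diff:
  fixes x y :: "'a::field_char_0"
  shows "algebraic_int x \<Longrightarrow> algebraic_int y \<Longrightarrow> algebraic_int (x - y)"
  using algebraic_int_plus[of x "- y"] by auto

lemma algebraic_int_sum:
  fixes f :: "'b \<Rightarrow> 'a::field_char_0"
  shows "(\<And>i. i \<in> I \<Longrightarrow> algebraic_int (f i)) \<Longrightarrow> algebraic_int (sum f I)"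
  by (induction I rule: infinite_finite_induct) (auto intro: algebraic_int_plus)

lemma algebraic_int_prod:
  fixes f :: "'b \<Rightarrow> 'a::field_char_0"
  shows "(\<And>i. i \<in> I \<Longrightarrow> algebraic_int (f i)) \<Longrightarrow> algebraic_int (prod f I)"
  by (induction I rule: infinite_finite_induct) (auto intro: algebraic_int_times)

section \<open>Lebesgue measure on finite powers of the reals\<close>

abbreviation lborel_power :: "'i set \<Rightarrow> ('i \<Rightarrow> real) measure" where
  "lborel_power I \<equiv> Pi\<^sub>M I (\<lambda>_. lborel)"

interpretation lborel_product: product_sigma_finite "\<lambda>_. lborel :: real measure"
  by standard

lemma space_lborel_power: "space (lborel_power I) = extensional I"
  by (simp add: space_PiM PiE_def)

lemma emeasure_lborel_affine:
  fixes c t :: real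
  assumes "c \<noteq> 0" "A \<in> sets borel"
  shows "emeasure lborel A = ennreal \<bar>c\<bar> * emeasure lborel ((\<lambda>x. t + c * x) -` A)"
proof -
  have "emeasure lborel A = emeasure (density (distr lborel borel (\<lambda>x. t + c * x)) (\<lambda>_. ennreal \<bar>c\<bar>)) A"
    using lborel_real_affine[OF assms(1), of t] by simp
  also have "\<dots> = ennreal \<bar>c\<bar> * emeasure (distr lborel borel (\<lambda>x. t + c * x)) A"
    using assms by (simp add: emeasure_density nn_integral_cmult_indicator)
  also have "emeasure (distr lborel borel (\<lambda>x. t + c * x)) A = emeasure lborel ((\<lambda>x. t + c * x) -` A)"
    using assms by (subst emeasure_distr) auto
  finally show ?thesis .
qed

lemma measurable_affine_power [measurable]:
  fixes a c :: "'i \<Rightarrow> real"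
  shows "(\<lambda>x. \<lambda>i\<in>I. a i + c i * x i) \<in> lborel_power I \<rightarrow>\<^sub>M lborel_power I"
  by (rule measurable_restrict) measurable

text \<open>On boxes the claim factors into one-dimensional affine substitutions, and a measure that
  agrees with the product measure on boxes is the product measure.\<close>

lemma emeasure_lborel_power_affine:
  fixes a c :: "'i \<Rightarrow> real"
  assumes fin: "finite I" and c: "\<And>i. i \<in> I \<Longrightarrow> c i \<noteq> 0" and S: "S \<in> sets (lborel_power I)"
  shows "emeasure (lborel_power I) S = ennreal (\<Prod>i\<in>I. \<bar>c i\<bar>) *
    emeasure (lborel_power I) ((\<lambda>x. \<lambda>i\<in>I. a i + c i * x i) -` S \<inter> space (lborel_power I))"
proof -
  let ?f = "\<lambda>x. \<lambda>i\<in>I. a i + c i * x i" and ?M = "lborel_power I"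
  define P where "P = density (distr ?M ?M ?f) (\<lambda>_. ennreal (\<Prod>i\<in>I. \<bar>c i\<bar>))"
  have em: "emeasure P B = ennreal (\<Prod>i\<in>I. \<bar>c i\<bar>) * emeasure ?M (?f -` B \<inter> space ?M)"
    if "B \<in> sets ?M" for B
  proof -
    have "emeasure P B = ennreal (\<Prod>i\<in>I. \<bar>c i\<bar>) * emeasure (distr ?M ?M ?f) B"
      using that by (simp add: P_def emeasure_density nn_integral_cmult_indicator)
    also have "emeasure (distr ?M ?M ?f) B = emeasure ?M (?f -` B \<inter> space ?M)"
      using that by (subst emeasure_distr) auto
    finally show ?thesis .
  qed
  have "P = ?M"
  proof (rule lborel_product.PiM_eqI[OF fin])
    show "sets P = sets ?M" by (simp add: P_def)
  next
    fix A :: "'i \<Rightarrow> real set" assume A: "\<And>i. i \<in> I \<Longrightarrow> A i \<in> sets lborel"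
    have "?f -` Pi\<^sub>E I A \<inter> space ?M = Pi\<^sub>E I (\<lambda>i. (\<lambda>x. a i + c i * x) -` A i)"
      by (auto simp: space_PiM PiE_def Pi_def)
    moreover have "(\<lambda>x. a i + c i * x) -` A i \<in> sets lborel" if "i \<in> I" for i
      using A[OF that] measurable_sets[of "\<lambda>x. a i + c i * x" borel borel "A i"] by simp
    ultimately have "emeasure P (Pi\<^sub>E I A) = ennreal (\<Prod>i\<in>I. \<bar>c i\<bar>) *
        (\<Prod>i\<in>I. emeasure lborel ((\<lambda>x. a i + c i * x) -` A i))"
      using A fin by (subst em) (auto intro!: sets_PiM_I_finite simp: lborel_product.emeasure_PiM)
    also have "\<dots> = (\<Prod>i\<in>I. ennreal \<bar>c i\<bar> * emeasure lborel ((\<lambda>x. a i + c i * x) -` A i))"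
      by (simp add: prod.distrib prod_ennreal)
    also have "\<dots> = (\<Prod>i\<in>I. emeasure lborel (A i))"
      using A c by (intro prod.cong refl emeasure_lborel_affine[symmetric]) auto
    finally show "emeasure P (Pi\<^sub>E I A) = (\<Prod>i\<in>I. emeasure lborel (A i))" .
  qed
  thus ?thesis using em[OF S] by simp
qed

lemma emeasure_lborel_power_translate:
  fixes a :: "'i \<Rightarrow> real"
  assumes "finite I" "S \<in> sets (lborel_power I)"
  shows "emeasure (lborel_power I) ((\<lambda>x. \<lambda>i\<in>I. x i + a i) -` S \<inter> space (lborel_power I)) =
    emeasure (lborel_power I) S"
  using emeasure_lborel_power_affine[of I "\<lambda>_. 1" S a] assms by (simp add: add.commute)

section \<open>Linear maps and volume\<close>

definition linear_action :: "nat \<Rightarrow> real mat \<Rightarrow> (nat \<Rightarrow> real) \<Rightarrow> nat \<Rightarrow> real" where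
  "linear_action n A x = (\<lambda>i\<in>{..<n}. \<Sum>j<n. A $$ (i, j) * x j)"

lemma measurable_linear_action [measurable]:
  "linear_action n A \<in> lborel_power {..<n} \<rightarrow>\<^sub>M lborel_power {..<n}"
  unfolding linear_action_def by (rule measurable_restrict) measurable

lemma linear_action_mult:
  assumes "A \<in> carrier_mat n n" "B \<in> carrier_mat n n"
  shows "linear_action n (A * B) x = linear_action n A (linear_action n B x)"
proof -
  have "(\<Sum>j<n. (A * B) $$ (i, j) * x j) = (\<Sum>j<n. A $$ (i, j) * (\<Sum>k<n. B $$ (j, k) * x k))"
    if i: "i < n" for i
  proof -
    have "(\<Sum>j<n. (A * B) $$ (i, j) * x j) = (\<Sum>j<n. (\<Sum>k<n. A $$ (i, k) * B $$ (k, j)) * x j)"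
      using assms i by (intro sum.cong refl) (auto simp: scalar_prod_def lessThan_atLeast0)
    also have "\<dots> = (\<Sum>j<n. \<Sum>k<n. A $$ (i, k) * (B $$ (k, j) * x j))"
      by (simp add: sum_distrib_left sum_distrib_right mult_ac)
    also have "\<dots> = (\<Sum>k<n. \<Sum>j<n. A $$ (i, k) * (B $$ (k, j) * x j))" by (rule sum.swap)
    finally show ?thesis by (simp add: sum_distrib_left)
  qed
  thus ?thesis by (auto simp: linear_action_def fun_eq_iff)
qed

text \<open>The change of variables formula in preimage form, so that measurability of images never
  has to be discussed and the property is stable under products of matrices.\<close>

definition scales_volume :: "nat \<Rightarrow> real mat \<Rightarrow> bool" where
  "scales_volume n A \<longleftrightarrow> (\<forall>S\<in>sets (lborel_power {..<n}).
     emeasure (lborel_power {..<n}) S = ennreal \<bar>det A\<bar> *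
     emeasure (lborel_power {..<n}) (linear_action n A -` S \<inter> space (lborel_power {..<n})))"

lemma scales_volume_mult:
  assumes AB: "A \<in> carrier_mat n n" "B \<in> carrier_mat n n" and "scales_volume n A" "scales_volume n B"
  shows "scales_volume n (A * B)"
  unfolding scales_volume_def
proof
  let ?M = "lborel_power {..<n}"
  fix S assume S: "S \<in> sets ?M"
  have S': "linear_action n A -` S \<inter> space ?M \<in> sets ?M"
    by (rule measurable_sets[OF measurable_linear_action S])
  have "linear_action n B x \<in> space ?M \<longleftrightarrow> True" for x
    by (simp add: space_lborel_power linear_action_def)
  note sp = this
  have eq: "linear_action n (A * B) -` S \<inter> space ?M =
      linear_action n B -` (linear_action n A -` S \<inter> space ?M) \<inter> space ?M"
    by (intro Set.set_eqI) (simp only: vimage_eq Int_iff linear_action_mult[OF AB] sp simp_thms)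
  have "emeasure ?M S = ennreal \<bar>det A\<bar> * (ennreal \<bar>det B\<bar> *
      emeasure ?M (linear_action n (A * B) -` S \<inter> space ?M))"
    unfolding eq bspec[OF assms(4)[unfolded scales_volume_def] S', symmetric]
    by (rule bspec[OF assms(3)[unfolded scales_volume_def] S])
  thus "emeasure ?M S = ennreal \<bar>det (A * B)\<bar> *
      emeasure ?M (linear_action n (A * B) -` S \<inter> space ?M)"
    by (simp only: det_mult[OF AB] abs_mult ennreal_mult[OF abs_ge_zero abs_ge_zero] mult.assoc)
qed

text \<open>A scaling of the coordinate \<open>k\<close> combined with a shear along it. These
  matrices are the elementary factors into which an invertible matrix is decomposed below.\<close>

definition column_mat :: "nat \<Rightarrow> nat \<Rightarrow> (nat \<Rightarrow> real) \<Rightarrow> real mat" where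
  "column_mat n k a = mat n n (\<lambda>(i, j). if j = k then a i else if i = j then 1 else 0)"

lemma column_mat_carrier [simp]: "column_mat n k a \<in> carrier_mat n n"
  by (simp add: column_mat_def)

lemma sum_column_mat_row:
  fixes f :: "nat \<Rightarrow> real"
  assumes "i < n" "k < n"
  shows "(\<Sum>j<n. column_mat n k a $$ (i, j) * f j) = (if i = k then a k * f k else f i + a i * f k)"
proof -
  have "(\<Sum>j<n. column_mat n k a $$ (i, j) * f j) =
     (\<Sum>j<n. (if j = k then a i * f k else 0) + (if j = i then (if i = k then 0 else f i) else 0))"
    using assms by (intro sum.cong) (auto simp: column_mat_def)
  also have "\<dots> = a i * f k + (if i = k then 0 else f i)"
    using assms by (simp add: sum.distrib)
  finally show ?thesis by simp
qed

lemma column_mat_mult: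
  assumes "i < n" "j < n" "k < n" "B \<in> carrier_mat n n"
  shows "(column_mat n k a * B) $$ (i, j) =
    (if i = k then a k * B $$ (k, j) else B $$ (i, j) + a i * B $$ (k, j))"
proof -
  have "(column_mat n k a * B) $$ (i, j) = (\<Sum>l<n. column_mat n k a $$ (i, l) * B $$ (l, j))"
    using assms by (simp add: scalar_prod_def column_mat_def lessThan_atLeast0)
  thus ?thesis using sum_column_mat_row[OF assms(1,3), of a "\<lambda>l. B $$ (l, j)"] by simp
qed

lemma det_column_mat:
  assumes "k < n"
  shows "det (column_mat n k a) = a k"
proof -
  have "det (column_mat n k a) =
    (\<Sum>j<n. column_mat n k a $$ (k, j) * cofactor (column_mat n k a) k j)"
    by (rule laplace_expansion_row[OF column_mat_carrier assms])
  also have "\<dots> = a k * cofactor (column_mat n k a) k k"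
    using sum_column_mat_row[OF assms assms, of a] by simp
  also have "mat_delete (column_mat n k a) k k = 1\<^sub>m (n - 1)"
    using assms by (intro eq_matI) (auto simp: mat_delete_def column_mat_def)
  hence "cofactor (column_mat n k a) k k = 1" by (simp add: cofactor_def)
  finally show ?thesis by simp
qed

text \<open>Fubini with the coordinate \<open>k\<close> outermost: for a fixed value
  \<open>y\<close> there, the action translates the remaining coordinates, which preserves their
  volume, and replaces \<open>y\<close> by \<open>a k * y\<close>, which contributes the factor
  \<open>\<bar>a k\<bar>\<close>.\<close>

lemma scales_volume_column_mat:
  assumes k: "k < n" and ak: "a k \<noteq> 0"
  shows "scales_volume n (column_mat n k a)"
  unfolding scales_volume_def
proof
  let ?M = "lborel_power {..<n}" and ?L = "linear_action n (column_mat n k a)"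
  define J where "J = {..<n} - {k}"
  have J: "{..<n} = insert k J" "finite J" "k \<notin> J" using k by (auto simp: J_def)
  fix S assume S: "S \<in> sets ?M"
  define g where "g z = (\<integral>\<^sup>+x. indicator S (x(k := z)) \<partial>lborel_power J)" for z
  have S2 [measurable]: "(indicator S :: _ \<Rightarrow> ennreal) \<in> borel_measurable ?M" using S by simp
  have upd: "(\<lambda>x. x(k := z)) \<in> lborel_power J \<rightarrow>\<^sub>M ?M" for z
    unfolding J(1) by (rule measurable_fun_upd[where J = J]) auto
  have "(\<lambda>p. (snd p)(k := fst p)) \<in> lborel \<Otimes>\<^sub>M lborel_power J \<rightarrow>\<^sub>M ?M"
    unfolding J(1) by (rule measurable_fun_upd[where J = J]) auto
  hence "(\<lambda>(z, x). indicator S (x(k := z)) :: ennreal) \<in> borel_measurable (lborel \<Otimes>\<^sub>M lborel_power J)"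
    unfolding split_beta by (rule measurable_compose[OF _ S2])
  hence g: "g \<in> borel_measurable lborel"
    unfolding g_def
    by (rule sigma_finite_measure.borel_measurable_nn_integral[OF lborel_product.sigma_finite[OF J(2)]])
  have inner: "(\<integral>\<^sup>+x. indicator S (?L (x(k := y))) \<partial>lborel_power J) = g (a k * y)" for y
  proof -
    define S' where "S' = (\<lambda>x. x(k := a k * y)) -` S \<inter> space (lborel_power J)"
    have S': "S' \<in> sets (lborel_power J)" unfolding S'_def using upd S by (rule measurable_sets)
    have L: "?L (x(k := y)) = (\<lambda>i\<in>J. x i + a i * y)(k := a k * y)" if "x \<in> space (lborel_power J)" for x
    proof
      fix i
      show "?L (x(k := y)) i = ((\<lambda>i\<in>J. x i + a i * y)(k := a k * y)) i"
      proof (cases "i < n")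
        case True
        thus ?thesis using sum_column_mat_row[OF True k, of a "x(k := y)"]
          by (auto simp: linear_action_def J_def)
      next
        case False
        thus ?thesis using k by (auto simp: linear_action_def J_def)
      qed
    qed
    have "(\<integral>\<^sup>+x. indicator S (?L (x(k := y))) \<partial>lborel_power J) =
      (\<integral>\<^sup>+x. indicator ((\<lambda>x. \<lambda>i\<in>J. x i + a i * y) -` S' \<inter> space (lborel_power J)) x \<partial>lborel_power J)"
    proof (rule nn_integral_cong)
      fix x assume x: "x \<in> space (lborel_power J)"
      have "(\<lambda>i\<in>J. x i + a i * y) \<in> space (lborel_power J)" by (simp add: space_lborel_power)
      with x show "indicator S (?L (x(k := y))) = (indicator ((\<lambda>x. \<lambda>i\<in>J. x i + a i * y) -` S' \<inter>
          space (lborel_power J)) x :: ennreal)"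
        by (simp only: L[OF x] S'_def indicator_def vimage_eq Int_iff simp_thms)
    qed
    also have "\<dots> = emeasure (lborel_power J) ((\<lambda>x. \<lambda>i\<in>J. x i + a i * y) -` S' \<inter> space (lborel_power J))"
      using measurable_sets[OF measurable_affine_power[of "\<lambda>i. a i * y" "\<lambda>_. 1" J] S']
      by (intro nn_integral_indicator) (simp add: add.commute)
    also have "\<dots> = emeasure (lborel_power J) S'"
      by (rule emeasure_lborel_power_translate[OF J(2) S'])
    also have "\<dots> = (\<integral>\<^sup>+x. indicator S' x \<partial>lborel_power J)" using S' by simp
    also have "\<dots> = g (a k * y)" unfolding g_def
      by (intro nn_integral_cong) (simp add: S'_def indicator_def)
    finally show ?thesis .
  qed
  have "emeasure ?M (?L -` S \<inter> space ?M) = (\<integral>\<^sup>+x. indicator (?L -` S \<inter> space ?M) x \<partial>?M)"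
    using measurable_sets[OF measurable_linear_action S] by (simp only: nn_integral_indicator)
  also have "\<dots> = (\<integral>\<^sup>+x. indicator S (?L x) \<partial>?M)"
    by (intro nn_integral_cong) (simp add: indicator_def)
  also have "\<dots> = (\<integral>\<^sup>+y. \<integral>\<^sup>+x. indicator S (?L (x(k := y))) \<partial>lborel_power J \<partial>lborel)"
    unfolding J(1)
    by (rule lborel_product.product_nn_integral_insert_rev[OF J(2,3)]) (unfold J(1)[symmetric], rule measurable_compose[OF measurable_linear_action S2])
  also have "\<dots> = (\<integral>\<^sup>+y. g (0 + a k * y) \<partial>lborel)" unfolding inner add_0_left ..
  finally have *: "ennreal \<bar>a k\<bar> * emeasure ?M (?L -` S \<inter> space ?M) = (\<integral>\<^sup>+y. g y \<partial>lborel)"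
    by (subst nn_integral_real_affine[OF _ ak, where t = 0]) (use g in simp_all)
  have "emeasure ?M S = (\<integral>\<^sup>+x. indicator S x \<partial>?M)" using S by simp
  also have "\<dots> = (\<integral>\<^sup>+y. g y \<partial>lborel)"
    unfolding J(1) g_def
    by (rule lborel_product.product_nn_integral_insert_rev[OF J(2,3)]) (unfold J(1)[symmetric], rule S2)
  finally show "emeasure ?M S = ennreal \<bar>det (column_mat n k a)\<bar> *
      emeasure ?M (?L -` S \<inter> space ?M)"
    using * by (simp add: det_column_mat[OF k])
qed

text \<open>Gauss-Jordan elimination, run as a downward induction on the number \<open>k\<close> of
  leading columns that already agree with the identity matrix. Clearing one further column splits
  off elementary factors.\<close>

lemma scales_volume_of_det_nonzero:
  assumes "A \<in> carrier_mat n n" "det A \<noteq> 0"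
  shows "scales_volume n A"
proof -
  have "scales_volume n A" if "k \<le> n" "A \<in> carrier_mat n n" "det A \<noteq> 0"
    "\<forall>i<n. \<forall>j<k. A $$ (i, j) = (if i = j then 1 else 0)" for k A
    using that
  proof (induction k arbitrary: A rule: inc_induct)
    case base
    have "linear_action n A x = x" if "x \<in> space (lborel_power {..<n})" for x
    proof -
      have "(\<Sum>j<n. A $$ (i, j) * x j) = x i" if "i < n" for i
      proof -
        have "(\<Sum>j<n. A $$ (i, j) * x j) = (\<Sum>j<n. if j = i then x j else 0)"
          using base(3) that by (intro sum.cong refl) simp
        thus ?thesis using that by simp
      qed
      thus ?thesis using that
        by (auto simp: linear_action_def space_lborel_power fun_eq_iff extensional_def)
    qed
    hence "linear_action n A -` S \<inter> space (lborel_power {..<n}) = S"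
      if "S \<in> sets (lborel_power {..<n})" for S using sets.sets_into_space[OF that] by auto
    moreover have "A = 1\<^sub>m n" using base(1,3) by (intro eq_matI) simp_all
    ultimately show ?case by (simp add: scales_volume_def)
  next
    case (step k)
    note A = step.prems(1)
    have pivot: "scales_volume n B" if B: "B \<in> carrier_mat n n" "det B \<noteq> 0"
      "\<forall>i<n. \<forall>j<k. B $$ (i, j) = (if i = j then 1 else 0)" "B $$ (k, k) \<noteq> 0" for B
    proof -
      define a where "a i = B $$ (i, k)" for i
      define a' where "a' i = (if i = k then 1 / a k else - a i / a k)" for i
      define C where "C = column_mat n k a' * B"
      have ak: "a k \<noteq> 0" using B by (simp add: a_def)
      have C: "C \<in> carrier_mat n n" using B by (simp add: C_def mult_carrier_mat[of _ n n])
      have Cij: "C $$ (i, j) = (if i = k then a' k * B $$ (k, j) else B $$ (i, j) + a' i * B $$ (k, j))"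
        if "i < n" "j < n" for i j
        unfolding C_def using column_mat_mult[OF that step.hyps(2) B(1)] .
      have BC: "B = column_mat n k a * C"
      proof (rule eq_matI)
        fix i j assume "i < dim_row (column_mat n k a * C)" "j < dim_col (column_mat n k a * C)"
        hence ij: "i < n" "j < n" using C by (auto simp: column_mat_def)
        show "B $$ (i, j) = (column_mat n k a * C) $$ (i, j)"
          using ak step.hyps(2) by (simp add: column_mat_mult[OF ij step.hyps(2) C] Cij ij a'_def)
      qed (use B C in \<open>auto simp: column_mat_def\<close>)
      have "det C \<noteq> 0" using B(2) BC det_mult[OF column_mat_carrier C] by auto
      moreover have "\<forall>i<n. \<forall>j<Suc k. C $$ (i, j) = (if i = j then 1 else 0)"
        using B(3) step.hyps ak by (auto simp: Cij less_Suc_eq a'_def a_def)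
      ultimately have "scales_volume n C" using step.IH C by blast
      thus ?thesis unfolding BC
        by (intro scales_volume_mult scales_volume_column_mat) (use C ak step.hyps in auto)
    qed
    show ?case
    proof (cases "A $$ (k, k) = 0")
      case False
      thus ?thesis using pivot step.prems by blast
    next
      case True
      \<comment> \<open>Otherwise column \<open>k\<close> is a combination of the earlier columns,
        which are unit vectors, and the matrix is singular; \<open>c\<close> is the resulting kernel
        vector.\<close>
      have "\<exists>i<n. i \<ge> k \<and> A $$ (i, k) \<noteq> 0"
      proof (rule ccontr)
        assume no: "\<not> ?thesis"
        define c where "c j = (if j = k then 1 else if j < k then - A $$ (j, k) else 0)" for j
        have "mat n n (\<lambda>(i, j). A $$ (i, j)) = A" using A by (intro eq_matI) auto
        hence ker: "\<forall>c. (\<forall>i<n. (\<Sum>j<n. A $$ (i, j) * c j) = 0) \<longrightarrow> (\<forall>j<n. c j = 0)"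
          using det_nonzero_iff_kernel[of n "\<lambda>i j. A $$ (i, j)"] step.prems(2) by simp
        have "\<forall>i<n. (\<Sum>j<n. A $$ (i, j) * c j) = 0"
        proof (intro allI impI)
          fix i assume i: "i < n"
          have "(\<Sum>j<n. A $$ (i, j) * c j) =
            (\<Sum>j<n. (if j = k then A $$ (i, k) else 0) + (if j = i then (if i < k then - A $$ (i, k) else 0) else 0))"
            using step.prems(3) i by (intro sum.cong) (auto simp: c_def)
          also have "\<dots> = A $$ (i, k) + (if i < k then - A $$ (i, k) else 0)"
            using step.hyps i by (simp add: sum.distrib)
          also have "\<dots> = 0" using no i by auto
          finally show "(\<Sum>j<n. A $$ (i, j) * c j) = 0" .
        qed
        hence "\<forall>j<n. c j = 0" by (rule mp[OF spec[OF ker]])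
        hence "c k = 0" using step.hyps by simp
        thus False by (simp add: c_def)
      qed
      then obtain i where i: "i < n" "i > k" "A $$ (i, k) \<noteq> 0" using True le_neq_implies_less by metis
      \<comment> \<open>The factor for \<open>e 1\<close> adds row \<open>i\<close> to row
        \<open>k\<close>, which makes the pivot nonzero; the factor for \<open>e (-1)\<close> undoes
        this.\<close>
      define e where "e s j = (if j = i then 1 else if j = k then s else 0)" for s :: real and j
      define B where "B = column_mat n i (e 1) * A"
      have B: "B \<in> carrier_mat n n" using A by (simp add: B_def mult_carrier_mat[of _ n n])
      have Bpq: "B $$ (p, q) = (if p = i then e 1 i * A $$ (i, q) else A $$ (p, q) + e 1 p * A $$ (i, q))"
        if "p < n" "q < n" for p q
        unfolding B_def using column_mat_mult[OF that i(1) A] .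
      have AB: "A = column_mat n i (e (-1)) * B"
      proof (rule eq_matI)
        fix p q assume "p < dim_row (column_mat n i (e (-1)) * B)" "q < dim_col (column_mat n i (e (-1)) * B)"
        hence pq: "p < n" "q < n" using B by (auto simp: column_mat_def)
        show "A $$ (p, q) = (column_mat n i (e (-1)) * B) $$ (p, q)"
          using i by (simp add: column_mat_mult[OF pq i(1) B] Bpq pq e_def)
      qed (use A B in \<open>auto simp: column_mat_def\<close>)
      have "det B \<noteq> 0" using step.prems(2) AB det_mult[OF column_mat_carrier B] by auto
      moreover have "\<forall>p<n. \<forall>q<k. B $$ (p, q) = (if p = q then 1 else 0)"
        using step.prems(3) i by (auto simp: Bpq e_def)
      moreover have "B $$ (k, k) \<noteq> 0" using True i by (simp add: Bpq e_def)
      ultimately have "scales_volume n B" using pivot B by blast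
      thus ?thesis by (subst AB, intro scales_volume_mult scales_volume_column_mat) (use B i in \<open>auto simp: e_def\<close>)
    qed
  qed
  from this[of 0 A] assms show ?thesis by simp
qed

text \<open>The slice at height \<open>y\<close> of one coordinate is a ball of radius
  \<open>t - \<bar>y\<bar>\<close> in the remaining ones; integrating the power of its radius over
  \<open>y\<close> raises the exponent by one and supplies the next factor of the factorial.\<close>

lemma emeasure_l1_ball:
  fixes t :: real
  assumes "finite I" "t > 0"
  shows "emeasure (lborel_power I) {x \<in> space (lborel_power I). (\<Sum>i\<in>I. \<bar>x i\<bar>) < t} =
    ennreal ((2 * t) ^ card I / fact (card I))"
  using assms
proof (induction arbitrary: t rule: finite_induct)
  case empty
  thus ?case by (simp add: space_PiM PiM_empty)
next
  case (insert b J)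
  define m where "m = card J"
  let ?B = "\<lambda>J t. {x \<in> space (lborel_power J). (\<Sum>i\<in>J. \<bar>x i\<bar>) < t} :: ('a \<Rightarrow> real) set"
  have meas [measurable]: "?B J t \<in> sets (lborel_power J)" if "finite J" for J t
    using that by measurable
  have mem: "x(b := y) \<in> ?B (insert b J) t \<longleftrightarrow> x \<in> ?B J (t - \<bar>y\<bar>)"
    if "x \<in> space (lborel_power J)" for x y
  proof -
    have "(\<Sum>i\<in>J. \<bar>(x(b := y)) i\<bar>) = (\<Sum>i\<in>J. \<bar>x i\<bar>)" using insert.hyps by (intro sum.cong) auto
    thus ?thesis using that insert.hyps
      by (auto simp: space_lborel_power extensional_def)
  qed
  \<comment> \<open>Splitting at height 0 removes the absolute value, so that each half has a
    polynomial primitive.\<close>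
  define f1 f2 where "f1 = (\<lambda>y. ennreal (2 ^ m * (t - y) ^ m / fact m) * indicator {0..t} y)"
    and "f2 = (\<lambda>y. ennreal (2 ^ m * (t + y) ^ m / fact m) * indicator {-t..0} y)"
  have inner: "emeasure (lborel_power J) (?B J (t - \<bar>y\<bar>)) = f1 y + f2 y"
    \<comment> \<open>At 0 both halves contribute, and at the end points \<open>0 ^ m\<close> is 1
      when \<open>m = 0\<close>. These three heights form a null set.\<close>
    if "y \<notin> {-t, 0, t}" for y
  proof (cases "\<bar>y\<bar> < t")
    case True
    thus ?thesis using insert.IH[of "t - \<bar>y\<bar>"] that
      by (auto simp: f1_def f2_def indicator_def m_def abs_if power_mult_distrib[symmetric] algebra_simps)
  next
    case False
    have "\<not> (\<Sum>i\<in>J. \<bar>x i\<bar>) < t - \<bar>y\<bar>" for x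
    proof -
      have "(\<Sum>i\<in>J. \<bar>x i\<bar>) \<ge> 0" by (rule sum_nonneg) simp
      thus ?thesis using False by linarith
    qed
    hence "?B J (t - \<bar>y\<bar>) = {}" by auto
    moreover have "f1 y = 0" "f2 y = 0" using False that by (auto simp: f1_def f2_def indicator_def)
    ultimately show ?thesis by (simp only: emeasure_empty) simp
  qed
  have "emeasure (lborel_power (insert b J)) (?B (insert b J) t) =
    (\<integral>\<^sup>+x. indicator (?B (insert b J) t) x \<partial>lborel_power (insert b J))"
    using insert.hyps by (subst nn_integral_indicator) auto
  also have "\<dots> = (\<integral>\<^sup>+y. \<integral>\<^sup>+x. indicator (?B (insert b J) t) (x(b := y)) \<partial>lborel_power J \<partial>lborel)"
    using insert.hyps by (intro lborel_product.product_nn_integral_insert_rev) auto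
  also have "\<dots> = (\<integral>\<^sup>+y. \<integral>\<^sup>+x. indicator (?B J (t - \<bar>y\<bar>)) x \<partial>lborel_power J \<partial>lborel)"
    using mem by (intro nn_integral_cong) (simp add: indicator_def)
  also have "\<dots> = (\<integral>\<^sup>+y. emeasure (lborel_power J) (?B J (t - \<bar>y\<bar>)) \<partial>lborel)"
    using meas[OF insert.hyps(1)] by simp
  also have "\<dots> = (\<integral>\<^sup>+y. f1 y + f2 y \<partial>lborel)"
  proof (rule nn_integral_cong_AE)
    have "AE y in lborel. y \<noteq> -t \<and> y \<noteq> 0 \<and> y \<noteq> t"
      using AE_lborel_singleton[of "-t"] AE_lborel_singleton[of 0] AE_lborel_singleton[of t] by eventually_elim auto
    thus "AE y in lborel. emeasure (lborel_power J) (?B J (t - \<bar>y\<bar>)) = f1 y + f2 y"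
      by eventually_elim (use inner in auto)
  qed
  also have "\<dots> = (\<integral>\<^sup>+y. f1 y \<partial>lborel) + (\<integral>\<^sup>+y. f2 y \<partial>lborel)"
    by (rule nn_integral_add) (auto simp: f1_def f2_def)
  also have "(\<integral>\<^sup>+y. f1 y \<partial>lborel) = ennreal (- (2 ^ m * (t - t) ^ Suc m / fact (Suc m)) - (- (2 ^ m * (t - 0) ^ Suc m / fact (Suc m))))"
    unfolding f1_def
  proof (rule nn_integral_FTC_Icc)
    fix x :: real assume "x \<in> {0..t}"
    have "((\<lambda>x. - (2 ^ m * (t - x) ^ Suc m / fact (Suc m))) has_real_derivative
       - (2 ^ m * (real (Suc m) * (t - x) ^ m * (- 1)) / fact (Suc m))) (at x)"
      by (rule derivative_eq_intros refl | simp)+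
    also have "- (2 ^ m * (real (Suc m) * (t - x) ^ m * (- 1)) / fact (Suc m)) = 2 ^ m * (t - x) ^ m / fact m"
      by (simp add: field_simps del: of_nat_Suc)
    finally show "((\<lambda>x. - (2 ^ m * (t - x) ^ Suc m / fact (Suc m))) has_real_derivative 2 ^ m * (t - x) ^ m / fact m) (at x)" .
  qed (use insert.prems in auto)
  also have "(\<integral>\<^sup>+y. f2 y \<partial>lborel) = ennreal (2 ^ m * (t + 0) ^ Suc m / fact (Suc m) - (2 ^ m * (t + - t) ^ Suc m / fact (Suc m)))"
    unfolding f2_def
  proof (rule nn_integral_FTC_Icc)
    fix x :: real assume "x \<in> {-t..0}"
    have "((\<lambda>x. 2 ^ m * (t + x) ^ Suc m / fact (Suc m)) has_real_derivative
       2 ^ m * (real (Suc m) * (t + x) ^ m) / fact (Suc m)) (at x)"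
      by (rule derivative_eq_intros refl | simp)+
    also have "2 ^ m * (real (Suc m) * (t + x) ^ m) / fact (Suc m) = 2 ^ m * (t + x) ^ m / fact m"
      by (simp add: field_simps del: of_nat_Suc)
    finally show "((\<lambda>x. 2 ^ m * (t + x) ^ Suc m / fact (Suc m)) has_real_derivative 2 ^ m * (t + x) ^ m / fact m) (at x)" .
  qed (use insert.prems in auto)
  also have "ennreal (- (2 ^ m * (t - t) ^ Suc m / fact (Suc m)) - (- (2 ^ m * (t - 0) ^ Suc m / fact (Suc m)))) +
    ennreal (2 ^ m * (t + 0) ^ Suc m / fact (Suc m) - (2 ^ m * (t + - t) ^ Suc m / fact (Suc m))) =
    ennreal ((2 * t) ^ Suc m / fact (Suc m))"
    using insert.prems by (subst ennreal_plus[symmetric]) (auto simp: power_mult_distrib mult_ac)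
  finally show ?case using insert.hyps by (simp add: m_def)
qed

section \<open>Discrete subgroups of coordinate space\<close>

definition subtraction_closed :: "('i \<Rightarrow> real) set \<Rightarrow> bool" where
  "subtraction_closed \<Gamma> \<longleftrightarrow> (\<lambda>_. 0) \<in> \<Gamma> \<and> (\<forall>x\<in>\<Gamma>. \<forall>y\<in>\<Gamma>. (\<lambda>i. x i - y i) \<in> \<Gamma>)"

lemma subtraction_closed_diff:
  "subtraction_closed \<Gamma> \<Longrightarrow> x \<in> \<Gamma> \<Longrightarrow> y \<in> \<Gamma> \<Longrightarrow> (\<lambda>i. x i - y i) \<in> \<Gamma>"
  by (simp add: subtraction_closed_def)

lemma subtraction_closed_zero: "subtraction_closed \<Gamma> \<Longrightarrow> (\<lambda>_. 0) \<in> \<Gamma>"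
  by (simp add: subtraction_closed_def)

lemma subtraction_closed_add:
  assumes "subtraction_closed \<Gamma>" "x \<in> \<Gamma>" "y \<in> \<Gamma>"
  shows "(\<lambda>i. x i + y i) \<in> \<Gamma>"
proof -
  note diff = subtraction_closed_diff[OF assms(1)]
  from diff[OF assms(2) diff[OF subtraction_closed_zero[OF assms(1)] assms(3)]] show ?thesis by simp
qed

lemma subtraction_closed_int_mult:
  assumes "subtraction_closed \<Gamma>" "x \<in> \<Gamma>"
  shows "(\<lambda>i. of_int n * x i) \<in> \<Gamma>"
proof (induction n rule: int_induct[where k = 0])
  case base
  show ?case using assms(1) by (simp add: subtraction_closed_def)
next
  case (step1 n)
  from subtraction_closed_add[OF assms(1) step1(2) assms(2)] show ?case by (simp add: algebra_simps)
next
  case (step2 n)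
  from subtraction_closed_diff[OF assms(1) step2(2) assms(2)] show ?case by (simp add: algebra_simps)
qed

lemma subtraction_closed_int_combination:
  fixes n :: "'k \<Rightarrow> int"
  assumes "subtraction_closed \<Gamma>" "\<And>k. k \<in> K \<Longrightarrow> e k \<in> \<Gamma>"
  shows "(\<lambda>i. \<Sum>k\<in>K. of_int (n k) * e k i) \<in> \<Gamma>"
  using assms(2)
proof (induction K rule: infinite_finite_induct)
  case (insert k K)
  have "(\<lambda>i. of_int (n k) * e k i + (\<Sum>k\<in>K. of_int (n k) * e k i)) \<in> \<Gamma>"
    using insert by (intro subtraction_closed_add subtraction_closed_int_mult assms(1)) simp_all
  thus ?case using insert.hyps by simp
qed (use assms(1) in \<open>simp_all add: subtraction_closed_def\<close>)

text \<open>A Hermite normal form: \<open>e i\<close> has the least positive coordinate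
  \<open>i\<close> among the elements of \<open>\<Gamma>\<close> that vanish beyond
  \<open>i\<close>. Division with remainder in the top coordinate leaves a remainder below this
  minimum, hence zero, and descending through the coordinates expresses every element
  integrally.\<close>

lemma triangular_basis:
  fixes \<Gamma> :: "(nat \<Rightarrow> real) set"
  assumes closed: "subtraction_closed \<Gamma>"
    and supp: "\<And>x i. x \<in> \<Gamma> \<Longrightarrow> i \<ge> r \<Longrightarrow> x i = 0"
    and disc: "\<And>B. finite {x \<in> \<Gamma>. \<forall>i<r. \<bar>x i\<bar> \<le> B}"
    and axis: "\<And>i. i < r \<Longrightarrow> \<exists>x\<in>\<Gamma>. x i > 0 \<and> (\<forall>j. j \<noteq> i \<longrightarrow> x j = 0)"
  shows "\<exists>e. (\<forall>i<r. e i \<in> \<Gamma> \<and> e i i > 0 \<and> (\<forall>j>i. e i j = 0)) \<and>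
    (\<forall>x\<in>\<Gamma>. \<exists>n::nat \<Rightarrow> int. \<forall>j. x j = (\<Sum>i<r. of_int (n i) * e i j))"
proof -
  have "\<forall>i. \<exists>x. i < r \<longrightarrow> x \<in> \<Gamma> \<and> x i > 0 \<and> (\<forall>j. j \<noteq> i \<longrightarrow> x j = 0)" using axis by blast
  then obtain d where d: "\<And>i. i < r \<Longrightarrow> d i \<in> \<Gamma>" "\<And>i. i < r \<Longrightarrow> d i i > 0"
    "\<And>i j. i < r \<Longrightarrow> j \<noteq> i \<Longrightarrow> d i j = 0" by metis
  have min: "\<exists>e. e \<in> \<Gamma> \<and> e i > 0 \<and> (\<forall>j>i. e j = 0) \<and>
    (\<forall>x\<in>\<Gamma>. x i > 0 \<longrightarrow> (\<forall>j>i. x j = 0) \<longrightarrow> e i \<le> x i)" if i: "i < r" for i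
  proof -
    define D where "D = (\<Sum>j<r. d j j)"
    have D: "d j j \<le> D" if "j < r" for j
      unfolding D_def by (rule member_le_sum) (use that d(2) in \<open>auto intro: less_imp_le\<close>)
    have D0: "D \<ge> 0" using D[OF i] d(2)[OF i] by linarith
    define F where "F = {x \<in> \<Gamma>. 0 < x i \<and> (\<forall>j>i. x j = 0) \<and> (\<forall>j<r. \<bar>x j\<bar> \<le> D)}"
    have finF: "finite F" by (rule finite_subset[OF _ disc[of D]]) (auto simp: F_def)
    have diF: "d i \<in> F"
    proof -
      have "\<bar>d i j\<bar> \<le> D" if "j < r" for j
        using d(2,3)[OF i] D[OF i] D0 by (cases "j = i") (auto simp: less_imp_le)
      thus ?thesis using d i by (auto simp: F_def)
    qed
    have neF: "F \<noteq> {}" using diF by blast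
    define e where "e = arg_min_on (\<lambda>x. x i) F"
    have e: "e \<in> F" "\<And>x. x \<in> F \<Longrightarrow> e i \<le> x i"
      unfolding e_def by (rule arg_min_if_finite(1)[OF finF neF], rule arg_min_least[OF finF neF])
    have "e i \<le> x i" if x: "x \<in> \<Gamma>" "x i > 0" "\<forall>j>i. x j = 0" for x
    proof (cases "x i \<le> D")
      case False
      have "e i \<le> D" using e(1) i by (auto simp: F_def)
      with False show ?thesis by linarith
    next
      case True
      \<comment> \<open>Subtracting multiples of the axis elements below \<open>i\<close> moves
        \<open>x\<close> into the finite set \<open>F\<close> without changing its coordinate
        \<open>i\<close>, so the minimum over \<open>F\<close> is a minimum over all
        candidates.\<close>
      define n where "n j = \<lfloor>x j / d j j\<rfloor>" for j
      define y where "y = (\<lambda>k. x k - (\<Sum>j<i. of_int (n j) * d j k))"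
      have "(\<lambda>k. \<Sum>j<i. of_int (n j) * d j k) \<in> \<Gamma>"
        by (rule subtraction_closed_int_combination[OF closed]) (use d(1) i in auto)
      from subtraction_closed_diff[OF closed x(1) this] have y: "y \<in> \<Gamma>" unfolding y_def .
      have yhi: "y k = x k" if "k \<ge> i" for k
      proof -
        have "(\<Sum>j<i. of_int (n j) * d j k) = 0" by (rule sum.neutral) (use d(3) i that in auto)
        thus ?thesis by (simp add: y_def)
      qed
      have ylo: "\<bar>y k\<bar> \<le> D" if k: "k < i" for k
      proof -
        have "(\<Sum>j<i. of_int (n j) * d j k) = (\<Sum>j<i. if j = k then of_int (n k) * d k k else 0)"
          by (rule sum.cong) (use d(3) i in auto)
        hence "y k = x k - of_int (n k) * d k k" using k by (simp add: y_def)
        moreover have "of_int (n k) * d k k \<le> x k" "x k < (of_int (n k) + 1) * d k k"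
          using d(2)[of k] k i floor_divide_lower[of "d k k" "x k"] floor_divide_upper[of "d k k" "x k"]
          by (auto simp: n_def)
        ultimately have "0 \<le> y k" "y k \<le> d k k" by (auto simp: algebra_simps)
        thus ?thesis using D[of k] k i by linarith
      qed
      have "\<bar>y k\<bar> \<le> D" if "k < r" for k
        using ylo[of k] yhi[of k] x True D0 by (cases k i rule: linorder_cases) auto
      hence "y \<in> F" using y yhi x by (auto simp: F_def)
      from e(2)[OF this] show ?thesis using yhi[of i] by simp
    qed
    thus ?thesis using e(1) by (intro exI[of _ e]) (auto simp: F_def)
  qed
  define good where "good i e \<longleftrightarrow> e \<in> \<Gamma> \<and> e i > 0 \<and> (\<forall>j>i. e j = 0) \<and>
    (\<forall>x\<in>\<Gamma>. x i > 0 \<longrightarrow> (\<forall>j>i. x j = 0) \<longrightarrow> e i \<le> x i)" for i e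
  define e where "e i = (SOME e. good i e)" for i
  have g: "good i (e i)" if "i < r" for i
  proof -
    have "\<exists>e. good i e" using min[OF that] unfolding good_def .
    thus ?thesis unfolding e_def by (rule someI_ex)
  qed
  have e: "e i \<in> \<Gamma>" "e i i > 0" "\<And>j. j > i \<Longrightarrow> e i j = 0"
    "\<And>x. x \<in> \<Gamma> \<Longrightarrow> x i > 0 \<Longrightarrow> \<forall>j>i. x j = 0 \<Longrightarrow> e i i \<le> x i" if "i < r" for i
    using g[OF that] unfolding good_def by blast+
  have "\<exists>n::nat \<Rightarrow> int. \<forall>j. x j = (\<Sum>i<m. of_int (n i) * e i j)"
    if "m \<le> r" "x \<in> \<Gamma>" "\<forall>j\<ge>m. x j = 0" for m x
    using that
  proof (induction m arbitrary: x)
    case 0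
    thus ?case by auto
  next
    case (Suc m)
    define k where "k = \<lfloor>x m / e m m\<rfloor>"
    define y where "y = (\<lambda>j. x j - of_int k * e m j)"
    have m: "m < r" using Suc.prems by simp
    from subtraction_closed_diff[OF closed Suc.prems(2) subtraction_closed_int_mult[OF closed e(1)[OF m], of k]]
    have y: "y \<in> \<Gamma>" unfolding y_def .
    have "0 \<le> y m" "y m < e m m"
      using floor_divide_lower[OF e(2)[OF m], of "x m"] floor_divide_upper[OF e(2)[OF m], of "x m"]
      by (auto simp: y_def k_def algebra_simps)
    moreover have yhi: "\<forall>j>m. y j = 0" using Suc.prems(3) e(3)[OF m] by (simp add: y_def)
    ultimately have "y m = 0" using e(4)[OF m y _ yhi] by (cases "y m > 0") simp_all
    with yhi have "\<forall>j\<ge>m. y j = 0" by (metis le_less)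
    from Suc.IH[OF less_imp_le[OF m] y this] obtain n :: "nat \<Rightarrow> int" where
      n: "\<forall>j. y j = (\<Sum>i<m. of_int (n i) * e i j)" by (elim exE)
    have "x j = (\<Sum>i<Suc m. of_int ((n(m := k)) i) * e i j)" for j
      using spec[OF n, of j] by (simp add: y_def)
    thus ?case by (intro exI allI)
  qed
  from this[OF order.refl] supp have "\<forall>x\<in>\<Gamma>. \<exists>n::nat \<Rightarrow> int. \<forall>j. x j = (\<Sum>i<r. of_int (n i) * e i j)"
    by blast
  with e(1-3) show ?thesis by (intro exI[of _ e] conjI allI impI)
qed

section \<open>Minkowski's second theorem for the cross-polytope\<close>

text \<open>Cut and translate: each piece \<open>Q k\<close> keeps its volume under the shift by
  \<open>\<tau> k\<close>, and \<open>inj\<close> makes the shifted pieces disjoint inside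
  \<open>S'\<close>.\<close>

lemma emeasure_le_by_translated_pieces:
  fixes \<tau> :: "'k \<Rightarrow> 'i \<Rightarrow> real"
  assumes fin: "finite I" and K: "countable K"
    and S': "S' \<in> sets (lborel_power I)"
    and Q: "\<And>k. k \<in> K \<Longrightarrow> Q k \<in> sets (lborel_power I)"
    and disj: "disjoint_family_on Q K"
    and maps: "\<And>k x. k \<in> K \<Longrightarrow> x \<in> Q k \<Longrightarrow> (\<lambda>i\<in>I. x i + \<tau> k i) \<in> S'"
    and inj: "\<And>k k' x x'. k \<in> K \<Longrightarrow> k' \<in> K \<Longrightarrow> x \<in> Q k \<Longrightarrow> x' \<in> Q k' \<Longrightarrow>
      (\<forall>i\<in>I. x i + \<tau> k i = x' i + \<tau> k' i) \<Longrightarrow> k = k'"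
  shows "emeasure (lborel_power I) (\<Union>k\<in>K. Q k) \<le> emeasure (lborel_power I) S'"
proof -
  let ?M = "lborel_power I"
  define T where "T k = (\<lambda>x. \<lambda>i\<in>I. x i + - \<tau> k i) -` Q k \<inter> space ?M" for k
  have T: "T k \<in> sets ?M" if "k \<in> K" for k
    using measurable_sets[OF measurable_affine_power[of "\<lambda>i. - \<tau> k i" "\<lambda>_. 1" I] Q[OF that]]
    by (simp add: T_def add.commute)
  have shift_back: "x = (\<lambda>i\<in>I. (\<lambda>i\<in>I. x i + - \<tau> k i) i + \<tau> k i)" if "x \<in> T k" for x k
    using that by (auto simp: T_def space_lborel_power extensional_def fun_eq_iff)
  have "emeasure ?M (\<Union>k\<in>K. Q k) = (\<integral>\<^sup>+k. emeasure ?M (Q k) \<partial>count_space K)"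
    by (rule emeasure_UN_countable[OF Q K disj])
  also have "\<dots> = (\<integral>\<^sup>+k. emeasure ?M (T k) \<partial>count_space K)"
    unfolding T_def by (intro nn_integral_cong emeasure_lborel_power_translate[symmetric] fin Q) simp
  also have "\<dots> = emeasure ?M (\<Union>k\<in>K. T k)"
  proof (rule emeasure_UN_countable[OF T K, symmetric])
    show "disjoint_family_on T K" unfolding disjoint_family_on_def
    proof (intro ballI impI)
      fix k k' assume k: "k \<in> K" "k' \<in> K" "k \<noteq> k'"
      show "T k \<inter> T k' = {}"
      proof (rule ccontr)
        assume "T k \<inter> T k' \<noteq> {}"
        then obtain x where x: "x \<in> T k" "x \<in> T k'" by blast
        have "k = k'"
          by (rule inj[OF k(1,2), of "\<lambda>i\<in>I. x i + - \<tau> k i" "\<lambda>i\<in>I. x i + - \<tau> k' i"])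
             (use x in \<open>simp_all add: T_def\<close>)
        with k(3) show False by simp
      qed
    qed
  qed
  also have "\<dots> \<le> emeasure ?M S'"
  proof (rule emeasure_mono[OF _ S'], rule subsetI)
    fix x assume "x \<in> (\<Union>k\<in>K. T k)"
    then obtain k where k: "k \<in> K" "x \<in> T k" by blast
    hence "(\<lambda>i\<in>I. x i + - \<tau> k i) \<in> Q k" by (simp add: T_def)
    from maps[OF k(1) this] show "x \<in> S'" unfolding shift_back[OF k(2), symmetric] .
  qed
  finally show ?thesis .
qed

definition unit_box :: "'i set \<Rightarrow> ('i \<Rightarrow> real) set" where
  "unit_box I = {x \<in> space (lborel_power I). \<forall>i\<in>I. 0 \<le> x i \<and> x i < 1}"

text \<open>Translation by \<open>a\<close> preserves volume on the torus. The piece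
  \<open>Q z\<close> consists of the points of the box whose translate must be moved back by the
  integer vector \<open>z\<close>; there are countably many of them.\<close>

lemma emeasure_torus_translate_le:
  fixes a :: "'i \<Rightarrow> real"
  assumes fin: "finite I" and G: "G \<in> sets (lborel_power I)" and G': "G' \<in> sets (lborel_power I)"
    and step: "\<And>x z. x \<in> G \<Longrightarrow> (\<lambda>i\<in>I. x i + a i - of_int (z i :: int)) \<in> G'"
  shows "emeasure (lborel_power I) (G \<inter> unit_box I) \<le> emeasure (lborel_power I) (G' \<inter> unit_box I)"
proof -
  let ?M = "lborel_power I"
  define K where "K = Pi\<^sub>E I (\<lambda>_. UNIV :: int set)"
  have K: "countable K" unfolding K_def using fin by (intro countable_PiE) auto
  define Q where "Q z = {x \<in> G \<inter> unit_box I. \<forall>i\<in>I. \<lfloor>x i + a i\<rfloor> = z i}" for z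
  have box [measurable]: "unit_box I \<in> sets ?M" unfolding unit_box_def using fin by measurable
  have "{x \<in> space ?M. \<forall>i\<in>I. \<lfloor>x i + a i\<rfloor> = z i} \<in> sets ?M" for z using fin by measurable
  moreover have "Q z = (G \<inter> unit_box I) \<inter> {x \<in> space ?M. \<forall>i\<in>I. \<lfloor>x i + a i\<rfloor> = z i}" for z
    by (auto simp: Q_def unit_box_def)
  ultimately have Q: "Q z \<in> sets ?M" for z using G box by (simp only: sets.Int)
  have "G \<inter> unit_box I \<subseteq> (\<Union>z\<in>K. Q z)"
  proof
    fix x assume "x \<in> G \<inter> unit_box I"
    hence "x \<in> Q (\<lambda>i\<in>I. \<lfloor>x i + a i\<rfloor>)" by (simp add: Q_def)
    thus "x \<in> (\<Union>z\<in>K. Q z)" by (auto simp: K_def)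
  qed
  hence "emeasure ?M (G \<inter> unit_box I) \<le> emeasure ?M (\<Union>z\<in>K. Q z)"
    using Q K by (intro emeasure_mono sets.countable_UN'') auto
  also have "\<dots> \<le> emeasure ?M (G' \<inter> unit_box I)"
  proof (rule emeasure_le_by_translated_pieces[OF fin K _ Q, where \<tau> = "\<lambda>z i. a i - of_int (z i)"])
    show "G' \<inter> unit_box I \<in> sets ?M" using G' by simp
    show "disjoint_family_on Q K" unfolding disjoint_family_on_def
    proof (intro ballI impI)
      fix z z' assume z: "z \<in> K" "z' \<in> K" "z \<noteq> z'"
      show "Q z \<inter> Q z' = {}"
      proof (rule ccontr)
        assume "Q z \<inter> Q z' \<noteq> {}"
        then obtain x where "x \<in> Q z" "x \<in> Q z'" by blast
        hence "\<forall>i\<in>I. z i = z' i" by (simp add: Q_def)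
        hence "z = z'" using z(1,2) unfolding K_def by (intro PiE_ext) auto
        with z(3) show False by simp
      qed
    qed
  next
    fix z x assume "z \<in> K" and x: "x \<in> Q z"
    have "x i + (a i - of_int (z i)) \<ge> 0 \<and> x i + (a i - of_int (z i)) < 1" if "i \<in> I" for i
    proof -
      have "\<lfloor>x i + a i\<rfloor> = z i" using x that by (simp add: Q_def)
      thus ?thesis by (simp add: floor_eq_iff)
    qed
    moreover have "(\<lambda>i\<in>I. x i + (a i - of_int (z i))) \<in> G'"
      using step[of x z] x by (simp add: Q_def algebra_simps)
    ultimately show "(\<lambda>i\<in>I. x i + (a i - of_int (z i))) \<in> G' \<inter> unit_box I"
      by (simp add: unit_box_def space_lborel_power)
  next
    fix z z' x x' assume z: "z \<in> K" "z' \<in> K" and x: "x \<in> Q z" "x' \<in> Q z'"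
      and eq: "\<forall>i\<in>I. x i + (a i - of_int (z i)) = x' i + (a i - of_int (z' i))"
    have "z i = z' i" if i: "i \<in> I" for i
    proof -
      have b: "0 \<le> x i" "x i < 1" "0 \<le> x' i" "x' i < 1" using x i by (auto simp: Q_def unit_box_def)
      have "x i - of_int (z i) = x' i - of_int (z' i)" using eq i by auto
      hence "\<bar>of_int (z i - z' i) :: real\<bar> < 1" using b by (simp add: abs_less_iff)
      thus ?thesis by linarith
    qed
    thus "z = z'" using z unfolding K_def by (intro PiE_ext) auto
  qed
  finally show ?thesis .
qed

section \<open>Distorted norms and folded balls\<close>

text \<open>The sum norm of the vector \<open>M y\<close>. A lattice with basis matrix
  \<open>M\<close> thereby becomes the standard integer lattice under a distorted norm, so that
  folding happens along the coordinate axes.\<close>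

definition l1_form :: "nat \<Rightarrow> (nat \<Rightarrow> nat \<Rightarrow> real) \<Rightarrow> (nat \<Rightarrow> real) \<Rightarrow> real" where
  "l1_form r M y = (\<Sum>p<r. \<bar>\<Sum>j<r. M p j * y j\<bar>)"

lemma l1_form_cong: "(\<And>j. j < r \<Longrightarrow> x j = y j) \<Longrightarrow> l1_form r M x = l1_form r M y"
  unfolding l1_form_def by (intro sum.cong refl arg_cong[of _ _ abs]) simp

lemma l1_form_nonneg: "l1_form r M y \<ge> 0"
  unfolding l1_form_def by (intro sum_nonneg) simp

lemma l1_form_scale: "l1_form r M (\<lambda>j. c * y j) = \<bar>c\<bar> * l1_form r M y"
proof -
  have *: "(\<Sum>j<r. M p j * (c * y j)) = c * (\<Sum>j<r. M p j * y j)" for p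
    by (simp add: sum_distrib_left mult_ac)
  show ?thesis unfolding l1_form_def * abs_mult by (rule sum_distrib_left[symmetric])
qed

lemma l1_form_triangle: "l1_form r M (\<lambda>j. x j + y j) \<le> l1_form r M x + l1_form r M y"
proof -
  have *: "(\<Sum>j<r. M p j * (x j + y j)) = (\<Sum>j<r. M p j * x j) + (\<Sum>j<r. M p j * y j)" for p
    by (simp add: distrib_left sum.distrib)
  have "l1_form r M (\<lambda>j. x j + y j) \<le> (\<Sum>p<r. \<bar>\<Sum>j<r. M p j * x j\<bar> + \<bar>\<Sum>j<r. M p j * y j\<bar>)"
    unfolding l1_form_def * by (intro sum_mono abs_triangle_ineq)
  also have "\<dots> = l1_form r M x + l1_form r M y" unfolding l1_form_def by (rule sum.distrib)
  finally show ?thesis .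
qed

text \<open>The full preimage of the image of the ball in the quotient by the first \<open>i\<close>
  integer directions, that is, the union of its translates by integer vectors supported
  there.\<close>

definition periodic_ball :: "nat \<Rightarrow> (nat \<Rightarrow> nat \<Rightarrow> real) \<Rightarrow> nat \<Rightarrow> real \<Rightarrow> (nat \<Rightarrow> real) set" where
  "periodic_ball r M i t = {y \<in> space (lborel_power {..<r}).
     \<exists>z::nat \<Rightarrow> int. l1_form r M (\<lambda>j. y j + (if j < i then of_int (z j) else 0)) < t}"

text \<open>The image of the ball of radius \<open>t\<close> in the quotient of the coordinate space by the first
  \<open>i\<close> integer coordinate directions, cut out by a fundamental domain.\<close>

definition folded_ball :: "nat \<Rightarrow> (nat \<Rightarrow> nat \<Rightarrow> real) \<Rightarrow> nat \<Rightarrow> real \<Rightarrow> (nat \<Rightarrow> real) set" where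
  "folded_ball r M i t = periodic_ball r M i t \<inter>
     {y \<in> space (lborel_power {..<r}). \<forall>j\<in>{..<min i r}. 0 \<le> y j \<and> y j < 1}"

lemma periodic_ball_sets [measurable]: "periodic_ball r M i t \<in> sets (lborel_power {..<r})"
proof -
  define K where "K = Pi\<^sub>E {..<i} (\<lambda>_. UNIV :: int set)"
  have K: "countable K" unfolding K_def by (intro countable_PiE) auto
  have "periodic_ball r M i t = (\<Union>z\<in>K. {y \<in> space (lborel_power {..<r}).
      l1_form r M (\<lambda>j. y j + (if j < i then of_int (z j) else 0)) < t})" (is "_ = ?U")
  proof (intro subset_antisym subsetI)
    fix y assume "y \<in> periodic_ball r M i t"
    then obtain z :: "nat \<Rightarrow> int" where y: "y \<in> space (lborel_power {..<r})"
      "l1_form r M (\<lambda>j. y j + (if j < i then of_int (z j) else 0)) < t" by (auto simp: periodic_ball_def)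
    have "(\<lambda>j. y j + (if j < i then of_int (z j) else 0)) =
          (\<lambda>j. y j + (if j < i then of_int (restrict z {..<i} j) else 0))" by (auto simp: fun_eq_iff)
    with y have "l1_form r M (\<lambda>j. y j + (if j < i then of_int (restrict z {..<i} j) else 0)) < t" by simp
    moreover have "restrict z {..<i} \<in> K" by (simp add: K_def)
    ultimately show "y \<in> ?U" using y(1) by blast
  qed (auto simp: periodic_ball_def)
  moreover have "{y \<in> space (lborel_power {..<r}).
      l1_form r M (\<lambda>j. y j + (if j < i then of_int (z j) else 0)) < t} \<in> sets (lborel_power {..<r})" for z :: "nat \<Rightarrow> int"
    unfolding l1_form_def by measurable
  ultimately show ?thesis using K by (simp only: sets.countable_UN'')
qed

lemma folded_ball_sets [measurable]: "folded_ball r M i t \<in> sets (lborel_power {..<r})"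
proof -
  have "{y \<in> space (lborel_power {..<r}). \<forall>j\<in>{..<min i r}. 0 \<le> y j \<and> y j < 1} \<in> sets (lborel_power {..<r})"
    by measurable
  thus ?thesis unfolding folded_ball_def by (intro sets.Int periodic_ball_sets)
qed

text \<open>Folding one more direction loses no volume. The strips on which \<open>y i\<close> has
  integer part \<open>m\<close> are shifted into one unit strip; two points that land together come
  from ball points differing by a lattice vector of norm below \<open>2 * t\<close>, whose entry
  \<open>i\<close> vanishes by \<open>flag\<close>, so they came from the same strip.\<close>

lemma emeasure_folded_ball_Suc:
  assumes i: "i < r"
    and flag: "\<And>z::nat \<Rightarrow> int. l1_form r M (\<lambda>j. of_int (z j)) < 2 * t \<Longrightarrow> z i = 0"
  shows "emeasure (lborel_power {..<r}) (folded_ball r M i t) \<le>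
         emeasure (lborel_power {..<r}) (folded_ball r M (Suc i) t)"
proof -
  let ?M = "lborel_power {..<r}"
  define Q where "Q m = {y \<in> folded_ball r M i t. \<lfloor>y i\<rfloor> = m}" for m :: int
  have sp: "folded_ball r M i t \<subseteq> space ?M" by (auto simp: folded_ball_def)
  have [measurable]: "(\<lambda>y. y i) \<in> borel_measurable ?M"
    using measurable_component_singleton[of i "{..<r}" "\<lambda>_. lborel"] i by simp
  have "{y \<in> space ?M. \<lfloor>y i\<rfloor> = m} \<in> sets ?M" for m by measurable
  moreover have "Q m = folded_ball r M i t \<inter> {y \<in> space ?M. \<lfloor>y i\<rfloor> = m}" for m
    using sp by (auto simp: Q_def)
  ultimately have Q: "Q m \<in> sets ?M" for m by (simp only: sets.Int folded_ball_sets)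
  have un: "folded_ball r M i t = (\<Union>m\<in>UNIV. Q m)" by (auto simp: Q_def)
  define \<tau> where "\<tau> m j = (if j = i then - of_int m else 0 :: real)" for m :: int and j
  have rep: "\<exists>z::nat \<Rightarrow> int. (\<forall>j>i. z j = 0) \<and> z i = m \<and>
      l1_form r M (\<lambda>j. (\<lambda>j\<in>{..<r}. y j + \<tau> m j) j + of_int (z j)) < t" if y: "y \<in> Q m" for y m
  proof -
    from y obtain z :: "nat \<Rightarrow> int" where z: "l1_form r M (\<lambda>j. y j + (if j < i then of_int (z j) else 0)) < t"
      by (auto simp: Q_def folded_ball_def periodic_ball_def)
    define z' where "z' j = (if j < i then z j else if j = i then m else 0)" for j
    have "l1_form r M (\<lambda>j. y j + (if j < i then of_int (z j) else 0)) =
      l1_form r M (\<lambda>j. (\<lambda>j\<in>{..<r}. y j + \<tau> m j) j + of_int (z' j))"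
      by (rule l1_form_cong) (auto simp: \<tau>_def z'_def)
    with z show ?thesis by (intro exI[of _ z']) (simp add: z'_def)
  qed
  show ?thesis unfolding un
  proof (rule emeasure_le_by_translated_pieces[where \<tau> = \<tau>])
    show "disjoint_family_on Q UNIV" by (auto simp: disjoint_family_on_def Q_def)
  next
    fix m y assume y: "y \<in> Q m"
    let ?y = "\<lambda>j\<in>{..<r}. y j + \<tau> m j"
    obtain z :: "nat \<Rightarrow> int" where z: "\<forall>j>i. z j = 0" "l1_form r M (\<lambda>j. ?y j + of_int (z j)) < t"
      using rep[OF y] by blast
    have "(\<lambda>j. ?y j + (if j < Suc i then of_int (z j) else 0)) = (\<lambda>j. ?y j + of_int (z j))"
      using z(1) by (auto simp: fun_eq_iff)
    with z(2) have ex: "\<exists>z::nat \<Rightarrow> int. l1_form r M (\<lambda>j. ?y j + (if j < Suc i then of_int (z j) else 0)) < t"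
      by (intro exI[of _ z]) (simp only:)
    have "0 \<le> ?y j \<and> ?y j < 1" if j: "j < Suc i" for j
    proof (cases "j = i")
      case True
      have "\<lfloor>y i\<rfloor> = m" using y by (simp add: Q_def)
      thus ?thesis using True i by (simp add: \<tau>_def floor_eq_iff)
    next
      case False
      thus ?thesis using y i j by (auto simp: Q_def folded_ball_def \<tau>_def)
    qed
    hence bx: "\<forall>j\<in>{..<min (Suc i) r}. 0 \<le> ?y j \<and> ?y j < 1" by (intro ballI) (simp only: lessThan_iff min_less_iff_conj)
    have sp: "?y \<in> space ?M" by (simp add: space_lborel_power)
    show "?y \<in> folded_ball r M (Suc i) t"
      unfolding folded_ball_def periodic_ball_def by (intro IntI CollectI conjI sp ex bx)
  next
    fix m m' y y' assume y: "y \<in> Q m" "y' \<in> Q m'" and eq: "\<forall>j\<in>{..<r}. y j + \<tau> m j = y' j + \<tau> m' j"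
    let ?y = "\<lambda>j\<in>{..<r}. y j + \<tau> m j"
    have e: "(\<lambda>j\<in>{..<r}. y' j + \<tau> m' j) = ?y" using eq by (intro restrict_ext) simp
    obtain z z' :: "nat \<Rightarrow> int" where z: "z i = m" "l1_form r M (\<lambda>j. ?y j + of_int (z j)) < t"
      and z': "z' i = m'" "l1_form r M (\<lambda>j. ?y j + of_int (z' j)) < t"
      using rep[OF y(1)] rep[OF y(2)] unfolding e by blast
    have "l1_form r M (\<lambda>j. of_int ((\<lambda>j. z j - z' j) j)) =
      l1_form r M (\<lambda>j. (?y j + of_int (z j)) + (-1) * (?y j + of_int (z' j)))"
      by (rule l1_form_cong) simp
    also have "\<dots> \<le> l1_form r M (\<lambda>j. ?y j + of_int (z j)) + l1_form r M (\<lambda>j. (-1) * (?y j + of_int (z' j)))"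
      by (rule l1_form_triangle)
    also have "\<dots> < 2 * t" unfolding l1_form_scale using z(2) z'(2) by simp
    finally have "z i - z' i = 0" by (rule flag)
    thus "m = m'" using z z' by simp
  qed (use Q in auto)
qed

lemma emeasure_lborel_power_fold:
  assumes fin: "finite I" "finite J" "I \<inter> J = {}" and S: "S \<in> sets (lborel_power (I \<union> J))"
  shows "emeasure (lborel_power (I \<union> J)) S =
    (\<integral>\<^sup>+x. emeasure (lborel_power J) {y \<in> space (lborel_power J). merge I J (x, y) \<in> S} \<partial>lborel_power I)"
    and "x \<in> space (lborel_power I) \<Longrightarrow>
      {y \<in> space (lborel_power J). merge I J (x, y) \<in> S} \<in> sets (lborel_power J)"
proof -
  have sect: "{y \<in> space (lborel_power J). merge I J (x, y) \<in> S} \<in> sets (lborel_power J)"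
    if "x \<in> space (lborel_power I)" for x
  proof -
    have "(\<lambda>y. merge I J (x, y)) \<in> lborel_power J \<rightarrow>\<^sub>M lborel_power (I \<union> J)"
      by (rule measurable_compose[OF measurable_Pair1'[OF that] measurable_merge])
    from measurable_sets[OF this S] show ?thesis
      by (simp add: vimage_def Int_def conj_commute)
  qed
  thus "x \<in> space (lborel_power I) \<Longrightarrow>
      {y \<in> space (lborel_power J). merge I J (x, y) \<in> S} \<in> sets (lborel_power J)" .
  have "emeasure (lborel_power (I \<union> J)) S = (\<integral>\<^sup>+x. indicator S x \<partial>lborel_power (I \<union> J))" using S by simp
  also have "\<dots> = (\<integral>\<^sup>+x. \<integral>\<^sup>+y. indicator S (merge I J (x, y)) \<partial>lborel_power J \<partial>lborel_power I)"
    by (rule lborel_product.product_nn_integral_fold) (use fin S in auto)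
  also have "\<dots> = (\<integral>\<^sup>+x. emeasure (lborel_power J) {y \<in> space (lborel_power J). merge I J (x, y) \<in> S} \<partial>lborel_power I)"
  proof (rule nn_integral_cong)
    fix x assume x: "x \<in> space (lborel_power I)"
    have "(\<integral>\<^sup>+y. indicator S (merge I J (x, y)) \<partial>lborel_power J) =
      (\<integral>\<^sup>+y. indicator {y \<in> space (lborel_power J). merge I J (x, y) \<in> S} y \<partial>lborel_power J)"
      by (intro nn_integral_cong) (simp add: indicator_def)
    also have "\<dots> = emeasure (lborel_power J) {y \<in> space (lborel_power J). merge I J (x, y) \<in> S}"
      using sect[OF x] by (rule nn_integral_indicator)
    finally show "(\<integral>\<^sup>+y. indicator S (merge I J (x, y)) \<partial>lborel_power J) = \<dots>" .
  qed
  finally show "emeasure (lborel_power (I \<union> J)) S =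
    (\<integral>\<^sup>+x. emeasure (lborel_power J) {y \<in> space (lborel_power J). merge I J (x, y) \<in> S} \<partial>lborel_power I)" .
qed

text \<open>Only the unfolded coordinates can be stretched by \<open>c\<close>, since the folded
  ones live on a torus. Fix their values \<open>x\<close> and a ball point \<open>u0\<close> over
  \<open>x\<close>: for any ball point \<open>u\<close> over \<open>x\<close>, the point
  \<open>u + (c - 1) * u0\<close> lies over \<open>c * x\<close> and in the ball of radius
  \<open>c * t\<close>. Hence each slice of the larger set contains a torus translate of the
  corresponding slice of the smaller one.\<close>

lemma emeasure_folded_ball_scale:
  assumes i: "i \<le> r" and c: "c \<ge> 1"
  shows "ennreal (c ^ (r - i)) * emeasure (lborel_power {..<r}) (folded_ball r M i t) \<le>
         emeasure (lborel_power {..<r}) (folded_ball r M i (c * t))"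
proof -
  let ?M = "lborel_power {..<r}"
  define I J where "I = {..<i}" and "J = {i..<r}"
  have IJ: "finite J" "finite I" "J \<inter> I = {}" "J \<union> I = {..<r}" using i by (auto simp: I_def J_def)
  define s where "s j = (if j < i then 1 else c)" for j
  define f where "f = (\<lambda>y. \<lambda>j\<in>{..<r}. 0 + s j * y j)"
  have fm: "f \<in> ?M \<rightarrow>\<^sub>M ?M" unfolding f_def by (rule measurable_affine_power)
  define S where "S = f -` folded_ball r M i (c * t) \<inter> space ?M"
  have S: "S \<in> sets ?M" unfolding S_def by (rule measurable_sets[OF fm folded_ball_sets])
  have "(\<Prod>j<r. \<bar>s j\<bar>) = (\<Prod>j\<in>J. \<bar>s j\<bar>) * (\<Prod>j\<in>I. \<bar>s j\<bar>)"
    unfolding IJ(4)[symmetric] by (rule prod.union_disjoint[OF IJ(1-3)])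
  also have "(\<Prod>j\<in>J. \<bar>s j\<bar>) = c ^ (r - i)" using c by (simp add: J_def s_def)
  also have "(\<Prod>j\<in>I. \<bar>s j\<bar>) = 1" by (simp add: I_def s_def)
  finally have "emeasure ?M (folded_ball r M i (c * t)) = ennreal (c ^ (r - i)) * emeasure ?M S"
    using emeasure_lborel_power_affine[of "{..<r}" s "folded_ball r M i (c * t)" "\<lambda>_. 0"] c
    by (simp add: S_def f_def s_def)
  moreover have "emeasure ?M (folded_ball r M i t) \<le> emeasure ?M S"
  proof -
    have sec: "emeasure (lborel_power I) {y \<in> space (lborel_power I). merge J I (x, y) \<in> folded_ball r M i t} \<le>
      emeasure (lborel_power I) {y \<in> space (lborel_power I). merge J I (x, y) \<in> S}"
      if x: "x \<in> space (lborel_power J)" for x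
    proof -
      have msp: "merge J I (x, y) \<in> space ?M" for y
        using IJ(4) by (auto simp: space_lborel_power merge_def extensional_def)
      have mlo: "merge J I (x, y) j = y j" if "j \<in> I" for y j using that by (auto simp: merge_def I_def J_def)
      have flo: "f (merge J I (x, y)) j = y j" if "j \<in> I" for y j
        using that mlo[OF that, of y] i by (auto simp: f_def s_def I_def)
      have Ieq: "{..<min i r} = I" using i by (simp add: I_def min_absorb1)
      have mhi: "merge J I (x, y) j = x j" if "i \<le> j" "j < r" for y j using that by (simp add: merge_def I_def J_def)
      define G where "G = {y \<in> space (lborel_power I). merge J I (x, y) \<in> periodic_ball r M i t}"
      define P where "P = f -` periodic_ball r M i (c * t) \<inter> space ?M"
      define G' where "G' = {y \<in> space (lborel_power I). merge J I (x, y) \<in> P}"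
      have P: "P \<in> sets ?M" unfolding P_def by (rule measurable_sets[OF fm periodic_ball_sets])
      have G: "G \<in> sets (lborel_power I)" unfolding G_def
        by (rule emeasure_lborel_power_fold(2)[OF IJ(1-3) _ x]) (simp add: IJ(4))
      have G': "G' \<in> sets (lborel_power I)" unfolding G'_def
        by (rule emeasure_lborel_power_fold(2)[OF IJ(1-3) _ x]) (simp add: IJ(4) P)
      have box: "(\<forall>j\<in>{..<min i r}. 0 \<le> merge J I (x, y) j \<and> merge J I (x, y) j < 1) \<longleftrightarrow>
          (\<forall>j\<in>I. 0 \<le> y j \<and> y j < 1)" for y
        unfolding Ieq by (intro ball_cong refl) (simp add: mlo)
      have e1: "{y \<in> space (lborel_power I). merge J I (x, y) \<in> folded_ball r M i t} = G \<inter> unit_box I"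
        unfolding G_def folded_ball_def unit_box_def using box msp by blast
      have fbox: "(\<forall>j\<in>{..<min i r}. 0 \<le> f (merge J I (x, y)) j \<and> f (merge J I (x, y)) j < 1) \<longleftrightarrow>
          (\<forall>j\<in>I. 0 \<le> y j \<and> y j < 1)" for y
        unfolding Ieq by (intro ball_cong refl) (simp add: flo)
      have fsp: "f y \<in> space ?M" for y by (simp add: f_def space_lborel_power)
      have e2: "{y \<in> space (lborel_power I). merge J I (x, y) \<in> S} = G' \<inter> unit_box I"
        unfolding G'_def P_def S_def folded_ball_def unit_box_def using fbox msp fsp by blast
      show ?thesis
      proof (cases "G = {}")
        case True
        thus ?thesis unfolding e1 by simp
      next
        case False
        then obtain y0 where "y0 \<in> G" by blast
        then obtain z0 :: "nat \<Rightarrow> int" where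
          z0: "l1_form r M (\<lambda>j. merge J I (x, y0) j + (if j < i then of_int (z0 j) else 0)) < t"
          by (auto simp: G_def periodic_ball_def)
        define u0 where "u0 = (\<lambda>j. merge J I (x, y0) j + (if j < i then of_int (z0 j) else 0))"
        define a where "a j = (c - 1) * u0 j" for j
        show ?thesis unfolding e1 e2
        proof (rule emeasure_torus_translate_le[OF IJ(2) G G', where a = a])
          fix y and zz :: "nat \<Rightarrow> int" assume y: "y \<in> G"
          then obtain z :: "nat \<Rightarrow> int" where
            z: "l1_form r M (\<lambda>j. merge J I (x, y) j + (if j < i then of_int (z j) else 0)) < t"
            by (auto simp: G_def periodic_ball_def)
          define u where "u = (\<lambda>j. merge J I (x, y) j + (if j < i then of_int (z j) else 0))"
          let ?y = "\<lambda>j\<in>I. y j + a j - of_int (zz j)"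
          have "l1_form r M (\<lambda>j. f (merge J I (x, ?y)) j + (if j < i then of_int ((\<lambda>j. z j + zz j) j) else 0)) =
            l1_form r M (\<lambda>j. u j + (c - 1) * u0 j)"
          proof (rule l1_form_cong)
            fix j assume j: "j < r"
            show "f (merge J I (x, ?y)) j + (if j < i then of_int ((\<lambda>j. z j + zz j) j) else 0) = u j + (c - 1) * u0 j"
            proof (cases "j < i")
              case True
              hence "j \<in> I" by (simp add: I_def)
              thus ?thesis using True by (simp add: flo mlo u_def a_def)
            next
              case False
              thus ?thesis using j by (simp add: f_def s_def mhi u_def u0_def algebra_simps)
            qed
          qed
          also have "\<dots> \<le> l1_form r M u + l1_form r M (\<lambda>j. (c - 1) * u0 j)" by (rule l1_form_triangle)
          also have "l1_form r M (\<lambda>j. (c - 1) * u0 j) = (c - 1) * l1_form r M u0"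
            using c by (simp add: l1_form_scale)
          also have "l1_form r M u + (c - 1) * l1_form r M u0 < t + (c - 1) * t"
            using z z0 c unfolding u_def[symmetric] u0_def[symmetric]
            by (intro add_less_le_mono mult_left_mono) simp_all
          also have "t + (c - 1) * t = c * t" by (simp add: algebra_simps)
          finally have "f (merge J I (x, ?y)) \<in> periodic_ball r M i (c * t)"
            unfolding periodic_ball_def by (intro CollectI conjI fsp exI[of _ "\<lambda>j. z j + zz j"])
          moreover have "?y \<in> space (lborel_power I)" by (simp add: space_lborel_power)
          ultimately show "?y \<in> G'"
            unfolding G'_def P_def by (intro CollectI conjI IntI vimageI2 msp)
        qed
      qed
    qed
    show ?thesis
      unfolding IJ(4)[symmetric]
      by (subst (1 2) emeasure_lborel_power_fold(1)[OF IJ(1-3)])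
         (unfold IJ(4), use S in \<open>auto intro!: nn_integral_mono sec\<close>)
  qed
  ultimately show ?thesis by (simp add: mult_left_mono)
qed

lemma emeasure_l1_form_ball:
  assumes det: "det (mat r r (\<lambda>(p, j). M p j)) \<noteq> 0" and t: "t > 0"
  shows "ennreal \<bar>det (mat r r (\<lambda>(p, j). M p j))\<bar> *
    emeasure (lborel_power {..<r}) (folded_ball r M 0 t) = ennreal ((2 * t) ^ r / fact r)"
proof -
  let ?M = "lborel_power {..<r}" and ?A = "mat r r (\<lambda>(p, j). M p j)"
  let ?S = "{x \<in> space ?M. (\<Sum>i<r. \<bar>x i\<bar>) < t}"
  have "folded_ball r M 0 t = linear_action r ?A -` ?S \<inter> space ?M"
    by (auto simp: folded_ball_def periodic_ball_def l1_form_def linear_action_def space_lborel_power)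
  moreover have "?S \<in> sets ?M" by measurable
  ultimately have "ennreal \<bar>det ?A\<bar> * emeasure ?M (folded_ball r M 0 t) = emeasure ?M ?S"
    using scales_volume_of_det_nonzero[of ?A r] det unfolding scales_volume_def by simp
  also have "\<dots> = ennreal ((2 * t) ^ r / fact r)"
    using emeasure_l1_ball[of "{..<r}" t] t by simp
  finally show ?thesis .
qed

text \<open>Successive minima enter through a basis adapted to their flag: lattice vectors shorter than
  the \<open>i\<close>-th minimum only involve the first \<open>i\<close> basis vectors.\<close>

lemma prod_minima_le:
  fixes M :: "nat \<Rightarrow> nat \<Rightarrow> real" and \<mu> :: "nat \<Rightarrow> real"
  assumes det: "det (mat r r (\<lambda>(p, j). M p j)) \<noteq> 0" (is "?d \<noteq> 0")
    and pos: "\<And>i. i < r \<Longrightarrow> \<mu> i > 0"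
    and mono: "\<And>i. Suc i < r \<Longrightarrow> \<mu> i \<le> \<mu> (Suc i)"
    and flag: "\<And>i z. i < r \<Longrightarrow> l1_form r M (\<lambda>j. of_int (z j :: int)) < \<mu> i \<Longrightarrow> z i = 0"
  shows "(\<Prod>i<r. \<mu> i) \<le> fact r * \<bar>?d\<bar>"
proof (cases r)
  case 0
  thus ?thesis by simp
next
  case (Suc r')
  let ?M = "lborel_power {..<r}"
  define V where "V i t = ennreal \<bar>?d\<bar> * emeasure ?M (folded_ball r M i t)" for i t
  have up: "V i (\<mu> i / 2) \<le> V (Suc i) (\<mu> i / 2)" if "i < r" for i
    unfolding V_def using that flag by (intro mult_left_mono emeasure_folded_ball_Suc) auto
  \<comment> \<open>Each step widens the radius from \<open>\<mu> i / 2\<close> to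
    \<open>\<mu> (Suc i) / 2\<close>, gaining a factor \<open>c\<close> for every unfolded
    direction, and then folds one more direction at no loss.\<close>
  have "V (Suc i) (\<mu> i / 2) \<ge> ennreal ((\<Prod>j\<le>i. \<mu> j) * \<mu> i ^ (r - Suc i) / fact r)" if "i < r" for i
    using that
  proof (induction i)
    case 0
    have "(2 * (\<mu> 0 / 2)) ^ r / fact r = (\<Prod>j\<le>0. \<mu> j) * \<mu> 0 ^ (r - Suc 0) / fact r"
      by (simp add: Suc)
    thus ?case using emeasure_l1_form_ball[OF det, of "\<mu> 0 / 2"] pos[OF 0] up[OF 0] by (simp add: V_def)
  next
    case (Suc i)
    define c where "c = \<mu> (Suc i) / \<mu> i"
    have p: "\<mu> i > 0" "\<mu> (Suc i) > 0" using pos Suc.prems by auto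
    have c: "c \<ge> 1" using mono[OF Suc.prems] p by (simp add: c_def)
    have ct: "c * (\<mu> i / 2) = \<mu> (Suc i) / 2" using p by (simp add: c_def)
    have "(\<Prod>j\<le>Suc i. \<mu> j) * \<mu> (Suc i) ^ (r - Suc (Suc i)) / fact r =
        c ^ (r - Suc i) * ((\<Prod>j\<le>i. \<mu> j) * \<mu> i ^ (r - Suc i) / fact r)"
    proof -
      define P where "P = (\<Prod>j\<le>i. \<mu> j)"
      obtain n where n: "r - Suc i = Suc n" "r - Suc (Suc i) = n"
        using Suc.prems by (metis Suc_diff_Suc)
      have "c ^ Suc n * \<mu> i ^ Suc n = \<mu> (Suc i) ^ Suc n"
        using p by (simp add: c_def power_divide)
      hence "c ^ Suc n * (P * \<mu> i ^ Suc n / fact r) = P * \<mu> (Suc i) ^ Suc n / fact r"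
        by (metis mult.left_commute times_divide_eq_right)
      thus ?thesis by (auto simp add: n P_def[symmetric] mult_ac)
    qed
    also have "ennreal \<dots> = ennreal (c ^ (r - Suc i)) * ennreal ((\<Prod>j\<le>i. \<mu> j) * \<mu> i ^ (r - Suc i) / fact r)"
      using c by (intro ennreal_mult) (auto intro!: mult_nonneg_nonneg prod_nonneg divide_nonneg_pos
        less_imp_le[OF pos] zero_le_power simp: Suc.prems Suc_lessD le_less_trans)
    also have "\<dots> \<le> ennreal (c ^ (r - Suc i)) * V (Suc i) (\<mu> i / 2)"
      using Suc.IH Suc.prems by (intro mult_left_mono) auto
    also have "\<dots> = ennreal \<bar>?d\<bar> * (ennreal (c ^ (r - Suc i)) * emeasure ?M (folded_ball r M (Suc i) (\<mu> i / 2)))"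
      by (simp add: V_def mult_ac)
    also have "\<dots> \<le> V (Suc i) (\<mu> (Suc i) / 2)"
      unfolding V_def ct[symmetric]
      using c Suc.prems by (intro mult_left_mono emeasure_folded_ball_scale) auto
    also have "\<dots> \<le> V (Suc (Suc i)) (\<mu> (Suc i) / 2)" by (rule up[OF Suc.prems])
    finally show ?case .
  qed
  from this[of r'] have "ennreal ((\<Prod>j\<le>r'. \<mu> j) / fact r) \<le> V r (\<mu> r' / 2)" using Suc by simp
  also have "\<dots> \<le> ennreal \<bar>?d\<bar> * 1"
    unfolding V_def
  proof (rule mult_left_mono)
    \<comment> \<open>With all \<open>r\<close> directions folded the set lies in the unit box, and
      this caps the accumulated volume.\<close>
    have "folded_ball r M r (\<mu> r' / 2) \<subseteq> Pi\<^sub>E {..<r} (\<lambda>_. {0..<1})"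
      by (auto simp: folded_ball_def space_lborel_power PiE_def)
    hence "emeasure ?M (folded_ball r M r (\<mu> r' / 2)) \<le> emeasure ?M (Pi\<^sub>E {..<r} (\<lambda>_. {0..<1}))"
      by (intro emeasure_mono sets_PiM_I_finite) auto
    also have "\<dots> = (\<Prod>i<r. emeasure lborel {0..<1::real})" by (rule lborel_product.emeasure_PiM) auto
    also have "\<dots> = 1" by simp
    finally show "emeasure ?M (folded_ball r M r (\<mu> r' / 2)) \<le> 1" .
  qed simp
  finally have "(\<Prod>j\<le>r'. \<mu> j) / fact r \<le> \<bar>?d\<bar>" by (subst (asm) mult_1_right, subst (asm) ennreal_le_iff) auto
  moreover have "(\<Prod>i<r. \<mu> i) = (\<Prod>j\<le>r'. \<mu> j)" by (simp add: Suc lessThan_Suc_atMost)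
  ultimately show ?thesis by (simp add: divide_le_eq mult.commute)
qed

section \<open>Successive minima\<close>

lemma finite_int_box: "finite {z::nat \<Rightarrow> int. (\<forall>j<r. \<bar>z j\<bar> \<le> K) \<and> (\<forall>j\<ge>r. z j = 0)}"
proof (rule finite_subset)
  show "{z::nat \<Rightarrow> int. (\<forall>j<r. \<bar>z j\<bar> \<le> K) \<and> (\<forall>j\<ge>r. z j = 0)} \<subseteq>
    (\<lambda>f j. if j < r then f j else 0) ` Pi\<^sub>E {..<r} (\<lambda>_. {-K..K})"
  proof
    fix z :: "nat \<Rightarrow> int" assume z: "z \<in> {z. (\<forall>j<r. \<bar>z j\<bar> \<le> K) \<and> (\<forall>j\<ge>r. z j = 0)}"
    hence "restrict z {..<r} \<in> Pi\<^sub>E {..<r} (\<lambda>_. {-K..K})" by (auto simp: abs_le_iff)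
    moreover have "z = (\<lambda>j. if j < r then restrict z {..<r} j else 0)" using z by (auto simp: fun_eq_iff)
    ultimately show "z \<in> (\<lambda>f j. if j < r then f j else 0) ` Pi\<^sub>E {..<r} (\<lambda>_. {-K..K})" by blast
  qed
qed (intro finite_imageI finite_PiE, auto)

lemma kernel_of_det_nonzero:
  fixes A :: "nat \<Rightarrow> nat \<Rightarrow> 'k::field"
  assumes "det (mat r r (\<lambda>(p, j). A p j)) \<noteq> 0" "\<And>p. p < r \<Longrightarrow> (\<Sum>j<r. A p j * c j) = 0" "j < r"
  shows "c j = 0"
proof -
  have "\<forall>p<r. (\<Sum>j<r. A p j * c j) = 0" using assms(2) by simp
  hence "\<forall>j<r. c j = 0" by (rule mp[OF spec[OF det_nonzero_iff_kernel[THEN iffD1, OF assms(1)]]])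
  thus ?thesis using assms(3) by simp
qed

text \<open>Row \<open>j\<close> of the inverse of \<open>A\<close>, obtained as the solution
  \<open>d j\<close> of a linear system, writes the coordinate \<open>y j\<close> as a fixed
  combination of the entries of \<open>A y\<close>.\<close>

lemma l1_form_coordinate_bound:
  assumes det: "det (mat r r (\<lambda>(p, j). A p j)) \<noteq> 0"
  shows "\<exists>C. \<forall>y. \<forall>j<r. \<bar>y j\<bar> \<le> C * l1_form r A y"
proof -
  have "\<exists>d. \<forall>j'\<in>{..<r}. (\<Sum>p\<in>{..<r}. A p j' * d p) = (if j' = j then 1 else 0)" for j
  proof (rule square_system_surj_left[where a = "\<lambda>j' p. A p j'"])
    fix d :: "nat \<Rightarrow> real" assume "\<And>p. p \<in> {..<r} \<Longrightarrow> (\<Sum>j'<r. d j' * A p j') = 0"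
    hence "(\<Sum>j'<r. A p j' * d j') = 0" if "p < r" for p using that by (simp add: mult.commute)
    thus "\<forall>j\<in>{..<r}. d j = 0" using kernel_of_det_nonzero[OF det, of d] by blast
  qed auto
  then obtain d where d: "\<And>j j'. j' < r \<Longrightarrow> (\<Sum>p<r. A p j' * d j p) = (if j' = j then 1 else 0)"
    by (metis lessThan_iff)
  have "\<bar>y j\<bar> \<le> (\<Sum>j<r. \<Sum>p<r. \<bar>d j p\<bar>) * l1_form r A y" if j: "j < r" for y j
  proof -
    have "y j = (\<Sum>j'<r. (if j' = j then 1 else 0) * y j')"
      using j by (simp add: if_distrib[of "\<lambda>x. x * _"] cong: if_cong)
    also have "\<dots> = (\<Sum>j'<r. (\<Sum>p<r. A p j' * d j p) * y j')" by (intro sum.cong refl) (simp add: d)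
    also have "\<dots> = (\<Sum>j'<r. \<Sum>p<r. d j p * (A p j' * y j'))" by (simp add: sum_distrib_right sum_distrib_left mult_ac)
    also have "\<dots> = (\<Sum>p<r. \<Sum>j'<r. d j p * (A p j' * y j'))" by (rule sum.swap)
    also have "\<dots> = (\<Sum>p<r. d j p * (\<Sum>j'<r. A p j' * y j'))" by (simp add: sum_distrib_left)
    finally have "\<bar>y j\<bar> \<le> (\<Sum>p<r. \<bar>d j p * (\<Sum>j'<r. A p j' * y j')\<bar>)" using sum_abs by simp
    also have "\<dots> \<le> (\<Sum>p<r. \<bar>d j p\<bar> * l1_form r A y)"
    proof (rule sum_mono)
      fix p assume p: "p \<in> {..<r}"
      have "\<bar>\<Sum>j'<r. A p j' * y j'\<bar> \<le> l1_form r A y"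
        unfolding l1_form_def by (rule member_le_sum[OF p]) auto
      thus "\<bar>d j p * (\<Sum>j'<r. A p j' * y j')\<bar> \<le> \<bar>d j p\<bar> * l1_form r A y"
        by (simp add: abs_mult mult_left_mono)
    qed
    also have "\<dots> = (\<Sum>p<r. \<bar>d j p\<bar>) * l1_form r A y" by (simp add: sum_distrib_right)
    also have "\<dots> \<le> (\<Sum>j<r. \<Sum>p<r. \<bar>d j p\<bar>) * l1_form r A y"
    proof (rule mult_right_mono[OF _ l1_form_nonneg])
      show "(\<Sum>p<r. \<bar>d j p\<bar>) \<le> (\<Sum>j<r. \<Sum>p<r. \<bar>d j p\<bar>)"
        using j by (intro member_le_sum[of j "{..<r}" "\<lambda>j. \<Sum>p<r. \<bar>d j p\<bar>"]) (auto intro: sum_nonneg)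
    qed
    finally show ?thesis .
  qed
  thus ?thesis by blast
qed

definition in_real_span :: "nat \<Rightarrow> (nat \<Rightarrow> nat \<Rightarrow> int) \<Rightarrow> nat \<Rightarrow> (nat \<Rightarrow> int) \<Rightarrow> bool" where
  "in_real_span r v i z \<longleftrightarrow> (\<exists>c::nat \<Rightarrow> real. \<forall>j<r. of_int (z j) = (\<Sum>p<i. c p * of_int (v p j)))"

text \<open>The greedy form of the successive minima, which are the norms of the vectors
  \<open>v i\<close>. Entries from \<open>r\<close> on are pinned to 0 so that only finitely many
  vectors have bounded norm.\<close>

definition successive_minimum where
  "successive_minimum r A v i \<longleftrightarrow> (\<forall>j\<ge>r. v i j = 0) \<and> \<not> in_real_span r v i (v i) \<and>
    (\<forall>z::nat \<Rightarrow> int. (\<forall>j\<ge>r. z j = 0) \<longrightarrow> \<not> in_real_span r v i z \<longrightarrow>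
       l1_form r A (\<lambda>j. of_int (v i j)) \<le> l1_form r A (\<lambda>j. of_int (z j)))"

lemma in_real_span_cong: "(\<And>p. p < i \<Longrightarrow> v p = v' p) \<Longrightarrow> in_real_span r v i = in_real_span r v' i"
  by (simp add: in_real_span_def fun_eq_iff)

text \<open>Some nonzero functional \<open>g\<close> kills the \<open>i < r\<close> given vectors,
  and a unit vector on which \<open>g\<close> does not vanish lies outside their span.\<close>

lemma exists_outside_real_span:
  assumes "i < r"
  shows "\<exists>z::nat \<Rightarrow> int. (\<forall>j\<ge>r. z j = 0) \<and> \<not> in_real_span r v i z"
proof (rule ccontr)
  assume "\<not> ?thesis"
  hence all: "in_real_span r v i z" if "\<forall>j\<ge>r. z j = 0" for z :: "nat \<Rightarrow> int" using that by blast
  have "card {..<i} < card {..<r}" using assms by simp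
  from homogeneous_nontrivial_solution[OF _ _ this, of "\<lambda>p j. of_int (v p j) :: real"] obtain g :: "nat \<Rightarrow> real"
    where g: "\<exists>j\<in>{..<r}. g j \<noteq> 0" "\<forall>p\<in>{..<i}. (\<Sum>j<r. of_int (v p j) * g j) = 0" by auto
  from g(1) obtain k where k: "k < r" "g k \<noteq> 0" by auto
  have "in_real_span r v i (\<lambda>j. if j = k then 1 else 0)" using k by (intro all) auto
  then obtain c :: "nat \<Rightarrow> real" where
    c: "\<And>j. j < r \<Longrightarrow> of_int (if j = k then 1 else 0) = (\<Sum>p<i. c p * of_int (v p j))"
    unfolding in_real_span_def by blast
  have "g k = (\<Sum>j<r. of_int (if j = k then 1 else 0) * g j)"
    using k by (simp add: if_distrib[of of_int] if_distrib[of "\<lambda>x. x * _"] cong: if_cong)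
  also have "\<dots> = (\<Sum>j<r. (\<Sum>p<i. c p * of_int (v p j)) * g j)" by (intro sum.cong refl) (simp only: c lessThan_iff)
  also have "\<dots> = (\<Sum>j<r. \<Sum>p<i. c p * (of_int (v p j) * g j))" by (simp add: sum_distrib_right sum_distrib_left mult_ac)
  also have "\<dots> = (\<Sum>p<i. \<Sum>j<r. c p * (of_int (v p j) * g j))" by (rule sum.swap)
  also have "\<dots> = (\<Sum>p<i. c p * (\<Sum>j<r. of_int (v p j) * g j))" by (simp add: sum_distrib_left)
  also have "\<dots> = 0" using g(2) by (intro sum.neutral) simp
  finally show False using k by simp
qed

lemma successive_minima_exist:
  assumes det: "det (mat r r (\<lambda>(p, j). A p j)) \<noteq> 0"
  shows "\<exists>v. \<forall>i<r. successive_minimum r A v i"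
proof -
  let ?N = "\<lambda>z::nat \<Rightarrow> int. l1_form r A (\<lambda>j. of_int (z j))"
  obtain C where C: "\<And>y j. j < r \<Longrightarrow> \<bar>y j\<bar> \<le> C * l1_form r A y"
    using l1_form_coordinate_bound[OF det] by blast
  have fin: "finite {z::nat \<Rightarrow> int. (\<forall>j\<ge>r. z j = 0) \<and> ?N z \<le> B}" for B
  proof (rule finite_subset[OF _ finite_int_box[of r "\<lceil>\<bar>C\<bar> * \<bar>B\<bar>\<rceil>"]], rule subsetI)
    fix z :: "nat \<Rightarrow> int" assume z: "z \<in> {z. (\<forall>j\<ge>r. z j = 0) \<and> ?N z \<le> B}"
    have "\<bar>z j\<bar> \<le> \<lceil>\<bar>C\<bar> * \<bar>B\<bar>\<rceil>" if "j < r" for j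
    proof -
      have "\<bar>of_int (z j) :: real\<bar> \<le> C * ?N z" using C[OF that, of "\<lambda>j. of_int (z j)"] .
      also have "\<dots> \<le> \<bar>C\<bar> * \<bar>B\<bar>" using z l1_form_nonneg[of r A "\<lambda>j. of_int (z j)"]
        by (intro mult_mono) auto
      finally have "of_int \<bar>z j\<bar> \<le> \<bar>C\<bar> * \<bar>B\<bar>" by simp
      thus ?thesis by linarith
    qed
    thus "z \<in> {z. (\<forall>j<r. \<bar>z j\<bar> \<le> \<lceil>\<bar>C\<bar> * \<bar>B\<bar>\<rceil>) \<and> (\<forall>j\<ge>r. z j = 0)}" using z by simp
  qed
  have "\<exists>v. \<forall>i<n. successive_minimum r A v i" if "n \<le> r" for n
    using that
  proof (induction n)
    case 0
    show ?case by simp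
  next
    case (Suc n)
    then obtain v where v: "\<And>i. i < n \<Longrightarrow> successive_minimum r A v i" by auto
    obtain z0 :: "nat \<Rightarrow> int" where z0: "\<forall>j\<ge>r. z0 j = 0" "\<not> in_real_span r v n z0"
      using exists_outside_real_span[of n r v] Suc.prems by auto
    define F where "F = {z. (\<forall>j\<ge>r. z j = 0) \<and> \<not> in_real_span r v n z \<and> ?N z \<le> ?N z0}"
    have finF: "finite F" by (rule finite_subset[OF _ fin[of "?N z0"]]) (auto simp: F_def)
    have neF: "F \<noteq> {}" using z0 by (auto simp: F_def)
    define w where "w = arg_min_on ?N F"
    have w: "w \<in> F" "\<And>z. z \<in> F \<Longrightarrow> ?N w \<le> ?N z"
      unfolding w_def by (rule arg_min_if_finite(1)[OF finF neF], rule arg_min_least[OF finF neF])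
    have wmin: "?N w \<le> ?N z" if "\<forall>j\<ge>r. z j = 0" "\<not> in_real_span r v n z" for z
    proof (cases "?N z \<le> ?N z0")
      case True
      thus ?thesis using that by (intro w(2)) (simp add: F_def)
    next
      case False
      have "?N w \<le> ?N z0" using w(1) by (simp add: F_def)
      thus ?thesis using False by linarith
    qed
    have sp: "in_real_span r (v(n := w)) i = in_real_span r v i" if "i \<le> n" for i
      by (rule in_real_span_cong) (use that in auto)
    have "successive_minimum r A (v(n := w)) i" if "i < Suc n" for i
    proof (cases "i = n")
      case True
      thus ?thesis using w(1) wmin unfolding successive_minimum_def by (simp add: sp F_def)
    next
      case False
      hence "i < n" using that by simp
      thus ?thesis using v[of i] unfolding successive_minimum_def by (simp add: sp)
    qed
    thus ?case by blast
  qed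
  thus ?thesis by blast
qed

lemma successive_minima_independent:
  fixes c :: "nat \<Rightarrow> real"
  assumes v: "\<And>i. i < r \<Longrightarrow> \<not> in_real_span r v i (v i)"
    and c: "\<And>j. j < r \<Longrightarrow> (\<Sum>p<r. c p * of_int (v p j)) = 0"
  shows "\<forall>p<r. c p = 0"
proof (rule ccontr)
  assume "\<not> ?thesis"
  hence ne: "{p. p < r \<and> c p \<noteq> 0} \<noteq> {}" and fin: "finite {p. p < r \<and> c p \<noteq> 0}" by auto
  define m where "m = Max {p. p < r \<and> c p \<noteq> 0}"
  have m: "m < r" "c m \<noteq> 0" using Max_in[OF fin ne] by (auto simp: m_def)
  have hi: "c p = 0" if "p > m" "p < r" for p
    using Max_ge[OF fin, of p] that unfolding m_def[symmetric] by fastforce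
  have "in_real_span r v m (v m)" unfolding in_real_span_def
  proof (intro exI[of _ "\<lambda>p. - c p / c m"] allI impI)
    fix j assume j: "j < r"
    have "(\<Sum>p<r. c p * of_int (v p j)) = (\<Sum>p<Suc m. c p * of_int (v p j))"
      by (rule sum.mono_neutral_right) (use m hi in auto)
    hence "c m * of_int (v m j) = - (\<Sum>p<m. c p * of_int (v p j))" using c[OF j] by simp
    hence "of_int (v m j) = - (\<Sum>p<m. c p * of_int (v p j)) / c m" using m by (simp add: field_simps)
    also have "\<dots> = (\<Sum>p<m. - c p / c m * of_int (v p j))" by (simp add: sum_divide_distrib sum_negf)
    finally show "of_int (v m j) = (\<Sum>p<m. - c p / c m * of_int (v p j))" .
  qed
  with v m show False by blast
qed

lemma mat_mult_of_functions:
  fixes f g :: "nat \<Rightarrow> nat \<Rightarrow> 'k::comm_ring_1"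
  shows "mat r r (\<lambda>(i, j). f i j) * mat r r (\<lambda>(i, j). g i j) = mat r r (\<lambda>(i, j). \<Sum>l<r. f i l * g l j)"
  by (rule eq_matI) (auto simp: scalar_prod_def lessThan_atLeast0)

lemma abs_det_unimodular:
  fixes U W :: "nat \<Rightarrow> nat \<Rightarrow> int"
  assumes "\<And>i j. i < r \<Longrightarrow> j < r \<Longrightarrow> (\<Sum>l<r. U i l * W l j) = (if i = j then 1 else 0)"
  shows "\<bar>det (mat r r (\<lambda>(i, j). real_of_int (U i j)))\<bar> = 1"
proof -
  let ?U = "mat r r (\<lambda>(i, j). U i j)" and ?W = "mat r r (\<lambda>(i, j). W i j)"
  have "?U * ?W = 1\<^sub>m r" unfolding mat_mult_of_functions by (rule eq_matI) (use assms in auto)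
  hence "det ?U * det ?W = 1"
    using det_mult[of ?U r ?W] by simp
  hence "\<bar>det ?U\<bar> = 1" by (auto simp: zmult_eq_1_iff)
  moreover have "mat r r (\<lambda>(i, j). real_of_int (U i j)) = of_int_hom.mat_hom ?U" by (rule eq_matI) auto
  ultimately show ?thesis by (simp add: of_int_hom.hom_det)
qed

text \<open>The vectors \<open>v\<close> attaining the minima may generate a proper sublattice, so
  the volume bound cannot be applied in their coordinates. It is applied in an integral basis
  \<open>u\<close> of the full lattice that is triangular with respect to \<open>v\<close>; passing
  to \<open>u\<close> changes the determinant at most by a sign.\<close>

theorem minkowski_second_l1:
  fixes A :: "nat \<Rightarrow> nat \<Rightarrow> real"
  assumes det: "det (mat r r (\<lambda>(p, j). A p j)) \<noteq> 0" (is "?d \<noteq> 0")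
  shows "\<exists>z::nat \<Rightarrow> nat \<Rightarrow> int.
    (\<forall>c::nat \<Rightarrow> real. (\<forall>j<r. (\<Sum>p<r. c p * of_int (z p j)) = 0) \<longrightarrow> (\<forall>p<r. c p = 0)) \<and>
    (\<Prod>p<r. l1_form r A (\<lambda>j. of_int (z p j))) \<le> fact r * \<bar>?d\<bar>"
proof -
  let ?N = "\<lambda>z::nat \<Rightarrow> int. l1_form r A (\<lambda>j. of_int (z j))"
  obtain v where v: "\<And>i. i < r \<Longrightarrow> successive_minimum r A v i"
    using successive_minima_exist[OF det] by blast
  have vsupp: "v i j = 0" if "i < r" "j \<ge> r" for i j
    using v[OF that(1)] that(2) unfolding successive_minimum_def by blast
  have vout: "\<not> in_real_span r v i (v i)" if "i < r" for i
    using v[OF that] unfolding successive_minimum_def by blast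
  have vmin: "?N (v i) \<le> ?N z" if "i < r" "\<forall>j\<ge>r. z j = 0" "\<not> in_real_span r v i z" for i z
    using v[OF that(1)] that(2,3) unfolding successive_minimum_def by blast
  have ind: "\<forall>p<r. c p = 0" if "\<And>j. j < r \<Longrightarrow> (\<Sum>p<r. c p * of_int (v p j)) = 0" for c :: "nat \<Rightarrow> real"
    by (rule successive_minima_independent[of r v]) (use vout that in auto)
  define comb where "comb c j = (\<Sum>p<r. c p * of_int (v p j))" for c :: "nat \<Rightarrow> real" and j
  \<comment> \<open>The integer lattice written in the coordinates of the vectors \<open>v\<close>.
    It contains the unit vectors, as \<open>triangular_basis\<close> demands.\<close>
  define \<Gamma> where "\<Gamma> = {c. (\<forall>p\<ge>r. c p = 0) \<and> (\<forall>j<r. comb c j \<in> \<int>)}"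
  have comb_diff: "comb (\<lambda>p. c p - c' p) j = comb c j - comb c' j" for c c' j
    by (simp add: comb_def left_diff_distrib sum_subtractf)
  have comb_inj: "c = c'" if "c \<in> \<Gamma>" "c' \<in> \<Gamma>" "\<And>j. j < r \<Longrightarrow> comb c j = comb c' j" for c c'
  proof
    fix p
    have "\<forall>p<r. c p - c' p = 0"
      by (rule ind) (use that(3) comb_diff[of c c'] in \<open>simp add: comb_def\<close>)
    moreover have "c p = c' p" if "p \<ge> r" using that \<open>c \<in> \<Gamma>\<close> \<open>c' \<in> \<Gamma>\<close> by (simp add: \<Gamma>_def)
    ultimately show "c p = c' p" by (cases "p < r") auto
  qed
  have coords: "\<exists>c. (\<forall>p\<ge>r. c p = 0) \<and> (\<forall>j<r. comb c j = x j)" for x :: "nat \<Rightarrow> real"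
  proof -
    have "\<exists>c. \<forall>j\<in>{..<r}. (\<Sum>p\<in>{..<r}. of_int (v p j) * c p) = x j"
    proof (rule square_system_solvable)
      fix c :: "nat \<Rightarrow> real" assume "\<And>j. j \<in> {..<r} \<Longrightarrow> (\<Sum>p<r. of_int (v p j) * c p) = 0"
      hence "\<forall>p<r. c p = 0" by (intro ind) (simp add: mult.commute)
      thus "\<forall>p\<in>{..<r}. c p = 0" by simp
    qed auto
    then obtain c where c: "\<And>j. j < r \<Longrightarrow> (\<Sum>p<r. of_int (v p j) * c p) = x j" by (metis lessThan_iff)
    have "comb (\<lambda>p. if p < r then c p else 0) j = (\<Sum>p<r. of_int (v p j) * c p)" for j
      unfolding comb_def by (intro sum.cong) auto
    thus ?thesis using c by (intro exI[of _ "\<lambda>p. if p < r then c p else 0"]) auto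
  qed
  have "\<exists>e. (\<forall>i<r. e i \<in> \<Gamma> \<and> e i i > 0 \<and> (\<forall>j>i. e i j = 0)) \<and>
    (\<forall>x\<in>\<Gamma>. \<exists>n::nat \<Rightarrow> int. \<forall>j. x j = (\<Sum>i<r. of_int (n i) * e i j))"
  proof (rule triangular_basis)
    show "subtraction_closed \<Gamma>" unfolding subtraction_closed_def
    proof (intro conjI ballI)
      show "(\<lambda>_. 0) \<in> \<Gamma>" by (simp add: \<Gamma>_def comb_def)
      fix x y assume "x \<in> \<Gamma>" "y \<in> \<Gamma>"
      thus "(\<lambda>i. x i - y i) \<in> \<Gamma>" by (simp add: \<Gamma>_def comb_diff)
    qed
  next
    fix B :: real
    define K where "K = \<lceil>\<Sum>j<r. \<Sum>p<r. \<bar>B\<bar> * \<bar>of_int (v p j)\<bar>\<rceil>"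
    define h where "h c j = (if j < r then \<lfloor>comb c j\<rfloor> else 0)" for c j
    have hc: "of_int (h c j) = comb c j" if "c \<in> \<Gamma>" "j < r" for c j
      using that by (auto simp: h_def \<Gamma>_def elim!: Ints_cases)
    show "finite {x \<in> \<Gamma>. \<forall>i<r. \<bar>x i\<bar> \<le> B}"
    proof (rule finite_imageD[where f = h], rule finite_subset[OF _ finite_int_box[of r K]], rule subsetI)
      fix z assume "z \<in> h ` {x \<in> \<Gamma>. \<forall>i<r. \<bar>x i\<bar> \<le> B}"
      then obtain c where c: "c \<in> \<Gamma>" "\<And>i. i < r \<Longrightarrow> \<bar>c i\<bar> \<le> B" "z = h c" by blast
      have "\<bar>z j\<bar> \<le> K" if j: "j < r" for j
      proof -
        have "\<bar>comb c j\<bar> \<le> (\<Sum>p<r. \<bar>c p * of_int (v p j)\<bar>)" unfolding comb_def by (rule sum_abs)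
        also have "\<dots> \<le> (\<Sum>p<r. \<bar>B\<bar> * \<bar>of_int (v p j)\<bar>)"
          using c(2) by (intro sum_mono) (force simp: abs_mult intro: mult_right_mono)
        also have "\<dots> \<le> (\<Sum>j<r. \<Sum>p<r. \<bar>B\<bar> * \<bar>of_int (v p j)\<bar>)"
          using j by (intro member_le_sum[of j "{..<r}" "\<lambda>j. \<Sum>p<r. \<bar>B\<bar> * \<bar>of_int (v p j)\<bar>"]) (auto intro: sum_nonneg)
        finally have "of_int \<bar>z j\<bar> \<le> (\<Sum>j<r. \<Sum>p<r. \<bar>B\<bar> * \<bar>of_int (v p j)\<bar>)"
          using hc[OF c(1) j] c(3) by simp
        thus ?thesis unfolding K_def by linarith
      qed
      thus "z \<in> {z. (\<forall>j<r. \<bar>z j\<bar> \<le> K) \<and> (\<forall>j\<ge>r. z j = 0)}" using c(3) by (simp add: h_def)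
    next
      show "inj_on h {x \<in> \<Gamma>. \<forall>i<r. \<bar>x i\<bar> \<le> B}"
      proof (rule inj_onI)
        fix c c' assume c: "c \<in> {x \<in> \<Gamma>. \<forall>i<r. \<bar>x i\<bar> \<le> B}" "c' \<in> {x \<in> \<Gamma>. \<forall>i<r. \<bar>x i\<bar> \<le> B}" "h c = h c'"
        show "c = c'" by (rule comb_inj) (use c hc[of c] hc[of c'] in auto)
      qed
    qed
  next
    fix i assume i: "i < r"
    define x where "x p = (if p = i then 1 else 0 :: real)" for p
    have "comb x j = of_int (v i j)" for j
      using i by (simp add: comb_def x_def if_distrib[of "\<lambda>x. x * _"] cong: if_cong)
    hence "x \<in> \<Gamma>" using i by (auto simp: \<Gamma>_def x_def)
    thus "\<exists>x\<in>\<Gamma>. x i > 0 \<and> (\<forall>j. j \<noteq> i \<longrightarrow> x j = 0)" by (intro bexI[of _ x]) (auto simp: x_def)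
  qed (simp add: \<Gamma>_def)
  then obtain e where e: "\<And>i. i < r \<Longrightarrow> e i \<in> \<Gamma>" "\<And>i. i < r \<Longrightarrow> e i i > 0" "\<And>i j. i < r \<Longrightarrow> i < j \<Longrightarrow> e i j = 0"
    "\<And>x. x \<in> \<Gamma> \<Longrightarrow> \<exists>n::nat \<Rightarrow> int. \<forall>j. x j = (\<Sum>i<r. of_int (n i) * e i j)" by blast
  define u where "u i j = (if j < r then \<lfloor>comb (e i) j\<rfloor> else 0)" for i j
  have u: "of_int (u i j) = comb (e i) j" if "i < r" "j < r" for i j
    using e(1)[OF that(1)] that(2) by (auto simp: u_def \<Gamma>_def elim!: Ints_cases)
  have comb_e: "comb (\<lambda>p. \<Sum>i<r. y i * e i p) j = (\<Sum>i<r. y i * of_int (u i j))" if j: "j < r" for y j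
  proof -
    have "comb (\<lambda>p. \<Sum>i<r. y i * e i p) j = (\<Sum>p<r. \<Sum>i<r. y i * (e i p * of_int (v p j)))"
      unfolding comb_def by (simp add: sum_distrib_left sum_distrib_right mult_ac)
    also have "\<dots> = (\<Sum>i<r. \<Sum>p<r. y i * (e i p * of_int (v p j)))" by (rule sum.swap)
    also have "\<dots> = (\<Sum>i<r. y i * of_int (u i j))"
      by (intro sum.cong refl) (simp add: u j comb_def sum_distrib_left)
    finally show ?thesis .
  qed
  define M where "M p i = (\<Sum>j<r. A p j * of_int (u i j))" for p i
  have NM: "l1_form r M y = l1_form r A (\<lambda>j. \<Sum>i<r. y i * of_int (u i j))" for y
  proof -
    have "(\<Sum>i<r. M p i * y i) = (\<Sum>j<r. A p j * (\<Sum>i<r. y i * of_int (u i j)))" for p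
    proof -
      have "(\<Sum>i<r. M p i * y i) = (\<Sum>i<r. \<Sum>j<r. A p j * (y i * of_int (u i j)))"
        unfolding M_def by (simp add: sum_distrib_left sum_distrib_right mult_ac)
      also have "\<dots> = (\<Sum>j<r. \<Sum>i<r. A p j * (y i * of_int (u i j)))" by (rule sum.swap)
      finally show ?thesis by (simp add: sum_distrib_left)
    qed
    thus ?thesis by (simp add: l1_form_def)
  qed
  \<comment> \<open>The unit vectors are integral combinations of the \<open>u i\<close>, so the
    matrix of \<open>u\<close> has an integral inverse \<open>n\<close>.\<close>
  have "\<exists>n. \<forall>k<r. \<forall>j<r. (\<Sum>i<r. u i j * n i k) = (if j = k then 1 else 0)"
  proof -
    have "\<exists>n::nat \<Rightarrow> int. \<forall>j<r. (\<Sum>i<r. u i j * n i) = (if j = k then 1 else 0)" for k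
    proof -
      obtain c where c: "\<forall>p\<ge>r. c p = 0" "\<And>j. j < r \<Longrightarrow> comb c j = (if j = k then 1 else 0)"
        using coords[of "\<lambda>j. if j = k then 1 else 0"] by blast
      hence "c \<in> \<Gamma>" by (auto simp: \<Gamma>_def)
      from e(4)[OF this] obtain n :: "nat \<Rightarrow> int" where n: "\<And>p. c p = (\<Sum>i<r. of_int (n i) * e i p)" by blast
      have "(\<Sum>i<r. u i j * n i) = (if j = k then 1 else 0)" if j: "j < r" for j
      proof -
        have ceq: "c = (\<lambda>p. \<Sum>i<r. of_int (n i) * e i p)" using n by (intro ext)
        have "of_int (\<Sum>i<r. u i j * n i) = comb c j"
          unfolding ceq comb_e[OF j] by (simp add: mult.commute)
        also have "\<dots> = of_int (if j = k then 1 else 0)" using c(2)[OF j] by simp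
        finally show ?thesis by (simp only: of_int_eq_iff)
      qed
      thus ?thesis by blast
    qed
    hence "\<exists>n. \<forall>k. \<forall>j<r. (\<Sum>i<r. u i j * n k i) = (if j = k then 1 else 0)" by (intro choice allI)
    then obtain n where "\<forall>k. \<forall>j<r. (\<Sum>i<r. u i j * n k i) = (if j = k then 1 else 0)" by blast
    thus ?thesis by (intro exI[of _ "\<lambda>i k. n k i"]) simp
  qed
  then obtain n where n: "\<And>k j. k < r \<Longrightarrow> j < r \<Longrightarrow> (\<Sum>i<r. u i j * n i k) = (if j = k then 1 else 0)" by blast
  have detU: "\<bar>det (mat r r (\<lambda>(j, i). real_of_int (u i j)))\<bar> = 1"
    by (rule abs_det_unimodular[where W = n]) (use n in simp)
  have "mat r r (\<lambda>(p, i). M p i) = mat r r (\<lambda>(p, j). A p j) * mat r r (\<lambda>(j, i). real_of_int (u i j))"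
    unfolding mat_mult_of_functions M_def ..
  hence detM: "\<bar>det (mat r r (\<lambda>(p, i). M p i))\<bar> = \<bar>?d\<bar>"
    using det_mult[of "mat r r (\<lambda>(p, j). A p j)" r "mat r r (\<lambda>(j, i). real_of_int (u i j))"] detU
    by (simp add: abs_mult)
  have Npos: "?N z > 0" if z: "\<not> in_real_span r v i z" for z i
  proof (rule ccontr)
    assume "\<not> ?N z > 0"
    hence N0: "?N z = 0" using l1_form_nonneg[of r A "\<lambda>j. of_int (z j)"] by linarith
    obtain C where "\<And>y j. j < r \<Longrightarrow> \<bar>y j\<bar> \<le> C * l1_form r A y"
      using l1_form_coordinate_bound[OF det] by blast
    from this[of _ "\<lambda>j. of_int (z j)"] N0 have "\<forall>j<r. real_of_int (z j) = 0" by auto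
    hence "in_real_span r v i z" unfolding in_real_span_def by (intro exI[of _ "\<lambda>_. 0"]) simp
    with z show False by simp
  qed
  have "(\<Prod>i<r. ?N (v i)) \<le> fact r * \<bar>det (mat r r (\<lambda>(p, i). M p i))\<bar>"
  proof (rule prod_minima_le)
    show "det (mat r r (\<lambda>(p, i). M p i)) \<noteq> 0" using detM det by auto
    show "?N (v i) > 0" if "i < r" for i using Npos[OF vout[OF that]] .
    show "?N (v i) \<le> ?N (v (Suc i))" if i: "Suc i < r" for i
    proof (rule vmin)
      show "\<not> in_real_span r v i (v (Suc i))"
      proof
        assume "in_real_span r v i (v (Suc i))"
        then obtain c :: "nat \<Rightarrow> real" where c: "\<forall>j<r. of_int (v (Suc i) j) = (\<Sum>p<i. c p * of_int (v p j))"
          unfolding in_real_span_def by blast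
        have "(\<Sum>p<Suc i. (c(i := 0)) p * of_int (v p j)) = (\<Sum>p<i. c p * of_int (v p j))" for j
          by simp
        hence "in_real_span r v (Suc i) (v (Suc i))"
          unfolding in_real_span_def using c by (intro exI[of _ "c(i := 0)"]) simp
        with vout[OF i] show False by simp
      qed
    qed (use i vsupp in auto)
    \<comment> \<open>A lattice vector shorter than the minimum \<open>i\<close> lies in the real
      span of the earlier \<open>v\<close>, so its \<open>v\<close>-coordinates from
      \<open>i\<close> on vanish. By triangularity, its \<open>u\<close>-coefficients from
      \<open>i\<close> on vanish too, from the top index downwards.\<close>
    show "y i = 0" if i: "i < r" and small: "l1_form r M (\<lambda>j. of_int (y j :: int)) < ?N (v i)" for i y
    proof -
      define z where "z j = (if j < r then \<Sum>q<r. y q * u q j else 0)" for j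
      have zc: "of_int (z j) = comb (\<lambda>p. \<Sum>q<r. of_int (y q) * e q p) j" if "j < r" for j
        using that by (simp add: z_def comb_e)
      have "?N z = l1_form r M (\<lambda>j. of_int (y j))"
        unfolding NM by (rule l1_form_cong) (simp add: z_def)
      with small have "in_real_span r v i z" using vmin[OF i, of z] by (force simp: z_def)
      then obtain c :: "nat \<Rightarrow> real" where c: "\<forall>j<r. of_int (z j) = (\<Sum>p<i. c p * of_int (v p j))"
        unfolding in_real_span_def by blast
      define c' where "c' p = (if p < i then c p else 0)" for p
      have c': "comb c' j = (\<Sum>p<i. c p * of_int (v p j))" for j
      proof -
        have "comb c' j = (\<Sum>p<i. c' p * of_int (v p j))"
          unfolding comb_def by (rule sum.mono_neutral_right) (use i in \<open>auto simp: c'_def\<close>)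
        thus ?thesis by (simp add: c'_def)
      qed
      have "\<forall>p<r. (\<Sum>q<r. of_int (y q) * e q p) - c' p = 0"
      proof (rule ind)
        fix j assume j: "j < r"
        have "comb (\<lambda>p. (\<Sum>q<r. of_int (y q) * e q p) - c' p) j = 0"
          unfolding comb_diff using zc[OF j] c c' j by simp
        thus "(\<Sum>p<r. ((\<Sum>q<r. of_int (y q) * e q p) - c' p) * of_int (v p j)) = 0"
          by (simp add: comb_def)
      qed
      hence zero: "(\<Sum>q<r. of_int (y q) * e q p) = 0" if "i \<le> p" "p < r" for p
        using that by (simp add: c'_def)
      have "y p = 0" if "i \<le> p" "p < r" for p
        using that
      proof (induction "r - p" arbitrary: p rule: less_induct)
        case less
        have "(\<Sum>q<r. of_int (y q) * e q p) = (\<Sum>q\<in>{p}. of_int (y q) * e q p)"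
        proof (rule sum.mono_neutral_right)
          show "\<forall>q\<in>{..<r} - {p}. of_int (y q) * e q p = 0"
          proof
            fix q assume q: "q \<in> {..<r} - {p}"
            show "of_int (y q) * e q p = 0"
            proof (cases "q < p")
              case True
              thus ?thesis using e(3)[of q p] q by simp
            next
              case False
              hence "q > p" using q by auto
              hence "y q = 0" using less q by (intro less.hyps) auto
              thus ?thesis by simp
            qed
          qed
        qed (use less.prems in auto)
        thus "y p = 0" using zero[OF less.prems] e(2)[OF less.prems(2)] by simp
      qed
      thus ?thesis using i by simp
    qed
  qed
  hence "(\<Prod>i<r. ?N (v i)) \<le> fact r * \<bar>?d\<bar>" unfolding detM .
  moreover have "\<forall>c::nat \<Rightarrow> real. (\<forall>j<r. (\<Sum>p<r. c p * of_int (v p j)) = 0) \<longrightarrow> (\<forall>p<r. c p = 0)"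
    using ind by (intro allI impI) (simp only:)
  ultimately show ?thesis by (intro exI[of _ v] conjI)
qed

section \<open>Number fields and their complex embeddings\<close>

lemma ambient_simps [simp]:
  "carrier ambient = UNIV" "x \<otimes>\<^bsub>ambient\<^esub> y = x * y" "x \<oplus>\<^bsub>ambient\<^esub> y = x + y"
  "\<one>\<^bsub>ambient\<^esub> = 1" "\<zero>\<^bsub>ambient\<^esub> = 0"
  by (simp_all add: ring_of_type_algebra_def)

lemma ambient_field: "field (ambient :: 'a::field_char_0 ring)"
  by (rule field_from_type_algebra)

lemma ambient_ring: "ring (ambient :: 'a::field_char_0 ring)"
  by (rule ring_from_type_algebra)

lemma ambient_uminus [simp]: "\<ominus>\<^bsub>ambient\<^esub> x = - (x :: 'a::field_char_0)"
proof -
  interpret R: field "ambient :: 'a ring" by (rule ambient_field)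
  show ?thesis by (rule R.minus_equality) simp_all
qed

lemma ambient_inverse [simp]: "x \<noteq> 0 \<Longrightarrow> inv\<^bsub>ambient\<^esub> x = inverse (x :: 'a::field_char_0)"
proof -
  assume x: "x \<noteq> 0"
  interpret R: field "ambient :: 'a ring" by (rule ambient_field)
  show ?thesis by (rule R.comm_inv_char) (use x in simp_all)
qed

text \<open>Subfields of the ambient field, in elementwise form. Since \<open>inverse 0 = 0\<close>,
  closure under inverses can be stated unconditionally.\<close>

definition field_set :: "'a::field_char_0 set \<Rightarrow> bool" where
  "field_set K \<longleftrightarrow> 1 \<in> K \<and> (\<forall>x\<in>K. - x \<in> K \<and> inverse x \<in> K) \<and>
     (\<forall>x\<in>K. \<forall>y\<in>K. x + y \<in> K \<and> x * y \<in> K)"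

lemma field_closed:
  assumes "field_set K"
  shows "1 \<in> K" "0 \<in> K" "x \<in> K \<Longrightarrow> - x \<in> K" "x \<in> K \<Longrightarrow> inverse x \<in> K"
    "x \<in> K \<Longrightarrow> y \<in> K \<Longrightarrow> x + y \<in> K" "x \<in> K \<Longrightarrow> y \<in> K \<Longrightarrow> x * y \<in> K"
    "x \<in> K \<Longrightarrow> y \<in> K \<Longrightarrow> x - y \<in> K" "x \<in> K \<Longrightarrow> y \<in> K \<Longrightarrow> x / y \<in> K" "x \<in> K \<Longrightarrow> x ^ n \<in> K"
proof -
  show 1: "1 \<in> K" "x \<in> K \<Longrightarrow> - x \<in> K" "x \<in> K \<Longrightarrow> inverse x \<in> K"
    "x \<in> K \<Longrightarrow> y \<in> K \<Longrightarrow> x + y \<in> K" "x \<in> K \<Longrightarrow> y \<in> K \<Longrightarrow> x * y \<in> K" for x y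
    using assms by (simp_all add: field_set_def)
  show 2: "x \<in> K \<Longrightarrow> y \<in> K \<Longrightarrow> x - y \<in> K" for x y
    using 1(4)[of x "- y"] 1(2)[of y] by simp
  show "x \<in> K \<Longrightarrow> y \<in> K \<Longrightarrow> x / y \<in> K" using 1(5)[of x "inverse y"] 1(3)[of y] by (simp add: field_simps)
  show "0 \<in> K" using 2[of 1 1] 1(1) by simp
  show "x \<in> K \<Longrightarrow> x ^ n \<in> K" by (induction n) (use 1 in auto)
qed

lemma field_set_sum: "field_set K \<Longrightarrow> (\<And>i. i \<in> I \<Longrightarrow> f i \<in> K) \<Longrightarrow> sum f I \<in> K"
  by (induction I rule: infinite_finite_induct) (auto intro: field_closed)

lemma field_set_prod: "field_set K \<Longrightarrow> (\<And>i. i \<in> I \<Longrightarrow> f i \<in> K) \<Longrightarrow> prod f I \<in> K"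
  by (induction I rule: infinite_finite_induct) (auto intro: field_closed)

lemma field_set_of_int: "field_set K \<Longrightarrow> of_int n \<in> K"
  by (induction n rule: int_induct[where k = 0]) (auto intro: field_closed)

lemma field_set_of_rat:
  assumes "field_set K"
  shows "of_rat q \<in> K"
proof (cases q)
  case (Fract a b)
  hence "of_rat q = of_int a / (of_int b :: 'a)" by (simp add: of_rat_rat)
  thus ?thesis using assms by (auto intro!: field_closed field_set_of_int)
qed

lemma Rats_subset_field_set: "field_set K \<Longrightarrow> \<rat> \<subseteq> K"
  by (auto elim!: Rats_cases intro: field_set_of_rat)

lemma field_set_Rats: "field_set (\<rat> :: 'a::field_char_0 set)"
  by (simp add: field_set_def)

lemma subfield_ambient_iff: "subfield K (ambient :: 'a::field_char_0 ring) \<longleftrightarrow> field_set K"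
proof
  assume K: "subfield K ambient"
  interpret R: field "ambient :: 'a ring" by (rule ambient_field)
  note S = subringE[OF subfieldE(1)[OF K]]
  have "inverse x \<in> K" if "x \<in> K" for x
  proof (cases "x = 0")
    case True
    thus ?thesis using S(2) by simp
  next
    case False
    with R.subfield_m_inv(1)[OF K] that have "inv\<^bsub>ambient\<^esub> x \<in> K - {0}" by auto
    thus ?thesis using False by simp
  qed
  thus "field_set K" using S(3,5,6,7) by (simp add: field_set_def)
next
  assume K: "field_set K"
  interpret R: field "ambient :: 'a ring" by (rule ambient_field)
  show "subfield K ambient"
    by (intro R.subfieldI' R.subringI) (use K in \<open>auto intro: field_closed\<close>)
qed

section \<open>Bases and degrees\<close>

text \<open>Bases as indexed families, so that sums over \<open>{..<n}\<close> replace combinations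
  of lists; \<open>is_basis_of_list\<close> is the bridge to the algebraic dimension theory.\<close>

definition is_basis :: "'a::field_char_0 set \<Rightarrow> 'a set \<Rightarrow> nat \<Rightarrow> (nat \<Rightarrow> 'a) \<Rightarrow> bool" where
  "is_basis k E n b \<longleftrightarrow> E = {\<Sum>i<n. c i * b i | c. \<forall>i<n. c i \<in> k} \<and>
     (\<forall>c. (\<forall>i<n. c i \<in> k) \<longrightarrow> (\<Sum>i<n. c i * b i) = 0 \<longrightarrow> (\<forall>i<n. c i = 0))"

lemma is_basisD:
  assumes "is_basis k E n b"
  shows "x \<in> E \<Longrightarrow> \<exists>c. (\<forall>i<n. c i \<in> k) \<and> x = (\<Sum>i<n. c i * b i)"
    and "(\<And>i. i < n \<Longrightarrow> c i \<in> k) \<Longrightarrow> (\<Sum>i<n. c i * b i) \<in> E"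
    and "(\<And>i. i < n \<Longrightarrow> c i \<in> k) \<Longrightarrow> (\<Sum>i<n. c i * b i) = 0 \<Longrightarrow> i < n \<Longrightarrow> c i = 0"
proof -
  note E = conjunct1[OF assms[unfolded is_basis_def]] and ind = conjunct2[OF assms[unfolded is_basis_def]]
  show "x \<in> E \<Longrightarrow> \<exists>c. (\<forall>i<n. c i \<in> k) \<and> x = (\<Sum>i<n. c i * b i)" by (subst (asm) E) blast
  show "(\<And>i. i < n \<Longrightarrow> c i \<in> k) \<Longrightarrow> (\<Sum>i<n. c i * b i) \<in> E" by (subst E) blast
  show "(\<And>i. i < n \<Longrightarrow> c i \<in> k) \<Longrightarrow> (\<Sum>i<n. c i * b i) = 0 \<Longrightarrow> i < n \<Longrightarrow> c i = 0"
  proof -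
    assume A: "\<And>i. i < n \<Longrightarrow> c i \<in> k" "(\<Sum>i<n. c i * b i) = 0" "i < n"
    have "\<forall>i<n. c i \<in> k" using A(1) by (intro allI impI)
    from mp[OF mp[OF spec[OF ind] this] A(2)] A(3) show "c i = 0" by (elim allE impE)
  qed
qed

lemma is_basis_mem:
  assumes "field_set k" "is_basis k E n b" "i < n"
  shows "b i \<in> E"
proof -
  have "(\<Sum>j<n. (if j = i then 1 else 0) * b j) \<in> E"
    by (rule is_basisD(2)[OF assms(2)]) (use assms(1) in \<open>auto intro: field_closed\<close>)
  also have "(\<Sum>j<n. (if j = i then 1 else 0) * b j) = b i"
    using assms(3) by (simp add: if_distrib[of "\<lambda>x. x * _"] cong: if_cong)
  finally show ?thesis .
qed

lemma ambient_combine: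
  fixes Us :: "'a::field_char_0 list"
  assumes "length Ks = length Us"
  shows "ring.combine ambient Ks Us = (\<Sum>i<length Us. Ks ! i * Us ! i)"
proof -
  interpret R: ring "ambient :: 'a ring" by (rule ambient_ring)
  from assms show ?thesis
  proof (induction Ks Us rule: list_induct2)
    case (Cons k Ks u Us)
    thus ?case by (simp add: sum.lessThan_Suc_shift del: sum.lessThan_Suc)
  qed simp
qed

lemma ambient_Span:
  fixes bs :: "'a::field_char_0 list"
  assumes k: "field_set k"
  shows "ring.Span ambient k bs = {\<Sum>i<length bs. c i * bs ! i | c. \<forall>i<length bs. c i \<in> k}"
proof -
  interpret R: ring "ambient :: 'a ring" by (rule ambient_ring)
  have "R.Span k bs = {R.combine Ks bs | Ks. length Ks = length bs \<and> set Ks \<subseteq> k}"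
    by (rule R.Span_eq_combine_set_length_version) (use k in \<open>auto simp: subfield_ambient_iff\<close>)
  also have "\<dots> = {\<Sum>i<length bs. c i * bs ! i | c. \<forall>i<length bs. c i \<in> k}"
  proof (intro subset_antisym subsetI)
    fix x assume "x \<in> {R.combine Ks bs | Ks. length Ks = length bs \<and> set Ks \<subseteq> k}"
    then obtain Ks where "x = R.combine Ks bs" "length Ks = length bs" "set Ks \<subseteq> k" by blast
    thus "x \<in> {\<Sum>i<length bs. c i * bs ! i | c. \<forall>i<length bs. c i \<in> k}"
      by (intro CollectI exI[of _ "\<lambda>i. Ks ! i"]) (auto simp: ambient_combine)
  next
    fix x assume "x \<in> {\<Sum>i<length bs. c i * bs ! i | c. \<forall>i<length bs. c i \<in> k}"
    then obtain c where c: "x = (\<Sum>i<length bs. c i * bs ! i)" "\<forall>i<length bs. c i \<in> k" by blast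
    hence "x = R.combine (map c [0..<length bs]) bs" by (simp add: ambient_combine)
    thus "x \<in> {R.combine Ks bs | Ks. length Ks = length bs \<and> set Ks \<subseteq> k}"
      using c(2) by (intro CollectI exI[of _ "map c [0..<length bs]"]) auto
  qed
  finally show ?thesis .
qed

lemma is_basis_of_list:
  fixes bs :: "'a::field_char_0 list"
  assumes k: "field_set k"
  shows "ring.independent ambient k bs \<and> ring.Span ambient k bs = E \<longleftrightarrow> is_basis k E (length bs) ((!) bs)"
proof -
  interpret R: ring "ambient :: 'a ring" by (rule ambient_ring)
  have sub: "subfield k (ambient :: 'a ring)" using k by (simp add: subfield_ambient_iff)
  have "R.independent k bs \<longleftrightarrow>
    (\<forall>c. (\<forall>i<length bs. c i \<in> k) \<longrightarrow> (\<Sum>i<length bs. c i * bs ! i) = 0 \<longrightarrow> (\<forall>i<length bs. c i = 0))"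
  proof (intro iffI allI impI)
    fix c i assume ind: "R.independent k bs" and c: "\<forall>i<length bs. c i \<in> k"
      and s: "(\<Sum>i<length bs. c i * bs ! i) = 0" and i: "i < length bs"
    have "set (take (length bs) (map c [0..<length bs])) \<subseteq> {\<zero>\<^bsub>ambient\<^esub>}"
      by (rule R.independent_imp_trivial_combine[OF sub ind]) (use c s in \<open>auto simp: ambient_combine\<close>)
    moreover have "c i \<in> set (take (length bs) (map c [0..<length bs]))" using i by simp
    ultimately show "c i = 0" by (metis ambient_simps(5) singletonD subsetD)
  next
    assume H: "\<forall>c. (\<forall>i<length bs. c i \<in> k) \<longrightarrow> (\<Sum>i<length bs. c i * bs ! i) = 0 \<longrightarrow> (\<forall>i<length bs. c i = 0)"
    show "R.independent k bs"
    proof (rule R.trivial_combine_imp_independent[OF sub])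
      fix Ks assume Ks: "set Ks \<subseteq> k" "R.combine Ks bs = \<zero>\<^bsub>ambient\<^esub>"
      obtain Ks' where Ks': "set Ks' \<subseteq> k" "length Ks' = length bs" "R.combine Ks' bs = \<zero>\<^bsub>ambient\<^esub>"
        "set (take (length bs) Ks) \<subseteq> set Ks'"
      proof -
        obtain Ks' where Ks': "set (take (length bs) Ks) \<subseteq> set Ks'" "set Ks' \<subseteq> set (take (length bs) Ks) \<union> {0}"
          "length Ks' = length bs" "R.combine Ks' bs = \<zero>\<^bsub>ambient\<^esub>"
          using R.combine_normalize[of Ks bs "\<zero>\<^bsub>ambient\<^esub>"] Ks by auto
        moreover have "set Ks' \<subseteq> k"
          using Ks'(2) set_take_subset[of "length bs" Ks] Ks(1) field_closed(2)[OF k] by blast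
        ultimately show ?thesis using that by blast
      qed
      have "\<forall>i<length bs. Ks' ! i = 0"
        by (rule mp[OF mp[OF spec[OF H]]]) (use Ks' in \<open>auto simp: ambient_combine\<close>)
      hence "set Ks' \<subseteq> {0}" using Ks'(2) by (auto simp: in_set_conv_nth)
      thus "set (take (length bs) Ks) \<subseteq> {\<zero>\<^bsub>ambient\<^esub>}" using Ks'(4) by auto
    qed simp
  qed
  hence *: "R.independent k bs \<longleftrightarrow> (\<forall>c. (\<forall>i<length bs. c i \<in> k) \<longrightarrow> (\<Sum>i<length bs. c i * bs ! i) = 0 \<longrightarrow>
      (\<forall>i<length bs. c i = 0))" .
  show ?thesis unfolding is_basis_def ambient_Span[OF k] * conj_commute[of "E = _"] by (subst eq_commute[of E]) (rule refl)
qed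

lemma dimension_iff_basis:
  assumes k: "field_set k"
  shows "ring.dimension ambient n k E \<longleftrightarrow> (\<exists>b. is_basis k E n b)"
proof -
  interpret R: ring "ambient :: 'a ring" by (rule ambient_ring)
  have sub: "subfield k (ambient :: 'a ring)" using k by (simp add: subfield_ambient_iff)
  show ?thesis
  proof
    assume "R.dimension n k E"
    from R.exists_base[OF sub this] obtain bs where
      "R.independent k bs" "length bs = n" "R.Span k bs = E" by blast
    thus "\<exists>b. is_basis k E n b" using is_basis_of_list[OF k, of bs E] by blast
  next
    assume "\<exists>b. is_basis k E n b"
    then obtain b where b: "is_basis k E n b" by blast
    define bs where "bs = map b [0..<n]"
    have *: "(\<Sum>i<n. c i * bs ! i) = (\<Sum>i<n. c i * b i)" for c by (intro sum.cong) (auto simp: bs_def)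
    have len: "length bs = n" by (simp add: bs_def)
    have "is_basis k E (length bs) ((!) bs)"
      unfolding len is_basis_def * by (rule b[unfolded is_basis_def])
    hence "R.independent k bs" "R.Span k bs = E" using is_basis_of_list[OF k, of bs E] by auto
    from R.dimensionI[OF sub this] show "R.dimension n k E" by (simp add: bs_def)
  qed
qed

lemma dimension_unique:
  assumes "field_set k" "ring.dimension (ambient :: 'a::field_char_0 ring) n k E" "ring.dimension ambient m k E"
  shows "n = m"
  using ring.dimension_is_inj[OF ambient_ring _ assms(2,3)] assms(1) by (simp add: subfield_ambient_iff)

lemma nf_props:
  assumes "number_field (K :: 'a::field_char_0 set)"
  shows "field_set K" "\<exists>b. is_basis \<rat> K (number_field_degree K) b"
    "ring.dimension ambient (number_field_degree K) \<rat> K"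
proof -
  interpret R: ring "ambient :: 'a ring" by (rule ambient_ring)
  show "field_set K" using assms by (simp add: number_field_def subfield_ambient_iff)
  from assms obtain n where n: "R.dimension n \<rat> K" by (auto simp: number_field_def R.finite_dimension_def)
  have "number_field_degree K = n"
    unfolding number_field_degree_def R.dim_def over_def
    by (rule the_equality[where P = "\<lambda>n. R.dimension n \<rat> K"], rule n, rule dimension_unique[OF field_set_Rats _ n])
  with n show "R.dimension (number_field_degree K) \<rat> K" by simp
  thus "\<exists>b. is_basis \<rat> K (number_field_degree K) b" by (simp add: dimension_iff_basis field_set_Rats)
qed

section \<open>Complex embeddings\<close>

text \<open>Extensionality makes equality of embeddings the same as agreement on \<open>K\<close>,
  which is what permits counting them.\<close>

definition embs :: "'a::field_char_0 set \<Rightarrow> ('a \<Rightarrow> complex) set" where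
  "embs K = {\<xi> \<in> extensional K. \<xi> 1 = 1 \<and>
     (\<forall>x\<in>K. \<forall>y\<in>K. \<xi> (x + y) = \<xi> x + \<xi> y \<and> \<xi> (x * y) = \<xi> x * \<xi> y)}"

lemma emb_simps:
  assumes K: "field_set K" and \<xi>: "\<xi> \<in> embs K"
  shows "\<xi> 1 = 1" "\<xi> 0 = 0" "x \<in> K \<Longrightarrow> y \<in> K \<Longrightarrow> \<xi> (x + y) = \<xi> x + \<xi> y"
    "x \<in> K \<Longrightarrow> y \<in> K \<Longrightarrow> \<xi> (x * y) = \<xi> x * \<xi> y" "x \<in> K \<Longrightarrow> \<xi> (- x) = - \<xi> x"
    "x \<in> K \<Longrightarrow> y \<in> K \<Longrightarrow> \<xi> (x - y) = \<xi> x - \<xi> y" "x \<in> K \<Longrightarrow> \<xi> (inverse x) = inverse (\<xi> x)"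
    "x \<in> K \<Longrightarrow> y \<in> K \<Longrightarrow> \<xi> (x / y) = \<xi> x / \<xi> y"
    "x \<in> K \<Longrightarrow> \<xi> x = 0 \<longleftrightarrow> x = 0" "x \<in> K \<Longrightarrow> \<xi> (x ^ n) = \<xi> x ^ n"
    "\<xi> (of_int m) = of_int m" "\<xi> (of_rat q) = of_rat q"
proof -
  note cl = field_closed[OF K]
  show 1: "\<xi> 1 = 1" and add: "\<And>x y. x \<in> K \<Longrightarrow> y \<in> K \<Longrightarrow> \<xi> (x + y) = \<xi> x + \<xi> y"
    and mult: "\<And>x y. x \<in> K \<Longrightarrow> y \<in> K \<Longrightarrow> \<xi> (x * y) = \<xi> x * \<xi> y"
    using \<xi> by (simp_all add: embs_def)
  show z: "\<xi> 0 = 0" using add[of 0 0] cl by simp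
  show neg: "\<xi> (- x) = - \<xi> x" if "x \<in> K" for x
    using add[of x "- x"] that cl z by (simp add: eq_neg_iff_add_eq_0 add.commute)
  show diff: "\<xi> (x - y) = \<xi> x - \<xi> y" if "x \<in> K" "y \<in> K" for x y
    using add[of x "- y"] neg[of y] that cl by simp
  have nz: "\<xi> x * \<xi> (inverse x) = 1" if "x \<in> K" "x \<noteq> 0" for x
    using mult[of x "inverse x"] that cl 1 by simp
  show inv: "\<xi> (inverse x) = inverse (\<xi> x)" if "x \<in> K" for x
    using nz[OF that] z by (cases "x = 0") (auto simp: inverse_unique)
  show "\<xi> (x / y) = \<xi> x / \<xi> y" if "x \<in> K" "y \<in> K"
    using mult[of x "inverse y"] inv[of y] that cl by (simp add: divide_inverse)
  show "\<xi> x = 0 \<longleftrightarrow> x = 0" if "x \<in> K" using nz[OF that] z by (cases "x = 0") auto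
  show "\<xi> (x ^ n) = \<xi> x ^ n" if "x \<in> K" for x n
    by (induction n) (use that cl 1 mult in auto)
  show int: "\<xi> (of_int m) = of_int m" for m
    by (induction m rule: int_induct[where k = 0])
       (use cl 1 z add diff field_set_of_int[OF K] in auto)
  show "\<xi> (of_rat q) = of_rat q"
  proof (cases q)
    case (Fract a b)
    have "\<xi> (of_rat q) = \<xi> (of_int a * inverse (of_int b))" using Fract by (simp add: of_rat_rat divide_inverse)
    also have "\<dots> = of_int a * inverse (of_int b)"
      using mult[of "of_int a" "inverse (of_int b)"] inv[of "of_int b"] int field_set_of_int[OF K] cl by simp
    also have "\<dots> = of_rat q" using Fract by (simp add: of_rat_rat divide_inverse)
    finally show ?thesis .
  qed
qed

lemma embedding_sum:
  assumes K: "field_set K" "\<xi> \<in> embs K" and "\<And>i. i \<in> I \<Longrightarrow> f i \<in> K"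
  shows "\<xi> (sum f I) = (\<Sum>i\<in>I. \<xi> (f i))"
  using assms(3) by (induction I rule: infinite_finite_induct)
    (auto simp: emb_simps[OF K] field_set_sum[OF K(1)])

lemma embedding_prod:
  assumes K: "field_set K" "\<xi> \<in> embs K" and "\<And>i. i \<in> I \<Longrightarrow> f i \<in> K"
  shows "\<xi> (prod f I) = (\<Prod>i\<in>I. \<xi> (f i))"
  using assms(3) by (induction I rule: infinite_finite_induct)
    (auto simp: emb_simps[OF K] field_set_prod[OF K(1)])

lemma embedding_inj:
  assumes K: "field_set K" "\<xi> \<in> embs K" and "x \<in> K" "y \<in> K" "\<xi> x = \<xi> y"
  shows "x = y"
  using emb_simps(9)[OF K, of "x - y"] emb_simps(6)[OF K, of x y] assms(3-5)
    field_closed(7)[OF K(1)] by simp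

lemma embedding_eqI:
  assumes "\<xi> \<in> embs K" "\<tau> \<in> embs K" "\<And>x. x \<in> K \<Longrightarrow> \<xi> x = \<tau> x"
  shows "\<xi> = \<tau>"
  by (rule extensionalityI[of _ K]) (use assms in \<open>auto simp: embs_def\<close>)

lemma embedding_restrict:
  assumes "\<tau> \<in> embs l" "k \<subseteq> l" "field_set k"
  shows "restrict \<tau> k \<in> embs k"
  using assms field_closed[OF assms(3)] unfolding embs_def by (auto simp: subset_iff)

text \<open>Independence of characters: evaluating the relation at \<open>y * x\<close> and
  subtracting \<open>\<tau> y\<close> times the relation at \<open>x\<close> removes
  \<open>\<tau>\<close> and multiplies every other coefficient by \<open>\<xi> y - \<tau> y\<close>,
  which is nonzero for a suitable \<open>y\<close>.\<close>

lemma dedekind_independence: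
  assumes K: "field_set K" and S: "finite S" "S \<subseteq> embs K"
    and zero: "\<And>x. x \<in> K \<Longrightarrow> (\<Sum>\<xi>\<in>S. c \<xi> * \<xi> x) = 0"
  shows "\<forall>\<xi>\<in>S. c \<xi> = 0"
  using S zero
proof (induction S arbitrary: c rule: finite_induct)
  case (insert \<tau> S)
  have \<tau>: "\<tau> \<in> embs K" and SK: "S \<subseteq> embs K" using insert.prems by auto
  have "c \<xi> = 0" if \<xi>: "\<xi> \<in> S" for \<xi>
  proof -
    obtain y where y: "y \<in> K" "\<xi> y \<noteq> \<tau> y"
      using embedding_eqI[of \<xi> K \<tau>] \<xi> SK \<tau> insert.hyps(2) by blast
    have "\<forall>\<xi>\<in>S. c \<xi> * (\<xi> y - \<tau> y) = 0"
    proof (rule insert.IH[OF SK])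
      fix x assume x: "x \<in> K"
      have "(\<Sum>\<xi>\<in>insert \<tau> S. c \<xi> * \<xi> (y * x)) - \<tau> y * (\<Sum>\<xi>\<in>insert \<tau> S. c \<xi> * \<xi> x) = 0"
        using insert.prems(2) x y field_closed(6)[OF K] by simp
      also have "(\<Sum>\<xi>\<in>insert \<tau> S. c \<xi> * \<xi> (y * x)) = (\<Sum>\<xi>\<in>insert \<tau> S. c \<xi> * (\<xi> y * \<xi> x))"
        using insert.prems(1) x y by (intro sum.cong) (auto simp: emb_simps(4)[OF K])
      also have "\<dots> - \<tau> y * (\<Sum>\<xi>\<in>insert \<tau> S. c \<xi> * \<xi> x) = (\<Sum>\<xi>\<in>S. c \<xi> * (\<xi> y - \<tau> y) * \<xi> x)"
        using insert.hyps by (simp add: algebra_simps sum_distrib_left sum_subtractf)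
      finally show "(\<Sum>\<xi>\<in>S. c \<xi> * (\<xi> y - \<tau> y) * \<xi> x) = 0" .
    qed
    thus ?thesis using \<xi> y by auto
  qed
  moreover from this have "c \<tau> = 0"
    using insert.prems(2)[of 1] insert.hyps emb_simps(1)[OF K \<tau>] field_closed(1)[OF K] by simp
  ultimately show ?case by simp
qed simp

definition extensions :: "'a::field_char_0 set \<Rightarrow> 'a set \<Rightarrow> ('a \<Rightarrow> complex) \<Rightarrow> ('a \<Rightarrow> complex) set" where
  "extensions k l \<xi> = {\<tau> \<in> embs l. restrict \<tau> k = \<xi>}"

lemma extensions_apply: "\<tau> \<in> extensions k l \<xi> \<Longrightarrow> x \<in> k \<Longrightarrow> \<tau> x = \<xi> x"
  by (auto simp: extensions_def)

text \<open>All embeddings in \<open>S\<close> agree with \<open>\<xi>\<close> on coefficients from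
  \<open>k\<close>, so a relation that holds on a basis holds on all of \<open>l\<close>, where
  Dedekind independence applies.\<close>

lemma embedding_relation_of_basis:
  assumes l: "field_set l" "k \<subseteq> l" "field_set k" and b: "is_basis k l m b"
    and S: "finite S" "S \<subseteq> extensions k l \<xi>" and c: "\<And>i. i < m \<Longrightarrow> (\<Sum>\<tau>\<in>S. c \<tau> * \<tau> (b i)) = 0"
  shows "\<forall>\<tau>\<in>S. c \<tau> = 0"
proof (rule dedekind_independence[OF l(1) S(1)])
  show "S \<subseteq> embs l" using S by (auto simp: extensions_def)
  fix x assume "x \<in> l"
  then obtain a where a: "\<forall>i<m. a i \<in> k" "x = (\<Sum>i<m. a i * b i)" using is_basisD(1)[OF b] by blast
  have bl: "b i \<in> l" if "i < m" for i by (rule is_basis_mem[OF l(3) b that])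
  have \<tau>x: "\<tau> x = (\<Sum>i<m. \<xi> (a i) * \<tau> (b i))" if \<tau>: "\<tau> \<in> S" for \<tau>
  proof -
    have \<tau>e: "\<tau> \<in> embs l" "\<tau> \<in> extensions k l \<xi>" using S \<tau> by (auto simp: extensions_def)
    have "\<tau> x = (\<Sum>i<m. \<tau> (a i * b i))" unfolding a(2)
      by (rule embedding_sum[OF l(1) \<tau>e(1)]) (use a bl l in \<open>auto intro: field_closed\<close>)
    also have "\<dots> = (\<Sum>i<m. \<xi> (a i) * \<tau> (b i))"
      using a bl l by (intro sum.cong refl) (auto simp: emb_simps(4)[OF l(1) \<tau>e(1)] extensions_apply[OF \<tau>e(2)])
    finally show ?thesis .
  qed
  have "(\<Sum>\<tau>\<in>S. c \<tau> * \<tau> x) = (\<Sum>\<tau>\<in>S. \<Sum>i<m. \<xi> (a i) * (c \<tau> * \<tau> (b i)))"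
    by (intro sum.cong refl, subst \<tau>x) (simp_all add: sum_distrib_left mult.left_commute)
  also have "\<dots> = (\<Sum>i<m. \<Sum>\<tau>\<in>S. \<xi> (a i) * (c \<tau> * \<tau> (b i)))" by (rule sum.swap)
  also have "\<dots> = (\<Sum>i<m. \<xi> (a i) * (\<Sum>\<tau>\<in>S. c \<tau> * \<tau> (b i)))" by (simp add: sum_distrib_left)
  also have "\<dots> = 0" using c by simp
  finally show "(\<Sum>\<tau>\<in>S. c \<tau> * \<tau> x) = 0" .
qed

text \<open>More than \<open>m\<close> extensions would admit a nontrivial relation on the
  \<open>m\<close> basis elements.\<close>

lemma extensions_bounded:
  assumes l: "field_set l" "k \<subseteq> l" "field_set k" and b: "is_basis k l m b"
  shows "finite (extensions k l \<xi>)" "card (extensions k l \<xi>) \<le> m"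
proof -
  have no: "card S \<le> m" if S: "finite S" "S \<subseteq> extensions k l \<xi>" for S
  proof (rule ccontr)
    assume "\<not> ?thesis"
    hence "card {..<m} < card S" by simp
    from homogeneous_nontrivial_solution[OF _ S(1) this, of "\<lambda>i \<tau>. \<tau> (b i)"] obtain c where
      c: "\<exists>\<tau>\<in>S. c \<tau> \<noteq> 0" "\<forall>i\<in>{..<m}. (\<Sum>\<tau>\<in>S. \<tau> (b i) * c \<tau>) = 0" by blast
    have "\<forall>\<tau>\<in>S. c \<tau> = 0"
      by (rule embedding_relation_of_basis[OF l b S]) (use c(2) in \<open>simp add: mult.commute\<close>)
    with c(1) show False by blast
  qed
  show fin: "finite (extensions k l \<xi>)"
  proof (rule ccontr)
    assume "infinite (extensions k l \<xi>)"
    then obtain S where "S \<subseteq> extensions k l \<xi>" "finite S" "card S = Suc m"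
      using infinite_arbitrarily_large by metis
    with no[of S] show False by simp
  qed
  show "card (extensions k l \<xi>) \<le> m" by (rule no[OF fin]) simp
qed

lemma embeddings_Rats_unique:
  assumes "\<xi> \<in> embs (\<rat> :: 'a::field_char_0 set)" "\<tau> \<in> embs \<rat>"
  shows "\<xi> = \<tau>"
  by (rule embedding_eqI[OF assms])
     (auto elim!: Rats_cases simp: emb_simps(12)[OF field_set_Rats] assms)

lemma embeddings_Rats_exists: "embs (\<rat> :: 'a::field_char_0 set) \<noteq> {}"
proof -
  define \<xi> where "\<xi> = (\<lambda>x\<in>(\<rat>::'a set). of_rat (inv_into UNIV of_rat x) :: complex)"
  have inv: "inv_into UNIV of_rat (of_rat q :: 'a) = q" for q by (rule inv_f_f) (simp add: inj_def)
  have \<xi>: "\<xi> (of_rat q) = of_rat q" for q by (simp add: \<xi>_def inv)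
  have "\<xi> \<in> embs \<rat>" unfolding embs_def
  proof (intro CollectI conjI ballI)
    show "\<xi> \<in> extensional \<rat>" by (simp add: \<xi>_def)
    show "\<xi> 1 = 1" using \<xi>[of 1] by simp
    fix x y :: 'a assume "x \<in> \<rat>" "y \<in> \<rat>"
    then obtain p q where pq: "x = of_rat p" "y = of_rat q" by (auto elim!: Rats_cases)
    show "\<xi> (x + y) = \<xi> x + \<xi> y" "\<xi> (x * y) = \<xi> x * \<xi> y"
      unfolding pq of_rat_add[symmetric] of_rat_mult[symmetric] \<xi> by (simp_all add: of_rat_add of_rat_mult)
  qed
  thus ?thesis by blast
qed

lemma algebraic_relation:
  fixes K :: "'a::field_char_0 set"
  assumes "number_field K" "\<theta> \<in> K"
  shows "\<exists>(c::nat \<Rightarrow> rat) n. (\<exists>j\<le>n. c j \<noteq> 0) \<and> (\<Sum>j\<le>n. of_rat (c j) * \<theta> ^ j) = 0"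
proof -
  define n where "n = number_field_degree K"
  obtain b where b: "is_basis \<rat> K n b" using nf_props(2)[OF assms(1)] n_def by blast
  have "\<exists>a::nat \<Rightarrow> rat. x = (\<Sum>i<n. of_rat (a i) * b i)" if xK: "x \<in> K" for x
  proof -
    obtain c where c: "\<forall>i<n. c i \<in> \<rat>" "x = (\<Sum>i<n. c i * b i)" using is_basisD(1)[OF b xK] by blast
    have "\<forall>i. \<exists>q. i < n \<longrightarrow> c i = of_rat q" using c(1) by (auto elim!: Rats_cases)
    then obtain a where a: "\<And>i. i < n \<longrightarrow> c i = of_rat (a i)" by metis
    show ?thesis unfolding c(2) using a by (intro exI[of _ a] sum.cong) auto
  qed
  hence "\<forall>j. \<exists>a::nat \<Rightarrow> rat. \<theta> ^ j = (\<Sum>i<n. of_rat (a i) * b i)"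
    using field_closed(9)[OF nf_props(1)[OF assms(1)] assms(2)] by blast
  then obtain a :: "nat \<Rightarrow> nat \<Rightarrow> rat" where a: "\<And>j. \<theta> ^ j = (\<Sum>i<n. of_rat (a j i) * b i)" by metis
  have "card {..<n} < card {..n}" by simp
  from homogeneous_nontrivial_solution[OF _ _ this, of "\<lambda>i j. a j i"] obtain c :: "nat \<Rightarrow> rat"
    where c: "\<exists>j\<in>{..n}. c j \<noteq> 0" "\<forall>i\<in>{..<n}. (\<Sum>j\<le>n. a j i * c j) = 0" by auto
  have "(\<Sum>j\<le>n. of_rat (c j) * \<theta> ^ j) = (\<Sum>j\<le>n. \<Sum>i<n. of_rat (a j i * c j) * b i)"
    by (intro sum.cong refl, subst a) (simp add: sum_distrib_left of_rat_mult mult_ac)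
  also have "\<dots> = (\<Sum>i<n. \<Sum>j\<le>n. of_rat (a j i * c j) * b i)" by (rule sum.swap)
  also have "\<dots> = (\<Sum>i<n. of_rat (\<Sum>j\<le>n. a j i * c j) * b i)"
    by (simp add: of_rat_sum sum_distrib_right)
  also have "\<dots> = 0" using c(2) by (intro sum.neutral) simp
  finally show ?thesis using c(1) by blast
qed

text \<open>Cancelling the lowest power of \<open>y\<close> from an algebraic relation leaves one
  with nonzero constant term; it can be solved for the inverse of \<open>y\<close>.\<close>

lemma inverse_is_rational_polynomial:
  fixes K :: "'a::field_char_0 set"
  assumes "number_field K" "y \<in> K" "y \<noteq> 0"
  shows "\<exists>(c::nat \<Rightarrow> rat) n. inverse y = (\<Sum>j<n. of_rat (c j) * y ^ j)"
proof -
  obtain c n where c: "\<exists>j\<le>n. c j \<noteq> (0::rat)" "(\<Sum>j\<le>n. of_rat (c j) * y ^ j) = 0"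
    using algebraic_relation[OF assms(1,2)] by blast
  define m where "m = (LEAST j. c j \<noteq> 0)"
  from c(1) obtain j0 where j0: "j0 \<le> n" "c j0 \<noteq> 0" by blast
  have m: "c m \<noteq> 0" unfolding m_def by (rule LeastI[of _ j0]) (rule j0)
  have mn: "m \<le> n" using Least_le[of "\<lambda>j. c j \<noteq> 0" j0] j0 by (simp add: m_def)
  have lo: "c j = 0" if "j < m" for j using not_less_Least[of j "\<lambda>j. c j \<noteq> 0"] that by (simp add: m_def)
  have "(\<Sum>j\<le>n. of_rat (c j) * y ^ j) = (\<Sum>j\<in>{m..n}. of_rat (c j) * y ^ j)"
    by (rule sum.mono_neutral_right) (use lo in auto)
  also have "\<dots> = of_rat (c m) * y ^ m + (\<Sum>j\<in>{Suc m..n}. of_rat (c j) * y ^ j)"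
    using mn by (rule sum.atLeast_Suc_atMost)
  also have "(\<Sum>j\<in>{Suc m..n}. of_rat (c j) * y ^ j) = (\<Sum>j<n - m. of_rat (c (Suc m + j)) * y ^ (Suc m + j))"
    by (rule sum.reindex_bij_witness[of _ "\<lambda>j. Suc m + j" "\<lambda>j. j - Suc m"]) auto
  also have "\<dots> = y ^ Suc m * (\<Sum>j<n - m. of_rat (c (Suc m + j)) * y ^ j)"
    by (simp add: sum_distrib_left power_add mult_ac)
  finally have "y ^ m * (of_rat (c m) + y * (\<Sum>j<n - m. of_rat (c (Suc m + j)) * y ^ j)) = 0"
    using c(2) by (simp add: algebra_simps)
  hence "of_rat (c m) + y * (\<Sum>j<n - m. of_rat (c (Suc m + j)) * y ^ j) = 0" using assms(3) by simp
  hence "inverse y = - (\<Sum>j<n - m. of_rat (c (Suc m + j)) * y ^ j) / of_rat (c m)"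
    using assms(3) m by (simp add: field_simps eq_neg_iff_add_eq_0)
  also have "\<dots> = (\<Sum>j<n - m. of_rat (- c (Suc m + j) / c m) * y ^ j)"
    by (simp add: sum_divide_distrib sum_negf of_rat_divide of_rat_minus)
  finally show ?thesis by (rule exI[where x = "\<lambda>j. - c (Suc m + j) / c m", OF exI])
qed

section \<open>Polynomials over a subfield and extension of embeddings\<close>

definition polys_over :: "'a::field_char_0 set \<Rightarrow> 'a poly set" where
  "polys_over F = {p. \<forall>i. poly.coeff p i \<in> F}"

lemma polys_over_closed:
  assumes F: "field_set F" and p: "p \<in> polys_over F" and q: "q \<in> polys_over F"
  shows "p + q \<in> polys_over F" "p - q \<in> polys_over F" "p * q \<in> polys_over F" "pderiv p \<in> polys_over F"
  using p q field_closed[OF F] field_set_of_int[OF F, of "int n" for n]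
  by (auto simp: polys_over_def coeff_mult coeff_pderiv intro!: field_set_sum[OF F] simp del: of_nat_Suc)

lemma polys_over_const: "field_set F \<Longrightarrow> a \<in> F \<Longrightarrow> [:a:] \<in> polys_over F"
  by (auto simp: polys_over_def coeff_pCons field_closed split: nat.splits)

lemma polys_over_monom: "field_set F \<Longrightarrow> a \<in> F \<Longrightarrow> Polynomial.monom a n \<in> polys_over F"
  by (auto simp: polys_over_def field_closed)

lemma map_poly_embedding:
  assumes F: "field_set F" "\<xi> \<in> embs F" and p: "p \<in> polys_over F" and q: "q \<in> polys_over F"
  shows "map_poly \<xi> (p + q) = map_poly \<xi> p + map_poly \<xi> q"
    "map_poly \<xi> (p - q) = map_poly \<xi> p - map_poly \<xi> q"
    "map_poly \<xi> (p * q) = map_poly \<xi> p * map_poly \<xi> q"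
    "map_poly \<xi> (pderiv p) = pderiv (map_poly \<xi> p)"
proof -
  have cm: "poly.coeff (map_poly \<xi> p) n = \<xi> (poly.coeff p n)" for p n
    by (rule coeff_map_poly) (rule emb_simps(2)[OF F])
  have c: "poly.coeff p i \<in> F" "poly.coeff q i \<in> F" for i using p q by (auto simp: polys_over_def)
  show "map_poly \<xi> (p + q) = map_poly \<xi> p + map_poly \<xi> q" "map_poly \<xi> (p - q) = map_poly \<xi> p - map_poly \<xi> q"
    by (auto simp: poly_eq_iff cm c emb_simps[OF F])
  show "map_poly \<xi> (p * q) = map_poly \<xi> p * map_poly \<xi> q"
  proof (rule poly_eqI)
    fix n
    have "\<xi> (\<Sum>i\<le>n. poly.coeff p i * poly.coeff q (n - i)) = (\<Sum>i\<le>n. \<xi> (poly.coeff p i * poly.coeff q (n - i)))"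
      by (rule embedding_sum[OF F]) (use c in \<open>auto intro: field_closed(6)[OF F(1)]\<close>)
    thus "poly.coeff (map_poly \<xi> (p * q)) n = poly.coeff (map_poly \<xi> p * map_poly \<xi> q) n"
      by (simp add: cm coeff_mult emb_simps(4)[OF F] c)
  qed
  show "map_poly \<xi> (pderiv p) = pderiv (map_poly \<xi> p)"
  proof (rule poly_eqI)
    fix n
    have n: "of_nat (Suc n) \<in> F" "\<xi> (of_nat (Suc n)) = of_nat (Suc n)"
      using field_set_of_int[OF F(1), of "int (Suc n)"] emb_simps(11)[OF F, of "int (Suc n)"]
      by (simp_all only: of_int_of_nat_eq)
    show "poly.coeff (map_poly \<xi> (pderiv p)) n = poly.coeff (pderiv (map_poly \<xi> p)) n"
      unfolding cm coeff_pderiv emb_simps(4)[OF F n(1) c(1)] n(2) ..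
  qed
qed

lemma polys_over_division:
  assumes F: "field_set F" and f: "f \<in> polys_over F" "lead_coeff f = 1" "Polynomial.degree f > 0"
    and p: "p \<in> polys_over F"
  shows "\<exists>q\<in>polys_over F. \<exists>r\<in>polys_over F. p = q * f + r \<and> Polynomial.degree r < Polynomial.degree f"
  using p
proof (induction "Polynomial.degree p" arbitrary: p rule: less_induct)
  case less
  show ?case
  proof (cases "Polynomial.degree p < Polynomial.degree f")
    case True
    have "0 \<in> polys_over F" using field_closed(2)[OF F] by (simp add: polys_over_def)
    thus ?thesis using True less.prems by (intro bexI[of _ 0] bexI[of _ p]) auto
  next
    case False
    define d where "d = Polynomial.degree p - Polynomial.degree f"
    define t where "t = Polynomial.monom (lead_coeff p) d"
    have t: "t \<in> polys_over F" unfolding t_def using less.prems by (intro polys_over_monom[OF F]) (simp add: polys_over_def)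
    have p0: "p \<noteq> 0" using False f(3) by auto
    have f0: "f \<noteq> 0" using f(3) by auto
    have dt0: "Polynomial.degree t = d" unfolding t_def by (rule degree_monom_eq) (use p0 in simp)
    have "lead_coeff t = lead_coeff p" unfolding dt0 by (simp add: t_def)
    hence lt: "lead_coeff (t * f) = lead_coeff p" by (simp add: lead_coeff_mult f(2))
    have t0: "t \<noteq> 0" using p0 by (simp add: t_def monom_eq_0_iff)
    have dt: "Polynomial.degree (t * f) = Polynomial.degree p"
      using False t0 f0 dt0 by (simp add: degree_mult_eq d_def)
    have tf: "t * f \<in> polys_over F" by (rule polys_over_closed(3)[OF F t f(1)])
    have p': "p - t * f \<in> polys_over F" by (rule polys_over_closed(2)[OF F less.prems tf])
    have "Polynomial.degree (p - t * f) < Polynomial.degree p"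
    proof -
      have "poly.coeff (p - t * f) (Polynomial.degree p) = 0" using lt dt by simp
      moreover have "Polynomial.degree (p - t * f) \<le> Polynomial.degree p" using dt by (intro degree_diff_le) auto
      moreover have "Polynomial.degree p > 0" using False f(3) by linarith
      ultimately show ?thesis
        by (metis degree_0 leading_coeff_0_iff le_neq_implies_less)
    qed
    from less.hyps[OF this p'] obtain q r where qr: "q \<in> polys_over F" "r \<in> polys_over F"
      "p - t * f = q * f + r" "Polynomial.degree r < Polynomial.degree f" by blast
    have "p = (q + t) * f + r" using qr(3) by (simp add: algebra_simps)
    thus ?thesis using qr polys_over_closed(1)[OF F qr(1) t] by blast
  qed
qed

lemma card_roots_of_simple:
  fixes g :: "complex poly"
  assumes "g \<noteq> 0" "\<And>x. poly g x = 0 \<Longrightarrow> poly (pderiv g) x \<noteq> 0"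
  shows "card {x. poly g x = 0} = Polynomial.degree g"
proof -
  have "rsquarefree g" using assms(2) by (auto simp: rsquarefree_roots)
  from complex_poly_decompose_rsquarefree[OF this]
  have "Polynomial.degree g = Polynomial.degree (Polynomial.smult (lead_coeff g) (\<Prod>z | poly g z = 0. [:- z, 1:]))" by simp
  also have "\<dots> = Polynomial.degree (\<Prod>z | poly g z = 0. [:- z, 1:])" using assms(1) by simp
  also have "\<dots> = (\<Sum>z | poly g z = 0. Polynomial.degree [:- z, 1:])"
    by (rule degree_prod_eq_sum_degree) auto
  finally show ?thesis by simp
qed

text \<open>Adjoining one element multiplies the degree and the number of embeddings by the same factor:
  the conjugates of the minimal polynomial are separable because its derivative does not vanish
  at the adjoined element.\<close>

lemma simple_extension_embeddings:
  fixes K :: "'a::field_char_0 set"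
  assumes nf: "number_field K" and F: "field_set F" "F \<subseteq> K" and \<theta>: "\<theta> \<in> K" "\<theta> \<notin> F"
  shows "\<exists>L m. field_set L \<and> F \<subseteq> L \<and> L \<subseteq> K \<and> m > 1 \<and> (\<exists>b. is_basis F L m b) \<and>
    (\<forall>\<xi>\<in>embs F. \<exists>S \<subseteq> extensions F L \<xi>. finite S \<and> card S = m)"
proof -
  note K = nf_props(1)[OF nf]
  define vanish where "vanish p \<longleftrightarrow> p \<in> polys_over F \<and> p \<noteq> 0 \<and> poly p \<theta> = 0" for p
  have ex: "\<exists>p. vanish p"
  proof -
    obtain c n where c: "\<exists>j\<le>n. c j \<noteq> (0::rat)" "(\<Sum>j\<le>n. of_rat (c j) * \<theta> ^ j) = 0"
      using algebraic_relation[OF nf \<theta>(1)] by blast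
    define p where "p = (\<Sum>j\<le>n. Polynomial.monom (of_rat (c j) :: 'a) j)"
    have co: "poly.coeff p i = (if i \<le> n then of_rat (c i) else 0)" for i
      by (simp add: p_def coeff_sum)
    have "p \<in> polys_over F" using field_set_of_rat[OF F(1)] field_closed(2)[OF F(1)] by (auto simp: polys_over_def co)
    moreover have "p \<noteq> 0"
    proof
      assume "p = 0"
      hence "c i = 0" if "i \<le> n" for i using co[of i] that by simp
      with c(1) show False by blast
    qed
    moreover have "poly p \<theta> = 0" using c(2) by (simp add: p_def poly_sum poly_monom)
    ultimately show ?thesis by (auto simp: vanish_def)
  qed
  define f0 where "f0 = (ARG_MIN Polynomial.degree p. vanish p)"
  have f0: "vanish f0" and f0min: "\<And>p. vanish p \<Longrightarrow> Polynomial.degree f0 \<le> Polynomial.degree p"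
    using arg_min_nat_lemma[of vanish _ Polynomial.degree] ex unfolding f0_def by blast+
  define f where "f = Polynomial.smult (inverse (lead_coeff f0)) f0"
  define m where "m = Polynomial.degree f"
  have f: "f \<in> polys_over F" "lead_coeff f = 1" "poly f \<theta> = 0" "m = Polynomial.degree f0"
    using f0 field_closed(4,6)[OF F(1)] unfolding vanish_def f_def m_def polys_over_def by auto
  \<comment> \<open>Minimality of the degree stands in for irreducibility of
    \<open>f\<close>.\<close>
  have minimal: "p = 0" if "p \<in> polys_over F" "poly p \<theta> = 0" "Polynomial.degree p < m" for p
    using f0min[of p] that f(4) by (auto simp: vanish_def)
  have m1: "m > 1"
  proof (rule ccontr)
    assume "\<not> m > 1"
    hence "Polynomial.degree f \<le> 1" by (simp add: m_def)
    hence pf: "f = [:poly.coeff f 0, poly.coeff f 1:]" 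
      by (intro poly_eqI) (auto simp: coeff_pCons coeff_eq_0 split: nat.splits)
    have "poly f \<theta> = poly.coeff f 0 + \<theta> * poly.coeff f 1" by (subst pf) simp
    hence *: "poly.coeff f 0 + \<theta> * poly.coeff f 1 = 0" using f(3) by simp
    show False
    proof (cases "poly.coeff f 1 = 0")
      case True
      with * pf have "f = 0" by simp
      with f(2) show False by simp
    next
      case False
      hence "\<theta> = - poly.coeff f 0 / poly.coeff f 1" using * by (simp add: field_simps eq_neg_iff_add_eq_0 add.commute)
      hence "\<theta> \<in> F" using f(1) field_closed[OF F(1)] by (simp add: polys_over_def)
      with \<theta>(2) show False by simp
    qed
  qed
  have reduce: "\<exists>r\<in>polys_over F. Polynomial.degree r < m \<and> (\<exists>q\<in>polys_over F. p = q * f + r)" if "p \<in> polys_over F" for p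
    using polys_over_division[OF F(1) f(1,2) _ that] m1 by (auto simp: m_def)
  define L where "L = (\<lambda>p. poly p \<theta>) ` polys_over F"
  have Lpoly: "poly p \<theta> \<in> L" if "p \<in> polys_over F" for p using that by (auto simp: L_def)
  have FL: "F \<subseteq> L"
  proof
    fix a assume "a \<in> F"
    from Lpoly[OF polys_over_const[OF F(1) this]] show "a \<in> L" by simp
  qed
  have LK: "L \<subseteq> K"
  proof
    fix x assume "x \<in> L"
    then obtain p where p: "p \<in> polys_over F" "x = poly p \<theta>" by (auto simp: L_def)
    have "poly p \<theta> \<in> K" unfolding poly_altdef
      by (rule field_set_sum[OF K]) (use p F \<theta> in \<open>auto simp: polys_over_def intro!: field_closed[OF K]\<close>)
    thus "x \<in> K" using p by simp
  qed
  have Ladd: "x + y \<in> L" "x * y \<in> L" if xy: "x \<in> L" "y \<in> L" for x y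
  proof -
    obtain p q where pq: "p \<in> polys_over F" "q \<in> polys_over F" "x = poly p \<theta>" "y = poly q \<theta>"
      using xy unfolding L_def by blast
    show "x + y \<in> L" "x * y \<in> L"
      using Lpoly[OF polys_over_closed(1)[OF F(1) pq(1,2)]] Lpoly[OF polys_over_closed(3)[OF F(1) pq(1,2)]] pq
      by simp_all
  qed
  have L01: "0 \<in> L" "1 \<in> L" "- 1 \<in> L" using FL field_closed[OF F(1)] by auto
  have Lpow: "x ^ n \<in> L" if "x \<in> L" for x n by (induction n) (use that Ladd L01 in auto)
  have Lsum: "(\<Sum>j<n. g j) \<in> L" if "\<And>j. g j \<in> L" for g and n :: nat by (induction n) (use that Ladd L01 in auto)
  have Linv: "inverse x \<in> L" if x: "x \<in> L" for x
  proof (cases "x = 0")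
    case True
    thus ?thesis using L01 by simp
  next
    case False
    obtain c n where "inverse x = (\<Sum>j<n. of_rat (c j) * x ^ j)"
      using inverse_is_rational_polynomial[OF nf _ False] x LK by blast
    moreover have "of_rat q \<in> L" for q using field_set_of_rat[OF F(1)] FL by blast
    ultimately show ?thesis using Lsum[of "\<lambda>j. of_rat (c j) * x ^ j"] Ladd(2) Lpow[OF x] by simp
  qed
  have L: "field_set L" unfolding field_set_def
    using L01 Ladd Linv Ladd(2)[OF L01(3)] by auto
  have basis: "is_basis F L m (\<lambda>i. \<theta> ^ i)"
  proof -
    have ps: "(\<Sum>i<m. Polynomial.monom (c i) i) \<in> polys_over F" "Polynomial.degree (\<Sum>i<m. Polynomial.monom (c i) i) < m"
      "poly (\<Sum>i<m. Polynomial.monom (c i) i) \<theta> = (\<Sum>i<m. c i * \<theta> ^ i)"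
      "\<And>j. poly.coeff (\<Sum>i<m. Polynomial.monom (c i) i) j = (if j < m then c j else 0)"
      if c: "\<forall>i<m. c i \<in> F" for c
    proof -
      show co: "\<And>j. poly.coeff (\<Sum>i<m. Polynomial.monom (c i) i) j = (if j < m then c j else 0)"
        by (simp add: coeff_sum)
      show "(\<Sum>i<m. Polynomial.monom (c i) i) \<in> polys_over F"
        unfolding polys_over_def mem_Collect_eq co using c field_closed(2)[OF F(1)] by auto
      show "Polynomial.degree (\<Sum>i<m. Polynomial.monom (c i) i) < m"
        using m1 by (intro degree_lessI) (auto simp: co)
      show "poly (\<Sum>i<m. Polynomial.monom (c i) i) \<theta> = (\<Sum>i<m. c i * \<theta> ^ i)"
        by (simp add: poly_sum poly_monom)
    qed
    show ?thesis unfolding is_basis_def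
    proof (intro conjI subset_antisym subsetI allI impI)
      fix x assume "x \<in> L"
      then obtain p where p: "p \<in> polys_over F" "x = poly p \<theta>" by (auto simp: L_def)
      from reduce[OF p(1)] obtain r q where r: "r \<in> polys_over F" "Polynomial.degree r < m" "p = q * f + r" by blast
      have "x = poly r \<theta>" using p(2) r(3) f(3) by simp
      also have "\<dots> = (\<Sum>i\<le>Polynomial.degree r. poly.coeff r i * \<theta> ^ i)" by (rule poly_altdef)
      also have "\<dots> = (\<Sum>i<m. poly.coeff r i * \<theta> ^ i)"
        by (rule sum.mono_neutral_left) (use r(2) in \<open>auto simp: coeff_eq_0\<close>)
      finally have "x = (\<Sum>i<m. poly.coeff r i * \<theta> ^ i)" .
      moreover have "\<forall>i<m. poly.coeff r i \<in> F" using r(1) by (simp add: polys_over_def)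
      ultimately show "x \<in> {\<Sum>i<m. c i * \<theta> ^ i | c. \<forall>i<m. c i \<in> F}" by blast
    next
      fix x assume "x \<in> {\<Sum>i<m. c i * \<theta> ^ i | c. \<forall>i<m. c i \<in> F}"
      then obtain c where c: "x = (\<Sum>i<m. c i * \<theta> ^ i)" "\<forall>i<m. c i \<in> F" by blast
      show "x \<in> L" using Lpoly[OF ps(1)[OF c(2)]] ps(3)[OF c(2)] c(1) by simp
    next
      fix c i assume c: "\<forall>i<m. c i \<in> F" "(\<Sum>i<m. c i * \<theta> ^ i) = 0" and i: "i < m"
      have "(\<Sum>i<m. Polynomial.monom (c i) i) = 0"
        using minimal[OF ps(1)[OF c(1)] _ ps(2)[OF c(1)]] ps(3)[OF c(1)] c(2) by simp
      thus "c i = 0" using ps(4)[OF c(1), of i] i by simp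
    qed
  qed
  have "\<exists>S \<subseteq> extensions F L \<xi>. finite S \<and> card S = m" if \<xi>: "\<xi> \<in> embs F" for \<xi>
  proof -
    note emb = emb_simps[OF F(1) \<xi>] and mp = map_poly_embedding[OF F(1) \<xi>]
    define g where "g = map_poly \<xi> f"
    have cg: "poly.coeff (map_poly \<xi> p) i = \<xi> (poly.coeff p i)" for p i by (rule coeff_map_poly) (rule emb(2))
    have dg: "Polynomial.degree g = m" unfolding g_def m_def
      by (rule degree_map_poly) (use f(2) emb(1) in auto)
    have g0: "g \<noteq> 0" using dg m1 by auto
    define \<rho> where "\<rho> x = (SOME p. p \<in> polys_over F \<and> poly p \<theta> = x)" for x
    have \<rho>: "\<rho> x \<in> polys_over F" "poly (\<rho> x) \<theta> = x" if "x \<in> L" for x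
    proof -
      have "\<exists>p. p \<in> polys_over F \<and> poly p \<theta> = x" using that by (auto simp: L_def)
      hence "\<rho> x \<in> polys_over F \<and> poly (\<rho> x) \<theta> = x" unfolding \<rho>_def by (rule someI_ex)
      thus "\<rho> x \<in> polys_over F" "poly (\<rho> x) \<theta> = x" by auto
    qed
    define \<tau> where "\<tau> \<zeta> = (\<lambda>x\<in>L. poly (map_poly \<xi> (\<rho> x)) \<zeta>)" for \<zeta>
    \<comment> \<open>At a root of \<open>g\<close> the value is independent of the representing
      polynomial: two representatives differ by a multiple of \<open>f\<close>, and the image of
      \<open>f\<close> under \<open>\<xi>\<close> vanishes there.\<close>
    have \<tau>p: "\<tau> \<zeta> (poly p \<theta>) = poly (map_poly \<xi> p) \<zeta>" if \<zeta>: "poly g \<zeta> = 0" and p: "p \<in> polys_over F" for \<zeta> p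
    proof -
      let ?p = "\<rho> (poly p \<theta>)"
      have pL: "poly p \<theta> \<in> L" by (rule Lpoly[OF p])
      have d: "p - ?p \<in> polys_over F" by (rule polys_over_closed(2)[OF F(1) p \<rho>(1)[OF pL]])
      from reduce[OF d] obtain r q where r: "r \<in> polys_over F" "Polynomial.degree r < m" "q \<in> polys_over F" "p - ?p = q * f + r" by blast
      have "poly r \<theta> = poly (p - ?p) \<theta>" using r(4) f(3) by simp
      also have "\<dots> = 0" using \<rho>(2)[OF pL] by simp
      finally have "r = 0" by (intro minimal r)
      hence "map_poly \<xi> p - map_poly \<xi> ?p = map_poly \<xi> q * g"
        using r(4) mp(2)[OF p \<rho>(1)[OF pL]] mp(3)[OF r(3) f(1)] by (simp add: g_def)
      hence "poly (map_poly \<xi> p - map_poly \<xi> ?p) \<zeta> = poly (map_poly \<xi> q * g) \<zeta>" by (rule arg_cong)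
      hence "poly (map_poly \<xi> p) \<zeta> - poly (map_poly \<xi> ?p) \<zeta> = 0" by (simp add: \<zeta>)
      thus ?thesis using pL by (simp add: \<tau>_def)
    qed
    have \<tau>e: "\<tau> \<zeta> \<in> embs L" if \<zeta>: "poly g \<zeta> = 0" for \<zeta>
      unfolding embs_def
    proof (intro CollectI conjI ballI)
      show "\<tau> \<zeta> \<in> extensional L" by (simp add: \<tau>_def)
      have "\<tau> \<zeta> (poly [:1:] \<theta>) = poly (map_poly \<xi> [:1:]) \<zeta>"
        by (rule \<tau>p[OF \<zeta> polys_over_const[OF F(1)]]) (rule field_closed(1)[OF F(1)])
      also have "map_poly \<xi> [:1:] = [:1:]" by (rule poly_eqI) (auto simp: cg emb coeff_pCons split: nat.splits)
      finally show "\<tau> \<zeta> 1 = 1" by simp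
      fix x y assume "x \<in> L" "y \<in> L"
      then obtain p q where pq: "p \<in> polys_over F" "q \<in> polys_over F" "x = poly p \<theta>" "y = poly q \<theta>"
        unfolding L_def by blast
      have "\<tau> \<zeta> (poly (p + q) \<theta>) = poly (map_poly \<xi> (p + q)) \<zeta>" by (intro \<tau>p \<zeta> polys_over_closed[OF F(1)] pq)
      thus "\<tau> \<zeta> (x + y) = \<tau> \<zeta> x + \<tau> \<zeta> y" using \<tau>p[OF \<zeta>] pq by (simp add: mp(1))
      have "\<tau> \<zeta> (poly (p * q) \<theta>) = poly (map_poly \<xi> (p * q)) \<zeta>" by (intro \<tau>p \<zeta> polys_over_closed[OF F(1)] pq)
      thus "\<tau> \<zeta> (x * y) = \<tau> \<zeta> x * \<tau> \<zeta> y" using \<tau>p[OF \<zeta>] pq by (simp add: mp(3))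
    qed
    have \<tau>ext: "\<tau> \<zeta> \<in> extensions F L \<xi>" if \<zeta>: "poly g \<zeta> = 0" for \<zeta>
    proof -
      have "\<tau> \<zeta> a = \<xi> a" if a: "a \<in> F" for a
      proof -
        have "\<tau> \<zeta> (poly [:a:] \<theta>) = poly (map_poly \<xi> [:a:]) \<zeta>" by (rule \<tau>p[OF \<zeta> polys_over_const[OF F(1) a]])
        also have "map_poly \<xi> [:a:] = [:\<xi> a:]" by (rule poly_eqI) (auto simp: cg emb coeff_pCons split: nat.splits)
        finally show ?thesis by simp
      qed
      moreover have "\<xi> \<in> extensional F" using \<xi> by (simp add: embs_def)
      ultimately have "restrict (\<tau> \<zeta>) F = \<xi>" by (intro extensionalityI[of _ F]) auto
      thus ?thesis using \<tau>e[OF \<zeta>] by (simp add: extensions_def)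
    qed
    have inj: "inj_on \<tau> {\<zeta>. poly g \<zeta> = 0}"
    proof (rule inj_onI)
      fix \<zeta> \<mu> assume lm: "\<zeta> \<in> {\<zeta>. poly g \<zeta> = 0}" "\<mu> \<in> {\<zeta>. poly g \<zeta> = 0}" "\<tau> \<zeta> = \<tau> \<mu>"
      have X: "[:0, 1:] \<in> polys_over F"
        using field_closed[OF F(1)] by (auto simp: polys_over_def coeff_pCons split: nat.splits)
      have mX: "map_poly \<xi> [:0, 1:] = [:0, 1:]"
        by (rule poly_eqI) (auto simp: cg emb coeff_pCons split: nat.splits)
      have at: "\<tau> \<zeta>' \<theta> = \<zeta>'" if "poly g \<zeta>' = 0" for \<zeta>' using \<tau>p[OF that X] mX by simp
      have "\<zeta> = \<tau> \<zeta> \<theta>" using lm(1) by (intro at[symmetric]) simp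
      also have "\<dots> = \<tau> \<mu> \<theta>" by (simp only: lm(3))
      also have "\<dots> = \<mu>" using lm(2) by (intro at) simp
      finally show "\<zeta> = \<mu>" .
    qed
    have "poly (pderiv g) \<zeta> \<noteq> 0" if \<zeta>: "poly g \<zeta> = 0" for \<zeta>
    proof -
      have pd: "pderiv f \<in> polys_over F" by (rule polys_over_closed(4)[OF F(1) f(1) f(1)])
      have "Polynomial.degree (pderiv f) < m" using m1 by (simp add: degree_pderiv m_def)
      moreover have "pderiv f \<noteq> 0" using m1 by (simp add: pderiv_eq_0_iff m_def)
      ultimately have "poly (pderiv f) \<theta> \<noteq> 0" using minimal[OF pd] by blast
      hence "\<tau> \<zeta> (poly (pderiv f) \<theta>) \<noteq> 0"
        using emb_simps(9)[OF L \<tau>e[OF \<zeta>] Lpoly[OF pd]] by simp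
      thus ?thesis using \<tau>p[OF \<zeta> pd] mp(4)[OF f(1) f(1)] by (simp add: g_def)
    qed
    hence "card {\<zeta>. poly g \<zeta> = 0} = m" using card_roots_of_simple[OF g0] dg by simp
    moreover have "finite {\<zeta>. poly g \<zeta> = 0}" by (rule poly_roots_finite[OF g0])
    ultimately show ?thesis using \<tau>ext inj
      by (intro exI[of _ "\<tau> ` {\<zeta>. poly g \<zeta> = 0}"]) (auto simp: card_image)
  qed
  thus ?thesis using L FL LK m1 basis by blast
qed

lemma finite_embeddings_of_basis:
  assumes L: "field_set L" and b: "is_basis \<rat> L d b"
  shows "finite (embs L)" "card (embs L) \<le> d"
proof -
  obtain \<xi>0 :: "'a \<Rightarrow> complex" where \<xi>0: "\<xi>0 \<in> embs \<rat>" using embeddings_Rats_exists by blast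
  have "embs L = extensions \<rat> L \<xi>0"
    using embeddings_Rats_unique[OF embedding_restrict[OF _ Rats_subset_field_set[OF L] field_set_Rats] \<xi>0]
    by (auto simp: extensions_def)
  thus "finite (embs L)" "card (embs L) \<le> d"
    using extensions_bounded[OF L Rats_subset_field_set[OF L] field_set_Rats b] by auto
qed

lemma is_basis_tower:
  fixes F :: "'a::field_char_0 set"
  assumes "field_set k" "field_set F" "is_basis k F d b" "is_basis F L m b'"
  shows "\<exists>b''. is_basis k L (d * m) b''"
  using ring.telescopic_base[OF ambient_ring, of k F d m L] assms dimension_iff_basis[of k] dimension_iff_basis[of F]
  by (auto simp: subfield_ambient_iff)

lemma is_basis_dim_mono:
  fixes F :: "'a::field_char_0 set"
  assumes k: "field_set k" and F: "is_basis k F d b" "F \<subseteq> K" and K: "is_basis k K n b'"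
  shows "d \<le> n"
proof -
  interpret R: ring "ambient :: 'a ring" by (rule ambient_ring)
  have sub: "subfield k (ambient :: 'a ring)" using k by (simp add: subfield_ambient_iff)
  have "R.dimension d k F" using F dimension_iff_basis[OF k] by blast
  from R.exists_base[OF sub this] obtain bs where bs: "R.independent k bs" "length bs = d" "R.Span k bs = F" by blast
  have bb: "is_basis k F (length bs) ((!) bs)" using bs is_basis_of_list[OF k, of bs F] by blast
  have "bs ! i \<in> K" if "i < length bs" for i using is_basis_mem[OF k bb that] F(2) by blast
  hence "set bs \<subseteq> K" by (auto simp: in_set_conv_nth)
  moreover have "R.dimension n k K" using K dimension_iff_basis[OF k] by blast
  ultimately show ?thesis using R.independent_length_le_dimension[OF sub _ bs(1)] bs(2) by blast
qed

text \<open>Among the subfields of \<open>K\<close> with at least as many embeddings as their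
  degree, one of largest degree must be \<open>K\<close>: adjoining a missing element would multiply
  degree and number of embeddings alike. The opposite inequality is the general bound by the size of
  a basis.\<close>

theorem card_embeddings:
  fixes K :: "'a::field_char_0 set"
  assumes nf: "number_field K"
  shows "finite (embs K)" "card (embs K) = number_field_degree K"
proof -
  define n where "n = number_field_degree K"
  note K = nf_props(1)[OF nf]
  obtain b where b: "is_basis \<rat> K n b" using nf_props(2)[OF nf] n_def by blast
  show "finite (embs K)" by (rule finite_embeddings_of_basis(1)[OF K b])
  define P where "P d \<longleftrightarrow> (\<exists>F. field_set F \<and> F \<subseteq> K \<and> (\<exists>b. is_basis \<rat> F d b) \<and> card (embs F) \<ge> d)" for d
  have bound: "d \<le> n" if "P d" for d
    using that is_basis_dim_mono[OF field_set_Rats _ _ b] unfolding P_def by blast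
  have "P 1"
  proof -
    have Q: "is_basis \<rat> (\<rat> :: 'a set) 1 (\<lambda>_. 1)" unfolding is_basis_def by auto
    have "card (embs (\<rat> :: 'a set)) \<noteq> 0"
      using finite_embeddings_of_basis(1)[OF field_set_Rats Q] embeddings_Rats_exists[where ?'a = 'a] by simp
    thus ?thesis unfolding P_def using Q Rats_subset_field_set[OF K] field_set_Rats
      by (intro exI[of _ "\<rat>"]) (auto simp: Suc_le_eq)
  qed
  define d where "d = (GREATEST d. P d)"
  have d: "P d" "\<And>d'. P d' \<Longrightarrow> d' \<le> d"
    using GreatestI_nat[of P 1 n] Greatest_le_nat[of P _ n] \<open>P 1\<close> bound unfolding d_def by blast+
  then obtain F c where F: "field_set F" "F \<subseteq> K" "is_basis \<rat> F d c" "card (embs F) \<ge> d"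
    unfolding P_def by blast
  have "d \<ge> 1" using d(2)[OF \<open>P 1\<close>] .
  have "F = K"
  proof (rule ccontr)
    assume "F \<noteq> K"
    then obtain \<theta> where "\<theta> \<in> K" "\<theta> \<notin> F" using F(2) by blast
    from simple_extension_embeddings[OF nf F(1,2) this] obtain L m where
      L: "field_set L" "F \<subseteq> L" "L \<subseteq> K" "m > 1" "\<exists>b. is_basis F L m b"
      and ext: "\<forall>\<xi>\<in>embs F. \<exists>S \<subseteq> extensions F L \<xi>. finite S \<and> card S = m" by blast
    obtain b' where b': "is_basis \<rat> L (d * m) b'"
      using is_basis_tower[OF field_set_Rats F(1,3)] L(5) by blast
    obtain S where S: "\<And>\<xi>. \<xi> \<in> embs F \<Longrightarrow> S \<xi> \<subseteq> extensions F L \<xi> \<and> finite (S \<xi>) \<and> card (S \<xi>) = m"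
      using bchoice[OF ext] by blast
    have "d * m \<le> card (embs F) * m" using F(4) by simp
    also have "\<dots> = (\<Sum>\<xi>\<in>embs F. card (S \<xi>))" using S by simp
    also have "\<dots> = card (\<Union>\<xi>\<in>embs F. S \<xi>)"
    proof (rule card_UN_disjoint[symmetric])
      show "finite (embs F)" by (rule finite_embeddings_of_basis(1)[OF F(1,3)])
      show "\<forall>\<xi>\<in>embs F. finite (S \<xi>)" using S by blast
      show "\<forall>\<xi>\<in>embs F. \<forall>\<tau>\<in>embs F. \<xi> \<noteq> \<tau> \<longrightarrow> S \<xi> \<inter> S \<tau> = {}"
        using S unfolding extensions_def by blast
    qed
    also have "\<dots> \<le> card (embs L)"
      using S finite_embeddings_of_basis(1)[OF L(1) b'] by (intro card_mono) (auto simp: extensions_def)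
    finally have "P (d * m)" unfolding P_def using L b' by blast
    from d(2)[OF this] \<open>d \<ge> 1\<close> L(4) show False by simp
  qed
  hence "d = n" using F(3) b dimension_iff_basis[OF field_set_Rats] dimension_unique[OF field_set_Rats] by blast
  with F \<open>F = K\<close> finite_embeddings_of_basis(2)[OF K b] show "card (embs K) = number_field_degree K"
    unfolding n_def by simp
qed

section \<open>Relative degrees and norms\<close>

text \<open>A rational basis of \<open>l\<close> spans \<open>l\<close> over \<open>k\<close> and
  can be thinned to an independent list.\<close>

lemma relative_basis_list:
  fixes k l :: "'a::field_char_0 set"
  assumes nf: "number_field k" "number_field l" "k \<subseteq> l"
  shows "\<exists>bs. ring.independent ambient k bs \<and> ring.Span ambient k bs = l"
proof -
  interpret R: ring "ambient :: 'a ring" by (rule ambient_ring)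
  note k = nf_props(1)[OF nf(1)] and l = nf_props(1)[OF nf(2)]
  have sub: "subfield k (ambient :: 'a ring)" using k by (simp add: subfield_ambient_iff)
  obtain b where b: "is_basis \<rat> l (number_field_degree l) b" using nf_props(2)[OF nf(2)] by blast
  define n where "n = number_field_degree l"
  define Us where "Us = map b [0..<n]"
  have Us: "(\<Sum>i<n. c i * Us ! i) = (\<Sum>i<n. c i * b i)" for c
    by (intro sum.cong) (auto simp: Us_def)
  have len: "length Us = n" by (simp add: Us_def)
  have bl: "b i \<in> l" if "i < n" for i using is_basis_mem[OF field_set_Rats b] that by (simp add: n_def)
  have "R.Span k Us = l" unfolding ambient_Span[OF k] len Us
  proof (intro subset_antisym subsetI)
    fix x assume "x \<in> {\<Sum>i<n. c i * b i | c. \<forall>i<n. c i \<in> k}"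
    then obtain c where c: "x = (\<Sum>i<n. c i * b i)" "\<forall>i<n. c i \<in> k" by blast
    show "x \<in> l" unfolding c(1)
      by (rule field_set_sum[OF l]) (use c(2) nf(3) bl in \<open>auto intro!: field_closed(6)[OF l]\<close>)
  next
    fix x assume "x \<in> l"
    then obtain c where "\<forall>i<n. c i \<in> \<rat>" "x = (\<Sum>i<n. c i * b i)" using is_basisD(1)[OF b] n_def by blast
    thus "x \<in> {\<Sum>i<n. c i * b i | c. \<forall>i<n. c i \<in> k}" using Rats_subset_field_set[OF k] by blast
  qed
  moreover obtain Vs where "R.independent k Vs" "R.Span k Vs = R.Span k Us"
    using R.filter_base[OF sub, of Us] by auto
  ultimately show ?thesis by blast
qed

text \<open>Restriction to \<open>k\<close> partitions the embeddings of \<open>l\<close>. Each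
  class has at most \<open>m\<close> members, and the total number, being the degree of
  \<open>l\<close>, leaves no room for a smaller class.\<close>

lemma card_extensions:
  fixes k l :: "'a::field_char_0 set"
  assumes nf: "number_field k" "number_field l" "k \<subseteq> l" and b: "is_basis k l m b" and \<xi>: "\<xi> \<in> embs k"
  shows "card (extensions k l \<xi>) = m"
proof -
  note k = nf_props(1)[OF nf(1)] and l = nf_props(1)[OF nf(2)]
  obtain b1 b2 where b1: "is_basis \<rat> k (number_field_degree k) b1" and b2: "is_basis \<rat> l (number_field_degree l) b2"
    using nf_props(2) nf by blast
  obtain b3 where "is_basis \<rat> l (number_field_degree k * m) b3"
    using is_basis_tower[OF field_set_Rats k b1 b] by blast
  with b2 have deg: "number_field_degree l = number_field_degree k * m"
    using dimension_iff_basis[OF field_set_Rats] dimension_unique[OF field_set_Rats] by blast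
  note ext = extensions_bounded[OF l nf(3) k b]
  have "embs l = (\<Union>\<xi>\<in>embs k. extensions k l \<xi>)"
    using embedding_restrict[OF _ nf(3) k] by (auto simp: extensions_def)
  hence "card (embs l) = (\<Sum>\<xi>\<in>embs k. card (extensions k l \<xi>))"
    using card_UN_disjoint[OF card_embeddings(1)[OF nf(1)], of "extensions k l"] ext(1)
    by (simp add: extensions_def disjoint_iff)
  hence "(\<Sum>\<xi>\<in>embs k. card (extensions k l \<xi>)) = (\<Sum>\<xi>\<in>embs k. m)"
    using card_embeddings(2)[OF nf(1)] card_embeddings(2)[OF nf(2)] deg by simp
  from sum_mono_inv[OF this ext(2) \<xi> card_embeddings(1)[OF nf(1)]] show ?thesis .
qed

lemma det_in_field_set:
  fixes A :: "'a::field_char_0 mat"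
  assumes k: "field_set k" and A: "A \<in> carrier_mat m m" "\<And>i j. i < m \<Longrightarrow> j < m \<Longrightarrow> A $$ (i, j) \<in> k"
  shows "det A \<in> k"
    and "\<xi> \<in> embs k \<Longrightarrow> \<xi> (det A) = det (mat m m (\<lambda>(i, j). \<xi> (A $$ (i, j))))"
proof -
  have sg: "signof p \<in> k" for p :: "nat \<Rightarrow> nat"
    using field_closed[OF k] by (cases p rule: sign_cases) (auto simp: sign_def)
  have pr: "(\<Prod>i = 0..<m. A $$ (i, p i)) \<in> k" if "p permutes {0..<m}" for p
    by (rule field_set_prod[OF k]) (use A(2) permutes_in_image[OF that] in auto)
  have det: "det A = (\<Sum>p | p permutes {0..<m}. signof p * (\<Prod>i = 0..<m. A $$ (i, p i)))"
    by (rule det_def'[OF A(1)])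
  show "det A \<in> k" unfolding det
    by (rule field_set_sum[OF k]) (use sg pr in \<open>auto intro: field_closed(6)[OF k]\<close>)
  assume \<xi>: "\<xi> \<in> embs k"
  note emb = emb_simps[OF k \<xi>]
  have s\<xi>: "\<xi> (signof p) = signof p" for p :: "nat \<Rightarrow> nat"
    using emb(1) emb(5)[of 1] field_closed(1)[OF k] by (simp add: sign_def)
  have "\<xi> (det A) = (\<Sum>p | p permutes {0..<m}. \<xi> (signof p * (\<Prod>i = 0..<m. A $$ (i, p i))))"
    unfolding det by (rule embedding_sum[OF k \<xi>]) (use sg pr in \<open>auto intro: field_closed(6)[OF k]\<close>)
  also have "\<dots> = (\<Sum>p | p permutes {0..<m}. signof p * (\<Prod>i = 0..<m. \<xi> (A $$ (i, p i))))"
  proof (intro sum.cong refl)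
    fix p assume "p \<in> {p. p permutes {0..<m}}"
    hence p: "p permutes {0..<m}" by simp
    have "\<xi> (\<Prod>i = 0..<m. A $$ (i, p i)) = (\<Prod>i = 0..<m. \<xi> (A $$ (i, p i)))"
      by (rule embedding_prod[OF k \<xi>]) (use A(2) permutes_in_image[OF p] in auto)
    thus "\<xi> (signof p * (\<Prod>i = 0..<m. A $$ (i, p i))) = signof p * (\<Prod>i = 0..<m. \<xi> (A $$ (i, p i)))"
      using emb(4)[OF sg pr[OF p]] s\<xi> by simp
  qed
  also have "\<dots> = det (mat m m (\<lambda>(i, j). \<xi> (A $$ (i, j))))"
    by (subst det_def'[of _ m]) (auto intro!: sum.cong prod.cong arg_cong2[of _ _ _ _ "(*)"] simp: permutes_in_image)
  finally show "\<xi> (det A) = det (mat m m (\<lambda>(i, j). \<xi> (A $$ (i, j))))" .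
qed

text \<open>The vectors of conjugates of the basis are simultaneous left eigenvectors of all multiplication
  matrices, and they are linearly independent.\<close>

theorem field_norm_conjugates:
  fixes k l :: "'a::field_char_0 set"
  assumes nf: "number_field k" "number_field l" "k \<subseteq> l" and x: "x \<in> l"
  shows "field_norm k l x \<in> k"
    and "\<xi> \<in> embs k \<Longrightarrow> \<xi> (field_norm k l x) = (\<Prod>\<tau>\<in>extensions k l \<xi>. \<tau> x)"
proof -
  interpret R: ring "ambient :: 'a ring" by (rule ambient_ring)
  note k = nf_props(1)[OF nf(1)] and l = nf_props(1)[OF nf(2)]
  \<comment> \<open>The norm is a choice, so everything is derived from the property
    \<open>Q\<close> of its value; that a basis and a matrix with this property exist has to be
    shown first.\<close>
  define Q where "Q d \<longleftrightarrow> (\<exists>bs A. R.independent k bs \<and> R.Span k bs = l \<and>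
     A \<in> carrier_mat (length bs) (length bs) \<and>
     (\<forall>i<length bs. \<forall>j<length bs. A $$ (i, j) \<in> k) \<and>
     (\<forall>j<length bs. x * bs ! j = (\<Sum>i<length bs. A $$ (i, j) * bs ! i)) \<and>
     d = det A)" for d
  have "\<exists>d. Q d"
  proof -
    obtain bs where bs: "R.independent k bs" "R.Span k bs = l" using relative_basis_list[OF nf] by blast
    define m where "m = length bs"
    have b: "is_basis k l m ((!) bs)" using bs is_basis_of_list[OF k, of bs l] m_def by blast
    have "\<forall>j. \<exists>c. j < m \<longrightarrow> (\<forall>i<m. c i \<in> k) \<and> x * bs ! j = (\<Sum>i<m. c i * bs ! i)"
      using is_basisD(1)[OF b field_closed(6)[OF l x is_basis_mem[OF k b]]] by blast
    then obtain c where c: "\<And>j. j < m \<Longrightarrow> (\<forall>i<m. c j i \<in> k) \<and> x * bs ! j = (\<Sum>i<m. c j i * bs ! i)" by metis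
    define A where "A = mat m m (\<lambda>(i, j). c j i)"
    have "Q (det A)" unfolding Q_def m_def[symmetric]
      using bs c by (intro exI[of _ bs] exI[of _ A]) (auto simp: A_def m_def)
    thus ?thesis by blast
  qed
  hence "Q (field_norm k l x)" unfolding field_norm_def Q_def by (rule someI_ex)
  then obtain bs A where bs: "R.independent k bs" "R.Span k bs = l"
    and A: "A \<in> carrier_mat (length bs) (length bs)" "\<And>i j. i < length bs \<Longrightarrow> j < length bs \<Longrightarrow> A $$ (i, j) \<in> k"
    and mult: "\<And>j. j < length bs \<Longrightarrow> x * bs ! j = (\<Sum>i<length bs. A $$ (i, j) * bs ! i)"
    and d: "field_norm k l x = det A" unfolding Q_def by blast
  define m where "m = length bs"
  have b: "is_basis k l m ((!) bs)" using bs is_basis_of_list[OF k, of bs l] m_def by blast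
  note A = A[folded m_def] and mult = mult[folded m_def]
  show "field_norm k l x \<in> k" unfolding d by (rule det_in_field_set(1)[OF k A])
  assume \<xi>: "\<xi> \<in> embs k"
  define E where "E = extensions k l \<xi>"
  have E: "finite E" "card E = m"
    using extensions_bounded(1)[OF l nf(3) k b] card_extensions[OF nf b \<xi>] by (simp_all add: E_def)
  obtain h where h: "bij_betw h {..<m} E"
    using ex_bij_betw_nat_finite[OF E(1)] E(2) by (auto simp: lessThan_atLeast0)
  have hE: "h p \<in> E" if "p < m" for p using h that by (auto simp: bij_betw_def)
  have he: "h p \<in> embs l" if "p < m" for p using hE[OF that] by (simp add: E_def extensions_def)
  have bl: "bs ! i \<in> l" if "i < m" for i by (rule is_basis_mem[OF k b that])
  define T where "T = mat m m (\<lambda>(p, i). h p (bs ! i))"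
  define S where "S = mat m m (\<lambda>(i, j). \<xi> (A $$ (i, j)))"
  define D where "D = mat m m (\<lambda>(p, q). if p = q then h p x else 0)"
  have carr: "T \<in> carrier_mat m m" "S \<in> carrier_mat m m" "D \<in> carrier_mat m m" by (simp_all add: T_def S_def D_def)
  have detT: "det T \<noteq> 0"
  proof -
    have "det (mat m m (\<lambda>(i, p). h p (bs ! i))) \<noteq> 0"
      unfolding det_nonzero_iff_kernel
    proof (intro allI impI)
      fix c p assume c: "\<forall>i<m. (\<Sum>p<m. h p (bs ! i) * c p) = 0" and p: "p < m"
      define c' where "c' \<tau> = c (the_inv_into {..<m} h \<tau>)" for \<tau>
      have c'h: "c' (h p) = c p" if "p < m" for p
        using h that by (simp add: c'_def the_inv_into_f_f bij_betw_def)
      have "\<forall>\<tau>\<in>E. c' \<tau> = 0"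
      proof (rule embedding_relation_of_basis[OF l nf(3) k b E(1)])
        show "E \<subseteq> extensions k l \<xi>" by (simp add: E_def)
        fix i assume i: "i < m"
        have "(\<Sum>\<tau>\<in>E. c' \<tau> * \<tau> (bs ! i)) = (\<Sum>p<m. c' (h p) * h p (bs ! i))"
          by (rule sum.reindex_bij_betw[OF h, symmetric])
        also have "\<dots> = (\<Sum>p<m. h p (bs ! i) * c p)" by (intro sum.cong refl) (simp add: c'h)
        finally show "(\<Sum>\<tau>\<in>E. c' \<tau> * \<tau> (bs ! i)) = 0" using c i by simp
      qed
      thus "c p = 0" using hE[OF p] c'h[OF p] by auto
    qed
    moreover have "mat m m (\<lambda>(i, p). h p (bs ! i)) = T\<^sup>T" by (rule eq_matI) (auto simp: T_def)
    ultimately show ?thesis using Determinant.det_transpose[OF carr(1)] by simp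
  qed
  have TS: "T * S = D * T"
  proof (rule eq_matI)
    fix p j assume "p < dim_row (D * T)" "j < dim_col (D * T)"
    hence pj: "p < m" "j < m" by (auto simp: D_def T_def)
    have "(T * S) $$ (p, j) = (\<Sum>i<m. h p (bs ! i) * \<xi> (A $$ (i, j)))"
      using pj by (simp add: T_def S_def scalar_prod_def lessThan_atLeast0)
    also have "\<dots> = (\<Sum>i<m. h p (A $$ (i, j) * bs ! i))"
    proof (intro sum.cong refl)
      fix i assume "i \<in> {..<m}"
      hence i: "i < m" by simp
      have "A $$ (i, j) \<in> l" using A(2)[OF i pj(2)] nf(3) by blast
      from emb_simps(4)[OF l he[OF pj(1)] this bl[OF i]]
      show "h p (bs ! i) * \<xi> (A $$ (i, j)) = h p (A $$ (i, j) * bs ! i)"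
        using extensions_apply[OF hE[OF pj(1), unfolded E_def] A(2)[OF i pj(2)]] by simp
    qed
    also have "\<dots> = h p (\<Sum>i<m. A $$ (i, j) * bs ! i)"
      by (rule embedding_sum[OF l he[OF pj(1)], symmetric])
         (use A(2) pj nf(3) bl in \<open>auto intro!: field_closed(6)[OF l]\<close>)
    also have "\<dots> = h p x * h p (bs ! j)"
      using mult[OF pj(2)] emb_simps(4)[OF l he[OF pj(1)] x bl[OF pj(2)]] by simp
    also have "\<dots> = (\<Sum>q<m. (if q = p then h p x * h q (bs ! j) else 0))" using pj by simp
    also have "\<dots> = (D * T) $$ (p, j)"
      using pj by (simp add: T_def D_def scalar_prod_def lessThan_atLeast0 if_distrib[of "\<lambda>x. x * _"] eq_commute[of p] cong: if_cong)
    finally show "(T * S) $$ (p, j) = (D * T) $$ (p, j)" .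
  qed (auto simp: T_def S_def D_def)
  have "det T * det S = det D * det T"
    unfolding det_mult[OF carr(1,2), symmetric] det_mult[OF carr(3,1), symmetric] TS ..
  hence "det T * det S = det T * det D" by (simp add: mult.commute)
  hence SD: "det S = det D" using detT by simp
  have "\<xi> (field_norm k l x) = det S"
    unfolding d S_def by (rule det_in_field_set(2)[OF k A \<xi>])
  also note SD
  also have "det D = prod_list (diag_mat D)"
    by (rule det_upper_triangular[OF _ carr(3)]) (auto simp: D_def upper_triangular_def)
  also have "\<dots> = (\<Prod>p<m. h p x)"
    by (simp add: diag_mat_def D_def prod.list_conv_set_nth lessThan_atLeast0)
  also have "\<dots> = (\<Prod>\<tau>\<in>E. \<tau> x)" by (rule prod.reindex_bij_betw[OF h])
  finally show "\<xi> (field_norm k l x) = (\<Prod>\<tau>\<in>extensions k l \<xi>. \<tau> x)"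
    unfolding E_def .
qed

section \<open>Archimedean places\<close>

lemma complex_of_real_of_rat: "complex_of_real (of_rat q) = of_rat q"
  by (cases q) (simp add: of_rat_rat)

definition place_of :: "'a::field_char_0 set \<Rightarrow> ('a \<Rightarrow> complex) \<Rightarrow> 'a \<Rightarrow> real" where
  "place_of K \<xi> = (\<lambda>x\<in>K. cmod (\<xi> x))"

definition conj_embedding :: "'a::field_char_0 set \<Rightarrow> ('a \<Rightarrow> complex) \<Rightarrow> 'a \<Rightarrow> complex" where
  "conj_embedding K \<xi> = (\<lambda>x\<in>K. cnj (\<xi> x))"

lemma place_of_apply: "x \<in> K \<Longrightarrow> place_of K \<xi> x = cmod (\<xi> x)"
  by (simp add: place_of_def)

lemma conj_embedding_apply: "x \<in> K \<Longrightarrow> conj_embedding K \<xi> x = cnj (\<xi> x)"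
  by (simp add: conj_embedding_def)

lemma conj_embedding_in:
  assumes "field_set K" "\<xi> \<in> embs K"
  shows "conj_embedding K \<xi> \<in> embs K"
  using assms field_closed[OF assms(1)]
  unfolding embs_def by (auto simp: conj_embedding_def)

lemma place_of_conj: "place_of K (conj_embedding K \<xi>) = place_of K \<xi>"
  by (auto simp: place_of_def conj_embedding_def fun_eq_iff)

lemma place_of_arch:
  assumes K: "field_set K" and \<xi>: "\<xi> \<in> embs K"
  shows "place_of K \<xi> \<in> arch_places K"
proof -
  note cl = field_closed[OF K] and emb = emb_simps[OF K \<xi>]
  have "cmod (of_rat q) = of_rat \<bar>q\<bar>" for q
  proof -
    have "cmod (complex_of_rat q) = cmod (complex_of_real (of_rat q))" by (simp only: complex_of_real_of_rat)
    also have "\<dots> = \<bar>of_rat q\<bar>" by (rule norm_of_real)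
    finally show ?thesis by simp
  qed
  moreover have "of_rat q \<in> K" for q by (rule field_set_of_rat[OF K])
  ultimately show ?thesis
    unfolding arch_places_def absolute_value_def
    by (simp add: place_of_def cl emb norm_mult norm_triangle_ineq)
qed

text \<open>Equal moduli at \<open>x\<close> and at \<open>x + 1\<close> force equal real parts, so
  at each element the two values are equal or conjugate. If \<open>x\<close> refuted the first
  alternative and \<open>y\<close> the second, then \<open>x + y\<close> would satisfy
  neither.\<close>

lemma place_of_eq_iff:
  assumes K: "field_set K" and \<xi>: "\<xi> \<in> embs K" and \<tau>: "\<tau> \<in> embs K"
  shows "place_of K \<tau> = place_of K \<xi> \<longleftrightarrow> \<tau> = \<xi> \<or> \<tau> = conj_embedding K \<xi>"
proof
  assume peq: "place_of K \<tau> = place_of K \<xi>"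
  have eq: "cmod (\<tau> x) = cmod (\<xi> x)" if "x \<in> K" for x
    using fun_cong[OF peq, of x] that by (simp add: place_of_apply)
  note cl = field_closed[OF K] and s = emb_simps[OF K \<xi>] and t = emb_simps[OF K \<tau>]
  have pt: "\<tau> x = \<xi> x \<or> \<tau> x = cnj (\<xi> x)" if x: "x \<in> K" for x
  proof -
    have "cmod (\<tau> x + 1) = cmod (\<xi> x + 1)" using eq[of "x + 1"] x cl s t by simp
    hence "cmod (\<tau> x + 1) ^ 2 = cmod (\<xi> x + 1) ^ 2" by simp
    moreover have sq: "cmod (\<tau> x) ^ 2 = cmod (\<xi> x) ^ 2" using eq[OF x] by simp
    ultimately have re: "Re (\<tau> x) = Re (\<xi> x)"
      unfolding cmod_power2 by (simp add: power2_eq_square algebra_simps)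
    hence "Im (\<tau> x) ^ 2 = Im (\<xi> x) ^ 2" using sq unfolding cmod_power2 by simp
    hence "Im (\<tau> x) = Im (\<xi> x) \<or> Im (\<tau> x) = - Im (\<xi> x)" by (simp add: power2_eq_iff)
    thus ?thesis using re by (auto simp: complex_eq_iff)
  qed
  show "\<tau> = \<xi> \<or> \<tau> = conj_embedding K \<xi>"
  proof (rule ccontr)
    assume "\<not> ?thesis"
    hence ne: "\<tau> \<noteq> \<xi>" "\<tau> \<noteq> conj_embedding K \<xi>" by blast+
    obtain x where x: "x \<in> K" "\<tau> x \<noteq> \<xi> x" using embedding_eqI[OF \<tau> \<xi>] ne(1) by blast
    obtain y where y: "y \<in> K" "\<tau> y \<noteq> conj_embedding K \<xi> y"
      using embedding_eqI[OF \<tau> conj_embedding_in[OF K \<xi>]] ne(2) by blast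
    note y = y(1) y(2)[unfolded conj_embedding_apply[OF y(1)]]
    have "\<tau> x = cnj (\<xi> x)" "\<tau> y = \<xi> y" using pt x y by auto
    moreover have "\<tau> (x + y) = \<xi> (x + y) \<or> \<tau> (x + y) = cnj (\<xi> (x + y))" by (rule pt[OF cl(5)[OF x(1) y(1)]])
    ultimately show False using x y by (auto simp: s t)
  qed
qed (auto simp: place_of_conj)

text \<open>The matrix of conjugates of a basis is square and, by Dedekind independence, invertible.
  The second claim provides the functionals that read off rational coordinates from
  conjugates.\<close>

lemma conjugate_system:
  assumes nf: "number_field K" and b: "is_basis \<rat> K n b"
  shows "\<exists>c. \<forall>\<xi>\<in>embs K. (\<Sum>j<n. c j * \<xi> (b j)) = t \<xi>"
    and "\<exists>d. \<forall>j<n. (\<Sum>\<xi>\<in>embs K. d \<xi> * \<xi> (b j)) = (if j = i then 1 else 0)"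
proof -
  note K = nf_props(1)[OF nf]
  obtain b' where b': "is_basis \<rat> K (number_field_degree K) b'" using nf_props(2)[OF nf] by blast
  have n: "n = number_field_degree K"
    using b b' dimension_iff_basis[OF field_set_Rats] dimension_unique[OF field_set_Rats] by blast
  obtain \<xi>0 :: "'a \<Rightarrow> complex" where \<xi>0: "\<xi>0 \<in> embs \<rat>" using embeddings_Rats_exists by blast
  have E: "embs K = extensions \<rat> K \<xi>0"
    using embeddings_Rats_unique[OF embedding_restrict[OF _ Rats_subset_field_set[OF K] field_set_Rats] \<xi>0]
    by (auto simp: extensions_def)
  have ker: "\<forall>\<xi>\<in>embs K. d \<xi> = 0" if "\<And>j. j \<in> {..<n} \<Longrightarrow> (\<Sum>\<xi>\<in>embs K. d \<xi> * \<xi> (b j)) = 0" for d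
    by (rule embedding_relation_of_basis[OF K Rats_subset_field_set[OF K] field_set_Rats b card_embeddings(1)[OF nf]])
       (use that E in auto)
  note fin = card_embeddings(1)[OF nf] and card = card_embeddings(2)[OF nf]
  have "\<exists>c. \<forall>\<xi>\<in>embs K. (\<Sum>j\<in>{..<n}. \<xi> (b j) * c j) = t \<xi>"
    by (rule square_system_surj_left[where a = "\<lambda>\<xi> j. \<xi> (b j)"]) (use fin card n ker in auto)
  thus "\<exists>c. \<forall>\<xi>\<in>embs K. (\<Sum>j<n. c j * \<xi> (b j)) = t \<xi>" by (simp add: mult.commute)
  have "\<exists>d. \<forall>j\<in>{..<n}. (\<Sum>\<xi>\<in>embs K. \<xi> (b j) * d \<xi>) = (if j = i then 1 else 0)"
    by (rule square_system_solvable[where a = "\<lambda>j \<xi>. \<xi> (b j)"]) (use fin card n ker in \<open>auto simp: mult.commute\<close>)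
  thus "\<exists>d. \<forall>j<n. (\<Sum>\<xi>\<in>embs K. d \<xi> * \<xi> (b j)) = (if j = i then 1 else 0)"
    unfolding Ball_def lessThan_iff by (simp only: mult.commute)
qed

text \<open>A complex solution \<open>c\<close> of the conjugate system remains a solution when
  replaced by its real part, because \<open>t\<close> is compatible with conjugation. Real
  coefficients are then approximated by rational ones.\<close>

lemma weak_approximation:
  assumes nf: "number_field K" and \<epsilon>: "\<epsilon> > 0"
    and sym: "\<And>\<xi>. \<xi> \<in> embs K \<Longrightarrow> t (conj_embedding K \<xi>) = cnj (t \<xi>)"
  shows "\<exists>x\<in>K. \<forall>\<xi>\<in>embs K. cmod (\<xi> x - t \<xi>) < \<epsilon>"
proof -
  note K = nf_props(1)[OF nf]
  define n where "n = number_field_degree K"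
  obtain b where b: "is_basis \<rat> K n b" using nf_props(2)[OF nf] n_def by blast
  have bK: "b j \<in> K" if "j < n" for j by (rule is_basis_mem[OF field_set_Rats b that])
  obtain c where c: "\<And>\<xi>. \<xi> \<in> embs K \<Longrightarrow> (\<Sum>j<n. c j * \<xi> (b j)) = t \<xi>"
    using conjugate_system(1)[OF nf b, of t] by blast
  have re: "(\<Sum>j<n. of_real (Re (c j)) * \<xi> (b j)) = t \<xi>" if \<xi>: "\<xi> \<in> embs K" for \<xi>
  proof -
    have "cnj (\<Sum>j<n. c j * conj_embedding K \<xi> (b j)) = t \<xi>"
      using c[OF conj_embedding_in[OF K \<xi>]] sym[OF \<xi>] by simp
    also have "cnj (\<Sum>j<n. c j * conj_embedding K \<xi> (b j)) = (\<Sum>j<n. cnj (c j) * \<xi> (b j))"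
      using bK by (simp add: conj_embedding_apply)
    finally have "(\<Sum>j<n. c j * \<xi> (b j)) + (\<Sum>j<n. cnj (c j) * \<xi> (b j)) = 2 * t \<xi>" using c[OF \<xi>] by simp
    also have "(\<Sum>j<n. c j * \<xi> (b j)) + (\<Sum>j<n. cnj (c j) * \<xi> (b j)) = 2 * (\<Sum>j<n. of_real (Re (c j)) * \<xi> (b j))"
      unfolding sum.distrib[symmetric] distrib_right[symmetric] complex_add_cnj by (simp add: sum_distrib_left mult_ac)
    finally show ?thesis by simp
  qed
  define B where "B = 1 + (\<Sum>\<xi>\<in>embs K. \<Sum>j<n. cmod (\<xi> (b j)))"
  have B: "B > 0" unfolding B_def by (intro add_pos_nonneg sum_nonneg) auto
  define \<delta> where "\<delta> = \<epsilon> / B"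
  have \<delta>: "\<delta> > 0" using \<epsilon> B by (simp add: \<delta>_def)
  have "\<exists>q::rat. \<bar>of_rat q - r\<bar> < \<delta>" for r :: real
  proof -
    obtain q :: rat where "r - \<delta> < of_rat q" "of_rat q < r + \<delta>"
      using of_rat_dense[of "r - \<delta>" "r + \<delta>"] \<delta> by auto
    thus ?thesis by (intro exI[of _ q]) (simp add: abs_less_iff)
  qed
  hence "\<forall>j. \<exists>q::rat. \<bar>of_rat q - Re (c j)\<bar> < \<delta>" by blast
  from choice[OF this] obtain q :: "nat \<Rightarrow> rat" where q: "\<And>j. \<bar>of_rat (q j) - Re (c j)\<bar> < \<delta>" by blast
  define x where "x = (\<Sum>j<n. of_rat (q j) * b j)"
  have xK: "x \<in> K" unfolding x_def by (rule is_basisD(2)[OF b]) simp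
  have "cmod (\<xi> x - t \<xi>) < \<epsilon>" if \<xi>: "\<xi> \<in> embs K" for \<xi>
  proof -
    note emb = emb_simps[OF K \<xi>]
    have "\<xi> x = (\<Sum>j<n. \<xi> (of_rat (q j) * b j))" unfolding x_def
      by (rule embedding_sum[OF K \<xi>]) (auto intro!: field_closed(6)[OF K] field_set_of_rat[OF K] bK)
    also have "\<dots> = (\<Sum>j<n. of_real (of_rat (q j)) * \<xi> (b j))"
      by (intro sum.cong refl) (simp add: emb(4,12) field_set_of_rat[OF K] bK complex_of_real_of_rat)
    finally have "\<xi> x - t \<xi> = (\<Sum>j<n. of_real (of_rat (q j) - Re (c j)) * \<xi> (b j))"
      unfolding re[OF \<xi>, symmetric] by (simp add: sum_subtractf[symmetric] left_diff_distrib)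
    also have "cmod \<dots> \<le> (\<Sum>j<n. cmod (of_real (of_rat (q j) - Re (c j)) * \<xi> (b j)))" by (rule norm_sum)
    also have "\<dots> \<le> (\<Sum>j<n. \<delta> * cmod (\<xi> (b j)))"
      unfolding norm_mult norm_of_real by (intro sum_mono mult_right_mono less_imp_le[OF q]) auto
    also have "\<dots> = \<delta> * (\<Sum>j<n. cmod (\<xi> (b j)))" by (simp add: sum_distrib_left)
    also have "\<dots> \<le> \<delta> * (\<Sum>\<xi>\<in>embs K. \<Sum>j<n. cmod (\<xi> (b j)))"
      using \<delta> by (intro mult_left_mono member_le_sum[OF \<xi>, of "\<lambda>\<xi>. \<Sum>j<n. cmod (\<xi> (b j))"]
        sum_nonneg card_embeddings(1)[OF nf]) auto
    also have "\<dots> < \<delta> * B" using \<delta> by (simp add: B_def)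
    finally show ?thesis using B by (simp add: \<delta>_def)
  qed
  thus ?thesis using xK by blast
qed

section \<open>Classification of the archimedean places\<close>

lemma absolute_value_props:
  assumes K: "field_set K" and w: "absolute_value K w"
  shows "w 1 = 1" "x \<in> K \<Longrightarrow> w (x ^ n) = w x ^ n" "x \<in> K \<Longrightarrow> w (inverse x) = inverse (w x)"
    "x \<in> K \<Longrightarrow> w (- x) = w x" "(\<And>i. i \<in> I \<Longrightarrow> f i \<in> K) \<Longrightarrow> w (sum f I) \<le> (\<Sum>i\<in>I. w (f i))"
proof -
  note cl = field_closed[OF K]
  have nn: "w x \<ge> 0" and z: "w x = 0 \<longleftrightarrow> x = 0" if "x \<in> K" for x using w that by (auto simp: absolute_value_def)
  have mult: "w (x * y) = w x * w y" and tri: "w (x + y) \<le> w x + w y" if "x \<in> K" "y \<in> K" for x y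
    using w that by (auto simp: absolute_value_def)
  have "w 1 * w 1 = w 1" using mult[of 1 1] cl by simp
  thus 1: "w 1 = 1" using z[of 1] cl by simp
  show "w (x ^ n) = w x ^ n" if "x \<in> K" for x n by (induction n) (use that 1 mult cl in auto)
  show "w (inverse x) = inverse (w x)" if "x \<in> K" for x
  proof (cases "x = 0")
    case True
    thus ?thesis using z[of 0] cl by simp
  next
    case False
    have "w x * w (inverse x) = 1" using mult[of x "inverse x"] that cl 1 False by simp
    thus ?thesis by (rule inverse_unique[symmetric])
  qed
  have "w (- 1) * w (- 1) = 1" using mult[of "- 1" "- 1"] cl 1 by simp
  hence "w (- 1) = 1" using nn[of "- 1"] cl square_eq_1_iff[of "w (- 1)"] by auto
  thus "w (- x) = w x" if "x \<in> K" using mult[of "- 1" x] that cl by simp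
  show "w (sum f I) \<le> (\<Sum>i\<in>I. w (f i))" if "\<And>i. i \<in> I \<Longrightarrow> f i \<in> K"
    using that
  proof (induction I rule: infinite_finite_induct)
    case (insert i I)
    have "w (f i + sum f I) \<le> w (f i) + w (sum f I)"
      using insert by (intro tri field_set_sum[OF K]) auto
    also have "\<dots> \<le> w (f i) + (\<Sum>i\<in>I. w (f i))" using insert by simp
    finally show ?case using insert.hyps by simp
  qed (use z[of 0] cl in auto)
qed

text \<open>The rational coordinates of \<open>x\<close> are linear in its conjugates, and
  \<open>w\<close> is the usual absolute value on the rationals, so the triangle inequality bounds
  \<open>w x\<close>.\<close>

lemma arch_place_bound:
  assumes nf: "number_field K" and w: "w \<in> arch_places K"
  shows "\<exists>C>0. \<forall>x\<in>K. w x \<le> C * (\<Sum>\<xi>\<in>embs K. cmod (\<xi> x))"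
proof -
  note K = nf_props(1)[OF nf]
  have wa: "absolute_value K w" and wq: "\<And>q. w (of_rat q) = of_rat \<bar>q\<bar>" using w by (auto simp: arch_places_def)
  note wp = absolute_value_props[OF K wa]
  define n where "n = number_field_degree K"
  obtain b where b: "is_basis \<rat> K n b" using nf_props(2)[OF nf] n_def by blast
  have bK: "b j \<in> K" if "j < n" for j by (rule is_basis_mem[OF field_set_Rats b that])
  have wb: "w (b j) \<ge> 0" if "j < n" for j using wa bK[OF that] by (simp add: absolute_value_def)
  have "\<forall>i. \<exists>d. \<forall>j<n. (\<Sum>\<xi>\<in>embs K. d \<xi> * \<xi> (b j)) = (if j = i then 1 else 0)"
    using conjugate_system(2)[OF nf b] by blast
  then obtain d where d: "\<And>i j. j < n \<Longrightarrow> (\<Sum>\<xi>\<in>embs K. d i \<xi> * \<xi> (b j)) = (if j = i then 1 else 0)" by metis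
  define D where "D = (\<Sum>i<n. \<Sum>\<xi>\<in>embs K. cmod (d i \<xi>))"
  define C where "C = 1 + (\<Sum>i<n. D * w (b i))"
  have D0: "D \<ge> 0" unfolding D_def by (intro sum_nonneg) auto
  have C0: "C > 0" unfolding C_def using D0 wb by (intro add_pos_nonneg sum_nonneg mult_nonneg_nonneg) auto
  have "w x \<le> C * (\<Sum>\<xi>\<in>embs K. cmod (\<xi> x))" if x: "x \<in> K" for x
  proof -
    define s where "s = (\<Sum>\<xi>\<in>embs K. cmod (\<xi> x))"
    have s0: "s \<ge> 0" unfolding s_def by (intro sum_nonneg) auto
    have les: "cmod (\<xi> x) \<le> s" if "\<xi> \<in> embs K" for \<xi>
      unfolding s_def by (rule member_le_sum[OF that]) (use card_embeddings(1)[OF nf] in auto)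
    obtain a where a: "\<forall>i<n. a i \<in> \<rat>" "x = (\<Sum>i<n. a i * b i)" using is_basisD(1)[OF b x] by blast
    have "\<forall>i. \<exists>q. i < n \<longrightarrow> a i = of_rat q" using a(1) by (auto elim!: Rats_cases)
    then obtain q :: "nat \<Rightarrow> rat" where q: "\<And>i. i < n \<Longrightarrow> a i = of_rat (q i)" by metis
    have xq: "x = (\<Sum>i<n. of_rat (q i) * b i)" unfolding a(2) by (intro sum.cong) (auto simp: q)
    have mem: "of_rat (q i) * b i \<in> K" if "i < n" for i
      using field_set_of_rat[OF K] bK[OF that] by (rule field_closed(6)[OF K])
    have \<xi>x: "\<xi> x = (\<Sum>j<n. of_rat (q j) * \<xi> (b j))" if \<xi>: "\<xi> \<in> embs K" for \<xi>
    proof -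
      have "\<xi> x = (\<Sum>j<n. \<xi> (of_rat (q j) * b j))" unfolding xq
        by (rule embedding_sum[OF K \<xi>]) (use mem in auto)
      thus ?thesis using bK by (simp add: emb_simps(4,12)[OF K \<xi>] field_set_of_rat[OF K])
    qed
    have qb: "\<bar>of_rat (q i) :: real\<bar> \<le> D * s" if i: "i < n" for i
    proof -
      have "(\<Sum>\<xi>\<in>embs K. d i \<xi> * \<xi> x) = (\<Sum>\<xi>\<in>embs K. \<Sum>j<n. of_rat (q j) * (d i \<xi> * \<xi> (b j)))"
        by (intro sum.cong refl) (simp add: \<xi>x sum_distrib_left mult_ac)
      also have "\<dots> = (\<Sum>j<n. of_rat (q j) * (\<Sum>\<xi>\<in>embs K. d i \<xi> * \<xi> (b j)))"
        by (subst sum.swap) (simp add: sum_distrib_left)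
      also have "\<dots> = (\<Sum>j<n. if j = i then of_rat (q j) else 0)"
        by (intro sum.cong refl) (simp add: d)
      also have "\<dots> = of_rat (q i)" using i by simp
      finally have eq: "complex_of_real (of_rat (q i)) = (\<Sum>\<xi>\<in>embs K. d i \<xi> * \<xi> x)"
        by (simp add: complex_of_real_of_rat)
      have "\<bar>of_rat (q i) :: real\<bar> = cmod (complex_of_real (of_rat (q i)))" by (simp only: norm_of_real)
      also have "\<dots> \<le> (\<Sum>\<xi>\<in>embs K. cmod (d i \<xi> * \<xi> x))" unfolding eq by (rule norm_sum)
      also have "\<dots> \<le> (\<Sum>\<xi>\<in>embs K. cmod (d i \<xi>) * s)"
        using les by (intro sum_mono) (auto simp: norm_mult intro!: mult_left_mono)
      also have "\<dots> = (\<Sum>\<xi>\<in>embs K. cmod (d i \<xi>)) * s" by (simp add: sum_distrib_right)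
      also have "\<dots> \<le> D * s" unfolding D_def
        using i by (intro mult_right_mono[OF _ s0] member_le_sum[of i "{..<n}" "\<lambda>i. \<Sum>\<xi>\<in>embs K. cmod (d i \<xi>)"])
          (auto intro: sum_nonneg)
      finally show ?thesis .
    qed
    have "w x \<le> (\<Sum>i<n. w (of_rat (q i) * b i))" unfolding xq by (rule wp(5)) (use mem in auto)
    also have "\<dots> = (\<Sum>i<n. \<bar>of_rat (q i)\<bar> * w (b i))"
      using wa bK field_set_of_rat[OF K] wq by (intro sum.cong refl) (auto simp: absolute_value_def)
    also have "\<dots> \<le> (\<Sum>i<n. D * s * w (b i))"
      using qb wb by (intro sum_mono mult_right_mono) auto
    also have "\<dots> = (\<Sum>i<n. D * w (b i)) * s" by (simp add: sum_distrib_right sum_distrib_left mult_ac)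
    also have "\<dots> \<le> C * s" unfolding C_def using s0 by (intro mult_right_mono) auto
    finally show ?thesis by (simp add: s_def)
  qed
  thus ?thesis using C0 by blast
qed

text \<open>Since \<open>w\<close> differs from the place of \<open>\<xi>\<close>, some
  \<open>z\<close> is larger at \<open>w\<close> than at \<open>\<xi>\<close>. If \<open>x\<close>
  is close to 1 at the place of \<open>\<xi>\<close> and close to 0 elsewhere, then the conjugates
  of \<open>z ^ N * x\<close> are small compared with \<open>w z ^ N\<close>, and
  \<open>arch_place_bound\<close> makes \<open>w x\<close> small.\<close>

lemma arch_place_vanishes_on_other_idempotents:
  assumes nf: "number_field K" and w: "w \<in> arch_places K" and \<xi>: "\<xi> \<in> embs K"
    and ne: "w \<noteq> place_of K \<xi>" and \<eta>: "\<eta> > 0"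
  shows "\<exists>\<epsilon>>0. \<forall>x\<in>K. (\<forall>\<tau>\<in>embs K. cmod (\<tau> x - (if place_of K \<tau> = place_of K \<xi> then 1 else 0)) < \<epsilon>) \<longrightarrow> w x < \<eta>"
proof -
  note K = nf_props(1)[OF nf] and fin = card_embeddings(1)[OF nf]
  note cl = field_closed[OF K]
  have wa: "absolute_value K w" using w by (auto simp: arch_places_def)
  note wp = absolute_value_props[OF K wa]
  have w0: "w x \<ge> 0" and wz: "w x = 0 \<longleftrightarrow> x = 0" if "x \<in> K" for x using wa that by (auto simp: absolute_value_def)
  obtain C where C: "C > 0" "\<And>x. x \<in> K \<Longrightarrow> w x \<le> C * (\<Sum>\<xi>\<in>embs K. cmod (\<xi> x))"
    using arch_place_bound[OF nf w] by blast
  have "\<exists>y\<in>K. w y \<noteq> cmod (\<xi> y)"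
  proof (rule ccontr)
    assume "\<not> ?thesis"
    hence "w = place_of K \<xi>"
      using wa by (intro extensionalityI[of _ K]) (auto simp: absolute_value_def place_of_def)
    with ne show False by simp
  qed
  then obtain y where y: "y \<in> K" "w y \<noteq> cmod (\<xi> y)" by blast
  have y0: "y \<noteq> 0" using y wz[of 0] cl(2) emb_simps(2)[OF K \<xi>] by auto
  have "\<exists>z\<in>K. cmod (\<xi> z) < w z"
  proof (cases "cmod (\<xi> y) < w y")
    case True
    thus ?thesis using y(1) by blast
  next
    case False
    hence "w y < cmod (\<xi> y)" using y(2) by simp
    moreover have "w y > 0" using w0[OF y(1)] wz[OF y(1)] y0 by simp
    ultimately have "inverse (cmod (\<xi> y)) < inverse (w y)" by (intro less_imp_inverse_less)
    hence "cmod (\<xi> (inverse y)) < w (inverse y)"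
      using wp(3)[OF y(1)] emb_simps(7)[OF K \<xi> y(1)] by (simp add: norm_inverse)
    thus ?thesis using cl(4)[OF y(1)] by blast
  qed
  then obtain z where z: "z \<in> K" "cmod (\<xi> z) < w z" by blast
  define a where "a = cmod (\<xi> z)"
  define W where "W = w z"
  have aW: "0 \<le> a" "a < W" "0 < W" using z by (auto simp: a_def W_def intro: le_less_trans[OF norm_ge_zero])
  define A where "A = C * (real (card (embs K)) + 1)"
  define B where "B = 1 + (\<Sum>\<tau>\<in>embs K. cmod (\<tau> z))"
  have A: "A > 0" using C by (simp add: A_def add_pos_nonneg)
  have B: "B > 0" unfolding B_def by (intro add_pos_nonneg sum_nonneg) auto
  have Bz: "cmod (\<tau> z) \<le> B" if "\<tau> \<in> embs K" for \<tau>
    using member_le_sum[OF that, of "\<lambda>\<tau>. cmod (\<tau> z)"] fin by (simp add: B_def)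
  \<comment> \<open>First \<open>N\<close> is fixed so that the conjugate at \<open>\<xi>\<close> is
    negligible against \<open>W ^ N\<close>; only then is \<open>\<epsilon>\<close> chosen, small
    enough to offset the growth \<open>B ^ N\<close> at the other embeddings.\<close>
  obtain N where N: "(a / W) ^ N < \<eta> / (4 * A)"
    using real_arch_pow_inv[of "\<eta> / (4 * A)" "a / W"] aW \<eta> A by (auto simp: divide_less_eq)
  have N': "4 * A * a ^ N < \<eta> * W ^ N"
    using N aW A by (simp add: power_divide field_simps)
  define \<epsilon> where "\<epsilon> = min 1 (\<eta> * W ^ N / (2 * A * B ^ N))"
  have \<epsilon>: "\<epsilon> > 0" "\<epsilon> \<le> 1" "2 * (A * (B ^ N * \<epsilon>)) \<le> \<eta> * W ^ N"
  proof -
    show "\<epsilon> > 0" "\<epsilon> \<le> 1" using \<eta> aW A B by (auto simp: \<epsilon>_def)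
    have "\<epsilon> \<le> \<eta> * W ^ N / (2 * A * B ^ N)" by (simp add: \<epsilon>_def)
    thus "2 * (A * (B ^ N * \<epsilon>)) \<le> \<eta> * W ^ N" using A B by (simp add: field_simps)
  qed
  have "w x < \<eta>" if x: "x \<in> K"
    and ap: "\<And>\<tau>. \<tau> \<in> embs K \<Longrightarrow> cmod (\<tau> x - (if place_of K \<tau> = place_of K \<xi> then 1 else 0)) < \<epsilon>" for x
  proof -
    have conj_bound: "cmod (\<tau> (z ^ N * x)) \<le> 2 * a ^ N + B ^ N * \<epsilon>" if \<tau>: "\<tau> \<in> embs K" for \<tau>
    proof -
      have "cmod (\<tau> (z ^ N * x)) = cmod (\<tau> z) ^ N * cmod (\<tau> x)"
        using z(1) x cl(9) by (simp add: emb_simps(4,10)[OF K \<tau>] norm_mult norm_power)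
      also have "\<dots> \<le> 2 * a ^ N + B ^ N * \<epsilon>"
      proof (cases "place_of K \<tau> = place_of K \<xi>")
        case True
        have "cmod (\<tau> z) = a" using fun_cong[OF True, of z] z(1) by (simp add: place_of_apply a_def)
        moreover have "cmod (\<tau> x) \<le> 2"
        proof -
          have "cmod (\<tau> x) \<le> cmod (\<tau> x - 1) + cmod 1" by (metis diff_add_cancel norm_triangle_ineq)
          thus ?thesis using ap[OF \<tau>] True \<epsilon>(2) by simp
        qed
        ultimately have "cmod (\<tau> z) ^ N * cmod (\<tau> x) \<le> a ^ N * 2"
          using aW by (simp add: mult_left_mono)
        also have "\<dots> \<le> 2 * a ^ N + B ^ N * \<epsilon>" using B \<epsilon> by simp
        finally show ?thesis .
      next
        case False
        have "cmod (\<tau> z) ^ N * cmod (\<tau> x) \<le> B ^ N * \<epsilon>"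
          using ap[OF \<tau>] False Bz[OF \<tau>] B by (intro mult_mono power_mono) auto
        thus ?thesis using aW by (simp add: add_increasing)
      qed
      finally show ?thesis .
    qed
    have zx: "z ^ N * x \<in> K" by (rule cl(6)[OF cl(9)[OF z(1)] x])
    have "W ^ N * w x = w (z ^ N * x)"
      using wa z(1) x cl(9)[OF z(1)] wp(2)[OF z(1)] by (simp add: absolute_value_def W_def)
    also have "\<dots> \<le> C * (\<Sum>\<tau>\<in>embs K. cmod (\<tau> (z ^ N * x)))" by (rule C(2)[OF zx])
    also have "\<dots> \<le> C * (\<Sum>\<tau>\<in>embs K. 2 * a ^ N + B ^ N * \<epsilon>)"
      using C(1) conj_bound by (intro mult_left_mono sum_mono) auto
    also have "\<dots> = C * real (card (embs K)) * (2 * a ^ N + B ^ N * \<epsilon>)" by simp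
    also have "\<dots> \<le> A * (2 * a ^ N + B ^ N * \<epsilon>)"
      unfolding A_def using C(1) aW B \<epsilon> by (intro mult_right_mono add_nonneg_nonneg) (auto simp: algebra_simps)
    finally have 1: "2 * (W ^ N * w x) \<le> 4 * A * a ^ N + 2 * (A * (B ^ N * \<epsilon>))" by (simp add: algebra_simps)
    have "2 * (W ^ N * w x) < 2 * (W ^ N * \<eta>)" using 1 N' \<epsilon>(3) by (simp add: mult.commute)
    thus ?thesis using aW by simp
  qed
  thus ?thesis using \<epsilon>(1) by blast
qed

text \<open>If \<open>w\<close> came from no embedding, approximate idempotents, one for each place
  of an embedding, would all be small at \<open>w\<close>. Yet their sum is close to 1 at every
  embedding and hence, by \<open>arch_place_bound\<close>, close to 1 at \<open>w\<close>, which
  contradicts the triangle inequality.\<close>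

theorem arch_places_eq:
  assumes nf: "number_field K"
  shows "arch_places K = place_of K ` embs K"
proof (intro subset_antisym subsetI)
  note K = nf_props(1)[OF nf] and fin = card_embeddings(1)[OF nf]
  fix w assume w: "w \<in> arch_places K"
  show "w \<in> place_of K ` embs K"
  proof (rule ccontr)
    assume out: "w \<notin> place_of K ` embs K"
    have wa: "absolute_value K w" using w by (auto simp: arch_places_def)
    note wp = absolute_value_props[OF K wa]
    obtain C where C: "C > 0" "\<And>x. x \<in> K \<Longrightarrow> w x \<le> C * (\<Sum>\<xi>\<in>embs K. cmod (\<xi> x))"
      using arch_place_bound[OF nf w] by blast
    define P where "P = place_of K ` embs K"
    define s where "s = real (card P) + 1"
    define n where "n = real (card (embs K)) + 1"
    have finP: "finite P" using fin by (simp add: P_def)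
    have sn: "s > 0" "n > 0" by (auto simp: s_def n_def)
    \<comment> \<open>Chosen so that the errors of all idempotents, added up over all embeddings and
      multiplied by \<open>C\<close>, stay below one half.\<close>
    define \<epsilon>0 where "\<epsilon>0 = 1 / (2 * C * n * s)"
    have \<epsilon>0: "\<epsilon>0 > 0" using C sn by (simp add: \<epsilon>0_def)
    define t where "t p \<tau> = (if place_of K \<tau> = p then 1 else 0 :: complex)" for p \<tau>
    have "\<exists>x\<in>K. w x < 1 / (2 * s) \<and> (\<forall>\<tau>\<in>embs K. cmod (\<tau> x - t p \<tau>) < \<epsilon>0)" if p: "p \<in> P" for p
    proof -
      obtain \<xi> where \<xi>: "\<xi> \<in> embs K" "p = place_of K \<xi>" using p by (auto simp: P_def)
      have "w \<noteq> place_of K \<xi>" using out \<xi> by blast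
      from arch_place_vanishes_on_other_idempotents[OF nf w \<xi>(1) this, of "1 / (2 * s)"] sn
      obtain \<epsilon> where \<epsilon>: "\<epsilon> > 0" "\<And>x. x \<in> K \<Longrightarrow> (\<And>\<tau>. \<tau> \<in> embs K \<Longrightarrow> cmod (\<tau> x - t p \<tau>) < \<epsilon>) \<Longrightarrow> w x < 1 / (2 * s)"
        unfolding t_def \<xi>(2) by auto
      have "\<exists>x\<in>K. \<forall>\<tau>\<in>embs K. cmod (\<tau> x - t p \<tau>) < min \<epsilon> \<epsilon>0"
        by (rule weak_approximation[OF nf]) (use \<epsilon> \<epsilon>0 in \<open>auto simp: t_def place_of_conj\<close>)
      then obtain x where x: "x \<in> K" "\<And>\<tau>. \<tau> \<in> embs K \<Longrightarrow> cmod (\<tau> x - t p \<tau>) < min \<epsilon> \<epsilon>0" by blast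
      have "w x < 1 / (2 * s)" using \<epsilon>(2)[OF x(1)] x(2) by simp
      thus ?thesis using x by (intro bexI[of _ x]) auto
    qed
    hence "\<forall>p\<in>P. \<exists>x. x \<in> K \<and> w x < 1 / (2 * s) \<and> (\<forall>\<tau>\<in>embs K. cmod (\<tau> x - t p \<tau>) < \<epsilon>0)" by blast
    from bchoice[OF this] obtain x where
      x: "\<And>p. p \<in> P \<Longrightarrow> x p \<in> K" "\<And>p. p \<in> P \<Longrightarrow> w (x p) < 1 / (2 * s)"
        "\<And>p \<tau>. p \<in> P \<Longrightarrow> \<tau> \<in> embs K \<Longrightarrow> cmod (\<tau> (x p) - t p \<tau>) < \<epsilon>0" by blast
    define y where "y = 1 - (\<Sum>p\<in>P. x p)"
    have sK: "(\<Sum>p\<in>P. x p) \<in> K" by (rule field_set_sum[OF K x(1)])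
    have yK: "y \<in> K" unfolding y_def using sK field_closed(1,7)[OF K] by blast
    have \<tau>y: "cmod (\<tau> y) \<le> s * \<epsilon>0" if \<tau>: "\<tau> \<in> embs K" for \<tau>
    proof -
      have "(\<Sum>p\<in>P. t p \<tau>) = (\<Sum>p\<in>P. if p = place_of K \<tau> then 1 else 0)"
        by (intro sum.cong) (auto simp: t_def)
      also have "\<dots> = 1" using finP \<tau> by (simp add: P_def)
      finally have t1: "(\<Sum>p\<in>P. t p \<tau>) = 1" .
      have "\<tau> y = 1 - (\<Sum>p\<in>P. \<tau> (x p))"
        unfolding y_def using emb_simps(6)[OF K \<tau> field_closed(1)[OF K] sK]
          embedding_sum[OF K \<tau> x(1)] emb_simps(1)[OF K \<tau>] by simp
      also have "\<dots> = - (\<Sum>p\<in>P. \<tau> (x p) - t p \<tau>)" unfolding sum_subtractf t1 by simp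
      finally have "cmod (\<tau> y) \<le> (\<Sum>p\<in>P. cmod (\<tau> (x p) - t p \<tau>))" using norm_sum by simp
      also have "\<dots> \<le> (\<Sum>p\<in>P. \<epsilon>0)" using x(3)[OF _ \<tau>] by (intro sum_mono less_imp_le)
      also have "\<dots> \<le> s * \<epsilon>0" using \<epsilon>0 by (simp add: s_def)
      finally show ?thesis .
    qed
    have "w y \<le> C * (\<Sum>\<tau>\<in>embs K. cmod (\<tau> y))" by (rule C(2)[OF yK])
    also have "\<dots> \<le> C * (\<Sum>\<tau>\<in>embs K. s * \<epsilon>0)" using C(1) \<tau>y by (intro mult_left_mono sum_mono) auto
    also have "\<dots> = real (card (embs K)) / (2 * n)" using C sn by (simp add: \<epsilon>0_def field_simps)
    also have "\<dots> < 1 / 2" using sn by (simp add: n_def field_simps)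
    finally have wy: "w y < 1 / 2" .
    have "1 = w (y + (\<Sum>p\<in>P. x p))" using wp(1) by (simp add: y_def)
    also have "\<dots> \<le> w y + w (\<Sum>p\<in>P. x p)" using wa yK sK by (simp add: absolute_value_def)
    also have "w (\<Sum>p\<in>P. x p) \<le> (\<Sum>p\<in>P. w (x p))" by (rule wp(5)[OF x(1)])
    also have "\<dots> \<le> (\<Sum>p\<in>P. 1 / (2 * s))" using x(2) by (intro sum_mono less_imp_le)
    also have "\<dots> \<le> 1 / 2" using sn by (simp add: s_def field_simps)
    finally show False using wy by simp
  qed
next
  fix w assume "w \<in> place_of K ` embs K"
  thus "w \<in> arch_places K" using place_of_arch[OF nf_props(1)[OF nf]] by blast
qed

text \<open>If \<open>w x > 1\<close>, the powers of \<open>w x\<close> are unbounded; but every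
  power of \<open>x\<close> is an integral combination of finitely many fixed ones, and integers
  have value at most 1. The argument runs on the triangle inequality alone, as the definition of
  places postulates no ultrametric one.\<close>

lemma nonarch_place_unit:
  assumes K: "field_set K" and w: "w \<in> nonarch_places K" and x: "x \<in> K" "algebraic_int x"
  shows "w x \<le> 1"
proof (rule ccontr)
  assume "\<not> w x \<le> 1"
  hence gt: "w x > 1" by simp
  have wa: "absolute_value K w" using w by (auto simp: nonarch_places_def)
  note wp = absolute_value_props[OF K wa]
  obtain p where p: "prime p" "\<And>q. w (of_rat q) = padic_abs p q" using w by (auto simp: nonarch_places_def)
  have wi: "w (of_int m) \<le> 1" for m
  proof -
    have "real p powi (- int (multiplicity (int p) m)) \<le> 1"
      using prime_ge_2_nat[OF p(1)] by (simp add: power_int_minus divide_simps power_int_def)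
    hence "padic_abs p (of_int m) \<le> 1" by (simp add: padic_abs_def)
    thus ?thesis using p(2)[of "of_int m"] by simp
  qed
  obtain n and M :: "nat \<Rightarrow> nat \<Rightarrow> int" where n: "n > 0" and M: "\<And>N. x ^ N = (\<Sum>j<n. of_int (M N j) * x ^ j)"
    using algebraic_int_power_reduction[OF x(2)] by blast
  have bd: "w x ^ N \<le> (\<Sum>j<n. w x ^ j)" for N
  proof -
    have xj: "x ^ j \<in> K" for j by (rule field_closed(9)[OF K x(1)])
    have mem: "of_int (M N j) * x ^ j \<in> K" for j
      using field_set_of_int[OF K] xj by (rule field_closed(6)[OF K])
    have "w x ^ N = w (x ^ N)" by (rule wp(2)[OF x(1), symmetric])
    also have "\<dots> = w (\<Sum>j<n. of_int (M N j) * x ^ j)" by (subst M) (rule refl)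
    also have "\<dots> \<le> (\<Sum>j<n. w (of_int (M N j) * x ^ j))" by (rule wp(5)) (rule mem)
    also have "\<dots> = (\<Sum>j<n. w (of_int (M N j)) * w x ^ j)"
      using wa field_set_of_int[OF K] xj wp(2)[OF x(1)] by (simp add: absolute_value_def)
    also have "\<dots> \<le> (\<Sum>j<n. w x ^ j)"
      using wi gt by (intro sum_mono) (simp add: mult_le_cancel_right1)
    finally show ?thesis .
  qed
  obtain N where "(\<Sum>j<n. w x ^ j) < w x ^ N" using real_arch_pow[OF gt] by blast
  with bd[of N] show False by simp
qed

section \<open>Completions and local degrees\<close>

lemma rational_sequence:
  fixes r :: real
  obtains q :: "nat \<Rightarrow> rat" where "(\<lambda>n. of_rat (q n) :: complex) \<longlonglongrightarrow> of_real r"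
proof -
  have "\<exists>q::rat. \<bar>of_rat q - r\<bar> < 1 / real (Suc n)" for n
  proof -
    obtain q :: rat where "r - 1 / real (Suc n) < of_rat q" "of_rat q < r + 1 / real (Suc n)"
      using of_rat_dense[of "r - 1 / real (Suc n)" "r + 1 / real (Suc n)"] by auto
    thus ?thesis by (intro exI[of _ q]) (simp add: abs_less_iff)
  qed
  hence "\<forall>n. \<exists>q::rat. \<bar>of_rat q - r\<bar> < 1 / real (Suc n)" by blast
  from choice[OF this] obtain q :: "nat \<Rightarrow> rat" where q: "\<And>n. \<bar>of_rat (q n) - r\<bar> < 1 / real (Suc n)" by blast
  have "(\<lambda>n. of_rat (q n) - r) \<longlonglongrightarrow> 0"
    by (rule Lim_null_comparison[OF _ LIMSEQ_Suc[OF lim_1_over_n]]) (use q in \<open>auto intro!: always_eventually less_imp_le\<close>)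
  hence "(\<lambda>n. of_rat (q n)) \<longlonglongrightarrow> r" by (simp add: LIM_zero_iff)
  hence "(\<lambda>n. complex_of_real (of_rat (q n))) \<longlonglongrightarrow> of_real r" by (rule tendsto_of_real)
  thus thesis using that by (simp add: complex_of_real_of_rat)
qed

lemma field_set_Reals: "field_set (\<real> :: complex set)"
  by (simp add: field_set_def)

lemma field_set_UNIV: "field_set (UNIV :: complex set)"
  by (simp add: field_set_def)

locale archimedean_completion =
  fixes K :: "'a::field_char_0 set" and \<xi> :: "'a \<Rightarrow> complex"
  assumes K: "field_set K" and \<xi>: "\<xi> \<in> embs K"
begin

definition "R = cauchy_sequences K (place_of K \<xi>)"
text \<open>On the ring of Cauchy sequences this is a ring homomorphism into the complex numbers
  whose kernel is the ideal of null sequences. It identifies the completion with a field of complex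
  numbers and the rational completion with \<open>\<real>\<close>.\<close>

definition "\<Lambda> x = lim (\<lambda>n. \<xi> (x n))"

lemma carrier_R: "x \<in> carrier R \<longleftrightarrow> range x \<subseteq> K \<and> convergent (\<lambda>n. \<xi> (x n))"
proof -
  have "place_of K \<xi> (x m - x n) = dist (\<xi> (x m)) (\<xi> (x n))" if "range x \<subseteq> K" for m n
  proof -
    have "x m \<in> K" "x n \<in> K" using that by auto
    thus ?thesis using field_closed(7)[OF K]
      by (simp add: place_of_apply emb_simps(6)[OF K \<xi>] dist_norm)
  qed
  hence "x \<in> carrier R \<longleftrightarrow> range x \<subseteq> K \<and> Cauchy (\<lambda>n. \<xi> (x n))"
    by (auto simp: R_def cauchy_sequences_def Cauchy_def)
  thus ?thesis by (simp add: Cauchy_convergent_iff)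
qed

lemma R_simps: "(x \<oplus>\<^bsub>R\<^esub> y) = (\<lambda>n. x n + y n)" "(x \<otimes>\<^bsub>R\<^esub> y) = (\<lambda>n. x n * y n)"
  "\<one>\<^bsub>R\<^esub> = (\<lambda>_. 1)" "\<zero>\<^bsub>R\<^esub> = (\<lambda>_. 0)"
  by (simp_all add: R_def cauchy_sequences_def)

lemma R_tendsto: "x \<in> carrier R \<Longrightarrow> (\<lambda>n. \<xi> (x n)) \<longlonglongrightarrow> \<Lambda> x"
  by (simp add: carrier_R \<Lambda>_def convergent_LIMSEQ_iff)

lemma R_I: "range x \<subseteq> K \<Longrightarrow> (\<lambda>n. \<xi> (x n)) \<longlonglongrightarrow> z \<Longrightarrow> x \<in> carrier R \<and> \<Lambda> x = z"
  by (auto simp: carrier_R \<Lambda>_def convergent_def limI)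

lemma R_mem: "x \<in> carrier R \<Longrightarrow> x n \<in> K"
  by (auto simp: carrier_R)

lemma R_ops:
  assumes x: "x \<in> carrier R" and y: "y \<in> carrier R"
  shows "(\<lambda>n. x n + y n) \<in> carrier R \<and> \<Lambda> (\<lambda>n. x n + y n) = \<Lambda> x + \<Lambda> y"
    "(\<lambda>n. x n * y n) \<in> carrier R \<and> \<Lambda> (\<lambda>n. x n * y n) = \<Lambda> x * \<Lambda> y"
proof -
  have mem: "x n \<in> K" "y n \<in> K" for n using R_mem x y by auto
  note emb = emb_simps(3,4)[OF K \<xi> mem] and cl = field_closed(5,6)[OF K mem]
  show "(\<lambda>n. x n + y n) \<in> carrier R \<and> \<Lambda> (\<lambda>n. x n + y n) = \<Lambda> x + \<Lambda> y"
    using cl(1) tendsto_add[OF R_tendsto[OF x] R_tendsto[OF y]] emb(1) by (intro R_I) auto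
  show "(\<lambda>n. x n * y n) \<in> carrier R \<and> \<Lambda> (\<lambda>n. x n * y n) = \<Lambda> x * \<Lambda> y"
    using cl(2) tendsto_mult[OF R_tendsto[OF x] R_tendsto[OF y]] emb(2) by (intro R_I) auto
qed

lemma R_const: "a \<in> K \<Longrightarrow> (\<lambda>_. a) \<in> carrier R \<and> \<Lambda> (\<lambda>_. a) = \<xi> a"
  by (intro R_I) auto

lemma ring_R: "ring R"
proof (rule ringI)
  show "abelian_group R"
  proof (rule abelian_groupI)
    fix x assume x: "x \<in> carrier R"
    have "(\<lambda>n. (- 1) * x n) \<in> carrier R"
      using R_ops(2)[OF conjunct1[OF R_const[of "- 1"]] x] field_closed[OF K] by simp
    thus "\<exists>y\<in>carrier R. y \<oplus>\<^bsub>R\<^esub> x = \<zero>\<^bsub>R\<^esub>" by (intro bexI[of _ "\<lambda>n. (- 1) * x n"]) (auto simp: R_simps)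
  qed (use R_ops(1) R_const[of 0] field_closed(2)[OF K] in \<open>auto simp: R_simps add_ac\<close>)
  show "Group.monoid R"
    by (rule monoidI) (use R_ops(2) R_const[of 1] field_closed(1)[OF K] in \<open>auto simp: R_simps mult_ac\<close>)
qed (auto simp: R_simps distrib_left distrib_right)

lemma null_sequences_kernel: "null_sequences K (place_of K \<xi>) = {x \<in> carrier R. \<Lambda> x = 0}"
proof -
  have "(\<lambda>n. place_of K \<xi> (x n)) \<longlonglongrightarrow> 0 \<longleftrightarrow> \<Lambda> x = 0" if x: "x \<in> carrier R" for x
  proof -
    have "(\<lambda>n. place_of K \<xi> (x n)) = (\<lambda>n. cmod (\<xi> (x n)))" using R_mem[OF x] by (simp add: place_of_apply)
    hence "(\<lambda>n. place_of K \<xi> (x n)) \<longlonglongrightarrow> 0 \<longleftrightarrow> (\<lambda>n. \<xi> (x n)) \<longlonglongrightarrow> 0" by (simp add: tendsto_norm_zero_iff)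
    also have "\<dots> \<longleftrightarrow> \<Lambda> x = 0"
    proof
      assume "(\<lambda>n. \<xi> (x n)) \<longlonglongrightarrow> 0"
      from LIMSEQ_unique[OF R_tendsto[OF x] this] show "\<Lambda> x = 0" .
    next
      assume "\<Lambda> x = 0"
      thus "(\<lambda>n. \<xi> (x n)) \<longlonglongrightarrow> 0" using R_tendsto[OF x] by simp
    qed
    finally show ?thesis .
  qed
  thus ?thesis by (auto simp: null_sequences_def R_def[symmetric])
qed

lemma limits_of_rationals: "\<Lambda> ` {x \<in> carrier R. range x \<subseteq> \<rat>} = \<real>"
proof (intro subset_antisym subsetI)
  fix z assume "z \<in> \<Lambda> ` {x \<in> carrier R. range x \<subseteq> \<rat>}"
  then obtain x where x: "x \<in> carrier R" "range x \<subseteq> \<rat>" "z = \<Lambda> x" by blast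
  have "\<xi> (x n) \<in> \<real>" for n
  proof -
    obtain q where "x n = of_rat q" using x(2) by (meson Rats_cases range_subsetD)
    hence "\<xi> (x n) = complex_of_real (of_rat q)" by (simp add: emb_simps(12)[OF K \<xi>] complex_of_real_of_rat)
    thus ?thesis by simp
  qed
  thus "z \<in> \<real>" unfolding x(3)
    by (intro Lim_in_closed_set[OF closed_complex_Reals _ _ R_tendsto[OF x(1)]]) auto
next
  fix z :: complex assume "z \<in> \<real>"
  then obtain r where r: "z = of_real r" by (auto elim: Reals_cases)
  obtain q :: "nat \<Rightarrow> rat" where q: "(\<lambda>n. of_rat (q n) :: complex) \<longlonglongrightarrow> of_real r" using rational_sequence .
  have "(\<lambda>n. of_rat (q n)) \<in> carrier R \<and> \<Lambda> (\<lambda>n. of_rat (q n)) = z"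
    by (rule R_I) (use q r field_set_of_rat[OF K] in \<open>auto simp: emb_simps(12)[OF K \<xi>]\<close>)
  thus "z \<in> \<Lambda> ` {x \<in> carrier R. range x \<subseteq> \<rat>}" by (intro image_eqI[of _ _ "\<lambda>n. of_rat (q n)"]) auto
qed

text \<open>An embedding that differs from its conjugate takes a nonreal value; together with 1 it
  spans the complex numbers over \<open>\<real>\<close>, and all real numbers are already limits of
  rationals.\<close>

lemma limits_eq: "\<Lambda> ` carrier R = (if conj_embedding K \<xi> = \<xi> then \<real> else UNIV)"
proof (cases "conj_embedding K \<xi> = \<xi>")
  case True
  have real: "\<xi> x \<in> \<real>" if "x \<in> K" for x
    using fun_cong[OF True, of x] that by (simp add: conj_embedding_apply Reals_cnj_iff)
  have "\<Lambda> x \<in> \<real>" if x: "x \<in> carrier R" for x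
    by (rule Lim_in_closed_set[OF closed_complex_Reals _ _ R_tendsto[OF x]]) (use real R_mem[OF x] in auto)
  moreover have "\<real> \<subseteq> \<Lambda> ` carrier R" unfolding limits_of_rationals[symmetric] by blast
  ultimately show ?thesis using True by auto
next
  case False
  then obtain a where a: "a \<in> K" "conj_embedding K \<xi> a \<noteq> \<xi> a"
    using embedding_eqI[OF conj_embedding_in[OF K \<xi>] \<xi>] by blast
  hence "cnj (\<xi> a) \<noteq> \<xi> a" by (simp add: conj_embedding_apply)
  hence im: "Im (\<xi> a) \<noteq> 0" by (auto simp: complex_eq_iff)
  have "z \<in> \<Lambda> ` carrier R" for z
  proof -
    define s where "s = Im z / Im (\<xi> a)"
    define t where "t = Re z - s * Re (\<xi> a)"
    have z: "z = of_real t + of_real s * \<xi> a" using im by (simp add: complex_eq_iff s_def t_def)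
    have "\<real> \<subseteq> \<Lambda> ` carrier R" unfolding limits_of_rationals[symmetric] by blast
    hence st: "of_real t \<in> \<Lambda> ` carrier R" "of_real s \<in> \<Lambda> ` carrier R" using Reals_of_real by (rule subsetD)+
    obtain x where x: "of_real t = \<Lambda> x" "x \<in> carrier R" by (rule imageE[OF st(1)])
    obtain y where y: "of_real s = \<Lambda> y" "y \<in> carrier R" by (rule imageE[OF st(2)])
    note xy = x(2) y(2) x(1)[symmetric] y(1)[symmetric]
    note A = R_const[OF a(1)]
    note B = R_ops(2)[OF xy(2) conjunct1[OF A]]
    note C = R_ops(1)[OF xy(1) conjunct1[OF B]]
    show ?thesis by (rule image_eqI[OF _ conjunct1[OF C]]) (simp only: conjunct2[OF C] conjunct2[OF B] conjunct2[OF A] xy z)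
  qed
  thus ?thesis using False by auto
qed

text \<open>Dimension is transported along \<open>\<psi>\<close>, the inverse of the isomorphism
  that \<open>\<Lambda>\<close> induces on the quotient; \<open>\<psi>\<close> carries
  \<open>\<real>\<close> onto the rational completion.\<close>

lemma local_degree_of_dimension:
  defines "L \<equiv> \<Lambda> ` carrier R"
  assumes L: "field_set L" and d: "ring.dimension (ambient\<lparr>carrier := L\<rparr>) d \<real> L"
    and sub: "subfield \<real> (ambient\<lparr>carrier := L\<rparr>)"
  shows "local_degree K (place_of K \<xi>) = d"
proof -
  define S where "S = (ambient :: complex ring)\<lparr>carrier := L\<rparr>"
  define N where "N = null_sequences K (place_of K \<xi>)"
  define Q where "Q = Defs.completion K (place_of K \<xi>)"
  interpret A: ring "ambient :: complex ring" by (rule ambient_ring)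
  have fieldS: "field S" unfolding S_def using A.subfield_iff(2) L by (simp add: subfield_ambient_iff)
  interpret S: field S by (rule fieldS)
  have S_simps: "carrier S = L" "x \<otimes>\<^bsub>S\<^esub> y = x * y" "x \<oplus>\<^bsub>S\<^esub> y = x + y" "\<one>\<^bsub>S\<^esub> = 1" "\<zero>\<^bsub>S\<^esub> = 0" for x y
    by (simp_all add: S_def)
  have hom: "\<Lambda> \<in> Ring.ring_hom R S"
    by (rule ring_hom_memI) (use R_ops R_const[of 1] field_closed(1)[OF K] emb_simps(1)[OF K \<xi>] in
      \<open>auto simp: S_simps R_simps L_def\<close>)
  interpret h: ring_hom_ring R S \<Lambda>
    by (rule ring_hom_ringI2[OF ring_R S.ring_axioms hom])
  have kerN: "a_kernel R S \<Lambda> = N"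
    unfolding N_def null_sequences_kernel a_kernel_def' S_simps ..
  have Q: "Q = R Quot a_kernel R S \<Lambda>" unfolding kerN by (simp add: Q_def Defs.completion_def R_def N_def)
  have ringQ: "ring Q" unfolding Q by (rule ideal.quotient_is_ring[OF h.kernel_is_ideal])
  define \<kappa> where "\<kappa> = (\<lambda>Y. the_elem (\<Lambda> ` Y))"
  have \<kappa>: "\<kappa> \<in> ring_iso Q S" unfolding \<kappa>_def Q by (rule h.FactRing_iso_set) (simp add: S_simps L_def)
  define \<psi> where "\<psi> = inv_into (carrier Q) \<kappa>"
  have \<psi>: "\<psi> \<in> ring_iso S Q" unfolding \<psi>_def by (rule ring_iso_set_sym[OF ringQ \<kappa>])
  interpret Q: ring Q by (rule ringQ)
  interpret p: ring_hom_ring S Q \<psi>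
    by (rule ring_hom_ringI2[OF S.ring_axioms ringQ]) (use \<psi> in \<open>simp add: ring_iso_def\<close>)
  have bij: "bij_betw \<psi> L (carrier Q)" using ring_iso_memE(5)[OF \<psi>] by (simp add: S_simps)
  have one: "\<one>\<^bsub>Q\<^esub> \<noteq> \<zero>\<^bsub>Q\<^esub>"
  proof
    assume "\<one>\<^bsub>Q\<^esub> = \<zero>\<^bsub>Q\<^esub>"
    hence "\<psi> \<one>\<^bsub>S\<^esub> = \<psi> \<zero>\<^bsub>S\<^esub>" by simp
    hence "\<one>\<^bsub>S\<^esub> = \<zero>\<^bsub>S\<^esub>"
      by (rule inj_onD[OF bij_betw_imp_inj_on[OF bij]]) (use S.one_closed S.zero_closed in \<open>simp_all only: S_simps\<close>)
    thus False by (simp add: S_simps)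
  qed
  define rc where "rc = rational_completion K (place_of K \<xi>)"
  have rc: "rc = (\<lambda>x. N +>\<^bsub>R\<^esub> x) ` {x \<in> carrier R. range x \<subseteq> \<rat>}"
    unfolding rc_def rational_completion_def N_def R_def by auto
  have "N +>\<^bsub>R\<^esub> x \<in> carrier Q" if "x \<in> carrier R" for x
    unfolding Q kerN FactRing_def using that by (auto simp: A_RCOSETS_def' kerN)
  hence rcQ: "rc \<subseteq> carrier Q" unfolding rc by blast
  have "\<kappa> ` rc = \<Lambda> ` {x \<in> carrier R. range x \<subseteq> \<rat>}"
    unfolding rc image_image \<kappa>_def using h.the_elem_simp[unfolded kerN] by (intro image_cong) auto
  hence \<kappa>rc: "\<kappa> ` rc = \<real>" by (simp only: limits_of_rationals)
  have inj\<kappa>: "inj_on \<kappa> (carrier Q)" using ring_iso_memE(5)[OF \<kappa>] by (simp add: bij_betw_def)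
  have \<psi>rc: "\<psi> ` \<real> = rc"
    unfolding \<kappa>rc[symmetric] \<psi>_def by (rule inv_into_image_cancel[OF inj\<kappa> rcQ])
  have \<psi>L: "\<psi> ` L = carrier Q" using bij by (simp add: bij_betw_def)
  have dimQ: "Q.dimension d rc (carrier Q)"
    using p.inj_hom_dimension[OF sub[folded S_def] one _ d[folded S_def]] bij unfolding \<psi>rc \<psi>L by (simp add: bij_betw_def)
  have subQ: "subfield rc Q" using p.img_is_subfield(2)[OF sub[folded S_def] one] unfolding \<psi>rc .
  show ?thesis
    unfolding local_degree_def Q_def[symmetric] rc_def[symmetric] Q.dim_def over_def
    by (rule the_equality[where P = "\<lambda>n. Q.dimension n rc (carrier Q)"], rule dimQ,
        rule Q.dimension_is_inj[OF subQ _ dimQ])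
qed

lemma local_degree_eq: "local_degree K (place_of K \<xi>) = (if conj_embedding K \<xi> = \<xi> then 1 else 2)"
proof (cases "conj_embedding K \<xi> = \<xi>")
  case True
  hence L: "\<Lambda> ` carrier R = \<real>" by (simp add: limits_eq)
  interpret A: ring "ambient :: complex ring" by (rule ambient_ring)
  have fieldS: "field ((ambient :: complex ring)\<lparr>carrier := \<real>\<rparr>)"
    using A.subfield_iff(2) field_set_Reals by (simp add: subfield_ambient_iff)
  interpret S: field "(ambient :: complex ring)\<lparr>carrier := \<real>\<rparr>" by (rule fieldS)
  have sub: "subfield \<real> ((ambient :: complex ring)\<lparr>carrier := \<real>\<rparr>)" using S.carrier_is_subfield by simp
  have "local_degree K (place_of K \<xi>) = 1"
    by (rule local_degree_of_dimension) (use L sub S.dimension_one[OF sub] field_set_Reals in simp_all)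
  thus ?thesis using True by simp
next
  case False
  hence L: "\<Lambda> ` carrier R = UNIV" by (simp add: limits_eq)
  have amb: "(ambient :: complex ring)\<lparr>carrier := UNIV\<rparr> = ambient" by (simp add: ring_of_type_algebra_def)
  have "is_basis \<real> (UNIV :: complex set) 2 (\<lambda>i. if i = 0 then 1 else \<i>)"
    unfolding is_basis_def
  proof (intro conjI subset_antisym subsetI allI impI)
    fix z :: complex
    define c :: "nat \<Rightarrow> complex" where "c i = (if i = 0 then of_real (Re z) else of_real (Im z))" for i
    have "z = c 0 + c 1 * \<i>" by (simp add: c_def complex_eq_iff)
    also have "\<dots> = (\<Sum>i<2. c i * (if i = 0 then 1 else \<i>))"
      unfolding numeral_2_eq_2 sum.lessThan_Suc by simp
    finally have "z = (\<Sum>i<2. c i * (if i = 0 then 1 else \<i>))" .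
    moreover have "\<forall>i<2. c i \<in> \<real>" by (simp add: c_def)
    ultimately show "z \<in> {\<Sum>i<(2::nat). c i * (if i = 0 then 1 else \<i>) | c. \<forall>i<(2::nat). c i \<in> \<real>}" by blast
  next
    fix c :: "nat \<Rightarrow> complex" and i :: nat
    assume c: "\<forall>i<2. c i \<in> \<real>" "(\<Sum>i<2. c i * (if i = 0 then 1 else \<i>)) = 0" and i: "i < 2"
    have "c 0 \<in> \<real>" "c 1 \<in> \<real>" by (rule c(1)[rule_format], simp)+
    hence r: "Im (c 0) = 0" "Im (c 1) = 0" by (simp_all only: complex_is_Real_iff)
    have eq: "c 0 + c 1 * \<i> = 0" using c(2) unfolding numeral_2_eq_2 sum.lessThan_Suc by simp
    have "Re (c 0 + c 1 * \<i>) = 0" "Im (c 0 + c 1 * \<i>) = 0" by (simp_all only: eq zero_complex.sel)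
    hence "c 0 = 0" "c 1 = 0" by (simp_all add: complex_eq_iff r r[unfolded One_nat_def])
    moreover have "i = 0 \<or> i = 1" using i by linarith
    ultimately show "c i = 0" by (elim disjE) (simp_all only:)
  qed auto
  hence dim: "ring.dimension (ambient :: complex ring) 2 \<real> UNIV"
    using dimension_iff_basis[OF field_set_Reals] by blast
  have "local_degree K (place_of K \<xi>) = 2"
  proof (rule local_degree_of_dimension)
    show "field_set (\<Lambda> ` carrier R)" by (simp only: L field_set_UNIV)
    show "ring.dimension (ambient\<lparr>carrier := \<Lambda> ` carrier R\<rparr>) 2 \<real> (\<Lambda> ` carrier R)"
      unfolding L amb by (rule dim)
    show "subfield \<real> (ambient\<lparr>carrier := \<Lambda> ` carrier R\<rparr>)"
      unfolding L amb by (simp only: subfield_ambient_iff field_set_Reals)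
  qed
  thus ?thesis using False by simp
qed

end

text \<open>Both sides are 1 or 2, according to whether \<open>\<xi>\<close> equals its conjugate.
  This is what turns sums weighted by local degrees into plain sums over embeddings.\<close>

lemma local_degree_card:
  assumes K: "field_set K" and \<xi>: "\<xi> \<in> embs K"
  shows "local_degree K (place_of K \<xi>) = card {\<tau> \<in> embs K. place_of K \<tau> = place_of K \<xi>}"
proof -
  interpret archimedean_completion K \<xi> using K \<xi> by unfold_locales
  have "{\<tau> \<in> embs K. place_of K \<tau> = place_of K \<xi>} = {\<tau> \<in> embs K. \<tau> = \<xi> \<or> \<tau> = conj_embedding K \<xi>}"
    by (intro Collect_cong conj_cong refl place_of_eq_iff[OF K \<xi>])
  also have "\<dots> = {\<xi>, conj_embedding K \<xi>}" using conj_embedding_in[OF K \<xi>] \<xi> by blast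
  finally have "card {\<tau> \<in> embs K. place_of K \<tau> = place_of K \<xi>} = card {\<xi>, conj_embedding K \<xi>}" by (rule arg_cong)
  thus ?thesis by (simp add: local_degree_eq eq_commute[of \<xi>])
qed

lemma sum_arch_places:
  fixes f :: "('a::field_char_0 \<Rightarrow> real) \<Rightarrow> real"
  assumes nf: "number_field K"
  shows "(\<Sum>w\<in>arch_places K. real (local_degree K w) * f w) = (\<Sum>\<xi>\<in>embs K. f (place_of K \<xi>))"
proof -
  note K = nf_props(1)[OF nf] and fin = card_embeddings(1)[OF nf]
  have "(\<Sum>\<xi>\<in>embs K. f (place_of K \<xi>)) =
    (\<Sum>w\<in>place_of K ` embs K. \<Sum>\<xi>\<in>{\<tau> \<in> embs K. place_of K \<tau> = w}. f (place_of K \<xi>))"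
    by (rule sum.group[OF fin finite_imageI[OF fin], symmetric]) simp
  also have "\<dots> = (\<Sum>w\<in>place_of K ` embs K. real (local_degree K w) * f w)"
  proof (intro sum.cong refl)
    fix w assume "w \<in> place_of K ` embs K"
    then obtain \<xi> where \<xi>: "\<xi> \<in> embs K" "w = place_of K \<xi>" by blast
    have "(\<Sum>\<xi>\<in>{\<tau> \<in> embs K. place_of K \<tau> = w}. f (place_of K \<xi>)) =
        (\<Sum>\<xi>\<in>{\<tau> \<in> embs K. place_of K \<tau> = w}. f w)" by (intro sum.cong refl) simp
    also have "\<dots> = real (local_degree K w) * f w"
      using local_degree_card[OF K \<xi>(1)] \<xi>(2) by simp
    finally show "(\<Sum>\<xi>\<in>{\<tau> \<in> embs K. place_of K \<tau> = w}. f (place_of K \<xi>)) = real (local_degree K w) * f w" .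
  qed
  finally show ?thesis by (simp add: arch_places_eq[OF nf])
qed

section \<open>Units and Dirichlet's theorem\<close>

lemma algebraic_int_embedding_iff:
  assumes K: "field_set K" and \<xi>: "\<xi> \<in> embs K" and x: "x \<in> K"
  shows "algebraic_int (\<xi> x) \<longleftrightarrow> algebraic_int x"
proof -
  have eq: "poly (of_int_poly P) (\<xi> x) = \<xi> (poly (of_int_poly P) x)" for P :: "int poly"
  proof -
    have mem: "of_int c * x ^ i \<in> K" for c i
      using field_set_of_int[OF K] field_closed(9)[OF K x] by (rule field_closed(6)[OF K])
    have "\<xi> (poly (of_int_poly P) x) = \<xi> (\<Sum>i\<le>Polynomial.degree P. of_int (poly.coeff P i) * x ^ i)"
      by (simp add: poly_altdef)
    also have "\<dots> = (\<Sum>i\<le>Polynomial.degree P. \<xi> (of_int (poly.coeff P i) * x ^ i))"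
      by (rule embedding_sum[OF K \<xi>]) (rule mem)
    also have "\<dots> = (\<Sum>i\<le>Polynomial.degree P. of_int (poly.coeff P i) * \<xi> x ^ i)"
      using emb_simps(4,10,11)[OF K \<xi>] field_set_of_int[OF K] field_closed(9)[OF K x] x by simp
    finally show ?thesis by (simp add: poly_altdef)
  qed
  have mem: "poly (of_int_poly P) x \<in> K" for P :: "int poly"
    unfolding poly_altdef using field_set_of_int[OF K] field_closed(9)[OF K x]
    by (intro field_set_sum[OF K] field_closed(6)[OF K]) auto
  show ?thesis unfolding algebraic_int_altdef_ipoly eq by (simp only: emb_simps(9)[OF K \<xi> mem])
qed

lemma number_field_Rats: "number_field (\<rat> :: 'a::field_char_0 set)"
proof -
  interpret R: ring "ambient :: 'a ring" by (rule ambient_ring)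
  have "subfield \<rat> (ambient :: 'a ring)" by (simp add: subfield_ambient_iff field_set_Rats)
  thus ?thesis using R.dimension_one by (auto simp: number_field_def R.finite_dimension_def)
qed

text \<open>Every embedding of \<open>K\<close> extends the unique embedding of
  \<open>\<rat>\<close>, so the product is the relative norm over \<open>\<rat>\<close>.\<close>

lemma norm_rational:
  assumes nf: "number_field K" and x: "x \<in> K"
  shows "(\<Prod>\<xi>\<in>embs K. \<xi> x) \<in> \<rat>"
proof -
  note K = nf_props(1)[OF nf]
  obtain \<xi>0 :: "'a \<Rightarrow> complex" where \<xi>0: "\<xi>0 \<in> embs \<rat>" using embeddings_Rats_exists by blast
  have E: "embs K = extensions \<rat> K \<xi>0"
    using embeddings_Rats_unique[OF embedding_restrict[OF _ Rats_subset_field_set[OF K] field_set_Rats] \<xi>0]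
    by (auto simp: extensions_def)
  note N = field_norm_conjugates[OF number_field_Rats nf Rats_subset_field_set[OF K] x]
  obtain q where "field_norm \<rat> K x = of_rat q" using N(1) by (rule Rats_cases)
  hence "(\<Prod>\<xi>\<in>embs K. \<xi> x) = of_rat q"
    using N(2)[OF \<xi>0] emb_simps(12)[OF field_set_Rats \<xi>0] E by simp
  thus ?thesis by simp
qed

lemma norm_integer:
  assumes nf: "number_field K" and x: "x \<in> K" "algebraic_int x"
  obtains m :: int where "(\<Prod>\<xi>\<in>embs K. \<xi> x) = of_int m"
proof -
  have "algebraic_int (\<Prod>\<xi>\<in>embs K. \<xi> x)"
    by (intro algebraic_int_prod) (use x algebraic_int_embedding_iff[OF nf_props(1)[OF nf] _ x(1)] in simp)
  from rational_algebraic_int_is_int[OF this norm_rational[OF nf x(1)]] that show thesis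
    by (auto elim: Ints_cases)
qed

lemma abs_norm_ge_1:
  assumes nf: "number_field K" and x: "x \<in> K" "algebraic_int x" "x \<noteq> 0"
  shows "(\<Prod>\<xi>\<in>embs K. cmod (\<xi> x)) \<ge> 1"
proof -
  obtain m :: int where m: "(\<Prod>\<xi>\<in>embs K. \<xi> x) = of_int m" by (rule norm_integer[OF nf x(1,2)])
  have "(\<Prod>\<xi>\<in>embs K. \<xi> x) \<noteq> 0"
    using card_embeddings(1)[OF nf] x(1,3) emb_simps(9)[OF nf_props(1)[OF nf]] by simp
  hence "m \<noteq> 0" using m by auto
  moreover have "(\<Prod>\<xi>\<in>embs K. cmod (\<xi> x)) = of_int \<bar>m\<bar>"
    unfolding prod_norm m by simp
  ultimately show ?thesis by simp
qed

lemma embeddings_nonempty: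
  assumes nf: "number_field K"
  shows "embs K \<noteq> {}"
proof
  assume "embs K = {}"
  hence "number_field_degree K = 0" using card_embeddings(2)[OF nf] by simp
  then obtain b where "is_basis \<rat> K 0 b" using nf_props(2)[OF nf] by auto
  from is_basisD(1)[OF this field_closed(1)[OF nf_props(1)[OF nf]]] show False by simp
qed

text \<open>The map \<open>g\<close> records the squares of side one half that contain the
  conjugates. Two integers with the same record differ by an integer all of whose conjugates have
  modulus below 1; a nonzero one would have norm below 1.\<close>

lemma finite_bounded_integers:
  assumes nf: "number_field K"
  shows "finite {x \<in> K. algebraic_int x \<and> (\<forall>\<xi>\<in>embs K. cmod (\<xi> x) \<le> B)}"
proof -
  note K = nf_props(1)[OF nf] and fin = card_embeddings(1)[OF nf]
  define g where "g x = (\<lambda>\<xi>\<in>embs K. (\<lfloor>2 * Re (\<xi> x)\<rfloor>, \<lfloor>2 * Im (\<xi> x)\<rfloor>))" for x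
  define M where "M = \<lceil>2 * \<bar>B\<bar>\<rceil>"
  let ?S = "{x \<in> K. algebraic_int x \<and> (\<forall>\<xi>\<in>embs K. cmod (\<xi> x) \<le> B)}"
  have "g ` ?S \<subseteq> Pi\<^sub>E (embs K) (\<lambda>_. {-M - 1..M} \<times> {-M - 1..M})"
  proof
    fix y assume "y \<in> g ` ?S"
    then obtain x where x: "x \<in> ?S" "y = g x" by blast
    have "\<lfloor>2 * r\<rfloor> \<in> {-M - 1..M}" if "\<bar>r\<bar> \<le> \<bar>B\<bar>" for r
    proof -
      have "- real_of_int M \<le> 2 * r" "2 * r \<le> real_of_int M" using that unfolding M_def by linarith+
      thus ?thesis by (simp add: le_floor_iff floor_le_iff)
    qed
    moreover have "\<bar>Re (\<xi> x)\<bar> \<le> \<bar>B\<bar>" "\<bar>Im (\<xi> x)\<bar> \<le> \<bar>B\<bar>" if "\<xi> \<in> embs K" for \<xi>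
    proof -
      have "cmod (\<xi> x) \<le> B" using x(1) that by simp
      thus "\<bar>Re (\<xi> x)\<bar> \<le> \<bar>B\<bar>" "\<bar>Im (\<xi> x)\<bar> \<le> \<bar>B\<bar>"
        using abs_Re_le_cmod[of "\<xi> x"] abs_Im_le_cmod[of "\<xi> x"] by linarith+
    qed
    ultimately show "y \<in> Pi\<^sub>E (embs K) (\<lambda>_. {-M - 1..M} \<times> {-M - 1..M})"
      unfolding x(2) g_def by (intro restrict_PiE_iff[THEN iffD2] ballI SigmaI) blast+
  qed
  moreover have "finite (Pi\<^sub>E (embs K) (\<lambda>_. {-M - 1..M} \<times> {-M - 1..M}))"
    by (rule finite_PiE[OF fin]) auto
  ultimately have "finite (g ` ?S)" by (rule finite_subset)
  moreover have "inj_on g ?S"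
  proof (rule inj_onI, rule ccontr)
    fix x y assume x: "x \<in> ?S" and y: "y \<in> ?S" and eq: "g x = g y" and ne: "x \<noteq> y"
    have xy: "x - y \<in> K" "algebraic_int (x - y)" "x - y \<noteq> 0"
      using x y ne field_closed(7)[OF K] algebraic_int_diff by auto
    have small: "cmod (\<xi> (x - y)) < 1" if \<xi>: "\<xi> \<in> embs K" for \<xi>
    proof -
      have "\<lfloor>2 * Re (\<xi> x)\<rfloor> = \<lfloor>2 * Re (\<xi> y)\<rfloor>" "\<lfloor>2 * Im (\<xi> x)\<rfloor> = \<lfloor>2 * Im (\<xi> y)\<rfloor>"
        using fun_cong[OF eq, of \<xi>] \<xi> by (auto simp: g_def)
      hence "\<bar>Re (\<xi> x) - Re (\<xi> y)\<bar> < 1 / 2" "\<bar>Im (\<xi> x) - Im (\<xi> y)\<bar> < 1 / 2" by linarith+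
      moreover have "\<xi> (x - y) = \<xi> x - \<xi> y" using emb_simps(6)[OF K \<xi>] x y by blast
      moreover have "cmod (\<xi> x - \<xi> y) \<le> \<bar>Re (\<xi> x - \<xi> y)\<bar> + \<bar>Im (\<xi> x - \<xi> y)\<bar>" by (rule cmod_le)
      ultimately show ?thesis by simp
    qed
    obtain \<xi>1 where \<xi>1: "\<xi>1 \<in> embs K" using embeddings_nonempty[OF nf] by blast
    have "(\<Prod>\<xi>\<in>embs K. cmod (\<xi> (x - y))) = cmod (\<xi>1 (x - y)) * (\<Prod>\<xi>\<in>embs K - {\<xi>1}. cmod (\<xi> (x - y)))"
      by (rule prod.remove[OF fin \<xi>1])
    also have "\<dots> \<le> cmod (\<xi>1 (x - y)) * 1"
      using small by (intro mult_left_mono prod_le_1) (auto intro: less_imp_le)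
    also have "\<dots> < 1" using small[OF \<xi>1] by simp
    finally show False using abs_norm_ge_1[OF nf xy] by simp
  qed
  ultimately show ?thesis by (rule finite_imageD)
qed

lemma common_denominator:
  fixes f :: "'i \<Rightarrow> rat"
  assumes "finite S"
  shows "\<exists>D::int. D > 0 \<and> (\<forall>s\<in>S. of_int D * f s \<in> \<int>)"
  using assms
proof (induction rule: finite_induct)
  case empty
  show ?case by (intro exI[of _ 1]) auto
next
  case (insert s S)
  then obtain D where D: "D > 0" "\<forall>s\<in>S. of_int D * f s \<in> \<int>" by blast
  obtain a b where ab: "quotient_of (f s) = (a, b)" by (cases "quotient_of (f s)")
  have b: "b > 0" "f s = of_int a / of_int b" using quotient_of_denom_pos[OF ab] quotient_of_div[OF ab] by auto
  have "of_int (D * b) * f s = of_int (D * a)" using b by simp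
  hence "of_int (D * b) * f s \<in> \<int>" by (metis Ints_of_int)
  moreover have "of_int (D * b) * f t \<in> \<int>" if "t \<in> S" for t
  proof -
    have "of_int b * (of_int D * f t) \<in> \<int>" by (rule Ints_mult[OF Ints_of_int bspec[OF D(2) that]])
    thus ?thesis by (simp add: mult_ac)
  qed
  ultimately show ?case using D(1) b(1) by (intro exI[of _ "D * b"]) auto
qed

text \<open>Clearing denominators in the multiplication table of a basis turns it into an integral system.\<close>

lemma integral_basis:
  assumes nf: "number_field K"
  shows "\<exists>b. is_basis \<rat> K (number_field_degree K) b \<and> (\<forall>j<number_field_degree K. algebraic_int (b j))"
proof -
  note K = nf_props(1)[OF nf]
  define n where "n = number_field_degree K"
  obtain b where b: "is_basis \<rat> K n b" using nf_props(2)[OF nf] n_def by blast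
  have bK: "b j \<in> K" if "j < n" for j by (rule is_basis_mem[OF field_set_Rats b that])
  have ex: "\<exists>c::nat \<Rightarrow> rat. i < n \<longrightarrow> j < n \<longrightarrow> b i * b j = (\<Sum>k<n. of_rat (c k) * b k)" for i j
  proof (cases "i < n \<and> j < n")
    case True
    then obtain a where a: "\<forall>k<n. a k \<in> \<rat>" "b i * b j = (\<Sum>k<n. a k * b k)"
      using is_basisD(1)[OF b field_closed(6)[OF K bK bK]] by blast
    have "\<forall>k. \<exists>q. k < n \<longrightarrow> a k = of_rat q" using a(1) by (auto elim!: Rats_cases)
    then obtain c where c: "\<And>k. k < n \<longrightarrow> a k = of_rat (c k)" by metis
    have "(\<Sum>k<n. a k * b k) = (\<Sum>k<n. of_rat (c k) * b k)" by (intro sum.cong refl) (simp add: c)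
    thus ?thesis using a(2) by auto
  qed auto
  define c :: "nat \<Rightarrow> nat \<Rightarrow> nat \<Rightarrow> rat"
    where "c i j = (SOME c. i < n \<longrightarrow> j < n \<longrightarrow> b i * b j = (\<Sum>k<n. of_rat (c k) * b k))" for i j
  have c: "b i * b j = (\<Sum>k<n. of_rat (c i j k) * b k)" if "i < n" "j < n" for i j
    using someI_ex[OF ex[of i j]] that unfolding c_def by blast
  obtain D :: int where D: "D > 0" "\<forall>s\<in>{..<n} \<times> {..<n} \<times> {..<n}. of_int D * (case s of (i, j, k) \<Rightarrow> c i j k) \<in> \<int>"
    using common_denominator[of "{..<n} \<times> {..<n} \<times> {..<n}" "\<lambda>(i, j, k). c i j k"] by auto
  define d where "d i j k = \<lfloor>of_int D * c i j k\<rfloor>" for i j k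
  have d: "of_int (d i j k) = (of_rat (of_int D * c i j k) :: 'a)" if "i < n" "j < n" "k < n" for i j k
  proof -
    have "of_int D * c i j k \<in> \<int>" using D(2) that by auto
    then obtain m where "of_int D * c i j k = of_int m" by (rule Ints_cases)
    thus ?thesis by (simp add: d_def)
  qed
  have alg: "algebraic_int (of_int D * b i)" if i: "i < n" for i
  proof (rule algebraic_int_of_integral_system[of "{..<n}"])
    fix j assume "j \<in> {..<n}"
    hence j: "j < n" by simp
    have "of_int D * b i * b j = of_int D * (\<Sum>k<n. of_rat (c i j k) * b k)" using c[OF i j] by (simp add: mult.assoc)
    also have "\<dots> = (\<Sum>k<n. of_int (d i j k) * b k)"
      unfolding sum_distrib_left by (intro sum.cong refl) (simp add: d i j of_rat_mult)
    finally show "of_int D * b i * b j = (\<Sum>k<n. of_int (d i j k) * b k)" .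
  next
    show "b i \<noteq> 0"
    proof
      assume 0: "b i = 0"
      have "(\<Sum>k<n. (if k = i then 1 else 0) * b k) = (\<Sum>k<n. if k = i then b k else 0)" by (intro sum.cong) auto
      also have "\<dots> = 0" using 0 i by simp
      finally have s0: "(\<Sum>k<n. (if k = i then 1 else 0) * b k) = 0" .
      have "(if i = i then 1 else 0) = (0::'a)"
        by (rule is_basisD(3)[OF b, where c = "\<lambda>k. if k = i then 1 else 0", OF _ s0 i]) simp
      thus False by simp
    qed
  qed (use i in auto)
  have D0: "of_int D \<noteq> (0::'a)" using D(1) by simp
  have "is_basis \<rat> K n (\<lambda>i. of_int D * b i)" unfolding is_basis_def
  proof (intro conjI subset_antisym subsetI allI impI)
    fix x assume "x \<in> K"
    then obtain a where a: "\<forall>i<n. a i \<in> \<rat>" "x = (\<Sum>i<n. a i * b i)" using is_basisD(1)[OF b] by blast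
    have "x = (\<Sum>i<n. a i / of_int D * (of_int D * b i))" using a(2) D0 by simp
    moreover have "\<forall>i<n. a i / of_int D \<in> \<rat>" using a(1) by simp
    ultimately show "x \<in> {\<Sum>i<n. a i * (of_int D * b i) | a. \<forall>i<n. a i \<in> \<rat>}"
      by (intro CollectI exI[of _ "\<lambda>i. a i / of_int D"] conjI)
  next
    fix x assume "x \<in> {\<Sum>i<n. a i * (of_int D * b i) | a. \<forall>i<n. a i \<in> \<rat>}"
    then obtain a where a: "x = (\<Sum>i<n. a i * (of_int D * b i))" "\<forall>i<n. a i \<in> \<rat>" by blast
    have "(\<Sum>i<n. (a i * of_int D) * b i) \<in> K" by (rule is_basisD(2)[OF b]) (use a(2) in simp)
    thus "x \<in> K" using a(1) by (simp add: mult.assoc)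
  next
    fix a i assume a: "\<forall>i<n. a i \<in> \<rat>" "(\<Sum>i<n. a i * (of_int D * b i)) = 0" and i: "i < n"
    have "a i * of_int D = 0"
      by (rule is_basisD(3)[OF b, where c = "\<lambda>i. a i * of_int D"]) (use a i in \<open>auto simp: mult.assoc\<close>)
    thus "a i = 0" using D0 by simp
  qed
  thus ?thesis using alg unfolding n_def[symmetric] by (intro exI[of _ "\<lambda>i. of_int D * b i"]) simp
qed

section \<open>Dirichlet's construction of units\<close>

text \<open>A pigeonhole on integer vectors with entries in \<open>0..H\<close>: two of them have
  nearly equal conjugates on all of \<open>F\<close>. Their difference is small on \<open>F\<close>
  and of size \<open>H\<close> elsewhere, and the exponents are balanced so that the bound
  \<open>C\<close> on the norm is independent of the parameter \<open>T\<close>.\<close>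

lemma small_conjugates:
  assumes nf: "number_field K" and b: "is_basis \<rat> K n b" and n: "n = number_field_degree K"
    and F: "F \<subset> embs K" and conj: "\<And>\<xi>. \<xi> \<in> F \<Longrightarrow> conj_embedding K \<xi> \<in> F"
  shows "\<exists>C. \<forall>\<epsilon>>0. \<exists>z::nat \<Rightarrow> int. (\<exists>j<n. z j \<noteq> 0) \<and>
    (\<forall>\<xi>\<in>F. cmod (\<xi> (\<Sum>j<n. of_int (z j) * b j)) < \<epsilon>) \<and>
    (\<Prod>\<xi>\<in>embs K. cmod (\<xi> (\<Sum>j<n. of_int (z j) * b j))) \<le> C"
proof -
  note K = nf_props(1)[OF nf] and fin = card_embeddings(1)[OF nf]
  have bK: "b j \<in> K" if "j < n" for j by (rule is_basis_mem[OF field_set_Rats b that])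
  define E where "E = embs K"
  have finF: "finite F" using F fin finite_subset by blast
  define f where "f = card F"
  have fn: "f < n" unfolding f_def n card_embeddings(2)[OF nf, symmetric] by (rule psubset_card_mono[OF fin F])
  define ev where "ev \<xi> z = (\<Sum>j<n. of_int (z j) * \<xi> (b j))" for \<xi> :: "'a \<Rightarrow> complex" and z :: "nat \<Rightarrow> int"
  have ev: "\<xi> (\<Sum>j<n. of_int (z j) * b j) = ev \<xi> z" if \<xi>: "\<xi> \<in> E" for \<xi> z
  proof -
    have \<xi>: "\<xi> \<in> embs K" using \<xi> by (simp add: E_def)
    have "\<xi> (\<Sum>j<n. of_int (z j) * b j) = (\<Sum>j<n. \<xi> (of_int (z j) * b j))"
      by (rule embedding_sum[OF K \<xi>]) (use bK field_set_of_int[OF K] in \<open>auto intro!: field_closed(6)[OF K]\<close>)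
    also have "\<dots> = ev \<xi> z" unfolding ev_def
      by (intro sum.cong refl) (simp add: emb_simps(4,11)[OF K \<xi>] bK field_set_of_int[OF K])
    finally show ?thesis .
  qed
  \<comment> \<open>The factor 2 pays for bounding \<open>Re + Im\<close> by the modulus; the
    summand 1 keeps \<open>c\<close> positive.\<close>
  define c where "c = 1 + 2 * (\<Sum>\<xi>\<in>E. \<Sum>j<n. cmod (\<xi> (b j)))"
  have c1: "c \<ge> 1" unfolding c_def by (intro add_increasing2 mult_nonneg_nonneg sum_nonneg) auto
  have evb: "2 * cmod (ev \<xi> z) \<le> c * H" if \<xi>: "\<xi> \<in> E" and z: "\<And>j. j < n \<Longrightarrow> \<bar>of_int (z j)\<bar> \<le> H" and H: "H \<ge> 0" for \<xi> z H
  proof -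
    have "cmod (ev \<xi> z) \<le> (\<Sum>j<n. cmod (of_int (z j) * \<xi> (b j)))" unfolding ev_def by (rule norm_sum)
    also have "\<dots> \<le> (\<Sum>j<n. H * cmod (\<xi> (b j)))"
      using z by (intro sum_mono) (auto simp: norm_mult intro!: mult_right_mono)
    also have "\<dots> = H * (\<Sum>j<n. cmod (\<xi> (b j)))" by (simp add: sum_distrib_left)
    also have "\<dots> \<le> H * (\<Sum>\<xi>\<in>E. \<Sum>j<n. cmod (\<xi> (b j)))"
      using fin H by (intro mult_left_mono member_le_sum[OF \<xi>, of "\<lambda>\<xi>. \<Sum>j<n. cmod (\<xi> (b j))"] sum_nonneg) (auto simp: E_def)
    finally have "2 * cmod (ev \<xi> z) \<le> H * (2 * (\<Sum>\<xi>\<in>E. \<Sum>j<n. cmod (\<xi> (b j))))" by simp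
    also have "\<dots> \<le> H * c" unfolding c_def using H by (intro mult_left_mono) auto
    finally show ?thesis by (simp add: mult.commute)
  qed
  \<comment> \<open>One real linear form per embedding, real or complex. For the conjugate
    embedding, also in \<open>F\<close>, the form is \<open>Re - Im\<close>, and the two together
    control the modulus.\<close>
  define \<phi> where "\<phi> \<xi> z = Re (ev \<xi> z) + Im (ev \<xi> z)" for \<xi> z
  have \<phi>b: "\<bar>\<phi> \<xi> z\<bar> \<le> c * H" if "\<xi> \<in> E" "\<And>j. j < n \<Longrightarrow> \<bar>of_int (z j)\<bar> \<le> H" "H \<ge> 0" for \<xi> z H
  proof -
    have "2 * cmod (ev \<xi> z) \<le> c * H" by (rule evb) (use that in auto)
    thus ?thesis using abs_Re_le_cmod[of "ev \<xi> z"] abs_Im_le_cmod[of "ev \<xi> z"] unfolding \<phi>_def by linarith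
  qed
  \<comment> \<open>One factor \<open>8 * c\<close> for each embedding in \<open>F\<close> and one
    factor \<open>c\<close> for each of the others. The 8 is a factor 2 each for the pair of forms,
    for the length \<open>2 * c * H\<close> of the range and for the quotient of
    \<open>T ^ n\<close> by \<open>q\<close>.\<close>
  define C where "C = (8 * c) ^ f * c ^ (n - f)"
  have "\<exists>z::nat \<Rightarrow> int. (\<exists>j<n. z j \<noteq> 0) \<and> (\<forall>\<xi>\<in>F. cmod (ev \<xi> z) < \<epsilon>) \<and> (\<Prod>\<xi>\<in>E. cmod (ev \<xi> z)) \<le> C" if \<epsilon>: "\<epsilon> > 0" for \<epsilon>
  proof -
    obtain T0 :: nat where T0: "8 * c / \<epsilon> < real T0" using reals_Archimedean2 by blast
    define T where "T = T0 + 2"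
    have T: "T \<ge> 2" "8 * c / \<epsilon> < real T" using T0 by (auto simp: T_def)
    define H where "H = T ^ f"
    \<comment> \<open>The floors take values in \<open>0..q\<close>, so there are
      \<open>T ^ n\<close> cells for each embedding in \<open>F\<close> and \<open>H ^ n\<close>
      cells in all, fewer than the number of vectors in \<open>Z\<close>.\<close>
    define q where "q = T ^ n - 1"
    have Tn: "T ^ n \<ge> 2" using T(1) fn power_increasing[of 1 n T] by simp
    have q: "q + 1 = T ^ n" "2 * q \<ge> T ^ n" "q > 0" using Tn by (auto simp: q_def)
    have H0: "H > 0" using T(1) by (simp add: H_def)
    define Z where "Z = Pi\<^sub>E {..<n} (\<lambda>_. {0..int H})"
    define s where "s = 2 * c * real H"
    have s0: "s > 0" using c1 H0 by (simp add: s_def)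
    define g where "g z = (\<lambda>\<xi>\<in>F. \<lfloor>(\<phi> \<xi> z + c * real H) * real q / s\<rfloor>)" for z
    have gZ: "g ` Z \<subseteq> Pi\<^sub>E F (\<lambda>_. {0..int q})"
    proof
      fix y assume "y \<in> g ` Z"
      then obtain z where z: "z \<in> Z" "y = g z" by blast
      have "\<lfloor>(\<phi> \<xi> z + c * real H) * real q / s\<rfloor> \<in> {0..int q}" if \<xi>: "\<xi> \<in> F" for \<xi>
      proof -
        have "\<bar>of_int (z j)\<bar> \<le> real H" if "j < n" for j
        proof -
          have "z j \<in> {0..int H}" by (rule PiE_mem[OF z(1)[unfolded Z_def]]) (use that in simp)
          thus ?thesis by simp
        qed
        hence "\<bar>\<phi> \<xi> z\<bar> \<le> c * real H" using F \<xi> by (intro \<phi>b) (auto simp: E_def)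
        hence "0 \<le> \<phi> \<xi> z + c * real H" "\<phi> \<xi> z + c * real H \<le> s" by (auto simp: s_def)
        hence "0 \<le> (\<phi> \<xi> z + c * real H) * real q" "(\<phi> \<xi> z + c * real H) * real q \<le> s * real q"
          by (simp, intro mult_right_mono) auto
        hence "0 \<le> (\<phi> \<xi> z + c * real H) * real q / s" "(\<phi> \<xi> z + c * real H) * real q / s \<le> real q"
          using s0 by (simp_all add: divide_le_eq mult.commute)
        thus ?thesis by (auto simp: floor_le_iff le_floor_iff)
      qed
      thus "y \<in> Pi\<^sub>E F (\<lambda>_. {0..int q})" unfolding z(2) g_def by (intro restrict_PiE_iff[THEN iffD2] ballI)
    qed
    have "card (g ` Z) \<le> card (Pi\<^sub>E F (\<lambda>_. {0..int q}))"
      by (intro card_mono gZ finite_PiE finF) auto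
    also have "\<dots> = (q + 1) ^ f" using finF by (simp add: card_PiE f_def nat_add_distrib)
    also have "\<dots> = H ^ n" unfolding q(1) H_def by (simp add: power_mult[symmetric] mult.commute)
    also have "\<dots> < (H + 1) ^ n" using fn by (intro power_strict_mono) auto
    also have "\<dots> = card Z" by (simp add: Z_def card_PiE nat_add_distrib)
    finally have "\<not> inj_on g Z" by (rule pigeonhole)
    then obtain z z' where zz: "z \<in> Z" "z' \<in> Z" "g z = g z'" "z \<noteq> z'" unfolding inj_on_def by blast
    define d where "d j = z j - z' j" for j
    have dne: "\<exists>j<n. d j \<noteq> 0"
    proof (rule ccontr)
      assume "\<not> ?thesis"
      hence "z = z'" by (intro PiE_ext[OF zz(1)[unfolded Z_def] zz(2)[unfolded Z_def]]) (simp add: d_def)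
      with zz(4) show False by simp
    qed
    have dH: "\<bar>of_int (d j)\<bar> \<le> real H" if "j < n" for j
    proof -
      have "z j \<in> {0..int H}" by (rule PiE_mem[OF zz(1)[unfolded Z_def]]) (use that in simp)
      moreover have "z' j \<in> {0..int H}" by (rule PiE_mem[OF zz(2)[unfolded Z_def]]) (use that in simp)
      ultimately have "\<bar>d j\<bar> \<le> int H" unfolding d_def atLeastAtMost_iff by linarith
      thus ?thesis by linarith
    qed
    have evd: "ev \<xi> d = ev \<xi> z - ev \<xi> z'" for \<xi> unfolding ev_def d_def by (simp add: left_diff_distrib sum_subtractf)
    have small: "\<bar>\<phi> \<xi> d\<bar> \<le> s / real q" if \<xi>: "\<xi> \<in> F" for \<xi>
    proof -
      have "\<lfloor>(\<phi> \<xi> z + c * real H) * real q / s\<rfloor> = \<lfloor>(\<phi> \<xi> z' + c * real H) * real q / s\<rfloor>"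
        using fun_cong[OF zz(3), of \<xi>] \<xi> by (simp add: g_def)
      hence "\<bar>(\<phi> \<xi> z + c * real H) * real q / s - (\<phi> \<xi> z' + c * real H) * real q / s\<bar> < 1" by linarith
      also have "(\<phi> \<xi> z + c * real H) * real q / s - (\<phi> \<xi> z' + c * real H) * real q / s = \<phi> \<xi> d * (real q / s)"
        by (simp add: \<phi>_def evd algebra_simps diff_divide_distrib add_divide_distrib)
      finally have "\<bar>\<phi> \<xi> d\<bar> * (real q / s) < 1" using s0 q(3) by (simp add: abs_mult)
      thus ?thesis using s0 q(3) by (simp add: field_simps)
    qed
    have evF: "cmod (ev \<xi> d) \<le> 8 * c * real (T ^ f) / real (T ^ n)" if \<xi>: "\<xi> \<in> F" for \<xi>
    proof -
      have "ev (conj_embedding K \<xi>) d = cnj (ev \<xi> d)"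
        unfolding ev_def using bK by (simp add: conj_embedding_apply)
      hence "\<phi> (conj_embedding K \<xi>) d = Re (ev \<xi> d) - Im (ev \<xi> d)" by (simp add: \<phi>_def)
      hence "cmod (ev \<xi> d) \<le> \<bar>\<phi> \<xi> d\<bar> + \<bar>\<phi> (conj_embedding K \<xi>) d\<bar>"
        using cmod_le[of "ev \<xi> d"] unfolding \<phi>_def by linarith
      also have "\<dots> \<le> 2 * (s / real q)" using small[OF \<xi>] small[OF conj[OF \<xi>]] by linarith
      also have "\<dots> \<le> 2 * (s / (real (T ^ n) / 2))"
      proof -
        have "real (T ^ n) / 2 \<le> real q" using q(2) by linarith
        thus ?thesis using s0 Tn q(3) T(1) by (intro mult_left_mono divide_left_mono mult_pos_pos) auto
      qed
      also have "\<dots> = 8 * c * real (T ^ f) / real (T ^ n)" by (simp add: s_def H_def)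
      finally show ?thesis .
    qed
    have Tpos: "real T > 0" using T(1) by simp
    have lt: "cmod (ev \<xi> d) < \<epsilon>" if \<xi>: "\<xi> \<in> F" for \<xi>
    proof -
      have "real (T ^ f) * real T \<le> real (T ^ n)"
        using power_increasing[of "Suc f" n "real T"] fn T(1) by (simp add: mult.commute)
      hence "8 * c * real (T ^ f) / real (T ^ n) \<le> 8 * c / real T"
        using c1 Tpos by (simp add: divide_simps mult_left_mono)
      also have "\<dots> < \<epsilon>" using T(2) \<epsilon> Tpos by (simp add: field_simps)
      finally show ?thesis using evF[OF \<xi>] by linarith
    qed
    have "(\<Prod>\<xi>\<in>E. cmod (ev \<xi> d)) = (\<Prod>\<xi>\<in>E - F. cmod (ev \<xi> d)) * (\<Prod>\<xi>\<in>F. cmod (ev \<xi> d))"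
      using F fin by (intro prod.subset_diff) (auto simp: E_def)
    also have "\<dots> \<le> (\<Prod>\<xi>\<in>E - F. c * real H) * (\<Prod>\<xi>\<in>F. 8 * c * real (T ^ f) / real (T ^ n))"
    proof (rule mult_mono)
      show "(\<Prod>\<xi>\<in>E - F. cmod (ev \<xi> d)) \<le> (\<Prod>\<xi>\<in>E - F. c * real H)"
      proof (intro prod_mono conjI norm_ge_zero)
        fix \<xi> assume "\<xi> \<in> E - F"
        hence "2 * cmod (ev \<xi> d) \<le> c * real H" by (intro evb dH) auto
        thus "cmod (ev \<xi> d) \<le> c * real H" using norm_ge_zero[of "ev \<xi> d"] by linarith
      qed
      show "(\<Prod>\<xi>\<in>F. cmod (ev \<xi> d)) \<le> (\<Prod>\<xi>\<in>F. 8 * c * real (T ^ f) / real (T ^ n))"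
        using evF by (intro prod_mono) auto
    qed (use c1 in \<open>auto intro!: prod_nonneg\<close>)
    also have "\<dots> = (c * real H) ^ (n - f) * (8 * c * real (T ^ f) / real (T ^ n)) ^ f"
      using card_Diff_subset[OF finF, of E] F card_embeddings(2)[OF nf] by (simp add: f_def n E_def psubset_eq)
    also have "\<dots> = C * (real T ^ (f * (n - f)) * real T ^ (f * f) / real T ^ (n * f))"
      by (simp add: C_def H_def power_mult_distrib power_divide power_mult[symmetric] mult_ac)
    also have "real T ^ (f * (n - f)) * real T ^ (f * f) = real T ^ (n * f)"
    proof -
      have "f * (n - f) + f * f = n * f" using fn by (simp add: algebra_simps diff_mult_distrib2)
      thus ?thesis unfolding power_add[symmetric] by simp
    qed
    finally have "(\<Prod>\<xi>\<in>E. cmod (ev \<xi> d)) \<le> C" using Tpos by simp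
    thus ?thesis using dne lt by (intro exI[of _ d] conjI ballI)
  qed
  note main = this
  show ?thesis
  proof (intro exI[of _ C] allI impI)
    fix \<epsilon> :: real assume "\<epsilon> > 0"
    from main[OF this] obtain z where z: "\<exists>j<n. z j \<noteq> 0" "\<forall>\<xi>\<in>F. cmod (ev \<xi> z) < \<epsilon>" "(\<Prod>\<xi>\<in>E. cmod (ev \<xi> z)) \<le> C" by blast
    have "(\<Prod>\<xi>\<in>embs K. cmod (\<xi> (\<Sum>j<n. of_int (z j) * b j))) = (\<Prod>\<xi>\<in>E. cmod (ev \<xi> z))"
      unfolding E_def[symmetric] by (intro prod.cong refl) (simp add: ev)
    moreover have "\<forall>\<xi>\<in>F. cmod (\<xi> (\<Sum>j<n. of_int (z j) * b j)) < \<epsilon>"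
    proof
      fix \<xi> assume "\<xi> \<in> F"
      thus "cmod (\<xi> (\<Sum>j<n. of_int (z j) * b j)) < \<epsilon>" using z(2) ev[of \<xi> z] F by (auto simp: E_def)
    qed
    ultimately show "\<exists>z::nat \<Rightarrow> int. (\<exists>j<n. z j \<noteq> 0) \<and>
      (\<forall>\<xi>\<in>F. cmod (\<xi> (\<Sum>j<n. of_int (z j) * b j)) < \<epsilon>) \<and>
      (\<Prod>\<xi>\<in>embs K. cmod (\<xi> (\<Sum>j<n. of_int (z j) * b j))) \<le> C"
      using z(1,3) by (intro exI[of _ z] conjI) simp_all
  qed
qed

text \<open>Under an embedding the quotient becomes the product of the remaining conjugates.\<close>

lemma quotient_algebraic_int:
  assumes nf: "number_field K" and x: "x \<in> K" "algebraic_int x" "x \<noteq> 0"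
    and m: "(\<Prod>\<xi>\<in>embs K. \<xi> x) = of_int m"
  shows "algebraic_int (of_int m / x)"
proof -
  note K = nf_props(1)[OF nf] and fin = card_embeddings(1)[OF nf]
  obtain \<xi> where \<xi>: "\<xi> \<in> embs K" using embeddings_nonempty[OF nf] by blast
  have "\<xi> x \<noteq> 0" using emb_simps(9)[OF K \<xi> x(1)] x(3) by simp
  have "of_int m = \<xi> x * (\<Prod>\<tau>\<in>embs K - {\<xi>}. \<tau> x)" unfolding m[symmetric] by (rule prod.remove[OF fin \<xi>])
  hence "\<xi> (of_int m / x) = (\<Prod>\<tau>\<in>embs K - {\<xi>}. \<tau> x)"
    using emb_simps(8,11)[OF K \<xi>] field_set_of_int[OF K] x(1) \<open>\<xi> x \<noteq> 0\<close> by simp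
  moreover have "algebraic_int (\<Prod>\<tau>\<in>embs K - {\<xi>}. \<tau> x)"
    using algebraic_int_embedding_iff[OF K _ x(1)] x(2) by (intro algebraic_int_prod) auto
  moreover have mem: "of_int m / x \<in> K" using field_set_of_int[OF K] x(1) by (rule field_closed(8)[OF K])
  ultimately show ?thesis using algebraic_int_embedding_iff[OF K \<xi> mem] by simp
qed

section \<open>The unit group\<close>

abbreviation units :: "'a::field_char_0 set \<Rightarrow> 'a set" where
  "units K \<equiv> carrier (unit_group K)"

abbreviation torsion_coset :: "'a::field_char_0 set \<Rightarrow> 'a \<Rightarrow> 'a set" where
  "torsion_coset K x \<equiv> torsion (unit_group K) #>\<^bsub>unit_group K\<^esub> x"

lemma unit_group_carrier:
  assumes K: "field_set K"
  shows "units K = {u \<in> K. u \<noteq> 0 \<and> algebraic_int u \<and> algebraic_int (inverse u)}"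
proof (intro subset_antisym subsetI)
  fix u assume "u \<in> units K"
  then obtain v where uv: "u \<in> K" "algebraic_int u" "v \<in> K" "algebraic_int v" "u * v = 1"
    by (auto simp: unit_group_def units_of_def Units_def ring_of_integers_def)
  hence "u \<noteq> 0" by auto
  moreover from uv have "inverse u = v" by (intro inverse_unique)
  ultimately show "u \<in> {u \<in> K. u \<noteq> 0 \<and> algebraic_int u \<and> algebraic_int (inverse u)}" using uv by simp
next
  fix u assume u: "u \<in> {u \<in> K. u \<noteq> 0 \<and> algebraic_int u \<and> algebraic_int (inverse u)}"
  hence "inverse u \<in> K" using field_closed(4)[OF K] by simp
  with u have "\<exists>x. x \<in> K \<and> algebraic_int x \<and> x * u = 1 \<and> u * x = 1" by (intro exI[of _ "inverse u"]) simp
  with u show "u \<in> units K"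
    by (auto simp: unit_group_def units_of_def Units_def ring_of_integers_def)
qed

lemma unit_group_simps [simp]: "x \<otimes>\<^bsub>unit_group K\<^esub> y = x * y" "\<one>\<^bsub>unit_group K\<^esub> = 1"
  by (simp_all add: unit_group_def units_of_def ring_of_integers_def)

lemma unit_group_comm_group:
  assumes K: "field_set K"
  shows "comm_group (unit_group K)"
proof (rule comm_groupI)
  fix x assume x: "x \<in> units K"
  have "inverse x \<in> units K"
    using x field_closed(4)[OF K] by (simp add: unit_group_carrier[OF K])
  moreover have "inverse x * x = 1" using x by (simp add: unit_group_carrier[OF K])
  ultimately show "\<exists>y\<in>units K. y \<otimes>\<^bsub>unit_group K\<^esub> x = \<one>\<^bsub>unit_group K\<^esub>" by auto
qed (auto simp: unit_group_carrier[OF K] field_closed[OF K] algebraic_int_times inverse_mult_distrib mult_ac)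

text \<open>Repeated use of \<open>small_conjugates\<close> gives integers of bounded norm whose
  conjugates away from \<open>w0\<close> decrease strictly. Two of them share the norm and, modulo
  the norm, the coordinates; their quotient is then integral in both directions, and the later over
  the earlier is smaller than 1 away from \<open>w0\<close>.\<close>

lemma exists_small_unit:
  assumes nf: "number_field K" and w0: "w0 \<in> arch_places K"
  shows "\<exists>u\<in>units K. \<forall>w\<in>arch_places K - {w0}. w u < 1"
proof -
  note K = nf_props(1)[OF nf] and fin = card_embeddings(1)[OF nf]
  define n where "n = number_field_degree K"
  obtain b where b: "is_basis \<rat> K n b" and bi: "\<And>j. j < n \<Longrightarrow> algebraic_int (b j)"
    using integral_basis[OF nf] n_def by blast
  have bK: "b j \<in> K" if "j < n" for j by (rule is_basis_mem[OF field_set_Rats b that])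
  define F where "F = {\<xi> \<in> embs K. place_of K \<xi> \<noteq> w0}"
  obtain \<xi>0 where "\<xi>0 \<in> embs K" "w0 = place_of K \<xi>0" using w0 by (auto simp: arch_places_eq[OF nf])
  hence F: "F \<subset> embs K" by (auto simp: F_def)
  have finF: "finite F" using F fin finite_subset by blast
  have conj: "conj_embedding K \<xi> \<in> F" if "\<xi> \<in> F" for \<xi>
    using that conj_embedding_in[OF K] by (simp add: F_def place_of_conj)
  define el where "el z = (\<Sum>j<n. of_int (z j) * b j)" for z :: "nat \<Rightarrow> int"
  obtain C where C: "\<And>\<epsilon>. \<epsilon> > 0 \<Longrightarrow> \<exists>z::nat \<Rightarrow> int. (\<exists>j<n. z j \<noteq> 0) \<and>
    (\<forall>\<xi>\<in>F. cmod (\<xi> (el z)) < \<epsilon>) \<and> (\<Prod>\<xi>\<in>embs K. cmod (\<xi> (el z))) \<le> C"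
    using small_conjugates[OF nf b n_def F conj] unfolding el_def by blast
  have elK: "el z \<in> K" for z unfolding el_def by (rule is_basisD(2)[OF b]) simp
  have elI: "algebraic_int (el z)" for z unfolding el_def
    by (intro algebraic_int_sum algebraic_int_times bi algebraic_int_of_int) simp
  have el0: "el z \<noteq> 0" if "\<exists>j<n. z j \<noteq> 0" for z
  proof
    assume "el z = 0"
    hence s0: "(\<Sum>j<n. of_int (z j) * b j) = 0" by (simp add: el_def)
    from that obtain j where j: "j < n" "z j \<noteq> 0" by blast
    have "of_int (z j) = (0::'a)"
      by (rule is_basisD(3)[OF b, where c = "\<lambda>j. of_int (z j)", OF _ s0 j(1)]) simp
    with j(2) show False by simp
  qed
  define P where "P z \<longleftrightarrow> (\<exists>j<n. z j \<noteq> 0) \<and> (\<Prod>\<xi>\<in>embs K. cmod (\<xi> (el z))) \<le> C" for z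
  have step: "\<exists>z'. P z' \<and> (\<forall>\<xi>\<in>F. cmod (\<xi> (el z')) < cmod (\<xi> (el z)))" if z: "P z" for z
  proof -
    define \<epsilon> where "\<epsilon> = Min (insert 1 ((\<lambda>\<xi>. cmod (\<xi> (el z))) ` F))"
    have "cmod (\<xi> (el z)) > 0" if "\<xi> \<in> F" for \<xi>
      using emb_simps(9)[OF K _ elK] el0 z that F by (auto simp: P_def)
    hence "\<epsilon> > 0" unfolding \<epsilon>_def using finF by (subst Min_gr_iff) auto
    from C[OF this] obtain z' where z': "P z'" "\<And>\<xi>. \<xi> \<in> F \<Longrightarrow> cmod (\<xi> (el z')) < \<epsilon>" unfolding P_def by blast
    have "cmod (\<xi> (el z')) < cmod (\<xi> (el z))" if "\<xi> \<in> F" for \<xi>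
    proof -
      have "\<epsilon> \<le> cmod (\<xi> (el z))" unfolding \<epsilon>_def using finF that by (intro Min_le) auto
      thus ?thesis using z'(2)[OF that] by linarith
    qed
    thus ?thesis using z'(1) by blast
  qed
  have "\<exists>z. P z" using C[of 1] unfolding P_def by auto
  then obtain \<alpha> where \<alpha>: "\<And>i. P (\<alpha> i)" "\<And>i. \<forall>\<xi>\<in>F. cmod (\<xi> (el (\<alpha> (Suc i)))) < cmod (\<xi> (el (\<alpha> i)))"
    using dependent_nat_choice[of "\<lambda>_. P" "\<lambda>_ z z'. \<forall>\<xi>\<in>F. cmod (\<xi> (el z')) < cmod (\<xi> (el z))"] step by blast
  have dec: "cmod (\<xi> (el (\<alpha> j))) < cmod (\<xi> (el (\<alpha> i)))" if "\<xi> \<in> F" "i < j" for \<xi> i j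
    using \<open>i < j\<close>
  proof (induction j rule: less_Suc_induct)
    case (1 i)
    thus ?case using \<alpha>(2) that(1) by blast
  qed simp
  have "\<exists>m::int. (\<Prod>\<xi>\<in>embs K. \<xi> (el (\<alpha> i))) = of_int m" for i
    using norm_integer[OF nf elK elI] by metis
  then obtain N :: "nat \<Rightarrow> int" where N: "\<And>i. (\<Prod>\<xi>\<in>embs K. \<xi> (el (\<alpha> i))) = of_int (N i)" by metis
  have absN: "of_int \<bar>N i\<bar> = (\<Prod>\<xi>\<in>embs K. cmod (\<xi> (el (\<alpha> i))))" for i
    unfolding prod_norm N by simp
  have N0: "N i \<noteq> 0" for i
  proof -
    have "of_int \<bar>N i\<bar> \<ge> (1::real)" unfolding absN
      by (rule abs_norm_ge_1[OF nf elK elI]) (use \<alpha>(1)[of i] el0 in \<open>auto simp: P_def\<close>)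
    thus ?thesis by auto
  qed
  define M where "M = \<lfloor>C\<rfloor>"
  have NM: "\<bar>N i\<bar> \<le> M" for i
    using \<alpha>(1)[of i] absN[of i] unfolding P_def M_def by (simp add: le_floor_iff)
  \<comment> \<open>The norm together with the coordinates modulo the norm. Bounded norms leave only
    finitely many keys.\<close>
  define key where "key i = (N i, (\<lambda>j\<in>{..<n}. \<alpha> i j mod \<bar>N i\<bar>))" for i
  have "range key \<subseteq> {-M..M} \<times> Pi\<^sub>E {..<n} (\<lambda>_. {0..M})"
  proof
    fix y assume "y \<in> range key"
    then obtain i where y: "y = key i" by blast
    have "\<alpha> i j mod \<bar>N i\<bar> \<in> {0..M}" for j
    proof -
      have "\<bar>N i\<bar> > 0" using N0[of i] by simp
      hence "0 \<le> \<alpha> i j mod \<bar>N i\<bar>" "\<alpha> i j mod \<bar>N i\<bar> < \<bar>N i\<bar>" by simp_all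
      thus ?thesis using NM[of i] unfolding atLeastAtMost_iff by linarith
    qed
    hence "(\<lambda>j\<in>{..<n}. \<alpha> i j mod \<bar>N i\<bar>) \<in> Pi\<^sub>E {..<n} (\<lambda>_. {0..M})" by (intro restrict_PiE_iff[THEN iffD2] ballI)
    moreover have "N i \<in> {-M..M}" using NM[of i] by (simp add: abs_le_iff)
    ultimately show "y \<in> {-M..M} \<times> Pi\<^sub>E {..<n} (\<lambda>_. {0..M})" unfolding y key_def by (intro SigmaI)
  qed
  moreover have "finite ({-M..M} \<times> Pi\<^sub>E {..<n} (\<lambda>_. {0..M}))" by (intro finite_cartesian_product finite_PiE) auto
  ultimately have "finite (range key)" by (rule finite_subset)
  hence "\<not> inj key" using finite_imageD[of key UNIV] infinite_UNIV_nat by blast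
  then obtain i j where ij: "key i = key j" "i \<noteq> j" unfolding inj_def by blast
  have "\<exists>i j. key i = key j \<and> i < j"
  proof (cases "i < j")
    case True
    thus ?thesis using ij by blast
  next
    case False
    hence "j < i" using ij(2) by simp
    thus ?thesis using ij(1) by (intro exI[of _ j] exI[of _ i]) simp
  qed
  then obtain i j where ij: "key i = key j" "i < j" by blast
  have Nij: "N j = N i" and modij: "\<And>k. k < n \<Longrightarrow> \<alpha> i k mod \<bar>N i\<bar> = \<alpha> j k mod \<bar>N i\<bar>"
  proof -
    show Ne: "N j = N i" using ij(1) by (simp add: key_def)
    fix k assume "k < n"
    thus "\<alpha> i k mod \<bar>N i\<bar> = \<alpha> j k mod \<bar>N i\<bar>"
      using fun_cong[OF arg_cong[OF ij(1), of snd], of k] by (simp add: key_def Ne)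
  qed
  \<comment> \<open>The congruence writes the quotient as 1 plus an integer multiple of the norm of
    \<open>el y\<close> divided by \<open>el y\<close>, which is integral.\<close>
  have alg: "algebraic_int (el x / el y)"
    if y: "(\<Prod>\<xi>\<in>embs K. \<xi> (el y)) = of_int (N i)" "el y \<noteq> 0"
      and m: "\<And>k. k < n \<Longrightarrow> x k mod \<bar>N i\<bar> = y k mod \<bar>N i\<bar>" for x y
  proof -
    have "\<exists>d. x k - y k = N i * d" if "k < n" for k
    proof -
      have "\<bar>N i\<bar> dvd x k - y k" using m[OF that] by (simp add: mod_eq_dvd_iff)
      thus ?thesis by (simp add: dvd_def[symmetric])
    qed
    then obtain d where d: "\<And>k. k < n \<Longrightarrow> x k - y k = N i * d k" by metis
    have "el x - el y = (\<Sum>k<n. of_int (x k - y k) * b k)"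
      unfolding el_def by (simp add: sum_subtractf left_diff_distrib)
    also have "\<dots> = (\<Sum>k<n. of_int (N i * d k) * b k)" by (intro sum.cong refl) (simp add: d)
    also have "\<dots> = of_int (N i) * el d" unfolding el_def by (simp add: sum_distrib_left mult_ac)
    finally have "el x / el y = 1 + el d * (of_int (N i) / el y)" using y(2) by (simp add: field_simps)
    moreover have "algebraic_int (of_int (N i) / el y)"
      by (rule quotient_algebraic_int[OF nf elK elI y(2,1)])
    hence "algebraic_int (1 + el d * (of_int (N i) / el y))"
      by (intro algebraic_int_plus algebraic_int_times elI algebraic_int_1)
    ultimately show ?thesis by (simp only:)
  qed
  have nz: "el (\<alpha> i) \<noteq> 0" "el (\<alpha> j) \<noteq> 0" using \<alpha>(1) el0 unfolding P_def by blast+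
  define u where "u = el (\<alpha> j) / el (\<alpha> i)"
  have uK: "u \<in> K" unfolding u_def using elK elK by (rule field_closed(8)[OF K])
  have a1: "algebraic_int u" unfolding u_def by (rule alg[OF N nz(1)]) (simp add: modij)
  have "algebraic_int (el (\<alpha> i) / el (\<alpha> j))" by (rule alg[OF _ nz(2)]) (simp_all add: N Nij modij)
  hence "algebraic_int (inverse u)" by (simp add: u_def)
  hence u: "u \<in> units K" using uK a1 nz by (simp add: unit_group_carrier[OF K] u_def)
  have "w u < 1" if w: "w \<in> arch_places K - {w0}" for w
  proof -
    obtain \<xi> where \<xi>: "\<xi> \<in> embs K" "w = place_of K \<xi>" using w by (auto simp: arch_places_eq[OF nf])
    have "\<xi> \<in> F" using \<xi> w by (simp add: F_def)
    from dec[OF this ij(2)] have "cmod (\<xi> (el (\<alpha> j))) < cmod (\<xi> (el (\<alpha> i)))" .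
    moreover have "cmod (\<xi> (el (\<alpha> i))) > 0" using emb_simps(9)[OF K \<xi>(1) elK] nz(1) by simp
    ultimately have "cmod (\<xi> u) < 1"
      unfolding u_def emb_simps(8)[OF K \<xi>(1) elK elK] by (simp add: norm_divide)
    thus ?thesis using \<xi>(2) uK by (simp add: place_of_apply)
  qed
  thus ?thesis using u by blast
qed

section \<open>Logarithms of units\<close>

definition log_vector :: "'a::field_char_0 set \<Rightarrow> 'a \<Rightarrow> ('a \<Rightarrow> real) \<Rightarrow> real" where
  "log_vector K u w = real (local_degree K w) * ln (w u)"

lemma arch_place_pos:
  assumes "number_field K" "w \<in> arch_places K" "u \<in> units K"
  shows "w u > 0"
proof -
  have "u \<in> K" "u \<noteq> 0" using assms(3) by (auto simp: unit_group_carrier[OF nf_props(1)[OF assms(1)]])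
  moreover have "absolute_value K w" using assms(2) by (simp add: arch_places_def)
  ultimately show ?thesis by (auto simp: absolute_value_def less_le)
qed

text \<open>Both \<open>u\<close> and its inverse are nonzero algebraic integers, so the absolute
  norm of \<open>u\<close> is at least 1 and at most 1.\<close>

lemma sum_log_vector:
  assumes nf: "number_field K" and u: "u \<in> units K"
  shows "(\<Sum>w\<in>arch_places K. log_vector K u w) = 0"
proof -
  note K = nf_props(1)[OF nf]
  have uK: "u \<in> K" "u \<noteq> 0" "algebraic_int u" "algebraic_int (inverse u)" using u by (auto simp: unit_group_carrier[OF K])
  have iK: "inverse u \<in> K" "inverse u \<noteq> 0" using uK field_closed(4)[OF K] by auto
  have "(\<Prod>\<xi>\<in>embs K. cmod (\<xi> (inverse u))) = inverse (\<Prod>\<xi>\<in>embs K. cmod (\<xi> u))"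
  proof -
    have "(\<Prod>\<xi>\<in>embs K. cmod (\<xi> (inverse u))) = (\<Prod>\<xi>\<in>embs K. inverse (cmod (\<xi> u)))"
      by (intro prod.cong refl) (simp add: emb_simps(7)[OF K _ uK(1)] norm_inverse)
    also have "\<dots> = inverse (\<Prod>\<xi>\<in>embs K. cmod (\<xi> u))"
      using prod_inversef[of "\<lambda>\<xi>. cmod (\<xi> u)" "embs K"] by (simp add: o_def)
    finally show ?thesis .
  qed
  hence "inverse (\<Prod>\<xi>\<in>embs K. cmod (\<xi> u)) \<ge> 1" using abs_norm_ge_1[OF nf iK(1) uK(4) iK(2)] by simp
  moreover have "(\<Prod>\<xi>\<in>embs K. cmod (\<xi> u)) \<ge> 1" by (rule abs_norm_ge_1[OF nf uK(1,3,2)])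
  ultimately have "(\<Prod>\<xi>\<in>embs K. cmod (\<xi> u)) = 1" by (simp add: one_le_inverse_iff)
  moreover have "\<And>\<xi>. \<xi> \<in> embs K \<Longrightarrow> cmod (\<xi> u) > 0" using emb_simps(9)[OF K _ uK(1)] uK(2) by simp
  ultimately have "(\<Sum>\<xi>\<in>embs K. ln (cmod (\<xi> u))) = 0"
    using ln_prod[of "embs K" "\<lambda>\<xi>. cmod (\<xi> u)"] card_embeddings(1)[OF nf] by simp
  moreover have "(\<Sum>w\<in>arch_places K. log_vector K u w) = (\<Sum>\<xi>\<in>embs K. ln (place_of K \<xi> u))"
    unfolding log_vector_def by (rule sum_arch_places[OF nf])
  ultimately show ?thesis using uK(1) by (simp add: place_of_apply)
qed

lemma finite_arch_places: "number_field K \<Longrightarrow> finite (arch_places K)"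
  by (simp add: arch_places_eq card_embeddings(1))

lemma local_degree_pos:
  assumes nf: "number_field K" and w: "w \<in> arch_places K"
  shows "local_degree K w > 0"
proof -
  obtain \<xi> where \<xi>: "\<xi> \<in> embs K" "w = place_of K \<xi>" using w by (auto simp: arch_places_eq[OF nf])
  have "card {\<tau> \<in> embs K. place_of K \<tau> = place_of K \<xi>} > 0"
    using \<xi> card_embeddings(1)[OF nf] by (auto simp: card_gt_0_iff)
  thus ?thesis using local_degree_card[OF nf_props(1)[OF nf] \<xi>(1)] \<xi>(2) by simp
qed

text \<open>Testing against a unit that is small at all places but the one where the functional is largest.\<close>

lemma log_annihilator_constant:
  assumes nf: "number_field K"
    and g: "\<And>u. u \<in> units K \<Longrightarrow> (\<Sum>w\<in>arch_places K. g w * log_vector K u w) = 0"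
    and w: "w \<in> arch_places K" "w' \<in> arch_places K"
  shows "g w = g w'"
proof -
  note fin = finite_arch_places[OF nf]
  define m where "m = Max (g ` arch_places K)"
  have "m \<in> g ` arch_places K" unfolding m_def using fin w by (intro Max_in) auto
  then obtain w0 where w0: "w0 \<in> arch_places K" "g w0 = m" by blast
  have le: "g v \<le> m" if "v \<in> arch_places K" for v unfolding m_def using fin that by (intro Max_ge) auto
  obtain u where u: "u \<in> units K" "\<And>v. v \<in> arch_places K - {w0} \<Longrightarrow> v u < 1"
    using exists_small_unit[OF nf w0(1)] by blast
  have neg: "log_vector K u v < 0" if "v \<in> arch_places K" "v \<noteq> w0" for v
    using u(2)[of v] that arch_place_pos[OF nf that(1) u(1)] local_degree_pos[OF nf that(1)]
    by (simp add: log_vector_def mult_pos_neg)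
  \<comment> \<open>The product formula allows \<open>m\<close> to be subtracted from
    \<open>g\<close>. Then no term is negative: away from \<open>w0\<close> both factors are
    nonpositive, and at \<open>w0\<close> the first is zero.\<close>
  have "(\<Sum>v\<in>arch_places K. (g v - m) * log_vector K u v) = 0"
    using g[OF u(1)] sum_log_vector[OF nf u(1)]
    by (simp add: left_diff_distrib sum_subtractf sum_distrib_left[symmetric])
  moreover have "(g v - m) * log_vector K u v \<ge> 0" if "v \<in> arch_places K" for v
    using le[OF that] neg[OF that] w0(2) by (cases "v = w0") (auto intro: mult_nonpos_nonpos less_imp_le)
  ultimately have zero: "(g v - m) * log_vector K u v = 0" if "v \<in> arch_places K" for v
    using sum_nonneg_eq_0_iff[OF fin, of "\<lambda>v. (g v - m) * log_vector K u v"] that by blast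
  have "g v = m" if "v \<in> arch_places K" for v
    using zero[OF that] neg[OF that] w0(2) by (cases "v = w0") auto
  thus ?thesis using w by simp
qed

lemma finite_bounded_log_vectors:
  assumes nf: "number_field K"
  shows "finite {u \<in> units K. \<forall>w\<in>arch_places K. log_vector K u w \<le> B}"
proof (rule finite_subset[OF _ finite_bounded_integers[OF nf, of "exp \<bar>B\<bar>"]], rule subsetI)
  note K = nf_props(1)[OF nf]
  fix u assume u: "u \<in> {u \<in> units K. \<forall>w\<in>arch_places K. log_vector K u w \<le> B}"
  hence uK: "u \<in> K" "algebraic_int u" by (auto simp: unit_group_carrier[OF K])
  have "cmod (\<xi> u) \<le> exp \<bar>B\<bar>" if \<xi>: "\<xi> \<in> embs K" for \<xi>
  proof -
    define w where "w = place_of K \<xi>"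
    have w: "w \<in> arch_places K" using \<xi> by (simp add: w_def arch_places_eq[OF nf])
    have pos: "w u > 0" using u by (intro arch_place_pos[OF nf w]) simp
    have d: "real (local_degree K w) \<ge> 1" using local_degree_pos[OF nf w] by simp
    have "ln (w u) \<le> \<bar>B\<bar>"
    proof (cases "ln (w u) \<ge> 0")
      case True
      have "ln (w u) \<le> real (local_degree K w) * ln (w u)" using d True by (simp add: mult_le_cancel_right1)
      also have "\<dots> \<le> B" using u w by (simp add: log_vector_def)
      finally show ?thesis by linarith
    qed simp
    hence "w u \<le> exp \<bar>B\<bar>" using pos by (metis exp_le_cancel_iff exp_ln)
    thus ?thesis using uK by (simp add: w_def place_of_apply)
  qed
  thus "u \<in> {x \<in> K. algebraic_int x \<and> (\<forall>\<xi>\<in>embs K. cmod (\<xi> x) \<le> exp \<bar>B\<bar>)}" using uK by simp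
qed

section \<open>Abelian groups with a logarithmic embedding\<close>

lemma (in comm_group) finprod_in_subgroup:
  assumes H: "subgroup H G" and x: "\<And>q. q \<in> J \<Longrightarrow> x q \<in> H"
  shows "finprod G x J \<in> H"
  using x
proof (induction J rule: infinite_finite_induct)
  case (insert q J)
  have "finprod G x (insert q J) = x q \<otimes> finprod G x J"
    using insert subgroup.mem_carrier[OF H] by (intro finprod_insert) auto
  thus ?case using insert subgroup.m_closed[OF H] by simp
qed (use subgroup.one_closed[OF H] in simp_all)

lemma (in group) int_pow_in_subgroup:
  assumes H: "subgroup H G" and x: "x \<in> H"
  shows "x [^] (n::int) \<in> H"
proof -
  interpret HG: group "G\<lparr>carrier := H\<rparr>" by (rule subgroup_imp_group[OF H])
  have "x [^]\<^bsub>G\<lparr>carrier := H\<rparr>\<^esub> n \<in> carrier (G\<lparr>carrier := H\<rparr>)" using x by (intro HG.int_pow_closed) simp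
  thus ?thesis using int_pow_consistent[OF H x] by simp
qed

lemma (in comm_group) subgroup_imp_comm_group:
  assumes H: "subgroup H G"
  shows "comm_group (G\<lparr>carrier := H\<rparr>)"
  by (rule group.group_comm_groupI[OF subgroup_imp_group[OF H]])
    (simp add: m_comm subgroup.mem_carrier[OF H])

lemma (in comm_group) finprod_subgroup_eq:
  assumes H: "subgroup H G" and x: "\<And>q. q \<in> J \<Longrightarrow> x q \<in> H"
  shows "finprod (G\<lparr>carrier := H\<rparr>) x J = finprod G x J"
proof -
  interpret HG: comm_group "G\<lparr>carrier := H\<rparr>" by (rule subgroup_imp_comm_group[OF H])
  show ?thesis using x
  proof (induction J rule: infinite_finite_induct)
    case (insert q J)
    have "finprod G x (insert q J) = x q \<otimes> finprod G x J"
      using insert subgroup.mem_carrier[OF H] by (intro finprod_insert) auto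
    moreover have "finprod (G\<lparr>carrier := H\<rparr>) x (insert q J) = x q \<otimes> finprod (G\<lparr>carrier := H\<rparr>) x J"
      using insert by (subst HG.finprod_insert) auto
    ultimately show ?case using insert by simp
  qed simp_all
qed

lemma (in comm_group) finprod_nat_pow:
  assumes "\<And>q. q \<in> J \<Longrightarrow> x q \<in> carrier G"
  shows "finprod G x J [^] (n::nat) = finprod G (\<lambda>q. x q [^] n) J"
  using assms
proof (induction J rule: infinite_finite_induct)
  case (insert q J)
  have "finprod G x (insert q J) = x q \<otimes> finprod G x J" using insert by (intro finprod_insert) auto
  moreover have "finprod G (\<lambda>q. x q [^] n) (insert q J) = x q [^] n \<otimes> finprod G (\<lambda>q. x q [^] n) J"
    using insert by (intro finprod_insert) auto
  moreover have "finprod G x J \<in> carrier G" using insert by (intro finprod_closed) auto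
  ultimately show ?case using insert by (simp add: nat_pow_distrib)
qed simp_all

lemma (in comm_group) mult_independent_subgroup:
  assumes H: "subgroup H G"
  shows "mult_independent (G\<lparr>carrier := H\<rparr>) n x \<longleftrightarrow> mult_independent G n x \<and> (\<forall>i<n. x i \<in> H)"
proof -
  have fp: "finprod (G\<lparr>carrier := H\<rparr>) (\<lambda>i. x i [^]\<^bsub>G\<lparr>carrier := H\<rparr>\<^esub> e i) {..<n} = finprod G (\<lambda>i. x i [^] e i) {..<n}"
    if x: "\<forall>i<n. x i \<in> H" for e :: "nat \<Rightarrow> int"
  proof -
    interpret HG: comm_group "G\<lparr>carrier := H\<rparr>" by (rule subgroup_imp_comm_group[OF H])
    have "finprod (G\<lparr>carrier := H\<rparr>) (\<lambda>i. x i [^]\<^bsub>G\<lparr>carrier := H\<rparr>\<^esub> e i) {..<n}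
        = finprod (G\<lparr>carrier := H\<rparr>) (\<lambda>i. x i [^] e i) {..<n}"
      using x int_pow_in_subgroup[OF H] int_pow_consistent[OF H] by (intro HG.finprod_cong') auto
    also have "\<dots> = finprod G (\<lambda>i. x i [^] e i) {..<n}"
      using x int_pow_in_subgroup[OF H] by (intro finprod_subgroup_eq[OF H]) auto
    finally show ?thesis .
  qed
  have H': "carrier (G\<lparr>carrier := H\<rparr>) = H" "\<one>\<^bsub>G\<lparr>carrier := H\<rparr>\<^esub> = \<one>" by simp_all
  have iff: "x \<in> {..<n} \<rightarrow> H \<longleftrightarrow> (\<forall>i<n. x i \<in> H)" by auto
  show ?thesis
  proof (cases "\<forall>i<n. x i \<in> H")
    case True
    hence "x \<in> {..<n} \<rightarrow> carrier G" using subgroup.mem_carrier[OF H] by auto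
    thus ?thesis unfolding mult_independent_def H' fp[OF True] iff
      by (simp only: simp_thms) (rule conj_commute)
  next
    case False
    thus ?thesis unfolding mult_independent_def H' iff by (simp only: simp_thms)
  qed
qed

lemma abs_combination_le:
  fixes x :: "nat \<Rightarrow> real" and v :: "nat \<Rightarrow> nat \<Rightarrow> real"
  assumes x: "\<forall>p<r. \<bar>x p\<bar> \<le> B" and i: "i < r"
  shows "\<bar>\<Sum>p<r. x p * v p i\<bar> \<le> (\<Sum>i<r. \<Sum>p<r. \<bar>B\<bar> * \<bar>v p i\<bar>)"
proof -
  have "\<bar>\<Sum>p<r. x p * v p i\<bar> \<le> (\<Sum>p<r. \<bar>x p * v p i\<bar>)" by (rule sum_abs)
  also have "\<dots> \<le> (\<Sum>p<r. \<bar>B\<bar> * \<bar>v p i\<bar>)"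
    using x by (intro sum_mono) (fastforce simp: abs_mult intro: mult_right_mono)
  also have "\<dots> \<le> (\<Sum>i<r. \<Sum>p<r. \<bar>B\<bar> * \<bar>v p i\<bar>)" using i
    by (intro member_le_sum[of i "{..<r}" "\<lambda>i. \<Sum>p<r. \<bar>B\<bar> * \<bar>v p i\<bar>"]) (auto intro: sum_nonneg)
  finally show ?thesis .
qed

text \<open>What is used of a logarithmic map: \<open>L_disc\<close> gives a discrete image with
  finite kernel, and \<open>L_full\<close> says that no nonzero functional vanishes on the image.
  The instances are the unit group, the relative units and, later, integral coordinates on the same
  group.\<close>

locale discrete_embedding = comm_group G for G :: "('a, 'b) monoid_scheme" (structure) +
  fixes L :: "'a \<Rightarrow> nat \<Rightarrow> real" and r :: nat
  assumes L_mult: "x \<in> carrier G \<Longrightarrow> y \<in> carrier G \<Longrightarrow> L (x \<otimes> y) i = L x i + L y i"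
    and L_supp: "r \<le> i \<Longrightarrow> L x i = 0"
    and L_disc: "finite {x \<in> carrier G. \<forall>i<r. \<bar>L x i\<bar> \<le> B}"
    and L_full: "(\<And>x. x \<in> carrier G \<Longrightarrow> (\<Sum>i<r. c i * L x i) = 0) \<Longrightarrow> \<forall>i<r. c i = 0"
begin

abbreviation int_spanned :: "(nat \<Rightarrow> 'a) \<Rightarrow> 'a \<Rightarrow> bool" where
  "int_spanned e x \<equiv> \<exists>n::nat \<Rightarrow> int. \<forall>i. L x i = (\<Sum>p<r. of_int (n p) * L (e p) i)"

lemma L_one: "L \<one> i = 0"
  using L_mult[of \<one> \<one> i] by simp

lemma L_inv: "x \<in> carrier G \<Longrightarrow> L (inv x) i = - L x i"
  using L_mult[of x "inv x" i] L_one by simp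

lemma L_nat_pow: "x \<in> carrier G \<Longrightarrow> L (x [^] (n::nat)) i = real n * L x i"
  by (induction n) (simp_all add: L_one L_mult algebra_simps)

lemma L_int_pow: "x \<in> carrier G \<Longrightarrow> L (x [^] (n::int)) i = of_int n * L x i"
proof (cases "n < 0")
  case True
  assume x: "x \<in> carrier G"
  have "x [^] n = inv (x [^] nat (- n))" using True unfolding int_pow_def2[of G x n] by (rule if_P)
  hence "L (x [^] n) i = L (inv (x [^] nat (- n))) i" by (simp only:)
  also have "\<dots> = - L (x [^] nat (- n)) i" by (rule L_inv[OF nat_pow_closed[OF x]])
  also have "\<dots> = - (real (nat (- n)) * L x i)" by (simp only: L_nat_pow[OF x])
  also have "\<dots> = of_int n * L x i" using True by simp
  finally show ?thesis .
next
  case False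
  assume x: "x \<in> carrier G"
  have "x [^] n = x [^] nat n" using False unfolding int_pow_def2[of G x n] by (rule if_not_P)
  hence "L (x [^] n) i = L (x [^] nat n) i" by (simp only:)
  also have "\<dots> = real (nat n) * L x i" by (rule L_nat_pow[OF x])
  also have "\<dots> = of_int n * L x i" using False by simp
  finally show ?thesis .
qed

lemma L_finprod:
  "(\<And>q. q \<in> J \<Longrightarrow> x q \<in> carrier G) \<Longrightarrow> L (finprod G x J) i = (\<Sum>q\<in>J. L (x q) i)"
proof (induction J rule: infinite_finite_induct)
  case (insert q J)
  have "finprod G x (insert q J) = x q \<otimes> finprod G x J" using insert by (intro finprod_insert) auto
  moreover have "finprod G x J \<in> carrier G" using insert by (intro finprod_closed) auto
  ultimately show ?case using insert by (simp add: L_mult)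
qed (simp_all add: L_one)

lemma L_finprod_int_pow:
  assumes "\<And>q. q \<in> J \<Longrightarrow> x q \<in> carrier G"
  shows "L (finprod G (\<lambda>q. x q [^] (a q :: int)) J) i = (\<Sum>q\<in>J. of_int (a q) * L (x q) i)"
  using assms by (subst L_finprod) (auto simp: L_int_pow)

lemma finprod_int_pow_closed:
  "(\<And>q. q \<in> J \<Longrightarrow> x q \<in> carrier G) \<Longrightarrow> finprod G (\<lambda>q. x q [^] (a q :: int)) J \<in> carrier G"
  by (rule finprod_closed) auto

text \<open>All powers of \<open>x\<close> lie in the finite kernel of \<open>L\<close>, so two of
  them coincide.\<close>

lemma L_zero_torsion:
  assumes x: "x \<in> carrier G" and L: "\<And>i. i < r \<Longrightarrow> L x i = 0"
  shows "\<exists>n::nat. n > 0 \<and> x [^] n = \<one>"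
proof -
  have "range (\<lambda>n::nat. x [^] n) \<subseteq> {y \<in> carrier G. \<forall>i<r. \<bar>L y i\<bar> \<le> 0}"
    using x L by (auto simp: L_nat_pow)
  hence "finite (range (\<lambda>n::nat. x [^] n))" using finite_subset L_disc[of 0] by blast
  hence "\<not> inj (\<lambda>n::nat. x [^] n)" using finite_imageD by blast
  then obtain m n :: nat where mn: "x [^] m = x [^] n" "m \<noteq> n" by (auto simp: inj_def)
  show ?thesis
  proof (cases "m < n")
    case True
    thus ?thesis using pow_eq_div2[OF x mn(1)[symmetric]] by (intro exI[of _ "n - m"]) simp
  next
    case False
    thus ?thesis using pow_eq_div2[OF x mn(1)] mn(2) by (intro exI[of _ "m - n"]) simp
  qed
qed

lemma subtraction_closed_image:
  assumes H: "subgroup H G"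
  shows "subtraction_closed (L ` H)"
  unfolding subtraction_closed_def
proof (intro conjI ballI)
  have "L \<one> = (\<lambda>_. 0)" by (rule ext) (rule L_one)
  thus "(\<lambda>_. 0) \<in> L ` H" using subgroup.one_closed[OF H] by (metis imageI)
  fix a b assume "a \<in> L ` H" "b \<in> L ` H"
  then obtain x y where xy: "x \<in> H" "y \<in> H" "a = L x" "b = L y" by blast
  have "L (x \<otimes> inv y) = (\<lambda>i. a i - b i)"
    using xy subgroup.mem_carrier[OF H] by (intro ext) (simp add: L_mult L_inv)
  moreover have "x \<otimes> inv y \<in> H" using xy H by (simp add: subgroup.m_closed subgroup.m_inv_closed)
  ultimately show "(\<lambda>i. a i - b i) \<in> L ` H" by (metis imageI)
qed

lemma finite_bounded_image: "finite {y \<in> L ` carrier G. \<forall>i<r. \<bar>y i\<bar> \<le> B}"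
proof -
  have "{y \<in> L ` carrier G. \<forall>i<r. \<bar>y i\<bar> \<le> B} = L ` {x \<in> carrier G. \<forall>i<r. \<bar>L x i\<bar> \<le> B}" by auto
  thus ?thesis using L_disc by simp
qed

lemma spanning_independent:
  assumes e: "\<And>x. x \<in> carrier G \<Longrightarrow> \<exists>a. \<forall>i<r. L x i = (\<Sum>p<r. a p * L (e p) i)"
    and c: "\<And>i. i < r \<Longrightarrow> (\<Sum>p<r. c p * L (e p) i) = 0" and p: "p < r"
  shows "c p = 0"
proof -
  have "\<forall>p\<in>{..<r}. c p = 0"
  proof (rule square_system_left_kernel[of "{..<r}" "{..<r}" "\<lambda>i p. L (e p) i"])
    fix d assume d: "\<And>p. p \<in> {..<r} \<Longrightarrow> (\<Sum>i<r. d i * L (e p) i) = 0"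
    have "\<forall>i<r. d i = 0"
    proof (rule L_full)
      fix x assume "x \<in> carrier G"
      then obtain a where a: "\<And>i. i < r \<Longrightarrow> L x i = (\<Sum>p<r. a p * L (e p) i)" using e by blast
      have "(\<Sum>i<r. d i * L x i) = (\<Sum>i<r. \<Sum>p<r. a p * (d i * L (e p) i))"
        by (intro sum.cong refl) (simp add: a sum_distrib_left mult_ac)
      also have "\<dots> = (\<Sum>p<r. a p * (\<Sum>i<r. d i * L (e p) i))"
        by (subst sum.swap) (simp add: sum_distrib_left)
      also have "\<dots> = 0" by (intro sum.neutral) (simp add: d)
      finally show "(\<Sum>i<r. d i * L x i) = 0" .
    qed
    thus "\<forall>i\<in>{..<r}. d i = 0" by simp
  qed (use c in \<open>simp_all add: mult.commute\<close>)
  thus ?thesis using p by simp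
qed

text \<open>The image need not meet the coordinate axes, as \<open>triangular_basis\<close> demands.
  It does after passing to real coordinates with respect to an independent family \<open>v\<close>
  taken from the image itself.\<close>

lemma integral_spanning_family:
  "\<exists>e. (\<forall>p<r. e p \<in> carrier G) \<and>
    (\<forall>x\<in>carrier G. int_spanned e x)"
proof -
  define \<Gamma> where "\<Gamma> = L ` carrier G"
  have "\<exists>v. (\<forall>p<card {..<r}. v p \<in> \<Gamma>) \<and>
    (\<forall>d. (\<forall>i\<in>{..<r}. (\<Sum>p<card {..<r}. d p * v p i) = 0) \<longrightarrow> (\<forall>p<card {..<r}. d p = 0))"
  proof (rule independent_family_of_trivial_annihilator)
    fix c assume c: "\<And>y. y \<in> \<Gamma> \<Longrightarrow> (\<Sum>i<r. c i * y i) = 0"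
    have "\<forall>i<r. c i = 0" by (rule L_full, rule c) (simp add: \<Gamma>_def)
    thus "\<forall>i\<in>{..<r}. c i = 0" by simp
  qed simp
  then obtain v where v: "\<And>p. p < r \<Longrightarrow> v p \<in> \<Gamma>"
    and ind0: "\<forall>d. (\<forall>i\<in>{..<r}. (\<Sum>p<r. d p * v p i) = 0) \<longrightarrow> (\<forall>p<r. d p = 0)"
    unfolding card_lessThan by (elim exE conjE) blast
  have ind: "\<forall>p\<in>{..<r}. d p = 0" if "\<And>i. i < r \<Longrightarrow> (\<Sum>p<r. d p * v p i) = 0" for d
    using spec[OF ind0, of d] that by simp
  have vsupp: "v p i = 0" if "p < r" "r \<le> i" for p i using v[OF that(1)] that(2) by (auto simp: \<Gamma>_def L_supp)
  define V where "V c i = (\<Sum>p<r. c p * v p i)" for c :: "nat \<Rightarrow> real" and i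
  \<comment> \<open>The image of \<open>L\<close> in the coordinates of \<open>v\<close>, in which
    the members of \<open>v\<close> become unit vectors.\<close>
  define \<Gamma>' where "\<Gamma>' = {c. (\<forall>p\<ge>r. c p = 0) \<and> V c \<in> \<Gamma>}"
  have \<Gamma>: "subtraction_closed \<Gamma>" unfolding \<Gamma>_def by (rule subtraction_closed_image[OF subgroup_self])
  have Vdiff: "V (\<lambda>p. c p - d p) = (\<lambda>i. V c i - V d i)" for c d
    by (rule ext) (simp add: V_def left_diff_distrib sum_subtractf)
  have Vinj: "c = d" if "c \<in> \<Gamma>'" "d \<in> \<Gamma>'" "V c = V d" for c d
  proof -
    have "\<forall>p\<in>{..<r}. c p - d p = 0"
    proof (rule ind)
      fix i
      have "V (\<lambda>p. c p - d p) i = 0" unfolding Vdiff that(3) by simp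
      thus "(\<Sum>p<r. (c p - d p) * v p i) = 0" by (simp add: V_def)
    qed
    moreover have "c p = 0 \<and> d p = 0" if "p \<ge> r" for p using that \<open>c \<in> \<Gamma>'\<close> \<open>d \<in> \<Gamma>'\<close> by (simp add: \<Gamma>'_def)
    ultimately show ?thesis by (intro ext) (metis eq_iff_diff_eq_0 lessThan_iff not_le)
  qed
  have "\<exists>e'. (\<forall>i<r. e' i \<in> \<Gamma>' \<and> e' i i > 0 \<and> (\<forall>j>i. e' i j = 0)) \<and>
    (\<forall>x\<in>\<Gamma>'. \<exists>n::nat \<Rightarrow> int. \<forall>j. x j = (\<Sum>i<r. of_int (n i) * e' i j))"
  proof (rule triangular_basis)
    have "V (\<lambda>_. 0) = (\<lambda>_. 0)" by (rule ext) (simp add: V_def)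
    hence "(\<lambda>_. 0) \<in> \<Gamma>'" using subtraction_closed_zero[OF \<Gamma>] by (simp add: \<Gamma>'_def)
    thus "subtraction_closed \<Gamma>'"
      unfolding subtraction_closed_def by (auto simp: \<Gamma>'_def Vdiff intro: subtraction_closed_diff[OF \<Gamma>])
    show "x i = 0" if "x \<in> \<Gamma>'" "i \<ge> r" for x i using that by (simp add: \<Gamma>'_def)
    show "finite {x \<in> \<Gamma>'. \<forall>i<r. \<bar>x i\<bar> \<le> B}" for B
    proof -
      define B' where "B' = (\<Sum>i<r. \<Sum>p<r. \<bar>B\<bar> * \<bar>v p i\<bar>)"
      have "\<bar>V x i\<bar> \<le> B'" if "\<forall>i<r. \<bar>x i\<bar> \<le> B" "i < r" for x i
        unfolding V_def B'_def by (rule abs_combination_le[OF that])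
      hence "V ` {x \<in> \<Gamma>'. \<forall>i<r. \<bar>x i\<bar> \<le> B} \<subseteq> {y \<in> \<Gamma>. \<forall>i<r. \<bar>y i\<bar> \<le> B'}" by (auto simp: \<Gamma>'_def)
      hence "finite (V ` {x \<in> \<Gamma>'. \<forall>i<r. \<bar>x i\<bar> \<le> B})"
        using finite_subset finite_bounded_image[of B'] unfolding \<Gamma>_def by blast
      moreover have "inj_on V {x \<in> \<Gamma>'. \<forall>i<r. \<bar>x i\<bar> \<le> B}" using Vinj by (intro inj_onI) simp
      ultimately show ?thesis by (rule finite_imageD)
    qed
    fix i assume i: "i < r"
    have "V (\<lambda>p. if p = i then 1 else 0) = v i"
      by (rule ext) (simp add: V_def if_distrib[of "\<lambda>x. x * _"] i cong: if_cong)
    hence "(\<lambda>p. if p = i then 1 else 0) \<in> \<Gamma>'" using v[OF i] i by (simp add: \<Gamma>'_def)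
    thus "\<exists>x\<in>\<Gamma>'. x i > 0 \<and> (\<forall>j. j \<noteq> i \<longrightarrow> x j = 0)" by (rule bexI[rotated]) simp
  qed
  then obtain e' where e': "\<And>i. i < r \<Longrightarrow> e' i \<in> \<Gamma>'"
    and sp: "\<And>x. x \<in> \<Gamma>' \<Longrightarrow> \<exists>n::nat \<Rightarrow> int. \<forall>j. x j = (\<Sum>i<r. of_int (n i) * e' i j)" by (elim exE conjE) blast
  have "\<forall>p\<in>{..<r}. \<exists>x. x \<in> carrier G \<and> L x = V (e' p)"
  proof
    fix p assume "p \<in> {..<r}"
    hence "V (e' p) \<in> L ` carrier G" using e'[of p] by (simp add: \<Gamma>'_def \<Gamma>_def)
    thus "\<exists>x. x \<in> carrier G \<and> L x = V (e' p)" by (auto simp: image_iff)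
  qed
  from bchoice[OF this] obtain e where e: "\<And>p. p < r \<Longrightarrow> e p \<in> carrier G" "\<And>p. p < r \<Longrightarrow> L (e p) = V (e' p)" by auto
  have "int_spanned e x" if x: "x \<in> carrier G" for x
  proof -
    have "\<exists>c. \<forall>i\<in>{..<r}. (\<Sum>p<r. v p i * c p) = L x i"
    proof (rule square_system_solvable)
      fix c assume "\<And>i. i \<in> {..<r} \<Longrightarrow> (\<Sum>p<r. v p i * c p) = 0"
      thus "\<forall>i\<in>{..<r}. c i = 0" by (intro ind) (simp add: mult.commute)
    qed simp_all
    then obtain c where c: "\<And>i. i < r \<Longrightarrow> (\<Sum>p<r. v p i * c p) = L x i" by auto
    define c' where "c' p = (if p < r then c p else 0)" for p
    have Vc: "V c' = L x"
    proof
      fix i show "V c' i = L x i"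
      proof (cases "i < r")
        case True
        have "V c' i = (\<Sum>p<r. v p i * c p)" unfolding V_def by (intro sum.cong refl) (simp add: c'_def)
        thus ?thesis using c[OF True] by simp
      qed (simp add: V_def vsupp L_supp)
    qed
    hence "c' \<in> \<Gamma>'" using x by (simp add: \<Gamma>'_def \<Gamma>_def c'_def)
    from sp[OF this] obtain n :: "nat \<Rightarrow> int" where n: "\<And>j. c' j = (\<Sum>i<r. of_int (n i) * e' i j)" by blast
    have "L x i = (\<Sum>p<r. of_int (n p) * L (e p) i)" for i
    proof -
      have "L x i = (\<Sum>p<r. (\<Sum>k<r. of_int (n k) * e' k p) * v p i)" unfolding Vc[symmetric] V_def n ..
      also have "\<dots> = (\<Sum>p<r. \<Sum>k<r. of_int (n k) * (e' k p * v p i))"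
        by (intro sum.cong refl) (simp only: sum_distrib_right mult.assoc)
      also have "\<dots> = (\<Sum>k<r. of_int (n k) * V (e' k) i)"
        by (subst sum.swap) (simp add: V_def sum_distrib_left)
      also have "\<dots> = (\<Sum>k<r. of_int (n k) * L (e k) i)" by (intro sum.cong refl) (simp add: e)
      finally show ?thesis .
    qed
    thus ?thesis by blast
  qed
  thus ?thesis using e by blast
qed

lemma mult_independentI:
  assumes x: "\<And>p. p < n \<Longrightarrow> x p \<in> carrier G"
    and ind: "\<And>c p. (\<And>i. i < r \<Longrightarrow> (\<Sum>p<n. c p * L (x p) i) = 0) \<Longrightarrow> p < n \<Longrightarrow> c p = 0"
  shows "mult_independent G n x"
  unfolding mult_independent_def
proof (intro conjI allI impI)
  show "x \<in> {..<n} \<rightarrow> carrier G" using x by auto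
  fix e :: "nat \<Rightarrow> int" and p assume e: "finprod G (\<lambda>i. x i [^] e i) {..<n} = \<one>" and p: "p < n"
  have "of_int (e p) = (0::real)"
  proof (rule ind[of "\<lambda>p. of_int (e p)", OF _ p])
    fix i
    have "L (finprod G (\<lambda>i. x i [^] e i) {..<n}) i = (\<Sum>p<n. of_int (e p) * L (x p) i)"
      by (rule L_finprod_int_pow) (simp add: x)
    thus "(\<Sum>p<n. of_int (e p) * L (x p) i) = 0" by (simp add: e L_one)
  qed
  thus "e p = 0" by simp
qed

lemma mult_independentD_carrier: "mult_independent G n x \<Longrightarrow> q < n \<Longrightarrow> x q \<in> carrier G"
  by (auto simp: mult_independent_def)

lemma group_basisD_carrier: "group_basis G n x \<Longrightarrow> q < n \<Longrightarrow> x q \<in> carrier G"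
  unfolding group_basis_def by (elim conjE) (rule mult_independentD_carrier)

text \<open>Independence speaks of integer exponents in \<open>G\<close>, not of coordinates. A
  rational relation is cleared of denominators; the corresponding product then lies in the kernel of
  \<open>L\<close>, and a power of it equals \<open>\<one>\<close>, which is an integer
  relation.\<close>

lemma mult_independent_rational:
  fixes a :: "nat \<Rightarrow> nat \<Rightarrow> int" and c :: "nat \<Rightarrow> rat"
  assumes x: "mult_independent G n x"
    and a: "\<And>q i. q < n \<Longrightarrow> i < r \<Longrightarrow> L (x q) i = (\<Sum>p<r. of_int (a q p) * L (e p) i)"
    and c: "\<And>p. p < r \<Longrightarrow> (\<Sum>q<n. of_int (a q p) * c q) = 0" and q: "q < n"
  shows "c q = 0"
proof -
  note xc = mult_independentD_carrier[OF x]
  obtain N :: int where N: "N > 0" "\<And>q. q \<in> {..<n} \<Longrightarrow> \<exists>m. of_int N * c q = of_int m"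
  proof -
    obtain D :: int where D: "D > 0" "\<forall>s\<in>{..<n}. of_int D * c s \<in> \<int>"
      using common_denominator[of "{..<n}" c] by blast
    show thesis by (rule that[OF D(1)]) (use D(2) in \<open>blast elim: Ints_cases\<close>)
  qed
  have "\<forall>q\<in>{..<n}. \<exists>m::int. of_int N * c q = of_int m" using N(2) by blast
  from bchoice[OF this] obtain m :: "nat \<Rightarrow> int" where m: "\<And>q. q < n \<Longrightarrow> of_int N * c q = of_int (m q)" by auto
  have z: "(\<Sum>q<n. m q * a q p) = 0" if p: "p < r" for p
  proof -
    have "of_int (\<Sum>q<n. m q * a q p) = (\<Sum>q<n. of_int N * (of_int (a q p) * c q))"
      unfolding of_int_sum of_int_mult by (intro sum.cong refl) (simp add: m[symmetric] mult_ac)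
    also have "\<dots> = 0" unfolding sum_distrib_left[symmetric] c[OF p] by simp
    finally show ?thesis by (simp only: of_int_eq_0_iff)
  qed
  define y where "y = finprod G (\<lambda>q. x q [^] m q) {..<n}"
  have y: "y \<in> carrier G" unfolding y_def by (rule finprod_int_pow_closed) (simp add: xc)
  have "L y i = 0" if i: "i < r" for i
  proof -
    have "L y i = (\<Sum>q<n. of_int (m q) * L (x q) i)" unfolding y_def by (rule L_finprod_int_pow) (simp add: xc)
    also have "\<dots> = (\<Sum>q<n. \<Sum>p<r. of_int (m q * a q p) * L (e p) i)"
      by (intro sum.cong refl) (simp add: a i sum_distrib_left mult_ac)
    also have "\<dots> = (\<Sum>p<r. of_int (\<Sum>q<n. m q * a q p) * L (e p) i)"
      by (subst sum.swap) (simp add: sum_distrib_right)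
    also have "\<dots> = 0" by (intro sum.neutral) (simp add: z)
    finally show ?thesis .
  qed
  from L_zero_torsion[OF y this] obtain k :: nat where k: "k > 0" "y [^] k = \<one>" by blast
  have "finprod G (\<lambda>q. x q [^] (m q * int k)) {..<n} = finprod G (\<lambda>q. (x q [^] m q) [^] k) {..<n}"
    using xc by (intro finprod_cong') (auto simp: int_pow_pow[symmetric] int_pow_int)
  also have "\<dots> = y [^] k" unfolding y_def by (rule finprod_nat_pow[symmetric]) (simp add: xc)
  finally have "\<forall>q<n. m q * int k = 0" using x unfolding k(2) mult_independent_def by (elim conjE allE[where x = "\<lambda>q. m q * int k"]) blast
  hence "m q = 0" using q k(1) by simp
  thus ?thesis using m[OF q] N(1) by simp
qed

text \<open>Integer coordinates with respect to a spanning family are what bounds the rank: more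
  than \<open>r\<close> vectors of length \<open>r\<close> over the rationals satisfy a rational
  relation.\<close>

lemma mult_independent_le:
  assumes x: "mult_independent G n x"
  shows "n \<le> r"
proof (rule ccontr)
  assume n: "\<not> n \<le> r"
  obtain e where e: "\<forall>x\<in>carrier G. int_spanned e x"
    using integral_spanning_family by (elim exE conjE) (rule that)
  have "\<forall>q\<in>{..<n}. \<exists>a::nat \<Rightarrow> int. \<forall>i. L (x q) i = (\<Sum>p<r. of_int (a p) * L (e p) i)"
    by (intro ballI bspec[OF e] mult_independentD_carrier[OF x]) simp
  from bchoice[OF this] obtain a :: "nat \<Rightarrow> nat \<Rightarrow> int" where
    a: "\<And>q i. q < n \<Longrightarrow> L (x q) i = (\<Sum>p<r. of_int (a q p) * L (e p) i)" by auto
  obtain c :: "nat \<Rightarrow> rat" where c: "\<exists>q\<in>{..<n}. c q \<noteq> 0" "\<And>p. p < r \<Longrightarrow> (\<Sum>q<n. of_int (a q p) * c q) = 0"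
    using homogeneous_nontrivial_solution[of "{..<r}" "{..<n}" "\<lambda>p q. of_int (a q p) :: rat"] n by auto
  have "c q = 0" if "q < n" for q using x a c(2) that by (rule mult_independent_rational)
  thus False using c(1) by simp
qed

lemma integral_spanning_independent:
  assumes "\<And>x. x \<in> carrier G \<Longrightarrow> int_spanned e x"
    and "\<And>i. i < r \<Longrightarrow> (\<Sum>p<r. c p * L (e p) i) = 0" "p < r"
  shows "c p = 0"
proof (rule spanning_independent[OF _ assms(2,3)])
  fix x assume "x \<in> carrier G"
  from assms(1)[OF this] obtain n :: "nat \<Rightarrow> int" where "\<forall>i. L x i = (\<Sum>p<r. of_int (n p) * L (e p) i)" ..
  thus "\<exists>a. \<forall>i<r. L x i = (\<Sum>p<r. a p * L (e p) i)" by (intro exI[of _ "\<lambda>p. of_int (n p)"]) simp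
qed

lemma integral_spanning_mult_independent:
  assumes e: "\<forall>p<r. e p \<in> carrier G"
    "\<forall>x\<in>carrier G. int_spanned e x"
  shows "mult_independent G r e"
proof (rule mult_independentI)
  show "e p \<in> carrier G" if "p < r" for p using e(1) that by simp
  fix c p assume c: "\<And>i. i < r \<Longrightarrow> (\<Sum>p<r. c p * L (e p) i) = 0" and p: "p < r"
  show "c p = 0" by (rule integral_spanning_independent[of e, OF bspec[OF e(2)] c p])
qed

lemma group_rank_eq: "group_rank G = r"
  unfolding group_rank_def
proof (rule Max_eqI)
  have "{n. \<exists>x. mult_independent G n x} \<subseteq> {..r}" using mult_independent_le by blast
  thus "finite {n. \<exists>x. mult_independent G n x}" using finite_subset by blast
  obtain e where e0: "\<forall>p<r. e p \<in> carrier G"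
    "\<forall>x\<in>carrier G. int_spanned e x"
    using integral_spanning_family by (elim exE conjE) (rule that)
  note e = e0(1)[rule_format] bspec[OF e0(2)]
  have "mult_independent G r e"
    using e0 by (rule integral_spanning_mult_independent)
  thus "r \<in> {n. \<exists>x. mult_independent G n x}" by blast
qed (use mult_independent_le in blast)

lemma L_eqD:
  assumes inj: "\<And>x. x \<in> carrier G \<Longrightarrow> (\<And>i. i < r \<Longrightarrow> L x i = 0) \<Longrightarrow> x = \<one>"
    and xy: "x \<in> carrier G" "y \<in> carrier G" "\<And>i. i < r \<Longrightarrow> L x i = L y i"
  shows "x = y"
proof -
  have "x \<otimes> inv y = \<one>" using xy by (intro inj) (simp_all add: L_mult L_inv)
  thus ?thesis using xy inv_equality[of x "inv y"] by simp
qed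

lemma group_basis_exists:
  assumes inj: "\<And>x. x \<in> carrier G \<Longrightarrow> (\<And>i. i < r \<Longrightarrow> L x i = 0) \<Longrightarrow> x = \<one>"
  shows "\<exists>\<eta>. group_basis G r \<eta>"
proof -
  obtain e where e0: "\<forall>p<r. e p \<in> carrier G"
    "\<forall>x\<in>carrier G. int_spanned e x"
    using integral_spanning_family by (elim exE conjE) (rule that)
  note e = e0(1)[rule_format] bspec[OF e0(2)]
  have sub: "e ` {..<r} \<subseteq> carrier G" using e(1) by auto
  have "x \<in> generate G (e ` {..<r})" if x: "x \<in> carrier G" for x
  proof -
    obtain n :: "nat \<Rightarrow> int" where n: "\<And>i. L x i = (\<Sum>p<r. of_int (n p) * L (e p) i)" using e(2)[OF x] by blast
    have "x = finprod G (\<lambda>p. e p [^] n p) {..<r}"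
    proof (rule L_eqD[OF inj x])
      show "finprod G (\<lambda>p. e p [^] n p) {..<r} \<in> carrier G" by (rule finprod_int_pow_closed) (simp add: e)
      show "L x i = L (finprod G (\<lambda>p. e p [^] n p) {..<r}) i" for i
        unfolding n by (rule L_finprod_int_pow[symmetric]) (simp add: e)
    qed
    also have "\<dots> \<in> generate G (e ` {..<r})"
      by (intro finprod_in_subgroup int_pow_in_subgroup generate_is_subgroup[OF sub]) (auto intro: generate.incl)
    finally show ?thesis .
  qed
  hence "generate G (e ` {..<r}) = carrier G" using generate_incl[OF sub] by blast
  moreover have "mult_independent G r e"
    using e0 by (rule integral_spanning_mult_independent)
  ultimately show ?thesis unfolding group_basis_def by blast
qed

text \<open>The coordinates follow the generation of \<open>x\<close> by induction: products add
  them and inverses negate them.\<close>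

lemma group_basis_spanning:
  assumes \<eta>: "group_basis G r \<eta>" and x: "x \<in> carrier G"
  shows "int_spanned \<eta> x"
proof -
  have c: "\<eta> p \<in> carrier G" if "p < r" for p by (rule group_basisD_carrier[OF \<eta> that])
  have delta: "\<forall>i. L (\<eta> p) i = (\<Sum>q<r. of_int (if q = p then 1 else 0) * L (\<eta> q) i)" if "p < r" for p
  proof
    fix i
    have "(\<Sum>q<r. of_int (if q = p then 1 else 0) * L (\<eta> q) i) = (\<Sum>q<r. if q = p then L (\<eta> q) i else 0)"
      by (intro sum.cong refl) simp
    thus "L (\<eta> p) i = (\<Sum>q<r. of_int (if q = p then 1 else 0) * L (\<eta> q) i)" using that by simp
  qed
  have "x \<in> generate G (\<eta> ` {..<r})" using \<eta> x by (simp add: group_basis_def)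
  thus ?thesis
  proof (induction rule: generate.induct)
    case one
    show ?case by (intro exI[of _ "\<lambda>_. 0"]) (simp add: L_one)
  next
    case (incl h)
    then obtain p where p: "p < r" "h = \<eta> p" by auto
    show ?case unfolding p(2)
      using delta[OF p(1)] by (rule exI[of _ "\<lambda>q. if q = p then 1 else 0"])
  next
    case (inv h)
    then obtain p where p: "p < r" "h = \<eta> p" by auto
    have "L (inv h) i = (\<Sum>q<r. of_int (- (if q = p then 1 else 0)) * L (\<eta> q) i)" for i
    proof -
      have "L (inv h) i = - L (\<eta> p) i" unfolding p(2) by (rule L_inv[OF c[OF p(1)]])
      also have "\<dots> = - (\<Sum>q<r. of_int (if q = p then 1 else 0) * L (\<eta> q) i)"
        using delta[OF p(1), THEN spec, of i] by (rule arg_cong)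
      also have "\<dots> = (\<Sum>q<r. of_int (- (if q = p then 1 else 0)) * L (\<eta> q) i)"
        by (simp only: of_int_minus mult_minus_left sum_negf)
      finally show ?thesis .
    qed
    thus ?case by (intro exI[of _ "\<lambda>q. - (if q = p then 1 else 0)"] allI)
  next
    case (eng h1 h2)
    have sub: "\<eta> ` {..<r} \<subseteq> carrier G" using c by auto
    note hc = generate_in_carrier[OF sub eng(1)] generate_in_carrier[OF sub eng(2)]
    obtain n1 :: "nat \<Rightarrow> int" where "\<forall>i. L h1 i = (\<Sum>p<r. of_int (n1 p) * L (\<eta> p) i)" using eng(3) ..
    moreover obtain n2 :: "nat \<Rightarrow> int" where "\<forall>i. L h2 i = (\<Sum>p<r. of_int (n2 p) * L (\<eta> p) i)" using eng(4) ..
    ultimately show ?case using hc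
      by (intro exI[of _ "\<lambda>p. n1 p + n2 p"]) (simp add: L_mult distrib_right sum.distrib)
  qed
qed

end

section \<open>Subgroups of full rank and their index\<close>

context discrete_embedding
begin

text \<open>The coordinates with respect to a basis form a second discrete embedding of the same
  group, now integer valued. The index of a subgroup is estimated there, independently of the real
  embedding \<open>L\<close>.\<close>

lemma integral_coordinates:
  assumes \<eta>: "group_basis G r \<eta>"
  shows "\<exists>\<kappa>::'a \<Rightarrow> nat \<Rightarrow> int. (\<forall>x\<in>carrier G. \<forall>i. L x i = (\<Sum>p<r. of_int (\<kappa> x p) * L (\<eta> p) i)) \<and>
    discrete_embedding G (\<lambda>x p. of_int (\<kappa> x p)) r \<and>
    (\<forall>p<r. \<forall>q. \<kappa> (\<eta> p) q = (if q = p then 1 else 0))"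
proof -
  have \<eta>c: "\<eta> p \<in> carrier G" if "p < r" for p by (rule group_basisD_carrier[OF \<eta> that])
  have "\<forall>x\<in>carrier G. int_spanned \<eta> x"
    using group_basis_spanning[OF \<eta>] by (rule ballI)
  from bchoice[OF this] obtain \<kappa>0 :: "'a \<Rightarrow> nat \<Rightarrow> int" where
    \<kappa>0: "\<forall>x\<in>carrier G. \<forall>i. L x i = (\<Sum>p<r. of_int (\<kappa>0 x p) * L (\<eta> p) i)" ..
  define \<kappa> where "\<kappa> x p = (if p < r then \<kappa>0 x p else 0)" for x p
  have \<kappa>: "L x i = (\<Sum>p<r. of_int (\<kappa> x p) * L (\<eta> p) i)" if "x \<in> carrier G" for x i
  proof -
    have "L x i = (\<Sum>p<r. of_int (\<kappa>0 x p) * L (\<eta> p) i)" using \<kappa>0 that by (elim ballE allE) auto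
    also have "\<dots> = (\<Sum>p<r. of_int (\<kappa> x p) * L (\<eta> p) i)" by (intro sum.cong refl) (simp add: \<kappa>_def)
    finally show ?thesis .
  qed
  have uniq: "a p = of_int (\<kappa> x p)"
    if x: "x \<in> carrier G" and a: "\<And>i. i < r \<Longrightarrow> L x i = (\<Sum>p<r. a p * L (\<eta> p) i)" and p: "p < r" for x a p
  proof -
    have "a p - of_int (\<kappa> x p) = 0"
    proof (rule integral_spanning_independent[of \<eta> "\<lambda>p. a p - of_int (\<kappa> x p)", OF group_basis_spanning[OF \<eta>] _ p])
      fix i assume "i < r"
      thus "(\<Sum>p<r. (a p - of_int (\<kappa> x p)) * L (\<eta> p) i) = 0"
        using a[of i] \<kappa>[OF x, of i] by (simp add: left_diff_distrib sum_subtractf)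
    qed
    thus ?thesis by simp
  qed
  have delta: "\<kappa> (\<eta> p) q = (if q = p then 1 else 0)" if p: "p < r" for p q
  proof (cases "q < r")
    case True
    have "(if q = p then 1 else 0) = real_of_int (\<kappa> (\<eta> p) q)"
    proof (rule uniq[of "\<eta> p" "\<lambda>q. if q = p then 1 else 0", OF \<eta>c[OF p] _ True])
      fix i
      have "(\<Sum>q<r. (if q = p then 1 else 0) * L (\<eta> q) i) = (\<Sum>q<r. if q = p then L (\<eta> q) i else 0)"
        by (intro sum.cong refl) simp
      thus "L (\<eta> p) i = (\<Sum>q<r. (if q = p then 1 else 0) * L (\<eta> q) i)" using p by simp
    qed
    thus ?thesis by (auto split: if_splits)
  qed (use p in \<open>auto simp: \<kappa>_def\<close>)
  have "discrete_embedding G (\<lambda>x p. of_int (\<kappa> x p)) r"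
  proof unfold_locales
    show "real_of_int (\<kappa> (x \<otimes> y) i) = real_of_int (\<kappa> x i) + real_of_int (\<kappa> y i)"
      if xy: "x \<in> carrier G" "y \<in> carrier G" for x y i
    proof (cases "i < r")
      case True
      show ?thesis
      proof (rule uniq[of "x \<otimes> y" "\<lambda>p. real_of_int (\<kappa> x p) + real_of_int (\<kappa> y p)", OF m_closed[OF xy] _ True, symmetric])
        fix i
        show "L (x \<otimes> y) i = (\<Sum>p<r. (real_of_int (\<kappa> x p) + real_of_int (\<kappa> y p)) * L (\<eta> p) i)"
          unfolding L_mult[OF xy] \<kappa>[OF xy(1)] \<kappa>[OF xy(2)] by (simp only: distrib_right sum.distrib)
      qed
    qed (simp add: \<kappa>_def)
    show "real_of_int (\<kappa> x i) = 0" if "r \<le> i" for x i using that by (simp add: \<kappa>_def)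
    show "finite {x \<in> carrier G. \<forall>i<r. \<bar>real_of_int (\<kappa> x i)\<bar> \<le> B}" for B
    proof -
      define B' where "B' = (\<Sum>i<r. \<Sum>p<r. \<bar>B\<bar> * \<bar>L (\<eta> p) i\<bar>)"
      have "\<bar>L x i\<bar> \<le> B'" if "x \<in> carrier G" "\<forall>i<r. \<bar>real_of_int (\<kappa> x i)\<bar> \<le> B" "i < r" for x i
        unfolding \<kappa>[OF that(1)] B'_def by (rule abs_combination_le[OF that(2,3)])
      hence "{x \<in> carrier G. \<forall>i<r. \<bar>real_of_int (\<kappa> x i)\<bar> \<le> B} \<subseteq> {x \<in> carrier G. \<forall>i<r. \<bar>L x i\<bar> \<le> B'}" by auto
      thus ?thesis using L_disc by (rule finite_subset)
    qed
    show "\<forall>i<r. c i = 0" if c: "\<And>x. x \<in> carrier G \<Longrightarrow> (\<Sum>i<r. c i * real_of_int (\<kappa> x i)) = 0" for c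
    proof (intro allI impI)
      fix q assume q: "q < r"
      have "(\<Sum>i<r. c i * real_of_int (\<kappa> (\<eta> q) i)) = (\<Sum>i<r. if i = q then c i else 0)"
        by (intro sum.cong refl) (simp add: delta[OF q])
      thus "c q = 0" using c[OF \<eta>c[OF q]] q by simp
    qed
  qed
  thus ?thesis using \<kappa> delta by (intro exI[of _ \<kappa>] conjI ballI allI impI)
qed

text \<open>The integer matrix of an independent family of \<open>r\<close> elements of
  \<open>H\<close> is invertible over the rationals; \<open>N\<close> is a common denominator of its
  inverse.\<close>

lemma subgroup_axis_multiples:
  assumes int: "\<And>x p. x \<in> carrier G \<Longrightarrow> L x p = of_int (\<kappa> x p)"
    and \<eta>: "\<And>p q. p < r \<Longrightarrow> L (\<eta> p) q = (if q = p then 1 else 0)"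
    and H: "subgroup H G" and rank: "group_rank (G\<lparr>carrier := H\<rparr>) = r"
  shows "\<exists>N::int. N > 0 \<and> (\<forall>i<r. \<exists>x\<in>H. \<forall>p. L x p = (if p = i then of_int N else 0))"
proof -
  \<comment> \<open>The rank is a maximum over a finite nonempty set, so it is attained by a family
    in \<open>H\<close>.\<close>
  define S where "S = {n. \<exists>x. mult_independent (G\<lparr>carrier := H\<rparr>) n x}"
  have "S \<subseteq> {..r}" unfolding S_def mult_independent_subgroup[OF H] using mult_independent_le by blast
  hence "finite S" using finite_subset by blast
  moreover have "mult_independent (G\<lparr>carrier := H\<rparr>) 0 (\<lambda>_. undefined)" by (simp add: mult_independent_def)
  hence "S \<noteq> {}" unfolding S_def by blast
  ultimately have "Max S \<in> S" by (rule Max_in)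
  hence "r \<in> S" using rank by (simp add: group_rank_def S_def)
  then obtain h where h: "mult_independent G r h" "\<forall>q<r. h q \<in> H"
    unfolding S_def mult_independent_subgroup[OF H] by blast
  have hc: "h q \<in> carrier G" if "q < r" for q using h(1) that by (rule mult_independentD_carrier)
  have ker: "\<forall>q\<in>{..<r}. c q = 0" if c: "\<And>p. p \<in> {..<r} \<Longrightarrow> (\<Sum>q<r. of_int (\<kappa> (h q) p) * c q) = 0" for c :: "nat \<Rightarrow> rat"
  proof
    fix q assume "q \<in> {..<r}"
    hence q: "q < r" by simp
    show "c q = 0"
    proof (rule mult_independent_rational[OF h(1), of "\<lambda>q. \<kappa> (h q)" \<eta> c q, OF _ _ q])
      fix q i assume qi: "q < r" "i < r"
      have "(\<Sum>p<r. of_int (\<kappa> (h q) p) * L (\<eta> p) i) = (\<Sum>p<r. if i = p then of_int (\<kappa> (h q) p) else 0)"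
        by (intro sum.cong refl) (simp add: \<eta>)
      thus "L (h q) i = (\<Sum>p<r. of_int (\<kappa> (h q) p) * L (\<eta> p) i)" using qi int[OF hc] by simp
    next
      fix p assume "p < r"
      thus "(\<Sum>q<r. of_int (\<kappa> (h q) p) * c q) = 0" using c by simp
    qed
  qed
  have "\<forall>i. \<exists>d::nat \<Rightarrow> rat. \<forall>p\<in>{..<r}. (\<Sum>q<r. of_int (\<kappa> (h q) p) * d q) = (if p = i then 1 else 0)"
    using ker by (intro allI square_system_solvable) simp_all
  from choice[OF this] obtain d :: "nat \<Rightarrow> nat \<Rightarrow> rat" where
    d: "\<forall>i. \<forall>p\<in>{..<r}. (\<Sum>q<r. of_int (\<kappa> (h q) p) * d i q) = (if p = i then 1 else 0)" ..
  obtain N :: int where N: "N > 0" "\<forall>s\<in>{..<r} \<times> {..<r}. of_int N * (case s of (i, q) \<Rightarrow> d i q) \<in> \<int>"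
    using common_denominator[of "{..<r} \<times> {..<r}" "\<lambda>(i, q). d i q"] by blast
  define m where "m i q = \<lfloor>of_int N * d i q\<rfloor>" for i q
  have m: "of_int (m i q) = of_int N * d i q" if "i < r" "q < r" for i q
  proof -
    have "of_int N * d i q \<in> \<int>" using bspec[OF N(2), of "(i, q)"] that by simp
    thus ?thesis by (auto simp: m_def elim: Ints_cases)
  qed
  have "\<exists>x\<in>H. \<forall>p. L x p = (if p = i then of_int N else 0)" if i: "i < r" for i
  proof
    let ?x = "finprod G (\<lambda>q. h q [^] m i q) {..<r}"
    show "?x \<in> H" using h(2) by (intro finprod_in_subgroup int_pow_in_subgroup H) simp
    show "\<forall>p. L ?x p = (if p = i then of_int N else 0)"
    proof
      fix p
      show "L ?x p = (if p = i then of_int N else 0)"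
      proof (cases "p < r")
        case True
        have "L ?x p = (\<Sum>q<r. of_int (m i q) * L (h q) p)" by (rule L_finprod_int_pow) (simp add: hc)
        also have "\<dots> = of_int (\<Sum>q<r. m i q * \<kappa> (h q) p)"
          unfolding of_int_sum by (intro sum.cong refl) (simp add: int hc)
        finally have 1: "L ?x p = of_int (\<Sum>q<r. m i q * \<kappa> (h q) p)" .
        have "rat_of_int (\<Sum>q<r. m i q * \<kappa> (h q) p) = (\<Sum>q<r. of_int N * (of_int (\<kappa> (h q) p) * d i q))"
          unfolding of_int_sum of_int_mult by (intro sum.cong refl) (simp add: m i)
        also have "\<dots> = of_int N * (if p = i then 1 else 0)"
          unfolding sum_distrib_left[symmetric] using d True by simp
        also have "\<dots> = of_int (if p = i then N else 0)" by simp
        finally have "(\<Sum>q<r. m i q * \<kappa> (h q) p) = (if p = i then N else 0)" by (simp only: of_int_eq_iff)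
        thus ?thesis unfolding 1 by simp
      next
        case False
        thus ?thesis using i by (auto simp: L_supp)
      qed
    qed
  qed
  thus ?thesis using N(1) by blast
qed

lemma rcoset_eq_iff:
  assumes H: "subgroup H G" and xy: "x \<in> carrier G" "y \<in> carrier G"
  shows "H #> x = H #> y \<longleftrightarrow> x \<otimes> inv y \<in> H"
proof
  assume eq: "H #> x = H #> y"
  have "x \<in> H #> y" unfolding eq[symmetric] by (rule rcos_self[OF xy(1) H])
  then obtain h where h: "h \<in> H" "x = h \<otimes> y" by (auto simp: r_coset_def)
  have "x \<otimes> inv y = h" using h xy(2) subgroup.mem_carrier[OF H h(1)] by (simp add: m_assoc)
  thus "x \<otimes> inv y \<in> H" using h(1) by simp
next
  assume h: "x \<otimes> inv y \<in> H"
  have "x = (x \<otimes> inv y) \<otimes> y" using xy by (simp add: m_assoc)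
  hence "x \<in> H #> y" using h by (auto simp: r_coset_def)
  from repr_independence[OF this xy(2) H] show "H #> x = H #> y" ..
qed

text \<open>\<open>H\<close> contains the multiples by \<open>N\<close> of all unit vectors, so the
  coset of an element is determined by its coordinates modulo \<open>N\<close>.\<close>

lemma finite_rcosets:
  assumes int: "\<And>x p. x \<in> carrier G \<Longrightarrow> L x p = of_int (\<kappa> x p)"
    and inj: "\<And>x. x \<in> carrier G \<Longrightarrow> (\<And>i. i < r \<Longrightarrow> L x i = 0) \<Longrightarrow> x = \<one>"
    and H: "subgroup H G" and N: "N > 0"
    and mult: "\<And>i. i < r \<Longrightarrow> \<exists>x\<in>H. \<forall>p. L x p = (if p = i then of_int N else 0)"
  shows "finite (rcosets H)"
proof -
  have "\<forall>i\<in>{..<r}. \<exists>x. x \<in> H \<and> (\<forall>p. L x p = (if p = i then of_int N else 0))" using mult by blast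
  from bchoice[OF this] obtain h where h: "\<And>i. i < r \<Longrightarrow> h i \<in> H"
    "\<And>i p. i < r \<Longrightarrow> L (h i) p = (if p = i then of_int N else 0)" by auto
  have hc: "h i \<in> carrier G" if "i < r" for i by (rule subgroup.mem_carrier[OF H h(1)[OF that]])
  define \<rho> where "\<rho> x = (\<lambda>p\<in>{..<r}. \<kappa> x p mod N)" for x
  have same: "H #> x = H #> y" if xy: "x \<in> carrier G" "y \<in> carrier G" and \<rho>: "\<rho> x = \<rho> y" for x y
  proof -
    define t where "t p = (\<kappa> x p - \<kappa> y p) div N" for p
    have t: "\<kappa> x p - \<kappa> y p = N * t p" if "p < r" for p
    proof -
      have "\<kappa> x p mod N = \<kappa> y p mod N" using fun_cong[OF \<rho>, of p] that by (simp add: \<rho>_def)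
      thus ?thesis by (simp add: t_def mod_eq_dvd_iff)
    qed
    have "x \<otimes> inv y = finprod G (\<lambda>p. h p [^] t p) {..<r}"
    proof (rule L_eqD[OF inj])
      show "finprod G (\<lambda>p. h p [^] t p) {..<r} \<in> carrier G" by (rule finprod_int_pow_closed) (simp add: hc)
      fix i assume i: "i < r"
      have "L (finprod G (\<lambda>p. h p [^] t p) {..<r}) i = (\<Sum>p<r. of_int (t p) * L (h p) i)"
        by (rule L_finprod_int_pow) (simp add: hc)
      also have "\<dots> = (\<Sum>p<r. if i = p then of_int (N * t p) else 0)"
        by (intro sum.cong refl) (simp add: h)
      also have "\<dots> = of_int (N * t i)" using i by simp
      also have "\<dots> = L x i - L y i" unfolding t[OF i, symmetric] using xy by (simp add: int)
      also have "\<dots> = L (x \<otimes> inv y) i" using xy by (simp add: L_mult L_inv)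
      finally show "L (x \<otimes> inv y) i = L (finprod G (\<lambda>p. h p [^] t p) {..<r}) i" ..
    qed (use xy in simp_all)
    also have "\<dots> \<in> H" using h(1) by (intro finprod_in_subgroup int_pow_in_subgroup H) simp
    finally show ?thesis using rcoset_eq_iff[OF H xy] by simp
  qed
  have "\<rho> ` carrier G \<subseteq> PiE {..<r} (\<lambda>_. {0..<N})" using N by (auto simp: \<rho>_def split: if_splits)
  hence fin: "finite (\<rho> ` carrier G)" using finite_PiE[of "{..<r}" "\<lambda>_. {0..<N}"] finite_subset by blast
  have "rcosets H \<subseteq> (\<lambda>z. H #> (SOME x. x \<in> carrier G \<and> \<rho> x = z)) ` (\<rho> ` carrier G)"
  proof
    fix C assume "C \<in> rcosets H"
    then obtain x where x: "x \<in> carrier G" "C = H #> x" by (auto simp: RCOSETS_def)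
    have "\<exists>y. y \<in> carrier G \<and> \<rho> y = \<rho> x" using x by blast
    from someI_ex[OF this] have "C = H #> (SOME y. y \<in> carrier G \<and> \<rho> y = \<rho> x)"
      unfolding x(2) by (intro same) (use x in simp_all)
    thus "C \<in> (\<lambda>z. H #> (SOME x. x \<in> carrier G \<and> \<rho> x = z)) ` (\<rho> ` carrier G)"
      using x(1) by (intro image_eqI[where x = "\<rho> x"]) simp_all
  qed
  thus ?thesis using fin by (meson finite_imageI finite_subset)
qed

text \<open>The integer points of the box with sides \<open>L (f i) i\<close> represent distinct
  cosets. If the difference of two of them lay in \<open>H\<close>, the topmost index
  \<open>M\<close> with nonzero coefficient would make it a nonzero multiple of the side in
  coordinate \<open>M\<close>, too large for the box.\<close>

lemma index_ge_prod:
  assumes int: "\<And>x p. x \<in> carrier G \<Longrightarrow> L x p = of_int (\<kappa> x p)"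
    and \<eta>: "\<And>p. p < r \<Longrightarrow> \<eta> p \<in> carrier G" "\<And>p q. p < r \<Longrightarrow> L (\<eta> p) q = (if q = p then 1 else 0)"
    and H: "subgroup H G" and fin: "finite (rcosets H)"
    and f: "\<And>i. i < r \<Longrightarrow> f i \<in> H" "\<And>i. i < r \<Longrightarrow> L (f i) i > 0" "\<And>i j. i < r \<Longrightarrow> i < j \<Longrightarrow> L (f i) j = 0"
    and span: "\<And>x. x \<in> H \<Longrightarrow> \<exists>n::nat \<Rightarrow> int. \<forall>j. L x j = (\<Sum>i<r. of_int (n i) * L (f i) j)"
  shows "(\<Prod>i<r. L (f i) i) \<le> real (card (rcosets H))"
proof -
  define d where "d i = nat (\<kappa> (f i) i)" for i
  have d: "L (f i) i = real (d i)" if "i < r" for i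
    using f(2)[OF that] int[OF subgroup.mem_carrier[OF H f(1)[OF that]], of i] by (simp add: d_def)
  define B where "B = PiE {..<r} (\<lambda>i. {..<d i})"
  define g where "g y = finprod G (\<lambda>p. \<eta> p [^] int (y p)) {..<r}" for y
  have gc: "g y \<in> carrier G" for y unfolding g_def by (rule finprod_int_pow_closed) (simp add: \<eta>)
  have Lg: "L (g y) i = real (y i)" if i: "i < r" for y i
  proof -
    have "L (g y) i = (\<Sum>p<r. of_int (int (y p)) * L (\<eta> p) i)"
      unfolding g_def by (rule L_finprod_int_pow) (simp add: \<eta>)
    also have "\<dots> = (\<Sum>p<r. if i = p then real (y p) else 0)" by (intro sum.cong refl) (simp add: \<eta>)
    finally show ?thesis using i by simp
  qed
  have inj: "inj_on (\<lambda>y. H #> g y) B"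
  proof (rule inj_onI)
    fix y z assume yz: "y \<in> B" "z \<in> B" and eq: "H #> g y = H #> g z"
    have "g y \<otimes> inv (g z) \<in> H" using eq rcoset_eq_iff[OF H gc gc] by simp
    from span[OF this] obtain n :: "nat \<Rightarrow> int" where
      n: "\<forall>j. L (g y \<otimes> inv (g z)) j = (\<Sum>i<r. of_int (n i) * L (f i) j)" ..
    have diff: "real (y j) - real (z j) = (\<Sum>i<r. of_int (n i) * L (f i) j)" if "j < r" for j
      using spec[OF n, of j] Lg[OF that] gc by (simp add: L_mult L_inv)
    have "n i = 0" if "i < r" for i
    proof (rule ccontr)
      assume ni: "n i \<noteq> 0"
      define M where "M = Max {i. i < r \<and> n i \<noteq> 0}"
      have fM: "finite {i. i < r \<and> n i \<noteq> 0}" by simp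
      have "M \<in> {i. i < r \<and> n i \<noteq> 0}" unfolding M_def using that ni by (intro Max_in fM) blast
      hence M: "M < r" "n M \<noteq> 0" by simp_all
      have big: "n i = 0" if "i < r" "M < i" for i
      proof (rule ccontr)
        assume "n i \<noteq> 0"
        hence "i \<le> M" unfolding M_def using that(1) by (intro Max_ge fM) simp
        thus False using that(2) by simp
      qed
      have "(\<Sum>i<r. of_int (n i) * L (f i) M) = (\<Sum>i<r. if i = M then of_int (n M) * L (f M) M else 0)"
      proof (intro sum.cong refl)
        fix i assume "i \<in> {..<r}"
        thus "of_int (n i) * L (f i) M = (if i = M then of_int (n M) * L (f M) M else 0)"
          using big[of i] f(3)[of i M] by (cases i M rule: linorder_cases) simp_all
      qed
      hence e: "real (y M) - real (z M) = of_int (n M) * real (d M)" using diff[OF M(1)] M(1) d[OF M(1)] by simp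
      have lt: "y M < d M" "z M < d M" using yz M(1) by (auto simp: B_def PiE_iff)
      have "real (d M) * 1 \<le> real (d M) * \<bar>of_int (n M)\<bar>" using M(2) by (intro mult_left_mono) auto
      also have "\<dots> = \<bar>real (y M) - real (z M)\<bar>" unfolding e by (simp add: abs_mult)
      also have "\<dots> < real (d M)" using lt by linarith
      finally show False by simp
    qed
    hence yz': "y j = z j" if "j < r" for j using diff[OF that] by simp
    show "y = z" by (rule PiE_ext[OF yz[unfolded B_def]]) (simp add: yz')
  qed
  have "card B \<le> card (rcosets H)"
    by (rule card_inj_on_le[OF inj _ fin]) (auto simp: RCOSETS_def intro: gc)
  moreover have "card B = (\<Prod>i<r. d i)" by (simp add: B_def card_PiE)
  moreover have "(\<Prod>i<r. L (f i) i) = (\<Prod>i<r. real (d i))" by (intro prod.cong refl) (simp add: d)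
  ultimately show ?thesis by (simp flip: of_nat_prod)
qed

text \<open>In integral coordinates \<open>H\<close> has a triangular basis \<open>f\<close>, so the
  determinant of \<open>L\<close> on \<open>f\<close> is that on \<open>\<eta>\<close> times the
  product of the diagonal, and this product is at most the index. Minkowski's theorem is applied to
  the lattice spanned by the vectors \<open>L (f j)\<close>.\<close>

theorem short_independent_elements:
  assumes inj: "\<And>x. x \<in> carrier G \<Longrightarrow> (\<And>i. i < r \<Longrightarrow> L x i = 0) \<Longrightarrow> x = \<one>"
    and \<eta>: "group_basis G r \<eta>" and H: "subgroup H G" and rank: "group_rank (G\<lparr>carrier := H\<rparr>) = r"
  shows "\<exists>\<psi>. (\<forall>j<r. \<psi> j \<in> H) \<and> mult_independent G r \<psi> \<and>
    (\<Prod>j<r. \<Sum>i<r. \<bar>L (\<psi> j) i\<bar>) \<le>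
      fact r * \<bar>det (mat r r (\<lambda>(i, j). L (\<eta> j) i))\<bar> * real (card (rcosets H))"
proof -
  note Hc = subgroup.mem_carrier[OF H]
  have \<eta>c: "\<eta> p \<in> carrier G" if "p < r" for p by (rule group_basisD_carrier[OF \<eta> that])
  obtain \<kappa> :: "'a \<Rightarrow> nat \<Rightarrow> int" where
    \<kappa>0: "\<forall>x\<in>carrier G. \<forall>i. L x i = (\<Sum>p<r. of_int (\<kappa> x p) * L (\<eta> p) i)"
    and emb: "discrete_embedding G (\<lambda>x p. of_int (\<kappa> x p)) r"
    and delta0: "\<forall>p<r. \<forall>q. \<kappa> (\<eta> p) q = (if q = p then 1 else 0)"
    using integral_coordinates[OF \<eta>] by (elim exE conjE) (rule that)
  note \<kappa> = bspec[OF \<kappa>0, THEN spec]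
  define M where "M x p = real_of_int (\<kappa> x p)" for x p
  interpret M: discrete_embedding G M r using emb unfolding M_def .
  have delta: "M (\<eta> p) q = (if q = p then 1 else 0)" if "p < r" for p q using delta0 that by (simp add: M_def)
  have Mint: "M x p = of_int (\<kappa> x p)" for x p by (simp add: M_def)
  have Minj: "x = \<one>" if x: "x \<in> carrier G" and 0: "\<And>p. p < r \<Longrightarrow> M x p = 0" for x
  proof (rule inj[OF x])
    fix i
    show "L x i = 0" unfolding \<kappa>[OF x] using 0 by (intro sum.neutral) (simp add: M_def)
  qed
  obtain N :: int where N: "N > 0" "\<And>i. i < r \<Longrightarrow> \<exists>x\<in>H. \<forall>p. M x p = (if p = i then of_int N else 0)"
    using M.subgroup_axis_multiples[OF Mint delta H rank] by blast
  \<comment> \<open>The cardinality of an infinite set is 0 by convention, so finiteness must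
    precede any lower bound for the index.\<close>
  have fin: "finite (rcosets H)" by (rule M.finite_rcosets[OF Mint Minj H N])
  have "\<exists>e. (\<forall>i<r. e i \<in> M ` H \<and> e i i > 0 \<and> (\<forall>j>i. e i j = 0)) \<and>
    (\<forall>x\<in>M ` H. \<exists>n::nat \<Rightarrow> int. \<forall>j. x j = (\<Sum>i<r. of_int (n i) * e i j))"
  proof (rule triangular_basis)
    show "subtraction_closed (M ` H)" by (rule M.subtraction_closed_image[OF H])
    show "y i = 0" if "y \<in> M ` H" "i \<ge> r" for y i using that M.L_supp by auto
    show "finite {y \<in> M ` H. \<forall>i<r. \<bar>y i\<bar> \<le> B}" for B
      using Hc by (intro finite_subset[OF _ M.finite_bounded_image[of B]]) auto
    fix i assume i: "i < r"
    from N(2)[OF i] obtain x where x: "x \<in> H" "\<forall>p. M x p = (if p = i then of_int N else 0)" ..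
    thus "\<exists>y\<in>M ` H. y i > 0 \<and> (\<forall>j. j \<noteq> i \<longrightarrow> y j = 0)"
      using N(1) by (intro bexI[of _ "M x"]) simp_all
  qed
  then obtain e where e: "\<forall>i<r. e i \<in> M ` H \<and> e i i > 0 \<and> (\<forall>j>i. e i j = 0)"
    and sp: "\<forall>x\<in>M ` H. \<exists>n::nat \<Rightarrow> int. \<forall>j. x j = (\<Sum>i<r. of_int (n i) * e i j)" by (elim exE conjE) (rule that)
  have "\<forall>i\<in>{..<r}. \<exists>x. x \<in> H \<and> e i = M x" using e by (auto simp: image_iff Bex_def)
  from bchoice[OF this] obtain f where f0: "\<forall>i\<in>{..<r}. f i \<in> H \<and> e i = M (f i)" ..
  have f: "f i \<in> H" "e i = M (f i)" if "i < r" for i using f0 that by simp_all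
  have fpos: "M (f i) i > 0" if "i < r" for i using e that unfolding f(2)[OF that, symmetric] by blast
  have ftri: "M (f i) j = 0" if "i < r" "i < j" for i j using e that unfolding f(2)[OF that(1), symmetric] by blast
  have span: "\<exists>n::nat \<Rightarrow> int. \<forall>j. M x j = (\<Sum>i<r. of_int (n i) * M (f i) j)" if "x \<in> H" for x
  proof -
    have "M x \<in> M ` H" using that by (rule imageI)
    from bspec[OF sp this] obtain n :: "nat \<Rightarrow> int" where
      n: "\<forall>j. M x j = (\<Sum>i<r. of_int (n i) * e i j)" ..
    have "M x j = (\<Sum>i<r. of_int (n i) * M (f i) j)" for j
      unfolding spec[OF n, of j] by (intro sum.cong refl) (simp add: f(2))
    thus ?thesis by (intro exI[of _ n] allI)
  qed
  have index: "(\<Prod>i<r. M (f i) i) \<le> real (card (rcosets H))"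
    by (rule M.index_ge_prod[OF Mint \<eta>c delta H fin f(1) fpos ftri span])
  define A where "A i j = L (f j) i" for i j
  let ?R = "det (mat r r (\<lambda>(i, j). L (\<eta> j) i))"
  let ?T = "mat r r (\<lambda>(p, j). M (f j) p)"
  have "mat r r (\<lambda>(i, j). A i j) = mat r r (\<lambda>(i, p). L (\<eta> p) i) * ?T"
    unfolding mat_mult_of_functions
  proof (rule eq_matI)
    fix i j assume ij: "i < dim_row (mat r r (\<lambda>(i, j). \<Sum>p<r. L (\<eta> p) i * M (f j) p))"
      "j < dim_col (mat r r (\<lambda>(i, j). \<Sum>p<r. L (\<eta> p) i * M (f j) p))"
    have "A i j = (\<Sum>p<r. L (\<eta> p) i * M (f j) p)"
      unfolding A_def using ij(2) \<kappa>[OF Hc[OF f(1)], of j i] by (simp add: M_def mult.commute)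
    thus "mat r r (\<lambda>(i, j). A i j) $$ (i, j) = mat r r (\<lambda>(i, j). \<Sum>p<r. L (\<eta> p) i * M (f j) p) $$ (i, j)"
      using ij by simp
  qed simp_all
  hence "det (mat r r (\<lambda>(i, j). A i j)) = ?R * det ?T"
    by (simp add: det_mult[of _ r])
  moreover have "det ?T = prod_list (diag_mat ?T)"
    by (rule det_upper_triangular[of _ r]) (auto simp: ftri)
  moreover have "prod_list (diag_mat ?T) = (\<Prod>i<r. M (f i) i)"
  proof -
    have "diag_mat ?T = map (\<lambda>i. M (f i) i) [0..<r]" unfolding diag_mat_def by (auto intro!: map_cong)
    thus ?thesis by (simp add: prod.list_conv_set_nth lessThan_atLeast0)
  qed
  ultimately have detA: "det (mat r r (\<lambda>(i, j). A i j)) = ?R * (\<Prod>i<r. M (f i) i)" by simp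
  have pos: "(\<Prod>i<r. M (f i) i) > 0" using fpos by (intro prod_pos) simp
  have "?R \<noteq> 0"
  proof (rule det_nonzero_iff_kernel[of r "\<lambda>i j. L (\<eta> j) i", THEN iffD2], intro allI impI)
    fix c p assume c: "\<forall>i<r. (\<Sum>j<r. L (\<eta> j) i * c j) = 0" and p: "p < r"
    show "c p = 0"
    proof (rule integral_spanning_independent[of \<eta> c, OF group_basis_spanning[OF \<eta>] _ p])
      fix i assume "i < r"
      thus "(\<Sum>p<r. c p * L (\<eta> p) i) = 0" using c by (simp add: mult.commute)
    qed
  qed
  hence detA0: "det (mat r r (\<lambda>(i, j). A i j)) \<noteq> 0"
    unfolding detA using pos by (metis less_irrefl mult_eq_0_iff)
  obtain z :: "nat \<Rightarrow> nat \<Rightarrow> int" where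
    zind: "\<forall>c::nat \<Rightarrow> real. (\<forall>j<r. (\<Sum>p<r. c p * of_int (z p j)) = 0) \<longrightarrow> (\<forall>p<r. c p = 0)"
    and zle: "(\<Prod>p<r. l1_form r A (\<lambda>j. of_int (z p j))) \<le> fact r * \<bar>det (mat r r (\<lambda>(i, j). A i j))\<bar>"
    using minkowski_second_l1[OF detA0] by (elim exE conjE) (rule that)
  define \<psi> where "\<psi> p = finprod G (\<lambda>j. f j [^] z p j) {..<r}" for p
  have \<psi>H: "\<psi> p \<in> H" for p unfolding \<psi>_def using f(1) by (intro finprod_in_subgroup int_pow_in_subgroup H) simp
  have L\<psi>: "L (\<psi> p) i = (\<Sum>j<r. A i j * of_int (z p j))" for p i
    unfolding \<psi>_def by (subst L_finprod_int_pow) (simp_all add: f Hc A_def mult.commute)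
  have "mult_independent G r \<psi>"
  proof (rule mult_independentI)
    show "\<psi> p \<in> carrier G" for p by (rule Hc[OF \<psi>H])
    fix c p assume c: "\<And>i. i < r \<Longrightarrow> (\<Sum>p<r. c p * L (\<psi> p) i) = 0" and p: "p < r"
    have "(\<Sum>p<r. c p * of_int (z p j)) = 0" if j: "j < r" for j
    proof (rule kernel_of_det_nonzero[OF detA0 _ j])
      fix i assume i: "i < r"
      have "(\<Sum>j<r. A i j * (\<Sum>p<r. c p * of_int (z p j))) = (\<Sum>j<r. \<Sum>p<r. c p * (A i j * of_int (z p j)))"
        by (intro sum.cong refl) (simp add: sum_distrib_left mult_ac)
      also have "\<dots> = (\<Sum>p<r. c p * L (\<psi> p) i)" by (subst sum.swap) (simp add: L\<psi> sum_distrib_left)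
      finally show "(\<Sum>j<r. A i j * (\<Sum>p<r. c p * of_int (z p j))) = 0" using c[OF i] by simp
    qed
    thus "c p = 0" using spec[OF zind, of c] p by simp
  qed
  moreover have "(\<Prod>j<r. \<Sum>i<r. \<bar>L (\<psi> j) i\<bar>) \<le> fact r * \<bar>?R\<bar> * real (card (rcosets H))"
  proof -
    have "(\<Prod>j<r. \<Sum>i<r. \<bar>L (\<psi> j) i\<bar>) = (\<Prod>p<r. l1_form r A (\<lambda>j. of_int (z p j)))"
      by (simp add: L\<psi> l1_form_def)
    also have "\<dots> \<le> fact r * (\<bar>?R\<bar> * (\<Prod>i<r. M (f i) i))" using zle pos unfolding detA by (simp add: abs_mult)
    also have "\<dots> \<le> fact r * (\<bar>?R\<bar> * real (card (rcosets H)))" using index by (intro mult_left_mono) simp_all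
    finally show ?thesis by (simp add: mult.assoc)
  qed
  ultimately show ?thesis using \<psi>H by blast
qed

end

section \<open>The rank of the unit group\<close>

lemma unit_group_nat_pow:
  assumes K: "field_set K"
  shows "x [^]\<^bsub>unit_group K\<^esub> (n::nat) = x ^ n"
proof -
  interpret U: comm_group "unit_group K" by (rule unit_group_comm_group[OF K])
  show ?thesis by (induction n) (simp_all add: mult.commute)
qed

lemma arch_place_mult:
  assumes "w \<in> arch_places K" "x \<in> K" "y \<in> K"
  shows "w (x * y) = w x * w y"
  using assms by (auto simp: arch_places_def absolute_value_def)

lemma log_vector_mult:
  assumes nf: "number_field K" and w: "w \<in> arch_places K"
    and xy: "x \<in> units K" "y \<in> units K"
  shows "log_vector K (x * y) w = log_vector K x w + log_vector K y w"
proof -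
  have "x \<in> K" "y \<in> K" using xy by (auto simp: unit_group_carrier[OF nf_props(1)[OF nf]])
  hence "w (x * y) = w x * w y" by (rule arch_place_mult[OF w])
  thus ?thesis using arch_place_pos[OF nf w xy(1)] arch_place_pos[OF nf w xy(2)]
    by (simp add: log_vector_def ln_mult distrib_left)
qed

lemma torsion_arch_place:
  assumes nf: "number_field K" and w: "w \<in> arch_places K" and t: "t \<in> torsion (unit_group K)"
  shows "w t = 1"
proof -
  note K = nf_props(1)[OF nf]
  obtain n :: nat where n: "n > 0" "t ^ n = 1" and tU: "t \<in> units K"
    using t by (auto simp: torsion_def unit_group_nat_pow[OF K])
  have tK: "t \<in> K" using tU by (simp add: unit_group_carrier[OF K])
  have wa: "absolute_value K w" using w by (simp add: arch_places_def)
  have "w t ^ n = 1" using absolute_value_props(1,2)[OF K wa] tK n(2) by metis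
  thus ?thesis using arch_place_pos[OF nf w tU] n(1) power_eq_iff_eq_base[of n "w t" 1] by simp
qed

definition place_coordinates :: "'a::field_char_0 set \<Rightarrow> nat \<Rightarrow> (nat \<Rightarrow> 'a \<Rightarrow> real) \<Rightarrow> 'a \<Rightarrow> nat \<Rightarrow> real" where
  "place_coordinates K r \<omega> u i = (if i < r then log_vector K u (\<omega> i) else 0)"

lemma enumerate_finite:
  assumes "finite S"
  obtains \<omega> :: "nat \<Rightarrow> 'b" where "bij_betw \<omega> {..<card S} S"
  using ex_bij_betw_nat_finite[OF assms] by (auto simp: lessThan_atLeast0)

lemma arch_places_nonempty: "number_field K \<Longrightarrow> arch_places K \<noteq> {}"
  using embeddings_nonempty by (simp add: arch_places_eq)

text \<open>Upper bounds on all logarithms leave finitely many units, and the places outside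
  \<open>S\<close> inherit theirs through \<open>rest\<close>. This serves the unit group, where one
  place is dropped, and the relative units, where one is dropped over each place of
  \<open>k\<close>.\<close>

lemma finite_of_bounded_sub_places:
  assumes nf: "number_field K" and S: "S \<subseteq> arch_places K"
    and rest: "\<And>u w. u \<in> V \<Longrightarrow> w \<in> arch_places K - S \<Longrightarrow> log_vector K u w \<le> (\<Sum>w\<in>S. \<bar>log_vector K u w\<bar>)"
    and V: "V \<subseteq> units K"
  shows "finite {u \<in> V. \<forall>w\<in>S. \<bar>log_vector K u w\<bar> \<le> B}"
proof (rule finite_subset[OF _ finite_bounded_log_vectors[OF nf, of "\<bar>B\<bar> + card S * \<bar>B\<bar>"]], rule subsetI)
  fix u assume u: "u \<in> {u \<in> V. \<forall>w\<in>S. \<bar>log_vector K u w\<bar> \<le> B}"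
  have "log_vector K u w \<le> \<bar>B\<bar> + card S * \<bar>B\<bar>" if w: "w \<in> arch_places K" for w
  proof (cases "w \<in> S")
    case True
    hence "\<bar>log_vector K u w\<bar> \<le> B" using u by blast
    moreover have "0 \<le> real (card S) * \<bar>B\<bar>" by simp
    ultimately show ?thesis by linarith
  next
    case False
    have "log_vector K u w \<le> (\<Sum>w\<in>S. \<bar>log_vector K u w\<bar>)" using u w False by (intro rest) auto
    also have "\<dots> \<le> (\<Sum>w\<in>S. \<bar>B\<bar>)" using u by (intro sum_mono) fastforce
    finally show ?thesis by simp
  qed
  thus "u \<in> {u \<in> units K. \<forall>w\<in>arch_places K. log_vector K u w \<le> \<bar>B\<bar> + card S * \<bar>B\<bar>}"
    using u V by auto
qed

text \<open>The product formula recovers the logarithm at the dropped place \<open>w0\<close>, which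
  gives discreteness. A functional that annihilates the remaining coordinates, extended by 0 at
  \<open>w0\<close>, is constant by \<open>log_annihilator_constant\<close>, hence zero, which gives
  full rank.\<close>

lemma unit_group_embedding:
  assumes nf: "number_field K"
  shows "\<exists>\<omega>. (\<forall>i<card (arch_places K) - 1. \<omega> i \<in> arch_places K) \<and>
    discrete_embedding (unit_group K) (place_coordinates K (card (arch_places K) - 1) \<omega>) (card (arch_places K) - 1)"
proof -
  note K = nf_props(1)[OF nf] and fin = finite_arch_places[OF nf]
  obtain w0 where w0: "w0 \<in> arch_places K" using arch_places_nonempty[OF nf] by blast
  define S where "S = arch_places K - {w0}"
  define r where "r = card (arch_places K) - 1"
  have S: "finite S" "card S = r" using fin w0 by (simp_all add: S_def r_def)
  have split: "(\<Sum>w\<in>arch_places K. f w) = f w0 + (\<Sum>w\<in>S. f w)" for f :: "('a \<Rightarrow> real) \<Rightarrow> real"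
    unfolding S_def by (rule sum.remove[OF fin w0])
  obtain \<omega> where \<omega>: "bij_betw \<omega> {..<r} S" using enumerate_finite[OF S(1)] S(2) by metis
  have \<omega>S: "\<omega> i \<in> S" if "i < r" for i using bij_betwE[OF \<omega>] that by blast
  interpret U: comm_group "unit_group K" by (rule unit_group_comm_group[OF K])
  have "discrete_embedding (unit_group K) (place_coordinates K r \<omega>) r"
  proof unfold_locales
    show "place_coordinates K r \<omega> (x \<otimes>\<^bsub>unit_group K\<^esub> y) i = place_coordinates K r \<omega> x i + place_coordinates K r \<omega> y i"
      if "x \<in> units K" "y \<in> units K" for x y i
    proof (cases "i < r")
      case True
      hence "\<omega> i \<in> arch_places K" using \<omega>S[OF True] by (simp add: S_def)
      thus ?thesis using that True by (simp add: place_coordinates_def log_vector_mult[OF nf])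
    qed (simp add: place_coordinates_def)
    show "place_coordinates K r \<omega> x i = 0" if "r \<le> i" for x i using that by (simp add: place_coordinates_def)
    show "finite {x \<in> units K. \<forall>i<r. \<bar>place_coordinates K r \<omega> x i\<bar> \<le> B}" for B
    proof -
      have "finite {u \<in> units K. \<forall>w\<in>S. \<bar>log_vector K u w\<bar> \<le> B}"
      proof (rule finite_of_bounded_sub_places[OF nf])
        fix u w assume u: "u \<in> units K" and w: "w \<in> arch_places K - S"
        hence w: "w = w0" by (auto simp: S_def)
        have "log_vector K u w0 = - (\<Sum>w\<in>S. log_vector K u w)"
          using sum_log_vector[OF nf u] split[of "log_vector K u"] by simp
        moreover have "\<bar>\<Sum>w\<in>S. log_vector K u w\<bar> \<le> (\<Sum>w\<in>S. \<bar>log_vector K u w\<bar>)" by (rule sum_abs)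
        ultimately show "log_vector K u w \<le> (\<Sum>w\<in>S. \<bar>log_vector K u w\<bar>)" unfolding w by linarith
      qed (auto simp: S_def)
      moreover have "{x \<in> units K. \<forall>i<r. \<bar>place_coordinates K r \<omega> x i\<bar> \<le> B} =
          {u \<in> units K. \<forall>w\<in>S. \<bar>log_vector K u w\<bar> \<le> B}"
        using bij_betw_imp_surj_on[OF \<omega>] by (auto simp: place_coordinates_def)
      ultimately show ?thesis by simp
    qed
    show "\<forall>i<r. c i = 0"
      if c: "\<And>x. x \<in> units K \<Longrightarrow> (\<Sum>i<r. c i * place_coordinates K r \<omega> x i) = 0" for c
    proof (intro allI impI)
      fix i assume i: "i < r"
      define g where "g w = (if w = w0 then 0 else c (the_inv_into {..<r} \<omega> w))" for w
      have g: "g (\<omega> i) = c i" if "i < r" for i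
        using \<omega>S[OF that] that by (simp add: g_def S_def the_inv_into_f_f[OF bij_betw_imp_inj_on[OF \<omega>]])
      have "g (\<omega> i) = g w0"
      proof (rule log_annihilator_constant[OF nf, where g = g])
        fix u assume u: "u \<in> units K"
        have "(\<Sum>w\<in>arch_places K. g w * log_vector K u w) = (\<Sum>w\<in>S. g w * log_vector K u w)"
          unfolding split by (simp add: g_def)
        also have "\<dots> = (\<Sum>i<r. g (\<omega> i) * log_vector K u (\<omega> i))"
          by (rule sum.reindex_bij_betw[OF \<omega>, symmetric])
        also have "\<dots> = (\<Sum>i<r. c i * place_coordinates K r \<omega> u i)"
          by (intro sum.cong refl) (simp add: g place_coordinates_def)
        finally show "(\<Sum>w\<in>arch_places K. g w * log_vector K u w) = 0" using c[OF u] by simp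
      qed (use \<omega>S[OF i] w0 in \<open>simp_all add: S_def\<close>)
      thus "c i = 0" using g[OF i] by (simp add: g_def)
    qed
  qed
  moreover have "\<forall>i<r. \<omega> i \<in> arch_places K" using \<omega>S by (simp add: S_def)
  ultimately show ?thesis unfolding r_def by blast
qed

lemma unit_rank_eq: "number_field K \<Longrightarrow> unit_rank K = card (arch_places K) - 1"
  using unit_group_embedding discrete_embedding.group_rank_eq unfolding unit_rank_def by blast

lemma torsion_of_log_zero:
  assumes nf: "number_field K" and u: "u \<in> units K"
    and 0: "\<And>w. w \<in> arch_places K \<Longrightarrow> log_vector K u w = 0"
  shows "u \<in> torsion (unit_group K)"
proof -
  obtain \<omega> where \<omega>: "\<forall>i<card (arch_places K) - 1. \<omega> i \<in> arch_places K"
    and emb: "discrete_embedding (unit_group K) (place_coordinates K (card (arch_places K) - 1) \<omega>) (card (arch_places K) - 1)"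
    using unit_group_embedding[OF nf] by blast
  interpret discrete_embedding "unit_group K" "place_coordinates K (card (arch_places K) - 1) \<omega>" "card (arch_places K) - 1"
    by (rule emb)
  have "\<exists>n::nat. n > 0 \<and> u [^]\<^bsub>unit_group K\<^esub> n = \<one>\<^bsub>unit_group K\<^esub>"
    using \<omega> 0 by (intro L_zero_torsion[OF u]) (simp add: place_coordinates_def)
  thus ?thesis using u unfolding torsion_def by blast
qed

section \<open>Norms of units\<close>

locale number_field_extension =
  fixes k l :: "'a::field_char_0 set"
  assumes nfk: "number_field k" and nfl: "number_field l" and sub: "k \<subseteq> l"
begin

lemma k: "field_set k" by (rule nf_props(1)[OF nfk])
lemma l: "field_set l" by (rule nf_props(1)[OF nfl])

lemma finite_extensions: "finite (extensions k l \<xi>)"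
  using card_embeddings(1)[OF nfl] by (simp add: extensions_def)

lemma relative_degree_exists: "\<exists>m>0. \<forall>\<xi>\<in>embs k. card (extensions k l \<xi>) = m"
proof -
  obtain bs where "ring.independent ambient k bs \<and> ring.Span ambient k bs = l"
    using relative_basis_list[OF nfk nfl sub] by blast
  hence b: "is_basis k l (length bs) ((!) bs)" by (simp add: is_basis_of_list[OF k])
  have m: "card (extensions k l \<xi>) = length bs" if "\<xi> \<in> embs k" for \<xi>
    by (rule card_extensions[OF nfk nfl sub b that])
  obtain \<tau> where \<tau>: "\<tau> \<in> embs l" using embeddings_nonempty[OF nfl] by blast
  have "\<tau> \<in> extensions k l (restrict \<tau> k)" using \<tau> by (simp add: extensions_def)
  hence "card (extensions k l (restrict \<tau> k)) > 0" using finite_extensions by (auto simp: card_gt_0_iff)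
  hence "length bs > 0" using m[OF embedding_restrict[OF \<tau> sub k]] by simp
  thus ?thesis using m by blast
qed

text \<open>The degree enters only as the common number of extensions of an embedding of
  \<open>k\<close>, and is defined by that count.\<close>

definition relative_degree :: nat where
  "relative_degree = (SOME m. m > 0 \<and> (\<forall>\<xi>\<in>embs k. card (extensions k l \<xi>) = m))"

lemma relative_degree: "relative_degree > 0" "\<xi> \<in> embs k \<Longrightarrow> card (extensions k l \<xi>) = relative_degree"
  using someI_ex[OF relative_degree_exists, folded relative_degree_def] by blast+

lemma norm_eqI:
  assumes "x \<in> l" "a \<in> k" "\<And>\<xi>. \<xi> \<in> embs k \<Longrightarrow> (\<Prod>\<tau>\<in>extensions k l \<xi>. \<tau> x) = \<xi> a"
  shows "field_norm k l x = a"
proof -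
  obtain \<xi> where \<xi>: "\<xi> \<in> embs k" using embeddings_nonempty[OF nfk] by blast
  show ?thesis
  proof (rule embedding_inj[OF k \<xi> _ assms(2)])
    show "field_norm k l x \<in> k" by (rule field_norm_conjugates(1)[OF nfk nfl sub assms(1)])
    show "\<xi> (field_norm k l x) = \<xi> a"
      unfolding field_norm_conjugates(2)[OF nfk nfl sub assms(1) \<xi>] by (rule assms(3)[OF \<xi>])
  qed
qed

lemma norm_in: "x \<in> l \<Longrightarrow> field_norm k l x \<in> k"
  by (rule field_norm_conjugates(1)[OF nfk nfl sub])

lemma norm_conj: "x \<in> l \<Longrightarrow> \<xi> \<in> embs k \<Longrightarrow> \<xi> (field_norm k l x) = (\<Prod>\<tau>\<in>extensions k l \<xi>. \<tau> x)"
  by (rule field_norm_conjugates(2)[OF nfk nfl sub])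

lemma extensions_embedding: "\<tau> \<in> extensions k l \<xi> \<Longrightarrow> \<tau> \<in> embs l"
  by (simp add: extensions_def)

lemma norm_mult:
  assumes "x \<in> l" "y \<in> l"
  shows "field_norm k l (x * y) = field_norm k l x * field_norm k l y"
proof (rule norm_eqI)
  show "x * y \<in> l" using assms by (rule field_closed(6)[OF l])
  show "field_norm k l x * field_norm k l y \<in> k"
    by (rule field_closed(6)[OF k norm_in[OF assms(1)] norm_in[OF assms(2)]])
  fix \<xi> assume \<xi>: "\<xi> \<in> embs k"
  have "(\<Prod>\<tau>\<in>extensions k l \<xi>. \<tau> (x * y)) = (\<Prod>\<tau>\<in>extensions k l \<xi>. \<tau> x * \<tau> y)"
    by (intro prod.cong refl emb_simps(4)[OF l extensions_embedding assms])
  thus "(\<Prod>\<tau>\<in>extensions k l \<xi>. \<tau> (x * y)) = \<xi> (field_norm k l x * field_norm k l y)"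
    using assms \<xi> by (simp add: emb_simps(4)[OF k \<xi> norm_in norm_in] norm_conj prod.distrib)
qed

lemma norm_base:
  assumes "a \<in> k"
  shows "field_norm k l a = a ^ relative_degree"
proof (rule norm_eqI)
  show "a \<in> l" using assms sub by blast
  show "a ^ relative_degree \<in> k" using assms by (rule field_closed(9)[OF k])
  fix \<xi> assume \<xi>: "\<xi> \<in> embs k"
  have "(\<Prod>\<tau>\<in>extensions k l \<xi>. \<tau> a) = (\<Prod>\<tau>\<in>extensions k l \<xi>. \<xi> a)"
    by (intro prod.cong refl extensions_apply[OF _ assms])
  thus "(\<Prod>\<tau>\<in>extensions k l \<xi>. \<tau> a) = \<xi> (a ^ relative_degree)"
    using assms \<xi> by (simp add: relative_degree(2) emb_simps(10)[OF k \<xi>])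
qed

lemma norm_one: "field_norm k l 1 = 1"
  using norm_base[OF field_closed(1)[OF k]] by simp

lemma norm_power: "x \<in> l \<Longrightarrow> field_norm k l (x ^ n) = field_norm k l x ^ n"
  by (induction n) (simp_all add: norm_one norm_mult field_closed(9)[OF l])

lemma norm_algebraic_int:
  assumes "x \<in> l" "algebraic_int x"
  shows "algebraic_int (field_norm k l x)"
proof -
  obtain \<xi> where \<xi>: "\<xi> \<in> embs k" using embeddings_nonempty[OF nfk] by blast
  have "algebraic_int (\<Prod>\<tau>\<in>extensions k l \<xi>. \<tau> x)"
    using assms by (intro algebraic_int_prod) (simp add: algebraic_int_embedding_iff[OF l extensions_embedding])
  hence "algebraic_int (\<xi> (field_norm k l x))" by (simp add: norm_conj[OF assms(1) \<xi>])
  thus ?thesis by (simp add: algebraic_int_embedding_iff[OF k \<xi> norm_in[OF assms(1)]])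
qed

lemma units_l: "x \<in> units l \<longleftrightarrow> x \<in> l \<and> x \<noteq> 0 \<and> algebraic_int x \<and> algebraic_int (inverse x)"
  by (auto simp: unit_group_carrier[OF l])

lemma units_k: "x \<in> units k \<longleftrightarrow> x \<in> k \<and> x \<noteq> 0 \<and> algebraic_int x \<and> algebraic_int (inverse x)"
  by (auto simp: unit_group_carrier[OF k])

lemma norm_unit:
  assumes x: "x \<in> units l"
  shows "field_norm k l x \<in> units k"
proof -
  have xl: "x \<in> l" "x \<noteq> 0" "algebraic_int x" "algebraic_int (inverse x)" using x by (auto simp: units_l)
  have il: "inverse x \<in> l" using xl(1) by (rule field_closed(4)[OF l])
  have "field_norm k l x * field_norm k l (inverse x) = 1"
    using norm_mult[OF xl(1) il] xl(2) by (simp add: norm_one)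
  hence "inverse (field_norm k l x) = field_norm k l (inverse x)" "field_norm k l x \<noteq> 0"
    by (auto intro: inverse_unique)
  thus ?thesis using norm_algebraic_int[OF xl(1,3)] norm_algebraic_int[OF il xl(4)] norm_in[OF xl(1)]
    by (simp add: units_k)
qed

lemma units_mono: "x \<in> units k \<Longrightarrow> x \<in> units l"
  using sub by (auto simp: units_k units_l)

lemma norm_torsion:
  assumes t: "t \<in> torsion (unit_group l)"
  shows "field_norm k l t \<in> torsion (unit_group k)"
proof -
  obtain n :: nat where n: "n > 0" "t ^ n = 1" and tU: "t \<in> units l"
    using t by (auto simp: torsion_def unit_group_nat_pow[OF l])
  have "field_norm k l t ^ n = 1" using norm_power[of t n] tU n(2) by (simp add: units_l norm_one)
  thus ?thesis using n(1) norm_unit[OF tU] by (auto simp: torsion_def unit_group_nat_pow[OF k])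
qed

lemma restrict_place_of: "restrict (place_of l \<tau>) k = place_of k (restrict \<tau> k)"
  using sub by (auto simp: place_of_def fun_eq_iff)

lemma restrict_arch_place: "w \<in> arch_places l \<Longrightarrow> restrict w k \<in> arch_places k"
  using embedding_restrict[OF _ sub k] by (auto simp: arch_places_eq[OF nfl] arch_places_eq[OF nfk] restrict_place_of)

lemma lies_over_iff:
  assumes "v \<in> arch_places k"
  shows "lies_over k w v \<longleftrightarrow> restrict w k = v"
proof -
  have "v \<in> extensional k" using assms by (auto simp: arch_places_def absolute_value_def)
  thus ?thesis by (auto simp: lies_over_def fun_eq_iff extensional_def)
qed

text \<open>Both sides become sums over embeddings. Grouping those of \<open>l\<close> by their
  restriction to \<open>k\<close>, the logarithms in one group add up to the logarithm of a
  conjugate of the norm.\<close>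

lemma fiber_log_sum:
  assumes v: "v \<in> arch_places k" and u: "u \<in> units l"
  shows "(\<Sum>w\<in>{w \<in> arch_places l. restrict w k = v}. log_vector l u w) = log_vector k (field_norm k l u) v"
proof -
  note fl = finite_arch_places[OF nfl] and fk = finite_arch_places[OF nfk]
  note el = card_embeddings(1)[OF nfl] and ek = card_embeddings(1)[OF nfk]
  have ul: "u \<in> l" "u \<noteq> 0" using u by (auto simp: units_l)
  have "(\<Sum>w\<in>{w \<in> arch_places l. restrict w k = v}. log_vector l u w)
      = (\<Sum>w\<in>arch_places l. if restrict w k = v then log_vector l u w else 0)"
    by (simp add: sum.inter_filter[OF fl])
  also have "\<dots> = (\<Sum>w\<in>arch_places l. real (local_degree l w) * (if restrict w k = v then ln (w u) else 0))"
    by (intro sum.cong refl) (simp add: log_vector_def)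
  also have "\<dots> = (\<Sum>\<tau>\<in>embs l. if restrict (place_of l \<tau>) k = v then ln (place_of l \<tau> u) else 0)"
    by (rule sum_arch_places[OF nfl])
  also have "\<dots> = (\<Sum>\<tau>\<in>embs l. if place_of k (restrict \<tau> k) = v then ln (cmod (\<tau> u)) else 0)"
    by (intro sum.cong refl) (simp add: restrict_place_of place_of_apply ul)
  also have "\<dots> = (\<Sum>\<xi>\<in>embs k. \<Sum>\<tau>\<in>{\<tau> \<in> embs l. restrict \<tau> k = \<xi>}.
      if place_of k (restrict \<tau> k) = v then ln (cmod (\<tau> u)) else 0)"
    by (rule sum.group[OF el ek, symmetric]) (use embedding_restrict[OF _ sub k] in blast)
  also have "\<dots> = (\<Sum>\<xi>\<in>embs k. if place_of k \<xi> = v then ln (place_of k \<xi> (field_norm k l u)) else 0)"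
  proof (intro sum.cong refl)
    fix \<xi> assume \<xi>: "\<xi> \<in> embs k"
    have pos: "cmod (\<tau> u) > 0" if "\<tau> \<in> extensions k l \<xi>" for \<tau>
      using emb_simps(9)[OF l extensions_embedding[OF that] ul(1)] ul(2) by simp
    have "(\<Sum>\<tau>\<in>extensions k l \<xi>. ln (cmod (\<tau> u))) = ln (\<Prod>\<tau>\<in>extensions k l \<xi>. cmod (\<tau> u))"
      using pos by (intro ln_prod[symmetric] finite_extensions) auto
    also have "\<dots> = ln (place_of k \<xi> (field_norm k l u))"
      by (simp add: place_of_apply norm_in ul norm_conj[OF ul(1) \<xi>] prod_norm)
    finally have e: "(\<Sum>\<tau>\<in>extensions k l \<xi>. ln (cmod (\<tau> u))) = ln (place_of k \<xi> (field_norm k l u))" .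
    have "(\<Sum>\<tau>\<in>{\<tau> \<in> embs l. restrict \<tau> k = \<xi>}. if place_of k (restrict \<tau> k) = v then ln (cmod (\<tau> u)) else 0)
        = (\<Sum>\<tau>\<in>extensions k l \<xi>. if place_of k \<xi> = v then ln (cmod (\<tau> u)) else 0)"
      by (intro sum.cong) (auto simp: extensions_def)
    thus "(\<Sum>\<tau>\<in>{\<tau> \<in> embs l. restrict \<tau> k = \<xi>}. if place_of k (restrict \<tau> k) = v then ln (cmod (\<tau> u)) else 0)
        = (if place_of k \<xi> = v then ln (place_of k \<xi> (field_norm k l u)) else 0)"
      using e by (cases "place_of k \<xi> = v") simp_all
  qed
  also have "\<dots> = (\<Sum>v'\<in>arch_places k. real (local_degree k v') * (if v' = v then ln (v' (field_norm k l u)) else 0))"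
    by (rule sum_arch_places[OF nfk, symmetric])
  also have "\<dots> = (\<Sum>v'\<in>arch_places k. if v' = v then log_vector k (field_norm k l u) v' else 0)"
    by (intro sum.cong refl) (simp add: log_vector_def)
  also have "\<dots> = log_vector k (field_norm k l u) v" using v fk by simp
  finally show ?thesis .
qed

end

section \<open>Relative units\<close>

lemma (in comm_group) torsion_subgroup: "subgroup (torsion G) G"
proof (rule subgroupI)
  show "torsion G \<subseteq> carrier G" by (auto simp: torsion_def)
  show "torsion G \<noteq> {}" by (auto simp: torsion_def intro!: exI[of _ \<one>] exI[of _ "Suc 0"])
  show "inv a \<in> torsion G" if a: "a \<in> torsion G" for a
  proof -
    obtain n :: nat where n: "n > 0" "a [^] n = \<one>" and ac: "a \<in> carrier G" using a by (auto simp: torsion_def)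
    have "inv a [^] n = \<one>" using n(2) ac by (simp add: nat_pow_inv)
    thus ?thesis using n(1) ac by (auto simp: torsion_def)
  qed
  show "a \<otimes> b \<in> torsion G" if a: "a \<in> torsion G" and b: "b \<in> torsion G" for a b
  proof -
    obtain n :: nat where n: "n > 0" "a [^] n = \<one>" and ac: "a \<in> carrier G" using a by (auto simp: torsion_def)
    obtain m :: nat where m: "m > 0" "b [^] m = \<one>" and bc: "b \<in> carrier G" using b by (auto simp: torsion_def)
    have "a [^] (n * m) = \<one>" unfolding nat_pow_pow[OF ac, symmetric] n(2) by simp
    moreover have "b [^] (n * m) = \<one>" unfolding mult.commute[of n m] nat_pow_pow[OF bc, symmetric] m(2) by simp
    ultimately have "(a \<otimes> b) [^] (n * m) = \<one>" using ac bc by (simp add: nat_pow_distrib)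
    thus ?thesis using n(1) m(1) ac bc unfolding torsion_def by (intro CollectI conjI exI[of _ "n * m"]) simp_all
  qed
qed

lemma image_eq_singleton: "x \<in> A \<Longrightarrow> (\<And>y. y \<in> A \<Longrightarrow> f y = c) \<Longrightarrow> f ` A = {c}"
  by auto

text \<open>A unit and its inverse both have value at most 1 at a non-archimedean place, so only
  archimedean places contribute and the infinite sum is finite. Multiplying by the degree cancels
  the normalising exponent.\<close>

lemma weil_height_unit:
  assumes nf: "number_field K" and u: "u \<in> units K"
  shows "real (number_field_degree K) * weil_height K u = (\<Sum>w\<in>arch_places K. max 0 (log_vector K u w))"
proof -
  note K = nf_props(1)[OF nf] and fin = finite_arch_places[OF nf]
  let ?n = "real (number_field_degree K)"
  have uK: "u \<in> K" "u \<noteq> 0" "algebraic_int u" "algebraic_int (inverse u)" using u by (auto simp: unit_group_carrier[OF K])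
  have n: "?n > 0"
    using card_embeddings[OF nf] embeddings_nonempty[OF nf] by (metis card_gt_0_iff of_nat_0_less_iff)
  have nonarch: "normalized_abs K w u = 1" if w: "w \<in> nonarch_places K" for w
  proof -
    have wa: "absolute_value K w" using w by (simp add: nonarch_places_def)
    have pos: "w u > 0" using wa uK by (auto simp: absolute_value_def less_le)
    have "w u \<le> 1" by (rule nonarch_place_unit[OF K w uK(1,3)])
    moreover have "w (inverse u) \<le> 1" by (rule nonarch_place_unit[OF K w field_closed(4)[OF K uK(1)] uK(4)])
    hence "inverse (w u) \<le> 1" using absolute_value_props(3)[OF K wa uK(1)] by simp
    hence "w u \<ge> 1" using pos by (simp add: inverse_le_1_iff)
    ultimately have "w u = 1" by simp
    thus ?thesis by (simp add: normalized_abs_def)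
  qed
  have "weil_height K u = (\<Sum>\<^sub>\<infinity>w\<in>arch_places K. max 0 (ln (normalized_abs K w u)))"
    unfolding weil_height_def by (rule infsum_cong_neutral) (auto simp: places_def nonarch)
  also have "\<dots> = (\<Sum>w\<in>arch_places K. max 0 (ln (normalized_abs K w u)))" using fin by (rule infsum_finite)
  finally have "?n * weil_height K u = (\<Sum>w\<in>arch_places K. ?n * max 0 (ln (normalized_abs K w u)))"
    by (simp only: sum_distrib_left)
  also have "\<dots> = (\<Sum>w\<in>arch_places K. max 0 (log_vector K u w))"
  proof (intro sum.cong refl)
    fix w assume w: "w \<in> arch_places K"
    have "ln (normalized_abs K w u) = log_vector K u w / ?n"
      using arch_place_pos[OF nf w u] by (simp add: normalized_abs_def ln_powr log_vector_def)
    moreover have "?n * max 0 (t / ?n) = max 0 t" for t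
      using n by (auto simp: max_def divide_le_0_iff zero_le_divide_iff)
    ultimately show "?n * max 0 (ln (normalized_abs K w u)) = max 0 (log_vector K u w)" by simp
  qed
  finally show ?thesis .
qed

section \<open>Units modulo torsion\<close>

context
  fixes K :: "'a::field_char_0 set"
  assumes nf: "number_field K"
begin

lemma units_mod_torsion_comm_group: "comm_group (units_mod_torsion K)"
proof -
  interpret U: comm_group "unit_group K" by (rule unit_group_comm_group[OF nf_props(1)[OF nf]])
  show ?thesis unfolding units_mod_torsion_def by (rule U.abelian_FactGroup[OF U.torsion_subgroup])
qed

lemma coset_eq:
  assumes A: "A \<in> carrier (units_mod_torsion K)" and x: "x \<in> A"
  shows "x \<in> units K" "A = torsion_coset K x"
proof -
  interpret U: comm_group "unit_group K" by (rule unit_group_comm_group[OF nf_props(1)[OF nf]])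
  note T = U.torsion_subgroup
  obtain a where a: "a \<in> units K" "A = torsion_coset K a"
    using A by (auto simp: units_mod_torsion_def carrier_FactGroup)
  show "x \<in> units K"
    using U.r_coset_subset_G[OF subgroup.subset[OF T] a(1)] x a(2) by blast
  show "A = torsion_coset K x"
    unfolding a(2) by (rule U.repr_independence[OF _ a(1) T]) (use x a(2) in simp)
qed

lemma coset_of_unit:
  assumes x: "x \<in> units K"
  shows "torsion_coset K x \<in> carrier (units_mod_torsion K)"
    "x \<in> torsion_coset K x"
proof -
  interpret U: comm_group "unit_group K" by (rule unit_group_comm_group[OF nf_props(1)[OF nf]])
  show "torsion_coset K x \<in> carrier (units_mod_torsion K)"
    using x by (simp add: units_mod_torsion_def carrier_FactGroup)
  show "x \<in> torsion_coset K x" by (rule U.rcos_self[OF x U.torsion_subgroup])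
qed

lemma coset_quotient:
  assumes A: "A \<in> carrier (units_mod_torsion K)" and xy: "x \<in> A" "y \<in> A"
  shows "\<exists>t\<in>torsion (unit_group K). y = t * x"
  using xy(2) unfolding coset_eq(2)[OF A xy(1)] by (auto simp: r_coset_def)

lemma coset_rep:
  assumes A: "A \<in> carrier (units_mod_torsion K)"
  shows "(SOME x. x \<in> A) \<in> A"
proof -
  obtain a where "a \<in> units K" "A = torsion_coset K a"
    using A by (auto simp: units_mod_torsion_def carrier_FactGroup)
  hence "a \<in> A" using coset_of_unit(2) by simp
  thus ?thesis by (rule someI)
qed

lemma coset_place:
  assumes A: "A \<in> carrier (units_mod_torsion K)" and xy: "x \<in> A" "y \<in> A" and w: "w \<in> arch_places K"
  shows "w y = w x"
proof -
  note K = nf_props(1)[OF nf]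
  obtain t where t: "t \<in> torsion (unit_group K)" "y = t * x" using coset_quotient[OF A xy] by blast
  have "t \<in> K" "x \<in> K" using t(1) coset_eq(1)[OF A xy(1)] by (auto simp: torsion_def unit_group_carrier[OF K])
  thus ?thesis using t arch_place_mult[OF w] torsion_arch_place[OF nf w t(1)] by simp
qed

lemma coset_log:
  assumes "A \<in> carrier (units_mod_torsion K)" "x \<in> A" "y \<in> A" "w \<in> arch_places K"
  shows "log_vector K y w = log_vector K x w"
  unfolding log_vector_def coset_place[OF assms] ..

lemma the_elem_place:
  assumes A: "A \<in> carrier (units_mod_torsion K)" and x: "x \<in> A" and w: "w \<in> arch_places K"
  shows "the_elem (w ` A) = w x"
proof -
  have "w ` A = {w x}" by (rule image_eq_singleton[OF x]) (rule coset_place[OF A x _ w])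
  thus ?thesis by simp
qed

lemma height_mod_torsion_eq:
  assumes A: "A \<in> carrier (units_mod_torsion K)" and x: "x \<in> A"
  shows "real (number_field_degree K) * height_mod_torsion K A = (\<Sum>w\<in>arch_places K. max 0 (log_vector K x w))"
proof -
  note U = coset_eq(1)[OF A]
  have "number_field_degree K \<noteq> 0" using card_embeddings[OF nf] embeddings_nonempty[OF nf] by (metis card_0_eq)
  have h: "weil_height K y = weil_height K x" if y: "y \<in> A" for y
  proof -
    have "real (number_field_degree K) * weil_height K y = real (number_field_degree K) * weil_height K x"
      unfolding weil_height_unit[OF nf U[OF y]] weil_height_unit[OF nf U[OF x]]
      by (intro sum.cong refl) (simp add: coset_log[OF A x y])
    thus ?thesis using \<open>number_field_degree K \<noteq> 0\<close> by simp
  qed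
  have "weil_height K ` A = {weil_height K x}" by (rule image_eq_singleton[OF x h])
  thus ?thesis unfolding height_mod_torsion_def using weil_height_unit[OF nf U[OF x]] by simp
qed

lemma coset_mult:
  assumes "A \<in> carrier (units_mod_torsion K)" "B \<in> carrier (units_mod_torsion K)" "x \<in> A" "y \<in> B"
  shows "x * y \<in> A \<otimes>\<^bsub>units_mod_torsion K\<^esub> B"
  using assms(3,4) by (auto simp: units_mod_torsion_def set_mult_def)

end

context number_field_extension
begin

abbreviation E :: "'a set monoid" where "E \<equiv> relative_units k l"

lemma norm_mod_torsion_eq:
  assumes A: "A \<in> carrier (units_mod_torsion l)" and x: "x \<in> A"
  shows "norm_mod_torsion k l A = torsion_coset k (field_norm k l x)"
proof -
  interpret Uk: comm_group "unit_group k" by (rule unit_group_comm_group[OF k])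
  have c: "torsion_coset k (field_norm k l y) = torsion_coset k (field_norm k l x)"
    if y: "y \<in> A" for y
  proof -
    obtain t where t: "t \<in> torsion (unit_group l)" "y = t * x" using coset_quotient[OF nfl A x y] by blast
    have tx: "t \<in> l" "x \<in> l" using t(1) coset_eq(1)[OF nfl A x] by (auto simp: torsion_def units_l)
    have xu: "field_norm k l x \<in> units k" by (rule norm_unit[OF coset_eq(1)[OF nfl A x]])
    have "field_norm k l y \<in> torsion_coset k (field_norm k l x)"
      unfolding t(2) norm_mult[OF tx] using norm_torsion[OF t(1)] by (auto simp: r_coset_def)
    from Uk.repr_independence[OF this xu Uk.torsion_subgroup] show ?thesis ..
  qed
  have "(\<lambda>x. torsion_coset k (field_norm k l x)) ` A =
      {torsion_coset k (field_norm k l x)}" by (rule image_eq_singleton[OF x c])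
  thus ?thesis by (simp add: norm_mod_torsion_def)
qed

lemma relative_units_iff:
  assumes A: "A \<in> carrier (units_mod_torsion l)" and x: "x \<in> A"
  shows "A \<in> carrier E \<longleftrightarrow> field_norm k l x \<in> torsion (unit_group k)"
proof -
  interpret Uk: comm_group "unit_group k" by (rule unit_group_comm_group[OF k])
  have xu: "field_norm k l x \<in> units k" by (rule norm_unit[OF coset_eq(1)[OF nfl A x]])
  have "A \<in> carrier E \<longleftrightarrow> torsion_coset k (field_norm k l x) = torsion (unit_group k)"
    using A by (simp add: relative_units_def kernel_def norm_mod_torsion_eq[OF A x] units_mod_torsion_def[of k])
  also have "\<dots> \<longleftrightarrow> field_norm k l x \<in> torsion (unit_group k)"
    using Uk.coset_join1[OF _ xu Uk.torsion_subgroup] Uk.coset_join2[OF xu Uk.torsion_subgroup] by blast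
  finally show ?thesis .
qed

lemma relative_units_carrier: "A \<in> carrier E \<Longrightarrow> A \<in> carrier (units_mod_torsion l)"
  by (simp add: relative_units_def kernel_def)

lemma relative_units_subgroup: "subgroup (carrier E) (units_mod_torsion l)"
proof -
  interpret Uk: comm_group "unit_group k" by (rule unit_group_comm_group[OF k])
  interpret Fl: comm_group "units_mod_torsion l" by (rule units_mod_torsion_comm_group[OF nfl])
  interpret Fk: comm_group "units_mod_torsion k" by (rule units_mod_torsion_comm_group[OF nfk])
  have Tn: "torsion (unit_group k) \<lhd> unit_group k" by (rule Uk.subgroup_imp_normal[OF Uk.torsion_subgroup])
  have "norm_mod_torsion k l \<in> hom (units_mod_torsion l) (units_mod_torsion k)"
  proof (rule homI)
    fix A assume A: "A \<in> carrier (units_mod_torsion l)"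
    note x = coset_rep[OF nfl A]
    show "norm_mod_torsion k l A \<in> carrier (units_mod_torsion k)"
      unfolding norm_mod_torsion_eq[OF A x] by (rule coset_of_unit(1)[OF nfk norm_unit[OF coset_eq(1)[OF nfl A x]]])
    fix B assume B: "B \<in> carrier (units_mod_torsion l)"
    note y = coset_rep[OF nfl B]
    let ?x = "SOME x. x \<in> A" and ?y = "SOME x. x \<in> B"
    have U: "?x \<in> units l" "?y \<in> units l"
      using coset_eq(1)[OF nfl A x] coset_eq(1)[OF nfl B y] by simp_all
    hence xyl: "?x \<in> l" "?y \<in> l" by (simp_all add: units_l)
    have "norm_mod_torsion k l (A \<otimes>\<^bsub>units_mod_torsion l\<^esub> B) = torsion_coset k (field_norm k l ?x * field_norm k l ?y)"
      unfolding norm_mod_torsion_eq[OF Fl.m_closed[OF A B] coset_mult[OF nfl A B x y]] norm_mult[OF xyl] ..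
    also have "\<dots> = (torsion_coset k (field_norm k l ?x)) \<otimes>\<^bsub>units_mod_torsion k\<^esub>
        (torsion_coset k (field_norm k l ?y))"
      using normal.rcos_sum[OF Tn norm_unit[OF U(1)] norm_unit[OF U(2)]] by (simp add: units_mod_torsion_def)
    finally show "norm_mod_torsion k l (A \<otimes>\<^bsub>units_mod_torsion l\<^esub> B) =
        norm_mod_torsion k l A \<otimes>\<^bsub>units_mod_torsion k\<^esub> norm_mod_torsion k l B"
      unfolding norm_mod_torsion_eq[OF A x] norm_mod_torsion_eq[OF B y] .
  qed
  then interpret group_hom "units_mod_torsion l" "units_mod_torsion k" "norm_mod_torsion k l"
    by unfold_locales
  show ?thesis using subgroup_kernel by (simp add: relative_units_def)
qed

lemma relative_units_eq: "E = (units_mod_torsion l)\<lparr>carrier := carrier E\<rparr>"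
  by (simp add: relative_units_def)

lemma relative_units_comm_group: "comm_group E"
proof -
  interpret Fl: comm_group "units_mod_torsion l" by (rule units_mod_torsion_comm_group[OF nfl])
  show ?thesis using Fl.subgroup_imp_comm_group[OF relative_units_subgroup] by (simp only: relative_units_eq[symmetric])
qed

lemma relative_units_simps:
  "A \<otimes>\<^bsub>E\<^esub> B = A \<otimes>\<^bsub>units_mod_torsion l\<^esub> B"
  "\<one>\<^bsub>E\<^esub> = torsion (unit_group l)"
  by (simp_all add: relative_units_def units_mod_torsion_def)

lemma relative_unit_fiber_sum:
  assumes A: "A \<in> carrier E" and x: "x \<in> A" and v: "v \<in> arch_places k"
  shows "(\<Sum>w\<in>{w \<in> arch_places l. restrict w k = v}. log_vector l x w) = 0"
proof -
  note AF = relative_units_carrier[OF A]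
  have "field_norm k l x \<in> torsion (unit_group k)" using relative_units_iff[OF AF x] A by simp
  hence "v (field_norm k l x) = 1" by (rule torsion_arch_place[OF nfk v])
  thus ?thesis unfolding fiber_log_sum[OF v coset_eq(1)[OF nfl AF x]] by (simp add: log_vector_def)
qed

text \<open>Every embedding of \<open>k\<close> extends to \<open>l\<close>, so every archimedean
  place of \<open>k\<close> has one above it. This is needed for the choice in the regulator to be
  meaningful.\<close>

lemma chosen_places_exist: "\<exists>c. chosen_places k l c"
proof -
  have "\<forall>v\<in>arch_places k. \<exists>w. w \<in> arch_places l \<and> lies_over k w v"
  proof
    fix v assume v: "v \<in> arch_places k"
    then obtain \<xi> where \<xi>: "\<xi> \<in> embs k" "v = place_of k \<xi>" by (auto simp: arch_places_eq[OF nfk])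
    have "extensions k l \<xi> \<noteq> {}" using relative_degree(2)[OF \<xi>(1)] relative_degree(1) by auto
    then obtain \<tau> where \<tau>: "\<tau> \<in> embs l" "restrict \<tau> k = \<xi>" by (auto simp: extensions_def)
    have "lies_over k (place_of l \<tau>) v" 
      unfolding lies_over_iff[OF v] unfolding restrict_place_of \<tau>(2) \<xi>(2) ..
    thus "\<exists>w. w \<in> arch_places l \<and> lies_over k w v" using place_of_arch[OF l \<tau>(1)] by blast
  qed
  from bchoice[OF this] show ?thesis unfolding chosen_places_def .
qed

end

section \<open>The logarithmic embedding of the relative units\<close>

locale chosen_place_system = number_field_extension k l for k l :: "'a::field_char_0 set" +
  fixes c :: "('a \<Rightarrow> real) \<Rightarrow> 'a \<Rightarrow> real" and \<omega> :: "nat \<Rightarrow> 'a \<Rightarrow> real" and r :: nat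
  assumes chosen: "chosen_places k l c"
    and enum: "bij_betw \<omega> {..<r} (arch_places l - c ` arch_places k)"
begin

definition S :: "('a \<Rightarrow> real) set" where "S = arch_places l - c ` arch_places k"

definition fiber :: "('a \<Rightarrow> real) \<Rightarrow> ('a \<Rightarrow> real) set" where "fiber v = {w \<in> arch_places l. restrict w k = v}"

lemma finl: "finite (arch_places l)" by (rule finite_arch_places[OF nfl])
lemma fink: "finite (arch_places k)" by (rule finite_arch_places[OF nfk])
lemma finS: "finite S" using finl by (simp add: S_def)

lemma chosen_arch: "v \<in> arch_places k \<Longrightarrow> c v \<in> arch_places l"
  using chosen by (simp add: chosen_places_def)

lemma restrict_chosen: "v \<in> arch_places k \<Longrightarrow> restrict (c v) k = v"
  using chosen lies_over_iff by (simp add: chosen_places_def)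

lemma chosen_inj: "inj_on c (arch_places k)"
  by (rule inj_on_inverseI[where g = "\<lambda>w. restrict w k"]) (rule restrict_chosen)

lemma sum_split:
  fixes f :: "('a \<Rightarrow> real) \<Rightarrow> real"
  shows "(\<Sum>w\<in>arch_places l. f w) = (\<Sum>w\<in>S. f w) + (\<Sum>v\<in>arch_places k. f (c v))"
proof -
  have "c ` arch_places k \<subseteq> arch_places l" using chosen_arch by blast
  from sum.subset_diff[OF this finl, of f] show ?thesis
    unfolding S_def sum.reindex[OF chosen_inj] by (simp add: o_def)
qed

lemma card_S: "card S = card (arch_places l) - card (arch_places k)"
proof -
  have "c ` arch_places k \<subseteq> arch_places l" using chosen_arch by blast
  thus ?thesis unfolding S_def using fink by (simp add: card_Diff_subset card_image[OF chosen_inj])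
qed

text \<open>Each unit rank is a number of places minus one. The two subtractions cancel in the
  natural numbers because \<open>k\<close> has an archimedean place.\<close>

lemma card_S_rank: "card S = relative_unit_rank k l"
proof -
  have "card (arch_places k) > 0" using arch_places_nonempty[OF nfk] fink by (simp add: card_gt_0_iff)
  thus ?thesis by (simp add: card_S relative_unit_rank_def unit_rank_eq[OF nfk] unit_rank_eq[OF nfl])
qed

lemma enumS: "bij_betw \<omega> {..<r} S" using enum by (simp add: S_def)

lemma enum_mem: "i < r \<Longrightarrow> \<omega> i \<in> S" using bij_betwE[OF enumS] by blast

lemma enum_arch: "i < r \<Longrightarrow> \<omega> i \<in> arch_places l" using enum_mem by (simp add: S_def)

lemma relative_log_chosen:
  assumes A: "A \<in> carrier E" and x: "x \<in> A" and v: "v \<in> arch_places k"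
  shows "log_vector l x (c v) = - (\<Sum>w\<in>{w \<in> S. restrict w k = v}. log_vector l x w)"
proof -
  have "{w \<in> arch_places l. restrict w k = v} = insert (c v) {w \<in> S. restrict w k = v}"
  proof (intro subset_antisym subsetI)
    fix w assume w: "w \<in> {w \<in> arch_places l. restrict w k = v}"
    show "w \<in> insert (c v) {w \<in> S. restrict w k = v}"
    proof (cases "w \<in> S")
      case False
      then obtain v' where "v' \<in> arch_places k" "w = c v'" using w by (auto simp: S_def)
      thus ?thesis using restrict_chosen[of v'] w by simp
    qed (use w in simp)
  next
    fix w assume "w \<in> insert (c v) {w \<in> S. restrict w k = v}"
    thus "w \<in> {w \<in> arch_places l. restrict w k = v}"
      using chosen_arch[OF v] restrict_chosen[OF v] by (auto simp: S_def)
  qed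
  moreover have "c v \<notin> {w \<in> S. restrict w k = v}" using v by (simp add: S_def)
  ultimately show ?thesis using relative_unit_fiber_sum[OF A x v] finS by simp
qed

text \<open>The logarithm at a chosen place is minus the sum of those at the other places in its
  fibre, so its positive part is at most the sum of their negative parts. Adding the positive parts
  over \<open>S\<close> gives absolute values, with no loss of a constant.\<close>

lemma height_le:
  assumes A: "A \<in> carrier E" and x: "x \<in> A"
  shows "(\<Sum>w\<in>arch_places l. max 0 (log_vector l x w)) \<le> (\<Sum>w\<in>S. \<bar>log_vector l x w\<bar>)"
proof -
  let ?L = "log_vector l x"
  have sub: "max 0 (- (\<Sum>w\<in>M. ?L w)) \<le> (\<Sum>w\<in>M. max 0 (- ?L w))" for M
  proof -
    have "- (\<Sum>w\<in>M. ?L w) \<le> (\<Sum>w\<in>M. max 0 (- ?L w))" unfolding sum_negf[symmetric] by (rule sum_mono) simp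
    moreover have "0 \<le> (\<Sum>w\<in>M. max 0 (- ?L w))" by (rule sum_nonneg) simp
    ultimately show ?thesis by simp
  qed
  have "(\<Sum>v\<in>arch_places k. max 0 (?L (c v))) \<le> (\<Sum>v\<in>arch_places k. \<Sum>w\<in>{w \<in> S. restrict w k = v}. max 0 (- ?L w))"
    by (rule sum_mono) (simp only: relative_log_chosen[OF A x] sub)
  also have "\<dots> = (\<Sum>w\<in>S. max 0 (- ?L w))"
    by (rule sum.group[OF finS fink]) (use restrict_arch_place in \<open>auto simp: S_def\<close>)
  finally have "(\<Sum>w\<in>arch_places l. max 0 (?L w)) \<le> (\<Sum>w\<in>S. max 0 (?L w) + max 0 (- ?L w))"
    unfolding sum_split[of "\<lambda>w. max 0 (?L w)"] sum.distrib by simp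
  also have "\<dots> = (\<Sum>w\<in>S. \<bar>?L w\<bar>)" by (intro sum.cong refl) (simp add: max_def abs_if)
  finally show ?thesis .
qed

text \<open>The norm is multiplicative and raises elements of \<open>k\<close> to the power
  \<open>relative_degree\<close>, so the norm of the compensated unit is exactly 1. Its logarithms
  are those of \<open>u\<close>, scaled, minus a multiple of the fibre sum, which
  \<open>fiber_log_sum\<close> expresses through the norm.\<close>

lemma norm_compensated_unit:
  assumes u: "u \<in> units l"
  defines "y \<equiv> u ^ relative_degree * inverse (field_norm k l u)"
  shows "y \<in> units l" "field_norm k l y = 1"
    "w \<in> arch_places l \<Longrightarrow> log_vector l y w = real relative_degree * log_vector l u w -
      real (local_degree l w) / real (local_degree k (restrict w k)) * (\<Sum>w'\<in>fiber (restrict w k). log_vector l u w')"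
proof -
  let ?m = relative_degree and ?N = "field_norm k l u"
  interpret U: comm_group "unit_group l" by (rule unit_group_comm_group[OF l])
  have ul: "u \<in> l" "u \<noteq> 0" using u by (auto simp: units_l)
  note Nk = norm_unit[OF u]
  have N: "?N \<in> k" "?N \<noteq> 0" using Nk by (auto simp: units_k)
  have Nl: "?N \<in> l" using N(1) sub by blast
  have iN: "inverse ?N \<in> k" "inverse ?N \<in> l" using N(1) Nl field_closed(4)[OF k] field_closed(4)[OF l] by simp_all
  have pl: "u ^ ?m \<in> l" using ul(1) by (rule field_closed(9)[OF l])
  have "u ^ ?m \<in> units l" using U.nat_pow_closed[OF u, of ?m] by (simp add: unit_group_nat_pow[OF l])
  moreover have "inverse ?N \<in> units l" using units_mono[OF Nk] iN(2) by (simp add: units_l)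
  ultimately show "y \<in> units l" unfolding y_def using U.m_closed by simp
  show "field_norm k l y = 1"
    unfolding y_def norm_mult[OF pl iN(2)] norm_power[OF ul(1)] norm_base[OF iN(1)]
    using N(2) by (simp add: power_mult_distrib[symmetric])
  assume w: "w \<in> arch_places l"
  have wa: "absolute_value l w" using w by (simp add: arch_places_def)
  define v where "v = restrict w k"
  have v: "v \<in> arch_places k" unfolding v_def by (rule restrict_arch_place[OF w])
  have wN: "w ?N = v ?N" using N(1) by (simp add: v_def)
  have pos: "w u > 0" "w ?N > 0" using arch_place_pos[OF nfl w u] arch_place_pos[OF nfl w units_mono[OF Nk]] by simp_all
  have "w y = w u ^ ?m * inverse (w ?N)"
    unfolding y_def arch_place_mult[OF w pl iN(2)] absolute_value_props(2)[OF l wa ul(1)] absolute_value_props(3)[OF l wa Nl] ..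
  hence "ln (w y) = real ?m * ln (w u) - ln (w ?N)" using pos by (simp add: ln_mult ln_realpow ln_inverse)
  moreover have "(\<Sum>w'\<in>fiber v. log_vector l u w') = real (local_degree k v) * ln (v ?N)"
    unfolding fiber_def fiber_log_sum[OF v u] by (simp add: log_vector_def)
  hence "ln (w ?N) = (\<Sum>w'\<in>fiber v. log_vector l u w') / real (local_degree k v)"
    unfolding wN using local_degree_pos[OF nfk v] by simp
  ultimately show "log_vector l y w = real ?m * log_vector l u w -
      real (local_degree l w) / real (local_degree k (restrict w k)) * (\<Sum>w'\<in>fiber (restrict w k). log_vector l u w')"
    unfolding v_def[symmetric] by (simp add: log_vector_def right_diff_distrib mult_ac)
qed

text \<open>Pulling \<open>g\<close> back along the compensation of units gives a functional
  \<open>h\<close> that annihilates the logarithms of all units of \<open>l\<close>, so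
  \<open>h\<close> is constant. Since \<open>D\<close> depends only on the place below,
  \<open>g\<close> is constant on every fibre, and each fibre contains a chosen place, where
  \<open>g\<close> vanishes.\<close>

lemma relative_annihilator_trivial:
  assumes g: "\<And>A x. A \<in> carrier E \<Longrightarrow> x \<in> A \<Longrightarrow> (\<Sum>w\<in>arch_places l. g w * log_vector l x w) = 0"
    and chosen0: "\<And>v. v \<in> arch_places k \<Longrightarrow> g (c v) = 0" and w: "w \<in> arch_places l"
  shows "g w = 0"
proof -
  let ?m = "real relative_degree" and ?d = "\<lambda>w. real (local_degree l w)" and ?dk = "\<lambda>v. real (local_degree k v)"
  define D where "D v = (\<Sum>w\<in>fiber v. g w * ?d w) / ?dk v" for v
  define h where "h w = ?m * g w - D (restrict w k)" for w
  have "h w = h (c (restrict w k))"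
  proof (rule log_annihilator_constant[OF nfl, where g = h])
    fix u assume u: "u \<in> units l"
    define y where "y = u ^ relative_degree * inverse (field_norm k l u)"
    note y = norm_compensated_unit[OF u, folded y_def]
    define A where "A = torsion_coset l y"
    have A: "A \<in> carrier (units_mod_torsion l)" "y \<in> A" unfolding A_def using coset_of_unit[OF nfl y(1)] by simp_all
    interpret Uk: comm_group "unit_group k" by (rule unit_group_comm_group[OF k])
    have "1 \<in> torsion (unit_group k)" using subgroup.one_closed[OF Uk.torsion_subgroup] by simp
    hence AE: "A \<in> carrier E" by (simp add: relative_units_iff[OF A] y(2))
    \<comment> \<open>Exchanging the order of summation moves the fibre sums from the logarithms
      onto \<open>g\<close>, which produces \<open>D\<close>.\<close>
    have "(\<Sum>w\<in>arch_places l. g w * (?d w / ?dk (restrict w k) * (\<Sum>w'\<in>fiber (restrict w k). log_vector l u w')))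
        = (\<Sum>w\<in>arch_places l. \<Sum>w'\<in>arch_places l. if restrict w' k = restrict w k
            then g w * ?d w / ?dk (restrict w' k) * log_vector l u w' else 0)"
    proof (intro sum.cong refl)
      fix w
      have "g w * (?d w / ?dk (restrict w k) * (\<Sum>w'\<in>fiber (restrict w k). log_vector l u w'))
          = (\<Sum>w'\<in>fiber (restrict w k). g w * ?d w / ?dk (restrict w k) * log_vector l u w')"
        by (simp add: sum_distrib_left sum_divide_distrib mult_ac)
      also have "\<dots> = (\<Sum>w'\<in>arch_places l. if restrict w' k = restrict w k
            then g w * ?d w / ?dk (restrict w k) * log_vector l u w' else 0)"
        unfolding fiber_def by (rule sum.inter_filter[OF finl])
      also have "\<dots> = (\<Sum>w'\<in>arch_places l. if restrict w' k = restrict w k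
            then g w * ?d w / ?dk (restrict w' k) * log_vector l u w' else 0)" by (intro sum.cong refl) auto
      finally show "g w * (?d w / ?dk (restrict w k) * (\<Sum>w'\<in>fiber (restrict w k). log_vector l u w')) = \<dots>" .
    qed
    also have "\<dots> = (\<Sum>w'\<in>arch_places l. \<Sum>w\<in>arch_places l. if restrict w k = restrict w' k
            then g w * ?d w / ?dk (restrict w' k) * log_vector l u w' else 0)"
      by (subst sum.swap) (intro sum.cong refl, auto)
    also have "\<dots> = (\<Sum>w'\<in>arch_places l. D (restrict w' k) * log_vector l u w')"
    proof (intro sum.cong refl)
      fix w'
      have "(\<Sum>w\<in>arch_places l. if restrict w k = restrict w' k
            then g w * ?d w / ?dk (restrict w' k) * log_vector l u w' else 0)
          = (\<Sum>w\<in>fiber (restrict w' k). g w * ?d w / ?dk (restrict w' k) * log_vector l u w')"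
        unfolding fiber_def by (rule sum.inter_filter[OF finl, symmetric])
      also have "\<dots> = D (restrict w' k) * log_vector l u w'"
        by (simp add: D_def sum_divide_distrib sum_distrib_right)
      finally show "(\<Sum>w\<in>arch_places l. if restrict w k = restrict w' k
            then g w * ?d w / ?dk (restrict w' k) * log_vector l u w' else 0) = \<dots>" .
    qed
    finally have swap: "(\<Sum>w\<in>arch_places l. g w * (?d w / ?dk (restrict w k) * (\<Sum>w'\<in>fiber (restrict w k). log_vector l u w')))
        = (\<Sum>w\<in>arch_places l. D (restrict w k) * log_vector l u w)" .
    have "0 = (\<Sum>w\<in>arch_places l. g w * log_vector l y w)" using g[OF AE A(2)] by simp
    also have "\<dots> = (\<Sum>w\<in>arch_places l. ?m * g w * log_vector l u w -
        g w * (?d w / ?dk (restrict w k) * (\<Sum>w'\<in>fiber (restrict w k). log_vector l u w')))"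
      by (intro sum.cong refl) (simp add: y(3) right_diff_distrib mult_ac)
    also have "\<dots> = (\<Sum>w\<in>arch_places l. h w * log_vector l u w)"
      unfolding sum_subtractf swap unfolding sum_subtractf[symmetric] h_def by (simp add: left_diff_distrib)
    finally show "(\<Sum>w\<in>arch_places l. h w * log_vector l u w) = 0" ..
  qed (use w chosen_arch[OF restrict_arch_place[OF w]] in simp_all)
  moreover have "restrict w k \<in> arch_places k" by (rule restrict_arch_place[OF w])
  ultimately show ?thesis using relative_degree(1) by (simp add: h_def restrict_chosen chosen0)
qed

definition coords :: "'a set \<Rightarrow> nat \<Rightarrow> real" where
  "coords A = place_coordinates l r \<omega> (SOME x. x \<in> A)"

lemma coords_eq:
  assumes A: "A \<in> carrier E" and x: "x \<in> A" and i: "i < r"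
  shows "coords A i = log_vector l x (\<omega> i)"
  unfolding coords_def place_coordinates_def
  using coset_log[OF nfl relative_units_carrier[OF A] x coset_rep[OF nfl relative_units_carrier[OF A]] enum_arch[OF i]] i
  by simp

lemma coords_embedding: "discrete_embedding E coords r"
proof -
  interpret EG: comm_group E by (rule relative_units_comm_group)
  note EF = relative_units_carrier
  show ?thesis
  proof unfold_locales
    show "coords (A \<otimes>\<^bsub>E\<^esub> B) i = coords A i + coords B i"
      if A: "A \<in> carrier E" and B: "B \<in> carrier E" for A B i
    proof (cases "i < r")
      case True
      note x = coset_rep[OF nfl EF[OF A]] and y = coset_rep[OF nfl EF[OF B]]
      have xy: "(SOME x. x \<in> A) * (SOME x. x \<in> B) \<in> A \<otimes>\<^bsub>E\<^esub> B"
        unfolding relative_units_simps(1) by (rule coset_mult[OF nfl EF[OF A] EF[OF B] x y])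
      show ?thesis
        unfolding coords_eq[OF EG.m_closed[OF A B] xy True] coords_eq[OF A x True] coords_eq[OF B y True]
        by (rule log_vector_mult[OF nfl enum_arch[OF True] coset_eq(1)[OF nfl EF[OF A] x] coset_eq(1)[OF nfl EF[OF B] y]])
    qed (simp add: coords_def place_coordinates_def)
    show "coords A i = 0" if "r \<le> i" for A i using that by (simp add: coords_def place_coordinates_def)
    show "finite {A \<in> carrier E. \<forall>i<r. \<bar>coords A i\<bar> \<le> B}" (is "finite ?F") for B
    proof -
      \<comment> \<open>Finiteness is proved for the chosen representatives, which are units of
        \<open>l\<close>; a class is determined by its representative.\<close>
      define V where "V = {x. \<exists>A\<in>carrier E. x \<in> A}"
      have "finite {u \<in> V. \<forall>w\<in>S. \<bar>log_vector l u w\<bar> \<le> B}"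
      proof (rule finite_of_bounded_sub_places[OF nfl])
        show "S \<subseteq> arch_places l" by (auto simp: S_def)
        show "V \<subseteq> units l" using coset_eq(1)[OF nfl EF] by (auto simp: V_def)
        fix u w assume u: "u \<in> V" and w: "w \<in> arch_places l - S"
        obtain A where A: "A \<in> carrier E" "u \<in> A" using u by (auto simp: V_def)
        obtain v where v: "v \<in> arch_places k" "w = c v" using w by (auto simp: S_def)
        have "log_vector l u w \<le> (\<Sum>w\<in>{w \<in> S. restrict w k = v}. \<bar>log_vector l u w\<bar>)"
          unfolding v(2) relative_log_chosen[OF A v(1)] unfolding sum_negf[symmetric] by (rule sum_mono) simp
        also have "\<dots> \<le> (\<Sum>w\<in>S. \<bar>log_vector l u w\<bar>)" using finS by (intro sum_mono2) auto
        finally show "log_vector l u w \<le> (\<Sum>w\<in>S. \<bar>log_vector l u w\<bar>)" .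
      qed
      moreover have "(\<lambda>A. SOME x. x \<in> A) ` ?F \<subseteq> {u \<in> V. \<forall>w\<in>S. \<bar>log_vector l u w\<bar> \<le> B}"
      proof (rule image_subsetI)
        fix A assume "A \<in> ?F"
        hence A: "A \<in> carrier E" and b: "\<forall>i<r. \<bar>coords A i\<bar> \<le> B" by blast+
        note x = coset_rep[OF nfl EF[OF A]]
        have "\<bar>log_vector l (SOME x. x \<in> A) w\<bar> \<le> B" if w: "w \<in> S" for w
        proof -
          obtain i where i: "i < r" "w = \<omega> i" using w bij_betw_imp_surj_on[OF enumS] by auto
          have "\<bar>coords A i\<bar> \<le> B" using b i(1) by blast
          thus ?thesis unfolding i(2) coords_eq[OF A x i(1)] .
        qed
        moreover have "(SOME x. x \<in> A) \<in> V" unfolding V_def using A x by blast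
        ultimately show "(SOME x. x \<in> A) \<in> {u \<in> V. \<forall>w\<in>S. \<bar>log_vector l u w\<bar> \<le> B}" by simp
      qed
      ultimately have "finite ((\<lambda>A. SOME x. x \<in> A) ` ?F)" by (rule finite_subset[rotated])
      moreover have "inj_on (\<lambda>A. SOME x. x \<in> A) ?F"
      proof (rule inj_onI)
        fix A A' assume "A \<in> ?F" "A' \<in> ?F" and eq: "(SOME x. x \<in> A) = (SOME x. x \<in> A')"
        hence A: "A \<in> carrier E" "A' \<in> carrier E" by blast+
        have "A = torsion_coset l (SOME x. x \<in> A)"
          by (rule coset_eq(2)[OF nfl EF[OF A(1)] coset_rep[OF nfl EF[OF A(1)]]])
        moreover have "A' = torsion_coset l (SOME x. x \<in> A')"
          by (rule coset_eq(2)[OF nfl EF[OF A(2)] coset_rep[OF nfl EF[OF A(2)]]])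
        ultimately show "A = A'" using eq by metis
      qed
      ultimately show ?thesis by (rule finite_imageD)
    qed
    show "\<forall>i<r. a i = 0"
      if a: "\<And>A. A \<in> carrier E \<Longrightarrow> (\<Sum>i<r. a i * coords A i) = 0" for a
    proof (intro allI impI)
      fix i assume i: "i < r"
      define g where "g w = (if w \<in> S then a (the_inv_into {..<r} \<omega> w) else 0)" for w
      have g: "g (\<omega> i) = a i" if "i < r" for i
        using enum_mem[OF that] that by (simp add: g_def the_inv_into_f_f[OF bij_betw_imp_inj_on[OF enumS]])
      have "g (\<omega> i) = 0"
      proof (rule relative_annihilator_trivial[where g = g])
        fix A x assume A: "A \<in> carrier E" and x: "x \<in> A"
        have "(\<Sum>w\<in>arch_places l. g w * log_vector l x w) = (\<Sum>w\<in>S. g w * log_vector l x w)"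
          unfolding sum_split by (simp add: g_def S_def)
        also have "\<dots> = (\<Sum>i<r. g (\<omega> i) * log_vector l x (\<omega> i))"
          by (rule sum.reindex_bij_betw[OF enumS, symmetric])
        also have "\<dots> = (\<Sum>i<r. a i * coords A i)"
          by (intro sum.cong refl) (simp add: g coords_eq[OF A x])
        finally show "(\<Sum>w\<in>arch_places l. g w * log_vector l x w) = 0" using a[OF A] by simp
      qed (use enum_arch[OF i] in \<open>simp_all add: g_def S_def\<close>)
      thus "a i = 0" using g[OF i] by simp
    qed
  qed
qed

lemma coords_inj:
  assumes A: "A \<in> carrier E" and 0: "\<And>i. i < r \<Longrightarrow> coords A i = 0"
  shows "A = \<one>\<^bsub>E\<^esub>"
proof -
  note AF = relative_units_carrier[OF A]
  define x where "x = (SOME x. x \<in> A)"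
  have x: "x \<in> A" unfolding x_def by (rule coset_rep[OF nfl AF])
  interpret U: comm_group "unit_group l" by (rule unit_group_comm_group[OF l])
  note xU = coset_eq(1)[OF nfl AF x]
  have onS: "log_vector l x w = 0" if w: "w \<in> S" for w
  proof -
    obtain i where i: "i < r" "w = \<omega> i" using w bij_betw_imp_surj_on[OF enumS] by auto
    thus ?thesis using 0[OF i(1)] coords_eq[OF A x i(1)] by simp
  qed
  have "log_vector l x w = 0" if w: "w \<in> arch_places l" for w
  proof (cases "w \<in> S")
    case False
    then obtain v where v: "v \<in> arch_places k" "w = c v" using w by (auto simp: S_def)
    show ?thesis unfolding v(2) relative_log_chosen[OF A x v(1)] by (simp add: onS)
  qed (rule onS)
  hence "x \<in> torsion (unit_group l)" by (rule torsion_of_log_zero[OF nfl xU])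
  from U.coset_join2[OF xU U.torsion_subgroup this] show ?thesis
    using coset_eq(2)[OF nfl AF x] by (simp add: relative_units_simps(2))
qed

lemma height_le_coords:
  assumes A: "A \<in> carrier E"
  shows "real (number_field_degree l) * height_mod_torsion l A \<le> (\<Sum>i<r. \<bar>coords A i\<bar>)"
proof -
  note AF = relative_units_carrier[OF A] and x = coset_rep[OF nfl relative_units_carrier[OF A]]
  have "real (number_field_degree l) * height_mod_torsion l A \<le> (\<Sum>w\<in>S. \<bar>log_vector l (SOME x. x \<in> A) w\<bar>)"
    unfolding height_mod_torsion_eq[OF nfl AF x] by (rule height_le[OF A x])
  also have "\<dots> = (\<Sum>i<r. \<bar>log_vector l (SOME x. x \<in> A) (\<omega> i)\<bar>)" by (rule sum.reindex_bij_betw[OF enumS, symmetric])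
  also have "\<dots> = (\<Sum>i<r. \<bar>coords A i\<bar>)" by (intro sum.cong refl) (simp add: coords_eq[OF A x])
  finally show ?thesis .
qed

lemma height_nonneg:
  assumes A: "A \<in> carrier E"
  shows "real (number_field_degree l) * height_mod_torsion l A \<ge> 0"
  unfolding height_mod_torsion_eq[OF nfl relative_units_carrier[OF A] coset_rep[OF nfl relative_units_carrier[OF A]]]
  by (rule sum_nonneg) simp

lemma regulator_entry:
  assumes A: "A \<in> carrier E" and i: "i < r"
  shows "real (local_degree l (\<omega> i)) * ln (the_elem (\<omega> i ` A)) = coords A i"
proof -
  note AF = relative_units_carrier[OF A] and x = coset_rep[OF nfl relative_units_carrier[OF A]]
  show ?thesis unfolding coords_eq[OF A x i] the_elem_place[OF nfl AF x enum_arch[OF i]] log_vector_def ..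
qed

end

theorem theorem1p3:
  fixes k l :: "'a::field_char_0 set" and \<EE> :: "'a set set"
  assumes "number_field k" and "number_field l" and "k \<subseteq> l"
    and "relative_unit_rank k l > 0"
    and "subgroup \<EE> (relative_units k l)"
    and "group_rank ((relative_units k l)\<lparr>carrier := \<EE>\<rparr>) = relative_unit_rank k l"
  shows "\<exists>\<psi>. (\<forall>j<relative_unit_rank k l. \<psi> j \<in> \<EE>) \<and>
    mult_independent (relative_units k l) (relative_unit_rank k l) \<psi> \<and>
    (\<Prod>j<relative_unit_rank k l.
        real (number_field_degree l) * height_mod_torsion l (\<psi> j))
      \<le> fact (relative_unit_rank k l) * relative_regulator k l *
        real (card (rcosets\<^bsub>relative_units k l\<^esub> \<EE>))"
proof -
  interpret number_field_extension k l using assms(1-3) by unfold_locales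
  define r where "r = relative_unit_rank k l"
  define is_regulator where "is_regulator R \<longleftrightarrow> (\<exists>c w \<eta>. chosen_places k l c \<and>
     bij_betw w {..<r} (arch_places l - c ` arch_places k) \<and> group_basis (relative_units k l) r \<eta> \<and>
     R = \<bar>det (mat r r (\<lambda>(i, j). real (local_degree l (w i)) * ln (the_elem (w i ` \<eta> j))))\<bar>)" for R
  have reg: "relative_regulator k l = (SOME R. is_regulator R)"
    by (simp add: relative_regulator_def is_regulator_def r_def Let_def)
  \<comment> \<open>Once one admissible value exists, the chosen regulator comes with its own
    places, enumeration and basis, and the estimate is carried out for these.\<close>
  have "\<exists>R. is_regulator R"
  proof -
    obtain c where c: "chosen_places k l c" using chosen_places_exist by blast
    define S where "S = arch_places l - c ` arch_places k"
    have "finite S" using finite_arch_places[OF nfl] by (simp add: S_def)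
    then obtain \<omega> where \<omega>: "bij_betw \<omega> {..<card S} S" by (rule enumerate_finite)
    interpret P: chosen_place_system k l c \<omega> "card S" using c \<omega> by unfold_locales (simp_all add: S_def)
    \<comment> \<open>The remaining places must be exactly as many as the relative rank for the
      enumeration required by the regulator to exist.\<close>
    have cS: "card S = r" using P.card_S_rank by (simp add: r_def S_def P.S_def)
    have \<omega>': "bij_betw \<omega> {..<r} (arch_places l - c ` arch_places k)" using \<omega> unfolding cS unfolding S_def .
    obtain \<eta> where "group_basis (relative_units k l) r \<eta>"
      using discrete_embedding.group_basis_exists[OF P.coords_embedding P.coords_inj] cS by auto
    thus ?thesis unfolding is_regulator_def using c \<omega>' by blast
  qed
  hence "is_regulator (relative_regulator k l)" unfolding reg by (rule someI_ex)
  then obtain c \<omega> \<eta> where c: "chosen_places k l c" and \<omega>: "bij_betw \<omega> {..<r} (arch_places l - c ` arch_places k)"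
    and \<eta>: "group_basis (relative_units k l) r \<eta>"
    and R: "relative_regulator k l = \<bar>det (mat r r (\<lambda>(i, j). real (local_degree l (\<omega> i)) * ln (the_elem (\<omega> i ` \<eta> j))))\<bar>"
    unfolding is_regulator_def by blast
  interpret P: chosen_place_system k l c \<omega> r using c \<omega> by unfold_locales
  interpret D: discrete_embedding "relative_units k l" P.coords r by (rule P.coords_embedding)
  have \<eta>c: "\<eta> j \<in> carrier (relative_units k l)" if "j < r" for j by (rule D.group_basisD_carrier[OF \<eta> that])
  have "mat r r (\<lambda>(i, j). real (local_degree l (\<omega> i)) * ln (the_elem (\<omega> i ` \<eta> j))) = mat r r (\<lambda>(i, j). P.coords (\<eta> j) i)"
    by (rule eq_matI) (simp_all add: P.regulator_entry \<eta>c)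
  hence R': "relative_regulator k l = \<bar>det (mat r r (\<lambda>(i, j). P.coords (\<eta> j) i))\<bar>" by (simp only: R)
  obtain \<psi> where \<psi>: "\<forall>j<r. \<psi> j \<in> \<EE>" "mult_independent (relative_units k l) r \<psi>"
    and le: "(\<Prod>j<r. \<Sum>i<r. \<bar>P.coords (\<psi> j) i\<bar>) \<le>
      fact r * relative_regulator k l * real (card (rcosets\<^bsub>relative_units k l\<^esub> \<EE>))"
    using D.short_independent_elements[OF P.coords_inj \<eta> assms(5) assms(6)[folded r_def]] unfolding R' by blast
  have \<psi>c: "\<psi> j \<in> carrier (relative_units k l)" if "j < r" for j
    using subgroup.mem_carrier[OF assms(5)] \<psi>(1) that by blast
  have "(\<Prod>j<r. real (number_field_degree l) * height_mod_torsion l (\<psi> j)) \<le> (\<Prod>j<r. \<Sum>i<r. \<bar>P.coords (\<psi> j) i\<bar>)"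
    using \<psi>c by (intro prod_mono) (simp add: P.height_le_coords P.height_nonneg)
  hence "(\<Prod>j<r. real (number_field_degree l) * height_mod_torsion l (\<psi> j)) \<le>
      fact r * relative_regulator k l * real (card (rcosets\<^bsub>relative_units k l\<^esub> \<EE>))" using le by (rule order_trans)
  thus ?thesis unfolding r_def[symmetric] using \<psi> by blast
qed

end
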